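(* If $(M,L)$ is a recurrent Finsler manifold of dimension $n\geq 3$ with recurrence form $A$, then: (a) $(M,L)$ is Ricci recurrent ($RF_n$); (b) $(M,L)$ is concircularly recurrent ($CF_n$) provided that $r\neq 0$; (c) $(M,L)$ is 2-recurrent ($2F_n$) (resp. 2-Ricci recurrent ($2RF_n$)) provided that $\overset{h}{\nabla}A+A\otimes A\neq 0$.
   Context: Setting. $(M,L)$ is a Finsler manifold of dimension $n$; $\pi:\mathcal{T}M\to M$ is the bundle of nonzero tangent vectors; $\pi$-tensor fields are tensor fields on the pullback bundle $\pi^{-1}(TM)$, $\pi$-vector fields ($\overline X,\overline Y,\dots$) are sections of it, and $\overline\eta(u)=(u,u)$ is the fundamental $\pi$-vector field. $g$ is the Finsler metric defined by $L$. $\rho:T(\mathcal{T}M)\to\pi^{-1}(TM)$ and $\gamma:\pi^{-1}(TM)\to T(\mathcal{T}M)$ are the canonical bundle maps. $\nabla$ is the Cartan connection: the unique linear connection on $\pi^{-1}(TM)$ which is regular ($T(\mathcal{T}M)$ is the direct sum of the vertical bundle and the horizontal bundle $\{X:\nabla_X\overline\eta=0\}$), metric ($\nabla g=0$), with $\mathbf{T}(\beta\overline X,\beta\overline Y)=0$ and with $T(\overline X,\overline Y):=\mathbf{T}(\gamma\overline X,\beta\overline Y)$ satisfying $g(T(\overline X,\overline Y),\overline Z)=g(T(\overline X,\overline Z),\overline Y)$, where $\mathbf{T}(X,Y)=\nabla_X\rho Y-\nabla_Y\rho X-\rho[X,Y]$ and $\beta$ is the inverse of $\rho$ restricted to the horizontal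 bundle. $\overset{h}{\nabla}$ is the $h$-covariant derivative, i.e. covariant derivative in the directions $\beta\overline X$; arguments are ordered so that the Leibniz rule reads $\overset{h}{\nabla}(A\otimes S)=\overset{h}{\nabla}A\otimes S+A\otimes\overset{h}{\nabla}S$, and $\overset{h}{\nabla}S=A\otimes S$ means $\nabla_{\beta\overline X}S=A(\overline X)S$ for all $\overline X$. Curvature. $R(\overline X,\overline Y)\overline Z=\mathbf{K}(\beta\overline X,\beta\overline Y)\overline Z$ is the $h$-curvature tensor, with $\mathbf{K}(X,Y)=-\nabla_X\nabla_Y+\nabla_Y\nabla_X+\nabla_{[X,Y]}$. The horizontal Ricci tensor $\mathrm{Ric}(\overline X,\overline Z)$ is the trace of $\overline Y\mapsto R(\overline X,\overline Y)\overline Z$, and the horizontal scalar curvature $r$ is the $g$-trace of $\mathrm{Ric}$. $G(\overline X,\overline Y)\overline Z:=g(\overline X,\overline Z)\overline Y-g(\overline Y,\overline Z)\overline X$. $C:=R-\frac{r}{n(n-1)}G$ is the concircular curvature tensor. Definitions. In all of them $A$ is a non-zero scalar 1-form and $\alpha$ a non-zero scalar 2-form (a $(0,1)$, resp. $(0,2)$, $\pi$-tensor field, the latter not necessarily skew), positively homogeneous of degree zero in $y$, called recurrence forms. A Finsler manifold of dimension $n\ge 3$ with non-zero $R$ is: recurrent ($F_n$) if $\overset{h}{\nabla}R=A\otimes R$; 2-recurrent ($2F_n$) if $\overset{h}{\nabla}\overset{h}{\nabla}R=\alpha\otimes R$. A Finsler manifold of dimension $n\ge 3$ with non-zero $\mathrm{Ric}$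 is: Ricci recurrent ($RF_n$) if $\overset{h}{\nabla}\mathrm{Ric}=A\otimes\mathrm{Ric}$; 2-Ricci recurrent ($2RF_n$) if $\overset{h}{\nabla}\overset{h}{\nabla}\mathrm{Ric}=\alpha\otimes\mathrm{Ric}$. A Finsler manifold of dimension $n\ge 3$ with non-zero $C$ is concircularly recurrent ($CF_n$) if $\overset{h}{\nabla}C=A\otimes C$.
   Formalization: The manifold is assumed connected: for a round 3-sphere with A = 0 together with a disjoint flat 3-torus with A ≠ 0, one has r ≠ 0 but C = 0, so (b) fails; "non-zero" is read as "not identically zero". *)

theory Defs
  imports "HOL-Analysis.Analysis"
begin

section \<open>Smooth maps between Euclidean spaces\<close>

primrec Ck_on ::
  "nat \<Rightarrow> 'a::euclidean_space set \<Rightarrow> ('a \<Rightarrow> 'b::real_normed_vector) \<Rightarrow> bool" where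
  "Ck_on 0 S f \<longleftrightarrow> continuous_on S f"
| "Ck_on (Suc k) S f \<longleftrightarrow> f differentiable_on S \<and>
     (\<forall>b\<in>Basis. Ck_on k S (\<lambda>x. frechet_derivative f (at x) b))"

text \<open>Only used for open \<open>S\<close>.\<close>

definition smooth_on ::
  "'a::euclidean_space set \<Rightarrow> ('a \<Rightarrow> 'b::real_normed_vector) \<Rightarrow> bool" where
  "smooth_on S f \<longleftrightarrow> (\<forall>k. Ck_on k S f)"


section \<open>Smooth manifolds\<close>

text \<open>A manifold is given by an atlas of charts \<open>(U, \<phi>)\<close> with values in a Euclidean space \<open>'e\<close>;
  its dimension is \<open>DIM('e)\<close>, its points are the points covered by the charts, and its topology is
  the one that makes all charts homeomorphisms onto open sets.\<close>

type_synonym ('p, 'e) chart = "'p set \<times> ('p \<Rightarrow> 'e)"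
type_synonym ('p, 'e) atlas = "('p, 'e) chart set"

definition carrier_of :: "('p, 'e) atlas \<Rightarrow> 'p set" where
  "carrier_of \<A> = (\<Union>c\<in>\<A>. fst c)"

definition chart_inv :: "('p, 'e) chart \<Rightarrow> 'e \<Rightarrow> 'p" where
  "chart_inv c = inv_into (fst c) (snd c)"

definition smooth_atlas :: "('p, 'e::euclidean_space) atlas \<Rightarrow> bool" where
  "smooth_atlas \<A> \<longleftrightarrow>
     (\<forall>c\<in>\<A>. inj_on (snd c) (fst c)) \<and>
     (\<forall>c\<in>\<A>. \<forall>d\<in>\<A>. open (snd c ` (fst c \<inter> fst d)) \<and>
        smooth_on (snd c ` (fst c \<inter> fst d)) (snd d \<circ> chart_inv c))"

definition atlas_topology :: "('p, 'e::euclidean_space) atlas \<Rightarrow> 'p topology" where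
  "atlas_topology \<A> =
     topology (\<lambda>W. W \<subseteq> carrier_of \<A> \<and> (\<forall>c\<in>\<A>. open (snd c ` (W \<inter> fst c))))"

lemma openin_atlas_topology:
  assumes "smooth_atlas \<A>"
  shows "openin (atlas_topology \<A>) W \<longleftrightarrow>
    W \<subseteq> carrier_of \<A> \<and> (\<forall>c\<in>\<A>. open (snd c ` (W \<inter> fst c)))"
proof -
  let ?P = "\<lambda>W. W \<subseteq> carrier_of \<A> \<and> (\<forall>c\<in>\<A>. open (snd c ` (W \<inter> fst c)))"
  have inj: "inj_on (snd c) (fst c)" if "c \<in> \<A>" for c
    using assms that by (simp add: smooth_atlas_def)
  have "istopology ?P"
    unfolding istopology_def
  proof (intro conjI allI impI)
    fix S T assume S: "?P S" and T: "?P T"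
    have "snd c ` (S \<inter> T \<inter> fst c) = snd c ` (S \<inter> fst c) \<inter> snd c ` (T \<inter> fst c)"
      if "c \<in> \<A>" for c
      using inj[OF that] unfolding inj_on_def by fastforce
    then show "S \<inter> T \<subseteq> carrier_of \<A>" "\<forall>c\<in>\<A>. open (snd c ` (S \<inter> T \<inter> fst c))"
      using S T by auto
  next
    fix \<K> assume K: "\<forall>K\<in>\<K>. ?P K"
    have "snd c ` (\<Union>\<K> \<inter> fst c) = (\<Union>K\<in>\<K>. snd c ` (K \<inter> fst c))" for c :: "('a, 'b) chart"
      by auto
    then show "\<Union>\<K> \<subseteq> carrier_of \<A>" "\<forall>c\<in>\<A>. open (snd c ` (\<Union>\<K> \<inter> fst c))"
      using K by (auto intro!: open_UN)
  qed
  then show ?thesis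
    by (simp add: atlas_topology_def topology_inverse')
qed

text \<open>Manifolds are connected, so that conditions such as \<open>R \<noteq> 0\<close> below cannot be met on one component
  and \<open>A \<noteq> 0\<close> on another, unrelated one.\<close>

definition smooth_manifold :: "('p, 'e::euclidean_space) atlas \<Rightarrow> bool" where
  "smooth_manifold \<A> \<longleftrightarrow> smooth_atlas \<A> \<and> Hausdorff_space (atlas_topology \<A>) \<and>
     second_countable (atlas_topology \<A>) \<and> connected_space (atlas_topology \<A>)"

text \<open>The tangent space at \<open>p\<close> is \<open>'e\<close>: a vector \<open>v\<close> stands for the tangent vector with components
  \<open>v\<close> in the chart chosen here. All notions below are independent of this choice.\<close>

definition chart_at :: "('p, 'e) atlas \<Rightarrow> 'p \<Rightarrow> ('p, 'e) chart" where
  "chart_at \<A> p = (SOME c. c \<in> \<A> \<and> p \<in> fst c)"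

text \<open>The differential of a vector-valued function \<open>f\<close> at \<open>p\<close>, applied to the tangent vector \<open>v\<close>.\<close>

definition dir ::
  "('p, 'e::euclidean_space) atlas \<Rightarrow> ('p \<Rightarrow> 'b::real_normed_vector) \<Rightarrow> 'p \<Rightarrow> 'e \<Rightarrow> 'b" where
  "dir \<A> f p v =
     frechet_derivative (f \<circ> chart_inv (chart_at \<A> p)) (at (snd (chart_at \<A> p) p)) v"

text \<open>Components in an arbitrary chart \<open>c\<close> of the tangent vector \<open>v\<close> at \<open>p\<close>, and conversely the
  tangent vector at \<open>p\<close> with given components \<open>w\<close> in \<open>c\<close>.\<close>

definition comps ::
  "('p, 'e::euclidean_space) atlas \<Rightarrow> ('p, 'e) chart \<Rightarrow> 'p \<Rightarrow> 'e \<Rightarrow> 'e" where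
  "comps \<A> c p v = dir \<A> (snd c) p v"

definition of_comps ::
  "('p, 'e::euclidean_space) atlas \<Rightarrow> ('p, 'e) chart \<Rightarrow> 'p \<Rightarrow> 'e \<Rightarrow> 'e" where
  "of_comps \<A> c p w =
     frechet_derivative (snd (chart_at \<A> p) \<circ> chart_inv c) (at (snd c p)) w"

definition smooth_fun ::
  "('p, 'e::euclidean_space) atlas \<Rightarrow> 'p set \<Rightarrow> ('p \<Rightarrow> 'b::real_normed_vector) \<Rightarrow> bool" where
  "smooth_fun \<A> W f \<longleftrightarrow> (\<forall>c\<in>\<A>. smooth_on (snd c ` (W \<inter> fst c)) (f \<circ> chart_inv c))"

definition smooth_vf ::
  "('p, 'e::euclidean_space) atlas \<Rightarrow> 'p set \<Rightarrow> ('p \<Rightarrow> 'e) \<Rightarrow> bool" where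
  "smooth_vf \<A> W X \<longleftrightarrow>
     (\<forall>c\<in>\<A>. smooth_on (snd c ` (W \<inter> fst c)) ((\<lambda>p. comps \<A> c p (X p)) \<circ> chart_inv c))"

text \<open>The Lie bracket, computed at \<open>p\<close> in the chart chosen at \<open>p\<close>.\<close>

definition bracket ::
  "('p, 'e::euclidean_space) atlas \<Rightarrow> ('p \<Rightarrow> 'e) \<Rightarrow> ('p \<Rightarrow> 'e) \<Rightarrow> 'p \<Rightarrow> 'e" where
  "bracket \<A> X Y p =
     dir \<A> (\<lambda>q. comps \<A> (chart_at \<A> p) q (Y q)) p (X p) -
     dir \<A> (\<lambda>q. comps \<A> (chart_at \<A> p) q (X q)) p (Y p)"


section \<open>The bundle of nonzero tangent vectors\<close>

text \<open>\<open>slit \<A>\<close> is the natural atlas of the bundle of nonzero tangent vectors, with points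
  \<open>u = (p, y)\<close>; tangent vectors of this manifold are elements of \<open>'e \<times> 'e\<close>.\<close>

definition slit_chart ::
  "('m, 'e::euclidean_space) atlas \<Rightarrow> ('m, 'e) chart \<Rightarrow> ('m \<times> 'e, 'e \<times> 'e) chart" where
  "slit_chart \<A> c =
     ({(p, y). p \<in> fst c \<and> y \<noteq> 0}, \<lambda>(p, y). (snd c p, comps \<A> c p y))"

definition slit ::
  "('m, 'e::euclidean_space) atlas \<Rightarrow> ('m \<times> 'e, 'e \<times> 'e) atlas" where
  "slit \<A> = slit_chart \<A> ` \<A>"

abbreviation TM0 :: "('m, 'e::euclidean_space) atlas \<Rightarrow> ('m \<times> 'e) set" where
  "TM0 \<A> \<equiv> carrier_of (slit \<A>)"

text \<open>\<open>\<pi>\<close>-vector fields, i.e. sections of the pullback bundle: the fibre over \<open>u = (p, y)\<close> is the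
  tangent space at \<open>p\<close>, so that a section is a function \<open>'m \<times> 'e \<Rightarrow> 'e\<close>.\<close>

type_synonym ('m, 'e) pi_field = "'m \<times> 'e \<Rightarrow> 'e"
type_synonym ('m, 'e) vfield = "'m \<times> 'e \<Rightarrow> 'e \<times> 'e"

definition smooth_pi ::
  "('m, 'e::euclidean_space) atlas \<Rightarrow> ('m \<times> 'e) set \<Rightarrow> ('m, 'e) pi_field \<Rightarrow> bool" where
  "smooth_pi \<A> W Z \<longleftrightarrow>
     (\<forall>c\<in>\<A>. smooth_on (snd (slit_chart \<A> c) ` (W \<inter> fst (slit_chart \<A> c)))
        ((\<lambda>q. comps \<A> c (fst q) (Z q)) \<circ> chart_inv (slit_chart \<A> c)))"

text \<open>The local \<open>\<pi>\<close>-vector field around \<open>u\<close> that extends the vector \<open>v\<close> in the fibre over \<open>u\<close> with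
  constant components in the chart chosen at the base point of \<open>u\<close>.\<close>

definition ext ::
  "('m, 'e::euclidean_space) atlas \<Rightarrow> 'm \<times> 'e \<Rightarrow> 'e \<Rightarrow> ('m, 'e) pi_field" where
  "ext \<A> u v = (\<lambda>q. of_comps \<A> (chart_at \<A> (fst u)) (fst q) v)"

definition eta :: "('m, 'e) pi_field" where
  "eta u = snd u"

definition rho ::
  "('m, 'e::euclidean_space) atlas \<Rightarrow> 'm \<times> 'e \<Rightarrow> 'e \<times> 'e \<Rightarrow> 'e" where
  "rho \<A> u \<xi> = dir (slit \<A>) (snd (chart_at \<A> (fst u)) \<circ> fst) u \<xi>"

text \<open>The vertical lift: the velocity at \<open>t = 0\<close> of the curve \<open>(p, y + t v)\<close>.\<close>

definition gamma ::
  "('m, 'e::euclidean_space) atlas \<Rightarrow> 'm \<times> 'e \<Rightarrow> 'e \<Rightarrow> 'e \<times> 'e" where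
  "gamma \<A> u v =
     vector_derivative (\<lambda>t. snd (chart_at (slit \<A>) u) (fst u, snd u + t *\<^sub>R v)) (at 0)"


section \<open>Finsler manifolds\<close>

text \<open>The Finsler metric: half the second fibre derivative of \<open>L\<^sup>2\<close>.\<close>

definition fmetric ::
  "('m \<times> 'e::euclidean_space \<Rightarrow> real) \<Rightarrow> 'm \<times> 'e \<Rightarrow> 'e \<Rightarrow> 'e \<Rightarrow> real" where
  "fmetric L u v w =
     frechet_derivative
       (\<lambda>z. frechet_derivative (\<lambda>y. (L (fst u, y))\<^sup>2 / 2) (at z) v) (at (snd u)) w"

definition finsler_manifold ::
  "('m, 'e::euclidean_space) atlas \<Rightarrow> ('m \<times> 'e \<Rightarrow> real) \<Rightarrow> bool" where
  "finsler_manifold \<A> L \<longleftrightarrow>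
     smooth_manifold \<A> \<and>
     smooth_fun (slit \<A>) (TM0 \<A>) L \<and>
     (\<forall>u\<in>TM0 \<A>. L u > 0) \<and>
     (\<forall>p\<in>carrier_of \<A>. \<forall>y. \<forall>t\<ge>0. L (p, t *\<^sub>R y) = t * L (p, y)) \<and>
     (\<forall>u\<in>TM0 \<A>. \<forall>v. v \<noteq> 0 \<longrightarrow> fmetric L u v v > 0)"


section \<open>Linear connections on the pullback bundle and the Cartan connection\<close>

text \<open>\<open>D u \<xi> Z\<close> is the covariant derivative at \<open>u\<close> of the \<open>\<pi>\<close>-vector field \<open>Z\<close> in the direction of
  the tangent vector \<open>\<xi>\<close> to the slit tangent bundle at \<open>u\<close>. As usual a connection is taken to act
  also on sections that are only defined on an open set \<open>W\<close>; the values of \<open>Z\<close> outside are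
  irrelevant (multiply \<open>Z\<close> by an indicator function in the Leibniz rule).\<close>

type_synonym ('m, 'e) conn = "'m \<times> 'e \<Rightarrow> 'e \<times> 'e \<Rightarrow> ('m, 'e) pi_field \<Rightarrow> 'e"

definition linear_connection ::
  "('m, 'e::euclidean_space) atlas \<Rightarrow> ('m, 'e) conn \<Rightarrow> bool" where
  "linear_connection \<A> D \<longleftrightarrow>
     (\<forall>W. openin (atlas_topology (slit \<A>)) W \<longrightarrow>
        (\<forall>Z. smooth_pi \<A> W Z \<longrightarrow>
           (\<forall>u\<in>W. linear (\<lambda>\<xi>. D u \<xi> Z)) \<and>
           (\<forall>X. smooth_vf (slit \<A>) W X \<longrightarrow> smooth_pi \<A> W (\<lambda>u. D u (X u) Z)) \<and>
           (\<forall>Z'. smooth_pi \<A> W Z' \<longrightarrow>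
              (\<forall>u\<in>W. \<forall>\<xi>. D u \<xi> (\<lambda>q. Z q + Z' q) = D u \<xi> Z + D u \<xi> Z')) \<and>
           (\<forall>f::'m \<times> 'e \<Rightarrow> real. smooth_fun (slit \<A>) W f \<longrightarrow>
              (\<forall>u\<in>W. \<forall>\<xi>. D u \<xi> (\<lambda>q. f q *\<^sub>R Z q) =
                 f u *\<^sub>R D u \<xi> Z + dir (slit \<A>) f u \<xi> *\<^sub>R Z u))))"

definition vertical ::
  "('m, 'e::euclidean_space) atlas \<Rightarrow> 'm \<times> 'e \<Rightarrow> ('e \<times> 'e) set" where
  "vertical \<A> u = {\<xi>. rho \<A> u \<xi> = 0}"

definition horizontal :: "('m, 'e) conn \<Rightarrow> 'm \<times> 'e \<Rightarrow> ('e \<times> 'e::euclidean_space) set" where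
  "horizontal D u = {\<xi>. D u \<xi> eta = 0}"

definition regular_connection ::
  "('m, 'e::euclidean_space) atlas \<Rightarrow> ('m, 'e) conn \<Rightarrow> bool" where
  "regular_connection \<A> D \<longleftrightarrow>
     (\<forall>u\<in>TM0 \<A>. vertical \<A> u \<inter> horizontal D u = {0} \<and>
        (\<forall>\<xi>. \<exists>v\<in>vertical \<A> u. \<exists>h\<in>horizontal D u. \<xi> = v + h))"

definition beta ::
  "('m, 'e::euclidean_space) atlas \<Rightarrow> ('m, 'e) conn \<Rightarrow> 'm \<times> 'e \<Rightarrow> 'e \<Rightarrow> 'e \<times> 'e" where
  "beta \<A> D u = inv_into (horizontal D u) (rho \<A> u)"

definition torsion ::
  "('m, 'e::euclidean_space) atlas \<Rightarrow> ('m, 'e) conn \<Rightarrow>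
   ('m, 'e) vfield \<Rightarrow> ('m, 'e) vfield \<Rightarrow> ('m, 'e) pi_field" where
  "torsion \<A> D X Y u =
     D u (X u) (\<lambda>q. rho \<A> q (Y q)) - D u (Y u) (\<lambda>q. rho \<A> q (X q)) -
     rho \<A> u (bracket (slit \<A>) X Y u)"

definition mixed_torsion ::
  "('m, 'e::euclidean_space) atlas \<Rightarrow> ('m, 'e) conn \<Rightarrow>
   ('m, 'e) pi_field \<Rightarrow> ('m, 'e) pi_field \<Rightarrow> ('m, 'e) pi_field" where
  "mixed_torsion \<A> D X Y =
     torsion \<A> D (\<lambda>q. gamma \<A> q (X q)) (\<lambda>q. beta \<A> D q (Y q))"

definition cartan_connection ::
  "('m, 'e::euclidean_space) atlas \<Rightarrow> ('m \<times> 'e \<Rightarrow> real) \<Rightarrow> ('m, 'e) conn \<Rightarrow> bool" where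
  "cartan_connection \<A> L D \<longleftrightarrow>
     linear_connection \<A> D \<and> regular_connection \<A> D \<and>
     (\<forall>W. openin (atlas_topology (slit \<A>)) W \<longrightarrow>
        (\<forall>X Y Z. smooth_pi \<A> W X \<and> smooth_pi \<A> W Y \<and> smooth_pi \<A> W Z \<longrightarrow>
           (\<forall>u\<in>W.
              (\<forall>\<xi>. dir (slit \<A>) (\<lambda>q. fmetric L q (Y q) (Z q)) u \<xi> =
                 fmetric L u (D u \<xi> Y) (Z u) + fmetric L u (Y u) (D u \<xi> Z)) \<and>
              torsion \<A> D (\<lambda>q. beta \<A> D q (X q)) (\<lambda>q. beta \<A> D q (Y q)) u = 0 \<and>
              fmetric L u (mixed_torsion \<A> D X Y u) (Z u) =
                fmetric L u (mixed_torsion \<A> D X Z u) (Y u))))"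


section \<open>Curvature\<close>

text \<open>\<open>\<pi>\<close>-tensor fields are represented pointwise, as functions of \<open>u\<close> and of vectors in the fibre
  over \<open>u\<close>; a tensor field that is given on \<open>\<pi>\<close>-vector fields is evaluated on vectors by means of
  their extensions \<open>ext\<close>.\<close>

definition curv ::
  "('m, 'e::euclidean_space) atlas \<Rightarrow> ('m, 'e) conn \<Rightarrow>
   ('m, 'e) vfield \<Rightarrow> ('m, 'e) vfield \<Rightarrow> ('m, 'e) pi_field \<Rightarrow> ('m, 'e) pi_field" where
  "curv \<A> D X Y Z u =
     - D u (X u) (\<lambda>q. D q (Y q) Z) + D u (Y u) (\<lambda>q. D q (X q) Z) +
     D u (bracket (slit \<A>) X Y u) Z"

type_synonym ('m, 'e) tensor01 = "'m \<times> 'e \<Rightarrow> 'e \<Rightarrow> real"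
type_synonym ('m, 'e) tensor02 = "'m \<times> 'e \<Rightarrow> 'e \<Rightarrow> 'e \<Rightarrow> real"
type_synonym ('m, 'e) tensor13 = "'m \<times> 'e \<Rightarrow> 'e \<Rightarrow> 'e \<Rightarrow> 'e \<Rightarrow> 'e"

definition hcurv ::
  "('m, 'e::euclidean_space) atlas \<Rightarrow> ('m, 'e) conn \<Rightarrow> ('m, 'e) tensor13" where
  "hcurv \<A> D u x y z =
     curv \<A> D (\<lambda>q. beta \<A> D q (ext \<A> u x q)) (\<lambda>q. beta \<A> D q (ext \<A> u y q)) (ext \<A> u z) u"

definition endo_trace :: "('e::euclidean_space \<Rightarrow> 'e) \<Rightarrow> real" where
  "endo_trace f = (\<Sum>b\<in>Basis. f b \<bullet> b)"

definition hric ::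
  "('m, 'e::euclidean_space) atlas \<Rightarrow> ('m, 'e) conn \<Rightarrow> ('m, 'e) tensor02" where
  "hric \<A> D u x z = endo_trace (\<lambda>y. hcurv \<A> D u x y z)"

text \<open>The \<open>g\<close>-trace of a bilinear form \<open>b\<close> is the trace of the endomorphism \<open>F\<close> with
  \<open>g (F x) z = b x z\<close>.\<close>

definition metric_trace ::
  "('e::euclidean_space \<Rightarrow> 'e \<Rightarrow> real) \<Rightarrow> ('e \<Rightarrow> 'e \<Rightarrow> real) \<Rightarrow> real" where
  "metric_trace g b = endo_trace (\<lambda>x. THE w. \<forall>z. g w z = b x z)"

definition hscal ::
  "('m, 'e::euclidean_space) atlas \<Rightarrow> ('m \<times> 'e \<Rightarrow> real) \<Rightarrow> ('m, 'e) conn \<Rightarrow>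
   'm \<times> 'e \<Rightarrow> real" where
  "hscal \<A> L D u = metric_trace (fmetric L u) (hric \<A> D u)"

definition Gtensor :: "('m \<times> 'e::euclidean_space \<Rightarrow> real) \<Rightarrow> ('m, 'e) tensor13" where
  "Gtensor L u x y z = fmetric L u x z *\<^sub>R y - fmetric L u y z *\<^sub>R x"

definition concircular ::
  "('m, 'e::euclidean_space) atlas \<Rightarrow> ('m \<times> 'e \<Rightarrow> real) \<Rightarrow> ('m, 'e) conn \<Rightarrow>
   ('m, 'e) tensor13" where
  "concircular \<A> L D u x y z =
     hcurv \<A> D u x y z -
     (hscal \<A> L D u / (real DIM('e) * (real DIM('e) - 1))) *\<^sub>R Gtensor L u x y z"


section \<open>Horizontal covariant derivatives of tensor fields\<close>

text \<open>\<open>hcov\<dots> \<A> D S u x\<close> is the covariant derivative of the tensor field \<open>S\<close> at \<open>u\<close> in the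
  direction \<open>\<beta> x\<close>.\<close>

definition hcov01 ::
  "('m, 'e::euclidean_space) atlas \<Rightarrow> ('m, 'e) conn \<Rightarrow> ('m, 'e) tensor01 \<Rightarrow>
   'm \<times> 'e \<Rightarrow> 'e \<Rightarrow> 'e \<Rightarrow> real" where
  "hcov01 \<A> D S u x y =
     (let \<xi> = beta \<A> D u x; Y = ext \<A> u y in
      dir (slit \<A>) (\<lambda>q. S q (Y q)) u \<xi> - S u (D u \<xi> Y))"

definition hcov02 ::
  "('m, 'e::euclidean_space) atlas \<Rightarrow> ('m, 'e) conn \<Rightarrow> ('m, 'e) tensor02 \<Rightarrow>
   'm \<times> 'e \<Rightarrow> 'e \<Rightarrow> 'e \<Rightarrow> 'e \<Rightarrow> real" where
  "hcov02 \<A> D S u x y z =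
     (let \<xi> = beta \<A> D u x; Y = ext \<A> u y; Z = ext \<A> u z in
      dir (slit \<A>) (\<lambda>q. S q (Y q) (Z q)) u \<xi> - S u (D u \<xi> Y) z - S u y (D u \<xi> Z))"

definition hcov13 ::
  "('m, 'e::euclidean_space) atlas \<Rightarrow> ('m, 'e) conn \<Rightarrow> ('m, 'e) tensor13 \<Rightarrow>
   'm \<times> 'e \<Rightarrow> 'e \<Rightarrow> 'e \<Rightarrow> 'e \<Rightarrow> 'e \<Rightarrow> 'e" where
  "hcov13 \<A> D S u x y z w =
     (let \<xi> = beta \<A> D u x; Y = ext \<A> u y; Z = ext \<A> u z; V = ext \<A> u w in
      D u \<xi> (\<lambda>q. S q (Y q) (Z q) (V q)) -
      S u (D u \<xi> Y) z w - S u y (D u \<xi> Z) w - S u y z (D u \<xi> V))"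

text \<open>The second derivative is the derivative of the tensor field \<open>(y, \<dots>) \<mapsto> hcov S u y \<dots>\<close>, the
  new slot \<open>x\<close> following the slot \<open>y\<close> of the first derivative:
  \<open>(\<nabla>\<nabla>S)(y, x) = \<nabla>\<^sub>x (\<nabla>\<^sub>Y S) - \<nabla>\<^bsub>\<nabla>\<^sub>x Y\<^esub> S\<close>, where \<open>cov\<close> is \<open>hcov02 \<A> D\<close> or \<open>hcov13 \<A> D\<close> and \<open>'t\<close> the
  corresponding type of tensors on a fibre. In the same way \<open>(\<nabla>A)(y, x) = hcov01 \<A> D A u x y\<close>
  for a 1-form \<open>A\<close>, so that \<open>\<nabla>(A \<otimes> S) = \<nabla>A \<otimes> S + A \<otimes> \<nabla>S\<close>.\<close>

definition hcov2 ::
  "('m, 'e::euclidean_space) atlas \<Rightarrow> ('m, 'e) conn \<Rightarrow>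
   (('m \<times> 'e \<Rightarrow> 't) \<Rightarrow> 'm \<times> 'e \<Rightarrow> 'e \<Rightarrow> 't) \<Rightarrow> ('m \<times> 'e \<Rightarrow> 't) \<Rightarrow>
   'm \<times> 'e \<Rightarrow> 'e \<Rightarrow> 'e \<Rightarrow> 't::minus" where
  "hcov2 \<A> D cov S u y x =
     (let Y = ext \<A> u y in
      cov (\<lambda>q. cov S q (Y q)) u x - cov S u (D u (beta \<A> D u x) Y))"


section \<open>Recurrence\<close>

text \<open>Throughout, a tensor field is non-zero if it does not vanish identically.\<close>

definition nonzero01 :: "('m, 'e::euclidean_space) atlas \<Rightarrow> ('m, 'e) tensor01 \<Rightarrow> bool" where
  "nonzero01 \<A> S \<longleftrightarrow> (\<exists>u\<in>TM0 \<A>. \<exists>x. S u x \<noteq> 0)"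

definition nonzero02 :: "('m, 'e::euclidean_space) atlas \<Rightarrow> ('m, 'e) tensor02 \<Rightarrow> bool" where
  "nonzero02 \<A> S \<longleftrightarrow> (\<exists>u\<in>TM0 \<A>. \<exists>x y. S u x y \<noteq> 0)"

definition nonzero13 :: "('m, 'e::euclidean_space) atlas \<Rightarrow> ('m, 'e) tensor13 \<Rightarrow> bool" where
  "nonzero13 \<A> S \<longleftrightarrow> (\<exists>u\<in>TM0 \<A>. \<exists>x y z. S u x y z \<noteq> 0)"

definition recurrence_form1 ::
  "('m, 'e::euclidean_space) atlas \<Rightarrow> ('m, 'e) tensor01 \<Rightarrow> bool" where
  "recurrence_form1 \<A> A \<longleftrightarrow>
     (\<forall>u\<in>TM0 \<A>. linear (A u)) \<and>
     (\<forall>W X. openin (atlas_topology (slit \<A>)) W \<and> smooth_pi \<A> W X \<longrightarrow>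
        smooth_fun (slit \<A>) W (\<lambda>q. A q (X q))) \<and>
     (\<forall>(p, y)\<in>TM0 \<A>. \<forall>t>0. A (p, t *\<^sub>R y) = A (p, y)) \<and>
     nonzero01 \<A> A"

definition recurrence_form2 ::
  "('m, 'e::euclidean_space) atlas \<Rightarrow> ('m, 'e) tensor02 \<Rightarrow> bool" where
  "recurrence_form2 \<A> \<alpha> \<longleftrightarrow>
     (\<forall>u\<in>TM0 \<A>. bilinear (\<alpha> u)) \<and>
     (\<forall>W X Y. openin (atlas_topology (slit \<A>)) W \<and> smooth_pi \<A> W X \<and> smooth_pi \<A> W Y \<longrightarrow>
        smooth_fun (slit \<A>) W (\<lambda>q. \<alpha> q (X q) (Y q))) \<and>
     (\<forall>(p, y)\<in>TM0 \<A>. \<forall>t>0. \<alpha> (p, t *\<^sub>R y) = \<alpha> (p, y)) \<and>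
     nonzero02 \<A> \<alpha>"

definition recurrent ::
  "('m, 'e::euclidean_space) atlas \<Rightarrow> ('m, 'e) conn \<Rightarrow> ('m, 'e) tensor01 \<Rightarrow> bool" where
  "recurrent \<A> D A \<longleftrightarrow>
     DIM('e) \<ge> 3 \<and> nonzero13 \<A> (hcurv \<A> D) \<and> recurrence_form1 \<A> A \<and>
     (\<forall>u\<in>TM0 \<A>. \<forall>x y z w. hcov13 \<A> D (hcurv \<A> D) u x y z w = A u x *\<^sub>R hcurv \<A> D u y z w)"

definition two_recurrent ::
  "('m, 'e::euclidean_space) atlas \<Rightarrow> ('m, 'e) conn \<Rightarrow> ('m, 'e) tensor02 \<Rightarrow> bool" where
  "two_recurrent \<A> D \<alpha> \<longleftrightarrow>
     DIM('e) \<ge> 3 \<and> nonzero13 \<A> (hcurv \<A> D) \<and> recurrence_form2 \<A> \<alpha> \<and>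
     (\<forall>u\<in>TM0 \<A>. \<forall>x x' y z w.
        hcov2 \<A> D (hcov13 \<A> D) (hcurv \<A> D) u x x' y z w = \<alpha> u x x' *\<^sub>R hcurv \<A> D u y z w)"

definition ricci_recurrent ::
  "('m, 'e::euclidean_space) atlas \<Rightarrow> ('m, 'e) conn \<Rightarrow> ('m, 'e) tensor01 \<Rightarrow> bool" where
  "ricci_recurrent \<A> D A \<longleftrightarrow>
     DIM('e) \<ge> 3 \<and> nonzero02 \<A> (hric \<A> D) \<and> recurrence_form1 \<A> A \<and>
     (\<forall>u\<in>TM0 \<A>. \<forall>x y z. hcov02 \<A> D (hric \<A> D) u x y z = A u x * hric \<A> D u y z)"

definition two_ricci_recurrent ::
  "('m, 'e::euclidean_space) atlas \<Rightarrow> ('m, 'e) conn \<Rightarrow> ('m, 'e) tensor02 \<Rightarrow> bool" where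
  "two_ricci_recurrent \<A> D \<alpha> \<longleftrightarrow>
     DIM('e) \<ge> 3 \<and> nonzero02 \<A> (hric \<A> D) \<and> recurrence_form2 \<A> \<alpha> \<and>
     (\<forall>u\<in>TM0 \<A>. \<forall>x x' y z.
        hcov2 \<A> D (hcov02 \<A> D) (hric \<A> D) u x x' y z = \<alpha> u x x' * hric \<A> D u y z)"

definition concircularly_recurrent ::
  "('m, 'e::euclidean_space) atlas \<Rightarrow> ('m \<times> 'e \<Rightarrow> real) \<Rightarrow> ('m, 'e) conn \<Rightarrow>
   ('m, 'e) tensor01 \<Rightarrow> bool" where
  "concircularly_recurrent \<A> L D A \<longleftrightarrow>
     DIM('e) \<ge> 3 \<and> nonzero13 \<A> (concircular \<A> L D) \<and> recurrence_form1 \<A> A \<and>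
     (\<forall>u\<in>TM0 \<A>. \<forall>x y z w.
        hcov13 \<A> D (concircular \<A> L D) u x y z w = A u x *\<^sub>R concircular \<A> L D u y z w)"

end

theory Submission
  imports Defs
begin

text \<open>Since \<open>\<nabla>g = 0\<close>, taking traces in \<open>\<nabla>R = A \<otimes> R\<close> shows that \<open>Ric\<close>, \<open>r\<close> and \<open>C\<close> are recurrent with the
  same form \<open>A\<close>, and the Leibniz rule gives \<open>\<nabla>\<nabla>R = (\<nabla>A + A \<otimes> A) \<otimes> R\<close>, likewise for \<open>Ric\<close>. What needs an
  argument is that \<open>Ric\<close> and \<open>C\<close> do not vanish identically.

  Suppose \<open>Ric = 0\<close>. Then the Jacobi endomorphism \<open>J X = R(X, y) y\<close>, which is self-adjoint, is trace free.
  If \<open>J \<noteq> 0\<close>, differentiating the recurrence along the spray and in vertical directions shows that the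
  Landsberg tensor \<open>P\<close> commutes with \<open>J\<close> and that the vertical derivative of \<open>J\<close> is, up to terms in \<open>A\<close> that
  turn out to vanish, a commutator with \<open>J\<close>. Within one fibre choose \<open>y\<close> and an eigenvector of \<open>J\<close> for
  which the eigenvalue divided by \<open>L\<^sup>2\<close> is minimal: the first and second order conditions there are incompatible with
  \<open>J\<close> having a negative and a positive eigenvalue. Hence \<open>J = 0\<close>, so that \<open>R(X, Y) y = 0\<close>, and the same
  argument for the endomorphisms \<open>X \<mapsto> R(X, v) v\<close> yields \<open>R = 0\<close>.

  Suppose \<open>C = 0\<close>, so that \<open>R = k G\<close>. The Bianchi identities show that \<open>k\<close> is locally constant, as in
  Schur's lemma, and that \<open>A = 0\<close> wherever \<open>k \<noteq> 0\<close>. As \<open>M\<close> is connected, \<open>r \<noteq> 0\<close> somewhere would force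
  \<open>A = 0\<close> everywhere.\<close>

section \<open>Smooth maps\<close>

text \<open>In the Ricci flat case the source of information is that horizontal derivatives do not
  commute: the bracket of two horizontal lifts has the vertical part \<open>R(X, Y) y\<close>.
  Commuting the derivatives of the recurrent \<open>J\<close> along the spray and along
  \<open>X\<close> therefore yields the derivative of \<open>J\<close> in the vertical direction
  \<open>J X\<close>. Trace freeness forces a nonzero \<open>J\<close> to have eigenvalues of both
  signs. As \<open>J\<close> has degree two in \<open>y\<close>, division by
  \<open>L\<^sup>2\<close> gives degree zero, and a minimum exists by compactness. Once
  \<open>J = 0\<close>, horizontal lifts do commute; the Ricci identity for \<open>R\<close> is then
  algebraic in one fibre, and the same extremum theorem applies with a metric that is constant in
  the variable \<open>v\<close>. When \<open>C = 0\<close>, \<open>k\<close> descends to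
  \<open>M\<close> and \<open>k A\<close> is its differential, but the Bianchi identity kills
  \<open>A\<close> only orthogonally to \<open>y\<close>. The remaining component is removed by
  moving \<open>y\<close> into the kernel of that differential, which is the same for all
  \<open>y\<close>.\<close>

abbreviation dd :: "('a::real_normed_vector \<Rightarrow> 'b::real_normed_vector) \<Rightarrow> 'a \<Rightarrow> 'a \<Rightarrow> 'b" where
  "dd f x \<equiv> frechet_derivative f (at x)"

lemma dd_works: "f differentiable (at x) \<Longrightarrow> (f has_derivative dd f x) (at x)"
  by (simp add: frechet_derivative_works)

lemma dd_eq: "(f has_derivative f') (at x) \<Longrightarrow> dd f x = f'"
  by (rule frechet_derivative_at[symmetric])

lemma dd_cong_open:
  assumes "open S" "x \<in> S" "\<And>y. y \<in> S \<Longrightarrow> f y = g y"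
  shows "dd f x = dd g x"
proof -
  have "(f has_derivative D) (at x) \<longleftrightarrow> (g has_derivative D) (at x)" for D
    using has_derivative_transform_within_open[OF _ assms(1,2), of f D UNIV g]
      has_derivative_transform_within_open[OF _ assms(1,2), of g D UNIV f] assms(3) by auto
  then show ?thesis
    by (simp add: frechet_derivative_def)
qed

lemma differentiable_cong_open:
  assumes "open S" "x \<in> S" "\<And>y. y \<in> S \<Longrightarrow> f y = g y" "f differentiable (at x)"
  shows "g differentiable (at x)"
  using has_derivative_transform_within_open[OF _ assms(1,2), of f _ UNIV g] assms(3,4)
  unfolding differentiable_def by auto

lemma dd_sum_Basis:
  fixes f :: "'a::euclidean_space \<Rightarrow> 'b::real_normed_vector"
  assumes "f differentiable (at x)"
  shows "dd f x v = (\<Sum>b\<in>Basis. (v \<bullet> b) *\<^sub>R dd f x b)"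
proof -
  have l: "linear (dd f x)"
    using assms by (rule linear_frechet_derivative)
  have "dd f x v = dd f x (\<Sum>b\<in>Basis. (v \<bullet> b) *\<^sub>R b)"
    by (simp add: euclidean_representation)
  also have "\<dots> = (\<Sum>b\<in>Basis. (v \<bullet> b) *\<^sub>R dd f x b)"
    by (simp add: linear_sum[OF l] linear_scale[OF l])
  finally show ?thesis .
qed

lemma Ck_on_cong:
  assumes "open S" "\<And>x. x \<in> S \<Longrightarrow> f x = g x" "Ck_on k S f"
  shows "Ck_on k S g"
  using assms(2,3)
proof (induction k arbitrary: f g)
  case 0
  then show ?case by (simp add: continuous_on_cong[OF refl, of S f g])
next
  case (Suc k)
  have d: "g differentiable_on S"
    using Suc.prems assms(1) differentiable_cong_open[OF assms(1)]
    by (metis Ck_on.simps(2) differentiable_on_eq_differentiable_at)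
  have "Ck_on k S (\<lambda>x. dd g x b)" if b: "b \<in> Basis" for b
  proof (rule Suc.IH[of "\<lambda>x. dd f x b"])
    show "dd f x b = dd g x b" if "x \<in> S" for x
      using dd_cong_open[OF assms(1) that Suc.prems(1)] by simp
  qed (use Suc.prems b in auto)
  with d show ?case by simp
qed

lemma Ck_on_subset: "Ck_on k S f \<Longrightarrow> T \<subseteq> S \<Longrightarrow> Ck_on k T f"
  by (induction k arbitrary: f) (auto intro: continuous_on_subset differentiable_on_subset)

lemma Ck_on_Suc_lower: "Ck_on (Suc k) S f \<Longrightarrow> Ck_on k S f"
proof (induction k arbitrary: f)
  case 0
  then show ?case by (simp add: differentiable_imp_continuous_on)
next
  case (Suc k)
  then show ?case by (metis Ck_on.simps(2))
qed

lemma Ck_on_const: "Ck_on k S (\<lambda>x. c)"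
  by (induction k arbitrary: c) auto

lemma Ck_on_diffble: "Ck_on (Suc k) S f \<Longrightarrow> open S \<Longrightarrow> x \<in> S \<Longrightarrow> f differentiable (at x)"
  by (simp add: differentiable_on_eq_differentiable_at)

lemma Ck_on_add:
  assumes "open S" "Ck_on k S f" "Ck_on k S g"
  shows "Ck_on k S (\<lambda>x. f x + g x)"
  using assms(2,3)
proof (induction k arbitrary: f g)
  case 0
  then show ?case by (auto intro: continuous_intros)
next
  case (Suc k)
  have d: "(\<lambda>x. f x + g x) differentiable_on S"
    using Suc.prems by (auto intro: derivative_intros)
  have "Ck_on k S (\<lambda>x. dd (\<lambda>x. f x + g x) x b)" if b: "b \<in> Basis" for b
  proof (rule Ck_on_cong[OF assms(1)])
    show "Ck_on k S (\<lambda>x. dd f x b + dd g x b)"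
      using Suc b by auto
    show "dd f x b + dd g x b = dd (\<lambda>x. f x + g x) x b" if "x \<in> S" for x
      using Suc.prems that assms(1)
      by (subst dd_eq[OF has_derivative_add[OF dd_works dd_works]]) (auto simp: differentiable_on_eq_differentiable_at)
  qed
  with d show ?case by simp
qed

lemma Ck_on_sum:
  assumes "open S" "\<And>i. i \<in> I \<Longrightarrow> Ck_on k S (f i)"
  shows "Ck_on k S (\<lambda>x. \<Sum>i\<in>I. f i x)"
  using assms(2)
proof (induction I rule: infinite_finite_induct)
  case (insert i I)
  then have "Ck_on k S (\<lambda>x. f i x + (\<Sum>i\<in>I. f i x))"
    by (intro Ck_on_add[OF assms(1)]) auto
  with insert show ?case by simp
qed (auto simp: Ck_on_const)

lemma Ck_on_bilinear:
  assumes "open S" "bounded_bilinear B" "Ck_on k S f" "Ck_on k S g"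
  shows "Ck_on k S (\<lambda>x. B (f x) (g x))"
  using assms(3,4)
proof (induction k arbitrary: f g)
  case 0
  then show ?case by (auto intro!: bounded_bilinear.continuous_on[OF assms(2)])
next
  case (Suc k)
  have has: "((\<lambda>x. B (f x) (g x)) has_derivative (\<lambda>h. B (f x) (dd g x h) + B (dd f x h) (g x))) (at x)"
    if "x \<in> S" for x
    using Suc.prems that assms(1)
    by (intro bounded_bilinear.FDERIV[OF assms(2)] dd_works) (auto simp: differentiable_on_eq_differentiable_at)
  then have d: "(\<lambda>x. B (f x) (g x)) differentiable_on S"
    by (auto simp: differentiable_on_eq_differentiable_at[OF assms(1)] differentiable_def)
  have "Ck_on k S (\<lambda>x. dd (\<lambda>x. B (f x) (g x)) x b)" if b: "b \<in> Basis" for b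
  proof (rule Ck_on_cong[OF assms(1)])
    show "Ck_on k S (\<lambda>x. B (f x) (dd g x b) + B (dd f x b) (g x))"
      using Suc.prems b Ck_on_Suc_lower[OF Suc.prems(1)] Ck_on_Suc_lower[OF Suc.prems(2)]
      by (intro Ck_on_add[OF assms(1)] Suc.IH) auto
  qed (simp add: dd_eq[OF has])
  with d show ?case by simp
qed

lemma Ck_on_linear:
  assumes "open S" "bounded_linear h" "Ck_on k S f"
  shows "Ck_on k S (\<lambda>x. h (f x))"
  using assms(3)
proof (induction k arbitrary: f)
  case 0
  then show ?case by (auto intro!: bounded_linear.continuous_on[OF assms(2)])
next
  case (Suc k)
  have has: "((\<lambda>x. h (f x)) has_derivative (\<lambda>v. h (dd f x v))) (at x)" if "x \<in> S" for x
    using Suc.prems that assms(1)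
    by (intro bounded_linear.has_derivative[OF assms(2)] dd_works) (auto simp: differentiable_on_eq_differentiable_at)
  then have d: "(\<lambda>x. h (f x)) differentiable_on S"
    by (auto simp: differentiable_on_eq_differentiable_at[OF assms(1)] differentiable_def)
  have "Ck_on k S (\<lambda>x. dd (\<lambda>x. h (f x)) x b)" if b: "b \<in> Basis" for b
    by (rule Ck_on_cong[OF assms(1), of "\<lambda>x. h (dd f x b)"]) (use Suc b in \<open>auto simp: dd_eq[OF has]\<close>)
  with d show ?case by simp
qed

lemma Ck_on_ident: "open S \<Longrightarrow> Ck_on k S (\<lambda>x. x)"
  by (cases k) (auto simp: Ck_on_const intro: continuous_intros derivative_intros)

lemma Ck_on_compose:
  fixes f :: "'a::euclidean_space \<Rightarrow> 'b::euclidean_space" and g :: "'b \<Rightarrow> 'c::real_normed_vector"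
  assumes "open S" "open T" "f ` S \<subseteq> T" "Ck_on k S f" "Ck_on k T g"
  shows "Ck_on k S (\<lambda>x. g (f x))"
  using assms(4,5)
proof (induction k arbitrary: g)
  case 0
  then show ?case
    using assms(3) by (auto intro: continuous_on_compose2)
next
  case (Suc k)
  have gd: "g differentiable (at (f x))" if "x \<in> S" for x
    using Suc.prems(2) assms that by (auto simp: differentiable_on_eq_differentiable_at)
  have has: "((\<lambda>x. g (f x)) has_derivative (\<lambda>v. dd g (f x) (dd f x v))) (at x)" if "x \<in> S" for x
    using Suc.prems(1) that assms(1) gd[OF that]
    by (intro has_derivative_compose[of f "dd f x" x UNIV g] dd_works)
       (auto simp: differentiable_on_eq_differentiable_at)
  then have d: "(\<lambda>x. g (f x)) differentiable_on S"
    by (auto simp: differentiable_on_eq_differentiable_at[OF assms(1)] differentiable_def)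
  have "Ck_on k S (\<lambda>x. dd (\<lambda>x. g (f x)) x b)" if b: "b \<in> Basis" for b
  proof (rule Ck_on_cong[OF assms(1)])
    \<comment> \<open>In a basis, the chain rule involves derivatives of \<open>g\<close> in fixed
      directions only, and these are the ones that the induction hypothesis controls.\<close>
    show "Ck_on k S (\<lambda>x. \<Sum>i\<in>Basis. (dd f x b \<bullet> i) *\<^sub>R dd g (f x) i)"
    proof (intro Ck_on_sum[OF assms(1)] Ck_on_bilinear[OF assms(1) bounded_bilinear_scaleR]
        Ck_on_bilinear[OF assms(1) bounded_bilinear_inner] Ck_on_const)
      show "Ck_on k S (\<lambda>x. dd f x b)" using Suc.prems(1) b by simp
      fix i :: 'b assume i: "i \<in> Basis"
      show "Ck_on k S (\<lambda>x. dd g (f x) i)"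
        using Suc.prems(2) i by (intro Suc.IH Ck_on_Suc_lower[OF Suc.prems(1)]) simp
    qed
  qed (simp add: dd_eq[OF has] dd_sum_Basis[OF gd, symmetric])
  with d show ?case by simp
qed

context
  fixes S :: "'a::euclidean_space set"
  assumes S: "open S"
begin

lemma smooth_on_cong: "smooth_on S f \<Longrightarrow> (\<And>x. x \<in> S \<Longrightarrow> f x = g x) \<Longrightarrow> smooth_on S g"
  unfolding smooth_on_def using Ck_on_cong[OF S] by blast

lemma smooth_on_diffble: "smooth_on S f \<Longrightarrow> x \<in> S \<Longrightarrow> f differentiable (at x)"
  unfolding smooth_on_def using Ck_on_diffble[OF _ S] by blast

lemma smooth_on_cont: "smooth_on S f \<Longrightarrow> continuous_on S f"
  unfolding smooth_on_def by (metis Ck_on.simps(1))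

lemma smooth_on_const: "smooth_on S (\<lambda>x. c)"
  by (simp add: smooth_on_def Ck_on_const)

lemma smooth_on_ident: "smooth_on S (\<lambda>x. x)"
  by (simp add: smooth_on_def Ck_on_ident S)

lemma smooth_on_add: "smooth_on S f \<Longrightarrow> smooth_on S g \<Longrightarrow> smooth_on S (\<lambda>x. f x + g x)"
  by (simp add: smooth_on_def Ck_on_add S)

lemma smooth_on_bilinear:
  "bounded_bilinear B \<Longrightarrow> smooth_on S f \<Longrightarrow> smooth_on S g \<Longrightarrow> smooth_on S (\<lambda>x. B (f x) (g x))"
  by (simp add: smooth_on_def Ck_on_bilinear S)

lemma smooth_on_linear: "bounded_linear h \<Longrightarrow> smooth_on S f \<Longrightarrow> smooth_on S (\<lambda>x. h (f x))"
  by (simp add: smooth_on_def Ck_on_linear S)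

lemma smooth_on_lin:
  fixes f :: "'a \<Rightarrow> 'b::euclidean_space"
  shows "linear h \<Longrightarrow> smooth_on S f \<Longrightarrow> smooth_on S (\<lambda>x. h (f x))"
  by (simp add: smooth_on_linear linear_conv_bounded_linear)

lemma smooth_on_minus: "smooth_on S f \<Longrightarrow> smooth_on S (\<lambda>x. - f x)"
  by (rule smooth_on_linear[OF bounded_linear_minus[OF bounded_linear_ident]])

lemma smooth_on_diff: "smooth_on S f \<Longrightarrow> smooth_on S g \<Longrightarrow> smooth_on S (\<lambda>x. f x - g x)"
  using smooth_on_add[OF _ smooth_on_minus, of f g] by simp

lemma smooth_on_scaleR: "smooth_on S f \<Longrightarrow> smooth_on S g \<Longrightarrow> smooth_on S (\<lambda>x. f x *\<^sub>R g x)"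
  by (rule smooth_on_bilinear[OF bounded_bilinear_scaleR])

lemma smooth_on_mult:
  fixes f g :: "'a \<Rightarrow> real"
  shows "smooth_on S f \<Longrightarrow> smooth_on S g \<Longrightarrow> smooth_on S (\<lambda>x. f x * g x)"
  by (rule smooth_on_bilinear[OF bounded_bilinear_mult])

lemma smooth_on_inner: "smooth_on S f \<Longrightarrow> smooth_on S g \<Longrightarrow> smooth_on S (\<lambda>x. f x \<bullet> g x)"
  by (rule smooth_on_bilinear[OF bounded_bilinear_inner])

lemma smooth_on_power:
  fixes f :: "'a \<Rightarrow> real"
  shows "smooth_on S f \<Longrightarrow> smooth_on S (\<lambda>x. f x ^ n)"
  by (induction n) (auto intro: smooth_on_const smooth_on_mult)

lemma smooth_on_sum: "(\<And>i. i \<in> I \<Longrightarrow> smooth_on S (f i)) \<Longrightarrow> smooth_on S (\<lambda>x. \<Sum>i\<in>I. f i x)"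
  by (simp add: smooth_on_def Ck_on_sum S)

lemma smooth_on_compose:
  fixes f :: "'a \<Rightarrow> 'b::euclidean_space"
  assumes "open T" "f ` S \<subseteq> T" "smooth_on S f" "smooth_on T g"
  shows "smooth_on S (\<lambda>x. g (f x))"
  using assms by (simp add: smooth_on_def Ck_on_compose[OF S])

lemma smooth_on_dd_Basis: "smooth_on S f \<Longrightarrow> b \<in> Basis \<Longrightarrow> smooth_on S (\<lambda>x. dd f x b)"
  unfolding smooth_on_def by (metis Ck_on.simps(2))

lemma smooth_on_dd_field:
  assumes "smooth_on S f" "smooth_on S v"
  shows "smooth_on S (\<lambda>x. dd f x (v x))"
proof (rule smooth_on_cong)
  show "smooth_on S (\<lambda>x. \<Sum>b\<in>Basis. (v x \<bullet> b) *\<^sub>R dd f x b)"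
    using assms by (intro smooth_on_sum smooth_on_scaleR smooth_on_inner smooth_on_const smooth_on_dd_Basis)
qed (simp add: dd_sum_Basis[symmetric] smooth_on_diffble[OF assms(1)])

lemma smooth_on_dd: "smooth_on S f \<Longrightarrow> smooth_on S (\<lambda>x. dd f x v)"
  by (rule smooth_on_dd_field[OF _ smooth_on_const])

end

lemma smooth_on_subset: "smooth_on S f \<Longrightarrow> T \<subseteq> S \<Longrightarrow> smooth_on T f"
  unfolding smooth_on_def using Ck_on_subset by blast

lemma smooth_on_Pair:
  fixes f :: "'a::euclidean_space \<Rightarrow> 'b::euclidean_space" and g :: "'a \<Rightarrow> 'c::euclidean_space"
  assumes "open S" "smooth_on S f" "smooth_on S g"
  shows "smooth_on S (\<lambda>x. (f x, g x))"
proof -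
  have "linear (\<lambda>u::'b. (u, 0::'c))" "linear (\<lambda>v::'c. (0::'b, v))"
    by (auto intro!: linearI)
  then have "smooth_on S (\<lambda>x. (f x, 0) + (0, g x))"
    by (intro smooth_on_add[OF assms(1)] smooth_on_lin[OF assms(1) _ assms(2)]
        smooth_on_lin[OF assms(1) _ assms(3)])
  then show ?thesis by simp
qed

text \<open>The mixed difference quotients along \<open>v\<close> and \<open>w\<close> are symmetric, and two applications of the
  mean value theorem identify their limit with either mixed derivative.\<close>

lemma dd_dd_commute_real:
  fixes f :: "'a::euclidean_space \<Rightarrow> real"
  assumes S: "open S" "x \<in> S" and f: "smooth_on S f"
  shows "dd (\<lambda>z. dd f z v) x w = dd (\<lambda>z. dd f z w) x v"
proof -
  define Q where "Q h = f (x + h *\<^sub>R v + h *\<^sub>R w) - f (x + h *\<^sub>R v) - f (x + h *\<^sub>R w) + f x" for h :: real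
  have key: "\<exists>s t. 0 \<le> s \<and> s \<le> h \<and> 0 \<le> t \<and> t \<le> h \<and>
      f (x + h *\<^sub>R v + h *\<^sub>R w) - f (x + h *\<^sub>R v) - f (x + h *\<^sub>R w) + f x
        = h * h * dd (\<lambda>z. dd f z v) (x + s *\<^sub>R v + t *\<^sub>R w) w"
    if h: "0 < h" and sub: "\<And>s t. 0 \<le> s \<Longrightarrow> s \<le> h \<Longrightarrow> 0 \<le> t \<Longrightarrow> t \<le> h \<Longrightarrow> x + s *\<^sub>R v + t *\<^sub>R w \<in> S"
    for h v w
  proof -
    have fd: "(f has_derivative dd f z) (at z)" if "z \<in> S" for z
      using smooth_on_diffble[OF S(1) f that] by (rule dd_works)
    have gd: "((\<lambda>z. dd f z v) has_derivative dd (\<lambda>z. dd f z v) z) (at z)" if "z \<in> S" for z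
      by (rule dd_works[OF smooth_on_diffble[OF S(1) smooth_on_dd[OF S(1) f] that]])
    have lin: "dd f z (c *\<^sub>R v) = c *\<^sub>R dd f z v" if "z \<in> S" for z c v
      using linear_frechet_derivative[OF smooth_on_diffble[OF S(1) f that]] by (rule linear_scale)
    have lin2: "dd (\<lambda>z. dd f z v) z (c *\<^sub>R w) = c *\<^sub>R dd (\<lambda>z. dd f z v) z w" if "z \<in> S" for z c
      using linear_frechet_derivative[OF smooth_on_diffble[OF S(1) smooth_on_dd[OF S(1) f] that]] by (rule linear_scale)
    define k where "k s = f (x + s *\<^sub>R v + h *\<^sub>R w) - f (x + s *\<^sub>R v)" for s
    have kd: "(k has_derivative (\<lambda>c. c * (dd f (x + s *\<^sub>R v + h *\<^sub>R w) v - dd f (x + s *\<^sub>R v) v))) (at s)"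
      if "0 \<le> s" "s \<le> h" for s
    proof -
      have i: "x + s *\<^sub>R v + h *\<^sub>R w \<in> S" "x + s *\<^sub>R v \<in> S"
        using sub[of s h] sub[of s 0] that h by auto
      have "(k has_derivative (\<lambda>c. dd f (x + s *\<^sub>R v + h *\<^sub>R w) (c *\<^sub>R v) - dd f (x + s *\<^sub>R v) (c *\<^sub>R v))) (at s)"
        unfolding k_def
        by (rule derivative_eq_intros has_derivative_compose[OF _ fd] i refl | simp)+
      then show ?thesis
        by (simp add: lin i right_diff_distrib)
    qed
    have "\<exists>s. 0 < s \<and> s < h \<and> k h - k 0 = h * (dd f (x + s *\<^sub>R v + h *\<^sub>R w) v - dd f (x + s *\<^sub>R v) v)"
    proof -
      have c: "continuous_on {0..h} k"
        using kd by (intro has_derivative_continuous_on[of "{0..h}" k]) (auto intro: has_derivative_at_withinI)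
      show ?thesis
        using mvt[OF h c, of "\<lambda>s c. c * (dd f (x + s *\<^sub>R v + h *\<^sub>R w) v - dd f (x + s *\<^sub>R v) v)"] kd
        by (auto simp: )
    qed
    then obtain s where s: "0 < s" "s < h"
      "k h - k 0 = h * (dd f (x + s *\<^sub>R v + h *\<^sub>R w) v - dd f (x + s *\<^sub>R v) v)" by blast
    define l where "l t = dd f (x + s *\<^sub>R v + t *\<^sub>R w) v" for t
    have ld: "(l has_derivative (\<lambda>c. c * dd (\<lambda>z. dd f z v) (x + s *\<^sub>R v + t *\<^sub>R w) w)) (at t)"
      if "0 \<le> t" "t \<le> h" for t
    proof -
      have i: "x + s *\<^sub>R v + t *\<^sub>R w \<in> S"
        using sub[of s t] that s by auto
      have "(l has_derivative (\<lambda>c. dd (\<lambda>z. dd f z v) (x + s *\<^sub>R v + t *\<^sub>R w) (c *\<^sub>R w))) (at t)"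
        unfolding l_def
        by (rule derivative_eq_intros has_derivative_compose[OF _ gd] i refl | simp)+
      then show ?thesis by (simp add: lin2 i)
    qed
    have "\<exists>t. 0 < t \<and> t < h \<and> l h - l 0 = h * dd (\<lambda>z. dd f z v) (x + s *\<^sub>R v + t *\<^sub>R w) w"
    proof -
      have c: "continuous_on {0..h} l"
        using ld by (intro has_derivative_continuous_on[of "{0..h}" l]) (auto intro: has_derivative_at_withinI)
      show ?thesis
        using mvt[OF h c, of "\<lambda>t c. c * dd (\<lambda>z. dd f z v) (x + s *\<^sub>R v + t *\<^sub>R w) w"] ld by auto
    qed
    then obtain t where "0 < t" "t < h" "l h - l 0 = h * dd (\<lambda>z. dd f z v) (x + s *\<^sub>R v + t *\<^sub>R w) w" by blast
    with s show ?thesis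
      by (intro exI[of _ s] exI[of _ t]) (auto simp: k_def l_def algebra_simps)
  qed
  have lim: "(\<lambda>n. Q (inverse (real (Suc n))) / (inverse (real (Suc n)))\<^sup>2) \<longlonglongrightarrow> dd (\<lambda>z. dd f z v) x w"
    if Q: "\<And>h. Q h = f (x + h *\<^sub>R v + h *\<^sub>R w) - f (x + h *\<^sub>R v) - f (x + h *\<^sub>R w) + f x" for v w and Q :: "real \<Rightarrow> real"
  proof (rule LIMSEQ_I)
    fix e :: real assume e: "0 < e"
    have "continuous (at x) (\<lambda>z. dd (\<lambda>z. dd f z v) z w)"
      using smooth_on_cont[OF S(1) smooth_on_dd[OF S(1) smooth_on_dd[OF S(1) f]]] S
      by (simp add: continuous_on_eq_continuous_at)
    then obtain d where d: "0 < d" "\<And>z. dist z x < d \<Longrightarrow> dist (dd (\<lambda>z. dd f z v) z w) (dd (\<lambda>z. dd f z v) x w) < e"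
      using e unfolding continuous_at_eps_delta by (metis dist_commute)
    obtain r where r: "0 < r" "ball x r \<subseteq> S"
      using S open_contains_ball by blast
    \<comment> \<open>For \<open>h < m\<close> the whole parallelogram spanned by \<open>h v\<close>
      and \<open>h w\<close> at \<open>x\<close> stays within \<open>min d r\<close> of
      \<open>x\<close>; the summand 1 keeps the denominator positive.\<close>
    define m where "m = min d r / (norm v + norm w + 1)"
    have m: "0 < m" using d r by (simp add: m_def pos_add_strict add_nonneg_pos)
    obtain n0 where n0: "inverse (real (Suc n0)) < m" using reals_Archimedean[OF m] by blast
    have "norm (Q (inverse (real (Suc n))) / (inverse (real (Suc n)))\<^sup>2 - dd (\<lambda>z. dd f z v) x w) < e" if n: "n \<ge> n0" for n
    proof -
      define h where "h = inverse (real (Suc n))"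
      have h: "0 < h" "h < m"
        using le_less_trans[OF le_imp_inverse_le[of "real (Suc n0)" "real (Suc n)"] n0] n
        by (auto simp: h_def)
      have near: "dist (x + s *\<^sub>R v + t *\<^sub>R w) x < min d r" if "0 \<le> s" "s \<le> h" "0 \<le> t" "t \<le> h" for s t
      proof -
        have "dist (x + s *\<^sub>R v + t *\<^sub>R w) x \<le> s * norm v + t * norm w"
          using that norm_triangle_ineq[of "s *\<^sub>R v" "t *\<^sub>R w"] by (simp add: dist_norm add.assoc)
        also have "\<dots> \<le> h * norm v + h * norm w"
          using that by (intro add_mono mult_right_mono) auto
        also have "\<dots> < h * (norm v + norm w + 1)" using h by (simp add: algebra_simps)
        also have "\<dots> \<le> m * (norm v + norm w + 1)" using h by (intro mult_right_mono) auto
        also have "\<dots> = min d r"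
          using norm_ge_zero[of v] norm_ge_zero[of w] by (simp add: m_def add_nonneg_eq_0_iff)
        finally show ?thesis .
      qed
      have inS: "x + s *\<^sub>R v + t *\<^sub>R w \<in> S" if "0 \<le> s" "s \<le> h" "0 \<le> t" "t \<le> h" for s t
        using near[OF that] r by (auto simp: dist_commute)
      obtain s t where st: "0 \<le> s" "s \<le> h" "0 \<le> t" "t \<le> h"
        "f (x + h *\<^sub>R v + h *\<^sub>R w) - f (x + h *\<^sub>R v) - f (x + h *\<^sub>R w) + f x
          = h * h * dd (\<lambda>z. dd f z v) (x + s *\<^sub>R v + t *\<^sub>R w) w"
        using key[OF h(1) inS] by blast
      have "Q h / h\<^sup>2 = dd (\<lambda>z. dd f z v) (x + s *\<^sub>R v + t *\<^sub>R w) w"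
        using h st(5) by (simp add: Q power2_eq_square)
      then show ?thesis
        using d(2)[of "x + s *\<^sub>R v + t *\<^sub>R w"] near[OF st(1-4)] by (simp add: h_def dist_norm)
    qed
    then show "\<exists>no. \<forall>n\<ge>no. norm (Q (inverse (real (Suc n))) / (inverse (real (Suc n)))\<^sup>2 - dd (\<lambda>z. dd f z v) x w) < e"
      by blast
  qed
  show ?thesis
    by (rule LIMSEQ_unique[OF lim[of Q v w] lim[of Q w v]]) (simp_all add: Q_def algebra_simps)
qed

lemma dd_inner_const:
  assumes "f differentiable (at x)"
  shows "dd (\<lambda>z. f z \<bullet> b) x v = dd f x v \<bullet> b"
  using dd_eq[OF has_derivative_inner_left[OF dd_works[OF assms]]] by simp

lemma dd_dd_commute:
  fixes f :: "'a::euclidean_space \<Rightarrow> 'b::euclidean_space"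
  assumes S: "open S" "x \<in> S" and f: "smooth_on S f"
  shows "dd (\<lambda>z. dd f z v) x w = dd (\<lambda>z. dd f z w) x v"
proof (rule euclidean_eqI)
  fix b :: 'b
  have fb: "smooth_on S (\<lambda>z. f z \<bullet> b)"
    by (intro smooth_on_inner[OF S(1)] f smooth_on_const[OF S(1)])
  have d1: "dd (\<lambda>z. f z \<bullet> b) z v = dd f z v \<bullet> b" if "z \<in> S" for z v
    by (rule dd_inner_const[OF smooth_on_diffble[OF S(1) f that]])
  have d2: "dd (\<lambda>z. dd f z v) x w \<bullet> b = dd (\<lambda>z. dd (\<lambda>z. f z \<bullet> b) z v) x w" for v w
    using dd_inner_const[OF smooth_on_diffble[OF S(1) smooth_on_dd[OF S(1) f] S(2)], of v b w]
      dd_cong_open[OF S, of "\<lambda>z. dd f z v \<bullet> b" "\<lambda>z. dd (\<lambda>z. f z \<bullet> b) z v"] d1 by simp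
  show "dd (\<lambda>z. dd f z v) x w \<bullet> b = dd (\<lambda>z. dd f z w) x v \<bullet> b"
    unfolding d2 by (rule dd_dd_commute_real[OF S fb])
qed

section \<open>Differential calculus of fields of multilinear maps\<close>

text \<open>The fields \<open>der\<close> put all derivatives into the form ``multilinear field applied to vectors'';
  the rules below compute with this form by rewriting.\<close>

definition der0 :: "('a::euclidean_space \<Rightarrow> 'c::euclidean_space) \<Rightarrow> 'a \<Rightarrow> 'a \<Rightarrow> 'c" where
  "der0 f x w = dd f x w"

definition der1 :: "('a::euclidean_space \<Rightarrow> 'b \<Rightarrow> 'c::euclidean_space) \<Rightarrow> 'a \<Rightarrow> 'a \<Rightarrow> 'b \<Rightarrow> 'c" where
  "der1 F x w X = dd (\<lambda>z. F z X) x w"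

definition der2 :: "('a::euclidean_space \<Rightarrow> 'b \<Rightarrow> 'd \<Rightarrow> 'c::euclidean_space) \<Rightarrow> 'a \<Rightarrow> 'a \<Rightarrow> 'b \<Rightarrow> 'd \<Rightarrow> 'c" where
  "der2 F x w X Y = dd (\<lambda>z. F z X Y) x w"

definition der3 :: "('a::euclidean_space \<Rightarrow> 'b \<Rightarrow> 'd \<Rightarrow> 'f \<Rightarrow> 'c::euclidean_space) \<Rightarrow> 'a \<Rightarrow> 'a \<Rightarrow> 'b \<Rightarrow> 'd \<Rightarrow> 'f \<Rightarrow> 'c" where
  "der3 F x w X Y Z = dd (\<lambda>z. F z X Y Z) x w"

text \<open>Smoothness is asked for constant arguments only. In finite dimension this already gives
  smoothness and a Leibniz rule for smooth arguments, see \<open>lf1_sm\<close> and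
  \<open>lf1_dd\<close>.\<close>

definition lf1 :: "'a::euclidean_space set \<Rightarrow> ('a \<Rightarrow> 'b::euclidean_space \<Rightarrow> 'c::euclidean_space) \<Rightarrow> bool" where
  "lf1 U F \<longleftrightarrow> (\<forall>x\<in>U. linear (F x)) \<and> (\<forall>X. smooth_on U (\<lambda>x. F x X))"

definition lf2 :: "'a::euclidean_space set \<Rightarrow> ('a \<Rightarrow> 'b::euclidean_space \<Rightarrow> 'd::euclidean_space \<Rightarrow> 'c::euclidean_space) \<Rightarrow> bool" where
  "lf2 U F \<longleftrightarrow> (\<forall>X. lf1 U (\<lambda>x. F x X)) \<and> (\<forall>Y. lf1 U (\<lambda>x X. F x X Y))"

definition lf3 :: "'a::euclidean_space set \<Rightarrow> ('a \<Rightarrow> 'b::euclidean_space \<Rightarrow> 'd::euclidean_space \<Rightarrow> 'f::euclidean_space \<Rightarrow> 'c::euclidean_space) \<Rightarrow> bool" where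
  "lf3 U F \<longleftrightarrow> (\<forall>X. lf2 U (\<lambda>x. F x X)) \<and> (\<forall>Y Z. lf1 U (\<lambda>x X. F x X Y Z))"

lemma linear_sum_Basis:
  fixes f :: "'a::euclidean_space \<Rightarrow> 'b::real_vector"
  assumes "linear f"
  shows "f v = (\<Sum>b\<in>Basis. (v \<bullet> b) *\<^sub>R f b)"
proof -
  have "f v = f (\<Sum>b\<in>Basis. (v \<bullet> b) *\<^sub>R b)"
    by (simp add: euclidean_representation)
  then show ?thesis
    by (simp add: linear_sum[OF assms] linear_scale[OF assms])
qed

locale smooth_domain =
  fixes U :: "'a::euclidean_space set"
  assumes open_U: "open U"
begin

abbreviation sm where "sm \<equiv> smooth_on U"

lemmas sm_rules =
  smooth_on_const[OF open_U] smooth_on_ident[OF open_U] smooth_on_add[OF open_U]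
  smooth_on_diff[OF open_U] smooth_on_minus[OF open_U] smooth_on_scaleR[OF open_U]
  smooth_on_mult[OF open_U] smooth_on_inner[OF open_U] smooth_on_sum[OF open_U]
  smooth_on_Pair[OF open_U] smooth_on_linear[OF open_U bounded_linear_fst]
  smooth_on_linear[OF open_U bounded_linear_snd] smooth_on_power[OF open_U]

lemmas sm_diffble = smooth_on_diffble[OF open_U]

lemma dd_rules:
  assumes x: "x \<in> U"
  shows "sm f \<Longrightarrow> sm g \<Longrightarrow> dd (\<lambda>z. f z + g z) x w = dd f x w + dd g x w"
    and "sm f \<Longrightarrow> sm g \<Longrightarrow> dd (\<lambda>z. f z - g z) x w = dd f x w - dd g x w"
    and "sm f \<Longrightarrow> dd (\<lambda>z. - f z) x w = - dd f x w"
    and "sm h \<Longrightarrow> sm f \<Longrightarrow> dd (\<lambda>z. h z *\<^sub>R f z) x w = dd h x w *\<^sub>R f x + h x *\<^sub>R dd f x w"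
    and "sm h \<Longrightarrow> sm k \<Longrightarrow> dd (\<lambda>z. h z * k z :: real) x w = dd h x w * k x + h x * dd k x w"
    and "sm a \<Longrightarrow> sm b \<Longrightarrow> dd (\<lambda>z. (a z, b z)) x w = (dd a x w, dd b x w)"
    and "sm c \<Longrightarrow> dd (\<lambda>z. fst (c z)) x w = fst (dd c x w)"
    and "sm c \<Longrightarrow> dd (\<lambda>z. snd (c z)) x w = snd (dd c x w)"
  by (simp_all add: dd_eq[OF has_derivative_add[OF dd_works dd_works]] dd_eq[OF has_derivative_diff[OF dd_works dd_works]]
      dd_eq[OF has_derivative_minus[OF dd_works]] dd_eq[OF has_derivative_scaleR[OF dd_works dd_works]]
      dd_eq[OF has_derivative_mult[OF dd_works dd_works]] dd_eq[OF has_derivative_Pair[OF dd_works dd_works]]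
      dd_eq[OF has_derivative_fst[OF dd_works]] dd_eq[OF has_derivative_snd[OF dd_works]] sm_diffble x algebra_simps)

lemma dd_lin:
  assumes "x \<in> U" "sm f"
  shows "dd f x (a + b) = dd f x a + dd f x b" "dd f x (a - b) = dd f x a - dd f x b"
    "dd f x (- a) = - dd f x a" "dd f x (c *\<^sub>R a) = c *\<^sub>R dd f x a" "dd f x 0 = 0"
  using linear_frechet_derivative[OF sm_diffble[OF assms(2,1)]]
  by (auto simp: linear_add linear_diff linear_neg linear_scale linear_0)

lemma dd_sum:
  assumes "x \<in> U" "\<And>i. i \<in> I \<Longrightarrow> sm (f i)"
  shows "dd (\<lambda>z. \<Sum>i\<in>I. f i z) x w = (\<Sum>i\<in>I. dd (f i) x w)"
proof -
  have "((\<lambda>z. \<Sum>i\<in>I. f i z) has_derivative (\<lambda>w. \<Sum>i\<in>I. dd (f i) x w)) (at x)"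
    by (rule has_derivative_sum) (intro dd_works sm_diffble assms)
  then show ?thesis by (simp add: dd_eq)
qed

lemma dd_cong_U: "x \<in> U \<Longrightarrow> (\<And>z. z \<in> U \<Longrightarrow> f z = g z) \<Longrightarrow> dd f x w = dd g x w"
  using dd_cong_open[OF open_U] by metis

lemma dd_const_U: "x \<in> U \<Longrightarrow> (\<And>z. z \<in> U \<Longrightarrow> f z = c) \<Longrightarrow> dd f x w = 0"
  using dd_cong_U[of x f "\<lambda>_. c" w] by simp

lemma lf1_sm:
  assumes "lf1 U F" "sm v"
  shows "sm (\<lambda>z. F z (v z))"
proof (rule smooth_on_cong[OF open_U])
  show "sm (\<lambda>z. \<Sum>b\<in>Basis. (v z \<bullet> b) *\<^sub>R F z b)"
    using assms by (intro sm_rules) (auto simp: lf1_def)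
qed (use assms in \<open>auto simp: lf1_def linear_sum_Basis[symmetric]\<close>)

lemma lf1_dd:
  assumes "lf1 U F" "x \<in> U" "sm v"
  shows "dd (\<lambda>z. F z (v z)) x w = der1 F x w (v x) + F x (dd v x w)"
proof -
  have lin: "linear (F z)" if "z \<in> U" for z using assms that by (auto simp: lf1_def)
  have s: "sm (\<lambda>z. F z X)" for X using assms by (auto simp: lf1_def)
  have e: "dd (\<lambda>z. F z (v z)) x w = (\<Sum>b\<in>Basis. dd (\<lambda>z. (v z \<bullet> b) *\<^sub>R F z b) x w)" if sv: "sm v" for v
  proof -
    have "dd (\<lambda>z. F z (v z)) x w = dd (\<lambda>z. \<Sum>b\<in>Basis. (v z \<bullet> b) *\<^sub>R F z b) x w"
      by (rule dd_cong_U[OF assms(2)]) (use linear_sum_Basis[OF lin] in blast)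
    also have "\<dots> = (\<Sum>b\<in>Basis. dd (\<lambda>z. (v z \<bullet> b) *\<^sub>R F z b) x w)"
      by (rule dd_sum[OF assms(2)]) (intro sm_rules sv s)
    finally show ?thesis .
  qed
  have t: "dd (\<lambda>z. (v z \<bullet> b) *\<^sub>R F z b) x w = (dd v x w \<bullet> b) *\<^sub>R F x b + (v x \<bullet> b) *\<^sub>R dd (\<lambda>z. F z b) x w"
    if "sm v" for v b
    using that s assms(2) by (simp add: dd_rules sm_rules dd_inner_const sm_diffble)
  have "der1 F x w (v x) = (\<Sum>b\<in>Basis. (v x \<bullet> b) *\<^sub>R dd (\<lambda>z. F z b) x w)"
    unfolding der1_def by (subst e) (simp_all add: t sm_rules)
  then show ?thesis
    by (subst e[OF assms(3)]) (simp add: t[OF assms(3)] sum.distrib linear_sum_Basis[OF lin[OF assms(2)], symmetric])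
qed

lemma lf1_lin:
  assumes "lf1 U F" "x \<in> U"
  shows "F x (a + b) = F x a + F x b" "F x (a - b) = F x a - F x b"
    "F x (- a) = - F x a" "F x (c *\<^sub>R a) = c *\<^sub>R F x a" "F x 0 = 0"
  using assms by (auto simp: lf1_def linear_add linear_diff linear_neg linear_scale linear_0)

lemmas lf1_rules = lf1_sm lf1_dd lf1_lin

lemma lf2_D: "lf2 U F \<Longrightarrow> lf1 U (\<lambda>x. F x X)" "lf2 U F \<Longrightarrow> lf1 U (\<lambda>x X. F x X Y)"
  by (auto simp: lf2_def)

lemma lf2_lin:
  assumes "lf2 U F" "x \<in> U"
  shows "F x (a + b) Y = F x a Y + F x b Y" "F x (a - b) Y = F x a Y - F x b Y"
    "F x (- a) Y = - F x a Y" "F x (c *\<^sub>R a) Y = c *\<^sub>R F x a Y" "F x 0 Y = 0"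
    "F x X (a' + b') = F x X a' + F x X b'" "F x X (a' - b') = F x X a' - F x X b'"
    "F x X (- a') = - F x X a'" "F x X (c *\<^sub>R a') = c *\<^sub>R F x X a'" "F x X 0 = 0"
  using lf1_lin[OF lf2_D(1)[OF assms(1)] assms(2)] lf1_lin[OF lf2_D(2)[OF assms(1)] assms(2)]
  by auto

lemma lf2_slot:
  assumes "lf2 U F" "sm v"
  shows "lf1 U (\<lambda>x. F x (v x))"
  unfolding lf1_def
proof (intro conjI ballI allI)
  show "linear (F x (v x))" if "x \<in> U" for x
    using lf2_D(1)[OF assms(1)] that by (auto simp: lf1_def)
  show "sm (\<lambda>x. F x (v x) X)" for X
    by (rule lf1_sm[OF lf2_D(2)[OF assms(1)] assms(2)])
qed

lemma lf2_sm: "lf2 U F \<Longrightarrow> sm v \<Longrightarrow> sm w \<Longrightarrow> sm (\<lambda>z. F z (v z) (w z))"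
  by (rule lf1_sm[OF lf2_slot])

lemma lf2_dd:
  assumes "lf2 U F" "x \<in> U" "sm v" "sm w"
  shows "dd (\<lambda>z. F z (v z) (w z)) x u = der2 F x u (v x) (w x) + F x (dd v x u) (w x) + F x (v x) (dd w x u)"
proof -
  have "dd (\<lambda>z. F z (v z) (w z)) x u = der1 (\<lambda>x. F x (v x)) x u (w x) + F x (v x) (dd w x u)"
    by (rule lf1_dd[OF lf2_slot[OF assms(1,3)] assms(2,4)])
  moreover have "der1 (\<lambda>x. F x (v x)) x u (w x) = der2 F x u (v x) (w x) + F x (dd v x u) (w x)"
    using lf1_dd[OF lf2_D(2)[OF assms(1)] assms(2,3), of "w x" u] by (simp add: der1_def der2_def)
  ultimately show ?thesis by simp
qed

lemmas lf2_rules = lf2_sm lf2_dd lf2_lin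

lemma lf3_D:
  "lf3 U F \<Longrightarrow> lf2 U (\<lambda>x. F x X)" "lf3 U F \<Longrightarrow> lf1 U (\<lambda>x X. F x X Y Z)"
  by (auto simp: lf3_def)

lemma lf3_lin:
  assumes "lf3 U F" "x \<in> U"
  shows "F x (a + b) Y Z = F x a Y Z + F x b Y Z" "F x (a - b) Y Z = F x a Y Z - F x b Y Z"
    "F x (- a) Y Z = - F x a Y Z" "F x (c *\<^sub>R a) Y Z = c *\<^sub>R F x a Y Z" "F x 0 Y Z = 0"
    "F x X (a' + b') Z = F x X a' Z + F x X b' Z" "F x X (a' - b') Z = F x X a' Z - F x X b' Z"
    "F x X (- a') Z = - F x X a' Z" "F x X (c *\<^sub>R a') Z = c *\<^sub>R F x X a' Z" "F x X 0 Z = 0"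
    "F x X Y (a'' + b'') = F x X Y a'' + F x X Y b''" "F x X Y (a'' - b'') = F x X Y a'' - F x X Y b''"
    "F x X Y (- a'') = - F x X Y a''" "F x X Y (c *\<^sub>R a'') = c *\<^sub>R F x X Y a''" "F x X Y 0 = 0"
  using lf1_lin[OF lf3_D(2)[OF assms(1)] assms(2)] lf2_lin[OF lf3_D(1)[OF assms(1)] assms(2)]
  by auto

lemma lf3_slot:
  assumes "lf3 U F" "sm v"
  shows "lf2 U (\<lambda>x. F x (v x))"
  unfolding lf2_def
proof (intro conjI allI)
  have l: "linear (F x (v x) X)" "linear (\<lambda>X. F x (v x) X Y)" if "x \<in> U" for x X Y
    using lf2_D[OF lf3_D(1)[OF assms(1), of "v x"]] that by (auto simp: lf1_def)
  have s: "sm (\<lambda>x. F x (v x) X Y)" for X Y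
    by (rule lf1_sm[OF lf3_D(2)[OF assms(1)] assms(2)])
  show "lf1 U (\<lambda>x. F x (v x) X)" for X
    using l s by (auto simp: lf1_def)
  show "lf1 U (\<lambda>x X. F x (v x) X Y)" for Y
    using l s by (auto simp: lf1_def)
qed

lemma lf3_sm: "lf3 U F \<Longrightarrow> sm v \<Longrightarrow> sm w \<Longrightarrow> sm y \<Longrightarrow> sm (\<lambda>z. F z (v z) (w z) (y z))"
  by (rule lf2_sm[OF lf3_slot])

lemma lf3_dd:
  assumes "lf3 U F" "x \<in> U" "sm v" "sm w" "sm y"
  shows "dd (\<lambda>z. F z (v z) (w z) (y z)) x u = der3 F x u (v x) (w x) (y x) + F x (dd v x u) (w x) (y x)
    + F x (v x) (dd w x u) (y x) + F x (v x) (w x) (dd y x u)"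
proof -
  have "der2 (\<lambda>x. F x (v x)) x u (w x) (y x) = der3 F x u (v x) (w x) (y x) + F x (dd v x u) (w x) (y x)"
    using lf1_dd[OF lf3_D(2)[OF assms(1)] assms(2,3), of "w x" "y x" u]
    by (simp add: der1_def der2_def der3_def)
  then show ?thesis
    using lf2_dd[OF lf3_slot[OF assms(1,3)] assms(2,4,5), of u] by simp
qed

lemmas lf3_rules = lf3_sm lf3_dd lf3_lin

lemma lf1_der0: "sm f \<Longrightarrow> lf1 U (der0 f)"
  unfolding lf1_def der0_def
  by (intro conjI ballI allI linearI) (auto simp: dd_lin smooth_on_dd[OF open_U])

lemma lf2_der1:
  assumes "lf1 U F"
  shows "lf2 U (der1 F)"
proof -
  have s: "sm (\<lambda>z. F z X)" for X
    using assms by (auto simp: lf1_def)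
  have F: "dd (\<lambda>z. F z (a + b)) x w = dd (\<lambda>z. F z a) x w + dd (\<lambda>z. F z b) x w" if "x \<in> U" for x w a b
    by (subst dd_rules(1)[OF that s s, symmetric], rule dd_cong_U[OF that]) (auto simp: lf1_lin[OF assms])
  have F': "dd (\<lambda>z. F z (c *\<^sub>R a)) x w = c *\<^sub>R dd (\<lambda>z. F z a) x w" if "x \<in> U" for x w c a
  proof -
    have "dd (\<lambda>z. F z (c *\<^sub>R a)) x w = dd (\<lambda>z. c *\<^sub>R F z a) x w"
      by (rule dd_cong_U[OF that]) (auto simp: lf1_lin[OF assms])
    then show ?thesis using that s by (simp add: dd_rules sm_rules)
  qed
  show ?thesis
    unfolding lf2_def lf1_def der1_def
    by (intro conjI ballI allI linearI) (auto simp: dd_lin s F F' smooth_on_dd[OF open_U s])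
qed

lemma lf3_der2:
  assumes "lf2 U F"
  shows "lf3 U (der2 F)"
proof -
  have s: "sm (\<lambda>z. F z X Y)" for X Y
    using assms by (auto simp: lf2_def lf1_def)
  have e: "der2 F x w X = der1 (\<lambda>x. F x X) x w" "der2 F x w X Y = der1 (\<lambda>x X. F x X Y) x w X" for x w X Y
    by (auto simp: der1_def der2_def)
  have 1: "lf2 U (\<lambda>x. der2 F x w)" for w
    unfolding lf2_def
  proof (intro conjI allI)
    show "lf1 U (\<lambda>x. der2 F x w X)" for X
      using lf2_D(1)[OF lf2_der1[OF lf2_D(1)[OF assms, of X]], of w] by (simp add: e(1))
    show "lf1 U (\<lambda>x X. der2 F x w X Y)" for Y
      using lf2_D(1)[OF lf2_der1[OF lf2_D(2)[OF assms, of Y]], of w] by (simp add: e(2))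
  qed
  moreover have "lf1 U (\<lambda>x X. der2 F x X Y Z)" for Y Z
    using lf1_der0[OF s[of Y Z]] unfolding der0_def der2_def .
  ultimately show ?thesis by (simp add: lf3_def)
qed

lemma der_const [simp]: "der1 (\<lambda>z X. f X) x w X = 0" "der2 (\<lambda>z X Y. k X Y) x w X Y = 0"
  by (simp_all add: der1_def der2_def)

lemma lf1I: "(\<And>x. x \<in> U \<Longrightarrow> linear (F x)) \<Longrightarrow> (\<And>X. sm (\<lambda>x. F x X)) \<Longrightarrow> lf1 U F"
  by (simp add: lf1_def)

lemma lf2I:
  assumes "\<And>x X. x \<in> U \<Longrightarrow> linear (F x X)" "\<And>x Y. x \<in> U \<Longrightarrow> linear (\<lambda>X. F x X Y)" "\<And>X Y. sm (\<lambda>x. F x X Y)"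
  shows "lf2 U F"
  using assms by (simp add: lf1_def lf2_def)

lemma lf3I:
  assumes "\<And>x X Y. x \<in> U \<Longrightarrow> linear (F x X Y)" "\<And>x X Z. x \<in> U \<Longrightarrow> linear (\<lambda>Y. F x X Y Z)"
    "\<And>x Y Z. x \<in> U \<Longrightarrow> linear (\<lambda>X. F x X Y Z)" "\<And>X Y Z. sm (\<lambda>x. F x X Y Z)"
  shows "lf3 U F"
  using assms by (simp add: lf1_def lf2_def lf3_def)

lemma der_commute:
  assumes "x \<in> U"
  shows "sm f \<Longrightarrow> der1 (der0 f) x u w = der1 (der0 f) x w u"
    and "lf1 U F \<Longrightarrow> der2 (der1 F) x u w X = der2 (der1 F) x w u X"
    and "lf2 U G \<Longrightarrow> der3 (der2 G) x u w X Y = der3 (der2 G) x w u X Y"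
  unfolding der1_def der0_def der2_def der3_def lf1_def lf2_def
  using dd_dd_commute[OF open_U assms] by blast+

end

section \<open>Inner products and self-adjoint endomorphisms\<close>

locale inner_form =
  fixes g :: "'e::euclidean_space \<Rightarrow> 'e \<Rightarrow> real"
  assumes lin_right: "linear (g x)"
    and sym: "g x y = g y x"
    and pos: "x \<noteq> 0 \<Longrightarrow> g x x > 0"
begin

lemma lin_left: "linear (\<lambda>x. g x y)"
  using lin_right[of y] by (simp add: sym[of _ y])

lemma rules:
  "g (a + b) y = g a y + g b y" "g (a - b) y = g a y - g b y" "g (- a) y = - g a y"
  "g (c *\<^sub>R a) y = c * g a y" "g 0 y = 0"
  "g x (a + b) = g x a + g x b" "g x (a - b) = g x a - g x b" "g x (- a) = - g x a"
  "g x (c *\<^sub>R a) = c * g x a" "g x 0 = 0"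
  by (simp_all add: linear_add[OF lin_left] linear_diff[OF lin_left] linear_neg[OF lin_left]
      linear_scale[OF lin_left] linear_0[OF lin_left] linear_add[OF lin_right] linear_diff[OF lin_right]
      linear_neg[OF lin_right] linear_scale[OF lin_right] linear_0[OF lin_right])

lemma zero_iff: "g x x = 0 \<longleftrightarrow> x = 0"
  using pos[of x] rules(5) by fastforce

lemma eqI: "(\<And>z. g x z = g y z) \<Longrightarrow> x = y"
  using zero_iff[of "x - y"] by (simp add: rules)

lemma sum_left: "g (\<Sum>i\<in>I. f i) y = (\<Sum>i\<in>I. g (f i) y)"
  using linear_sum[OF lin_left] by blast

lemma bounded_bilinear: "bounded_bilinear g"
  using bilinear_conv_bounded_bilinear[of g] lin_left lin_right by (auto simp: bilinear_def)

definition onb :: "'e set \<Rightarrow> bool" where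
  "onb B \<longleftrightarrow> finite B \<and> span B = UNIV \<and> (\<forall>a\<in>B. g a a = 1) \<and> (\<forall>a\<in>B. \<forall>b\<in>B. a \<noteq> b \<longrightarrow> g a b = 0)"

lemma onb_expand:
  assumes "onb B"
  shows "x = (\<Sum>a\<in>B. g x a *\<^sub>R a)"
proof -
  have fin: "finite B" using assms by (simp add: onb_def)
  have "x \<in> span B" using assms by (simp add: onb_def)
  then show ?thesis
  proof (induction rule: span_induct_alt)
    case base
    then show ?case by (simp add: rules)
  next
    case (step c x y)
    have "(\<Sum>a\<in>B. g x a *\<^sub>R a) = (\<Sum>a\<in>B. if a = x then x else 0)"
      using assms step(1) by (intro sum.cong) (auto simp: onb_def)
    then have x: "(\<Sum>a\<in>B. g x a *\<^sub>R a) = x" using step(1) fin by simp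
    have "(\<Sum>a\<in>B. g (c *\<^sub>R x + y) a *\<^sub>R a) = c *\<^sub>R (\<Sum>a\<in>B. g x a *\<^sub>R a) + (\<Sum>a\<in>B. g y a *\<^sub>R a)"
      by (simp add: rules scaleR_add_left sum.distrib scaleR_sum_right)
    then show ?case using x step(2) by simp
  qed
qed

lemma trace_onb:
  assumes B: "onb B" and M: "linear M"
  shows "endo_trace M = (\<Sum>a\<in>B. g (M a) a)"
proof -
  have "endo_trace M = (\<Sum>b\<in>Basis. \<Sum>a\<in>B. g b a * (M a \<bullet> b))"
    unfolding endo_trace_def
  proof (rule sum.cong[OF refl])
    fix b :: 'e
    have "M b \<bullet> b = M (\<Sum>a\<in>B. g b a *\<^sub>R a) \<bullet> b" using onb_expand[OF B, of b] by simp
    then show "M b \<bullet> b = (\<Sum>a\<in>B. g b a * (M a \<bullet> b))"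
      by (simp add: linear_sum[OF M] linear_scale[OF M] inner_sum_left)
  qed
  also have "\<dots> = (\<Sum>a\<in>B. \<Sum>b\<in>Basis. g b a * (M a \<bullet> b))" by (rule sum.swap)
  also have "\<dots> = (\<Sum>a\<in>B. g (M a) a)"
  proof (rule sum.cong[OF refl])
    fix a
    have "g (M a) a = g (\<Sum>b\<in>Basis. (M a \<bullet> b) *\<^sub>R b) a" by (simp add: euclidean_representation)
    then show "(\<Sum>b\<in>Basis. g b a * (M a \<bullet> b)) = g (M a) a"
      by (simp add: sum_left rules mult.commute)
  qed
  finally show ?thesis .
qed

lemma onb_eqI:
  assumes "onb B" "linear f" "linear h" "\<And>a. a \<in> B \<Longrightarrow> f a = h a"
  shows "f x = h x"
  using linear_eq_on_span[OF assms(2,3), of B x] assms(1,4) by (auto simp: onb_def)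

lemma onb_vec_eqI:
  assumes "onb B" "\<And>a. a \<in> B \<Longrightarrow> g x a = g y a"
  shows "x = y"
  using onb_expand[OF assms(1), of x] onb_expand[OF assms(1), of y] assms(2)
  by (metis (no_types, lifting) sum.cong)

text \<open>On \<open>V\<close> the symmetric form \<open>g ((J - m) x) y\<close> is nonnegative and
  vanishes at \<open>e\<close>, so \<open>e\<close> lies in its radical; as \<open>J e - m e\<close>
  belongs to \<open>V\<close>, it may be inserted as the second argument.\<close>

lemma eigen_min:
  assumes J: "linear J" "\<And>x y. g (J x) y = g x (J y)"
    and V: "subspace V" "\<And>x. x \<in> V \<Longrightarrow> J x \<in> V"
    and e: "e \<in> V" and min: "\<And>x. x \<in> V \<Longrightarrow> m * g x x \<le> g (J x) x" "g (J e) e = m * g e e"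
  shows "J e = m *\<^sub>R e"
proof -
  define b where "b x y = g (J x - m *\<^sub>R x) y" for x y
  have bs: "b x y = b y x" for x y
    using J(2)[of x y] sym by (simp add: b_def rules)
  have be: "b e x = 0" if x: "x \<in> V" for x
  proof -
    have "0 \<le> b (t *\<^sub>R e + x) (t *\<^sub>R e + x)" for t
      using min(1)[of "t *\<^sub>R e + x"] V(1) e x by (simp add: b_def rules subspace_add subspace_scale algebra_simps)
    moreover have "b (t *\<^sub>R e + x) (t *\<^sub>R e + x) = 2 * t * b e x + b x x" for t
    proof -
      have "b (t *\<^sub>R e + x) (t *\<^sub>R e + x) = t * t * b e e + t * b e x + t * b x e + b x x"
        by (simp add: b_def rules linear_add[OF J(1)] linear_scale[OF J(1)] algebra_simps)
      moreover have "b e e = 0" using min(2) by (simp add: b_def rules)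
      ultimately show ?thesis using bs[of x e] by simp
    qed
    ultimately have p: "0 \<le> 2 * t * b e x + b x x" for t by metis
    show ?thesis
    proof (rule ccontr)
      assume "b e x \<noteq> 0"
      \<comment> \<open>For this value of \<open>t\<close> the affine expression in \<open>p\<close>
        equals -1.\<close>
      then show False using p[of "- (b x x + 1) / (2 * b e x)"] by (simp add: field_simps)
    qed
  qed
  have "J e - m *\<^sub>R e \<in> V" using V e by (simp add: subspace_diff subspace_scale)
  from be[OF this] show ?thesis by (simp add: b_def zero_iff)
qed

text \<open>The minimum is taken on the Euclidean unit sphere, which is compact; the quotient is
  invariant under scaling, so the minimiser can be rescaled to \<open>g\<close>-length one
  afterwards.\<close>

lemma rayleigh_min:
  assumes J: "linear J" and V: "subspace V" and e0: "e0 \<in> V" "e0 \<noteq> 0"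
  obtains e m where "e \<in> V" "g e e = 1" "g (J e) e = m" "\<And>x. x \<in> V \<Longrightarrow> m * g x x \<le> g (J x) x"
proof -
  let ?K = "sphere 0 1 \<inter> V"
  have "(1 / norm e0) *\<^sub>R e0 \<in> ?K"
    using e0 V by (simp add: subspace_scale)
  then have K: "compact ?K" "?K \<noteq> {}"
    using closed_subspace[OF V] by (blast intro: compact_Int_closed compact_sphere)+
  have lc: "continuous_on A (\<lambda>x. J x)" for A
    using J by (simp add: linear_continuous_on linear_conv_bounded_linear)
  have "continuous_on ?K (\<lambda>x. g (J x) x / g x x)"
    by (intro continuous_intros bounded_bilinear.continuous_on[OF bounded_bilinear] lc)
       (auto simp: zero_iff)
  then obtain e1 where e1: "e1 \<in> ?K" "\<And>x. x \<in> ?K \<Longrightarrow> g (J e1) e1 / g e1 e1 \<le> g (J x) x / g x x"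
    using continuous_attains_inf[OF K] by blast
  define m where "m = g (J e1) e1 / g e1 e1"
  have "e1 \<noteq> 0" using e1(1) by auto
  then have pe: "0 < g e1 e1" by (rule pos)
  define e where "e = (1 / sqrt (g e1 e1)) *\<^sub>R e1"
  have s: "sqrt (g e1 e1) * sqrt (g e1 e1) = g e1 e1" using pe by simp
  show ?thesis
  proof (rule that[of e m])
    show "e \<in> V" using e1 V by (simp add: e_def subspace_scale)
    show "g e e = 1" using pe s by (simp add: e_def rules)
    show "g (J e) e = m" using pe s by (simp add: e_def m_def rules linear_scale[OF J])
    show "m * g x x \<le> g (J x) x" if x: "x \<in> V" for x
    proof (cases "x = 0")
      case False
      have "m \<le> g (J ((1 / norm x) *\<^sub>R x)) ((1 / norm x) *\<^sub>R x) / g ((1 / norm x) *\<^sub>R x) ((1 / norm x) *\<^sub>R x)"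
        unfolding m_def using False x V by (intro e1(2)) (auto simp: subspace_scale)
      also have "\<dots> = g (J x) x / g x x"
        using False by (simp add: linear_scale[OF J] rules)
      finally show ?thesis using pos[OF False] by (simp add: field_simps)
    qed (simp add: rules linear_0[OF J])
  qed
qed

text \<open>Invariant subspaces make the induction on the dimension possible: the
  \<open>g\<close>-orthogonal complement in \<open>V\<close> of a minimal eigenvector is again
  invariant.\<close>

lemma spectral_subspace:
  assumes J: "linear J" "\<And>x y. g (J x) y = g x (J y)"
    and V: "subspace V" "\<And>x. x \<in> V \<Longrightarrow> J x \<in> V"
  shows "\<exists>B\<subseteq>V. finite B \<and> V \<subseteq> span B \<and> (\<forall>a\<in>B. g a a = 1 \<and> (\<exists>l. J a = l *\<^sub>R a)) \<and>
    (\<forall>a\<in>B. \<forall>b\<in>B. a \<noteq> b \<longrightarrow> g a b = 0)"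
  using V
proof (induction "dim V" arbitrary: V rule: less_induct)
  case less
  show ?case
  proof (cases "V = {0}")
    case True
    then show ?thesis by (intro exI[of _ "{}"]) auto
  next
    case False
    then obtain e0 where e0: "e0 \<in> V" "e0 \<noteq> 0" using less.prems subspace_0 by fastforce
    obtain e m where e: "e \<in> V" "g e e = 1" "g (J e) e = m" "\<And>x. x \<in> V \<Longrightarrow> m * g x x \<le> g (J x) x"
      using rayleigh_min[OF J(1) less.prems(1) e0] by blast
    have Je: "J e = m *\<^sub>R e"
      using eigen_min[OF J less.prems e(1), of m] e by simp
    define W where "W = {x\<in>V. g e x = 0}"
    have W: "subspace W"
      using less.prems(1) unfolding W_def subspace_def by (auto simp: rules)
    have JW: "J x \<in> W" if "x \<in> W" for x
      using that less.prems(2) J(2)[of e x] by (auto simp: W_def Je rules)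
    have "e \<notin> W" using e by (simp add: W_def)
    then have "W \<subset> V" using e(1) W_def by blast
    then have "dim W < dim V"
      using W less.prems(1) by (intro dim_psubset) (simp add: span_eq_iff[THEN iffD2])
    from less.hyps[OF this W JW] obtain B where B: "B \<subseteq> W" "finite B" "W \<subseteq> span B"
      "\<forall>a\<in>B. g a a = 1 \<and> (\<exists>l. J a = l *\<^sub>R a)" "\<forall>a\<in>B. \<forall>b\<in>B. a \<noteq> b \<longrightarrow> g a b = 0" by blast
    have "V \<subseteq> span (insert e B)"
    proof
      fix x assume x: "x \<in> V"
      have "x - g e x *\<^sub>R e \<in> W"
        using x e less.prems(1) by (simp add: W_def rules subspace_diff subspace_scale)
      then have "x - g e x *\<^sub>R e \<in> span B" using B by auto
      then show "x \<in> span (insert e B)" by (auto simp: span_insert)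
    qed
    then show ?thesis
      using B e Je by (intro exI[of _ "insert e B"]) (auto simp: W_def sym)
  qed
qed

lemma spectral:
  assumes "linear J" "\<And>x y. g (J x) y = g x (J y)"
  obtains B l where "onb B" "\<And>a. a \<in> B \<Longrightarrow> J a = l a *\<^sub>R a"
proof -
  obtain B where B: "finite B" "UNIV \<subseteq> span B" "\<forall>a\<in>B. g a a = 1 \<and> (\<exists>l. J a = l *\<^sub>R a)"
    "\<forall>a\<in>B. \<forall>b\<in>B. a \<noteq> b \<longrightarrow> g a b = 0"
    using spectral_subspace[OF assms, of UNIV] by auto
  then obtain l where "\<forall>a\<in>B. J a = l a *\<^sub>R a" by metis
  with B show ?thesis by (intro that[of B l]) (auto simp: onb_def)
qed

lemma trace_zero_signs:
  assumes J: "linear J" and B: "onb B" "\<And>a. a \<in> B \<Longrightarrow> J a = l a *\<^sub>R a"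
    and tr: "endo_trace J = 0" and c: "c \<in> B" "l c \<noteq> 0"
  obtains b where "b \<in> B" "l b * l c < 0"
proof -
  have fin: "finite B" using B by (simp add: onb_def)
  have "(\<Sum>a\<in>B. l a) = 0"
    using trace_onb[OF B(1) J] B tr by (simp add: onb_def rules cong: sum.cong)
  then have s: "(\<Sum>a\<in>B. l a * l c) = 0" by (simp add: sum_distrib_right[symmetric])
  have "\<exists>b\<in>B. l b * l c < 0"
  proof (rule ccontr)
    assume "\<not> ?thesis"
    then have "0 \<le> l b * l c" if "b \<in> B" for b using that by force
    then have "l c * l c = 0" using s sum_nonneg_eq_0_iff[OF fin, of "\<lambda>a. l a * l c"] c by auto
    then show False using c by simp
  qed
  then show ?thesis using that by blast
qed

end

section \<open>The extremal argument in a fibre\<close>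

text \<open>\<open>J y\<close> is the Jacobi endomorphism, \<open>T\<close> and \<open>D2\<close> are its first two derivatives. Where
  the least eigenvalue \<open>r < 0\<close> of \<open>J\<close> is minimal among unit vectors \<open>y\<close>, the second order consequences of the identity below for the
  eigenvectors \<open>b\<close> (of \<open>r\<close>) and \<open>a\<close> (of \<open>p > 0\<close>) contradict \<open>r < 0 < p\<close>.\<close>

lemma (in inner_form) fibre_contradiction:
  fixes J :: "'e \<Rightarrow> 'e" and T :: "'e \<Rightarrow> 'e \<Rightarrow> 'e" and D2 :: "'e \<Rightarrow> 'e \<Rightarrow> 'e \<Rightarrow> 'e"
    and c :: "'e \<Rightarrow> real" and dc :: "'e \<Rightarrow> 'e \<Rightarrow> real" and y a b :: 'e
  defines "H \<equiv> \<lambda>X Z. (2/3) *\<^sub>R T Z X + (1/3) *\<^sub>R T X Z"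
    and "dH \<equiv> \<lambda>W X Z. (2/3) *\<^sub>R D2 W Z X + (1/3) *\<^sub>R D2 W X Z"
  assumes J: "linear J" "\<And>x y. g (J x) y = g x (J y)"
    and T: "\<And>X. linear (T X)" "\<And>X. linear (\<lambda>Z. T Z X)"
    and D2: "\<And>W Z. linear (D2 W Z)" "\<And>W X. linear (\<lambda>Z. D2 W Z X)" "\<And>W Z X. D2 W Z X = D2 Z W X"
    and S: "\<And>X Z. T (J X) Z = H X (J Z) - J (H X Z) + c X *\<^sub>R J Z"
    and dS: "\<And>W X Z. D2 W (J X) Z + T (T W X) Z =
      dH W X (J Z) + H X (T W Z) - T W (H X Z) - J (dH W X Z) + dc W X *\<^sub>R J Z + c X *\<^sub>R T W Z"
    and dc: "\<And>X. dc X X = 0"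
    and a: "J a = p *\<^sub>R a" "g a a = 1" "0 < p" and b: "J b = r *\<^sub>R b" "g b b = 1" "r < 0"
    and crit: "\<And>N. g (T N b) b = 2 * r * g N y / F" and F: "F > 0"
    and y: "\<And>X. g (J X) y = 0" "g (T a a) y = - p"
  shows False
proof -
  note Js = linear_add[OF J(1)] linear_diff[OF J(1)] linear_scale[OF J(1)] linear_0[OF J(1)]
  note Ts = linear_add[OF T(1)] linear_diff[OF T(1)] linear_scale[OF T(1)] linear_0[OF T(1)]
    linear_add[OF T(2)] linear_diff[OF T(2)] linear_scale[OF T(2)] linear_0[OF T(2)]
  note Ds = linear_scale[OF D2(1)] linear_scale[OF D2(2)] linear_0[OF D2(1)] linear_0[OF D2(2)]
  have Jb: "g (J X) b = r * g X b" for X using J(2)[of X b] by (simp add: b rules)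
  have ab: "g a b = 0"
  proof -
    have "p * g a b = r * g a b" using Jb[of a] by (simp add: a rules)
    then show ?thesis using a b by simp
  qed
  \<comment> \<open>Pairing \<open>S\<close> for the eigenvector \<open>b\<close> with
    \<open>b\<close> kills the commutator with \<open>J\<close>. The left side vanishes by the first
    order condition, because \<open>J X\<close> is orthogonal to \<open>y\<close>.\<close>
  have c0: "c X = 0" for X
  proof -
    have "g (T (J X) b) b = c X * r"
      by (subst S) (simp add: rules b Jb H_def Ts Js)
    then show ?thesis using crit[of "J X"] y(1)[of X] b by simp
  qed
  have S0: "T (J X) Z = H X (J Z) - J (H X Z)" for X Z using S c0 by simp
  define u v where "u = T a b" and "v = T b a"
  have eq1: "p *\<^sub>R u = r *\<^sub>R ((2/3) *\<^sub>R v + (1/3) *\<^sub>R u) - J ((2/3) *\<^sub>R v + (1/3) *\<^sub>R u)"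
    using S0[of a b] by (simp add: a b H_def u_def v_def Ts Js algebra_simps)
  have eq2: "r *\<^sub>R v = p *\<^sub>R ((2/3) *\<^sub>R u + (1/3) *\<^sub>R v) - J ((2/3) *\<^sub>R u + (1/3) *\<^sub>R v)"
    using S0[of b a] by (simp add: a b H_def u_def v_def Ts Js algebra_simps)
  obtain B l where B: "onb B" "\<And>e. e \<in> B \<Longrightarrow> J e = l e *\<^sub>R e"
    using spectral[OF J] by blast
  have uv: "g u e = 0 \<and> g v e = 0" if e: "e \<in> B" for e
  proof -
    have Je: "g (J X) e = l e * g X e" for X using J(2)[of X e] by (simp add: B(2)[OF e] rules)
    define U V L where "U = g u e" and "V = g v e" and "L = l e"
    have 1: "p * U = (r - L) * (2/3 * V + 1/3 * U)"
      using arg_cong[OF eq1, of "\<lambda>w. g w e"] by (simp add: rules Je U_def V_def L_def field_simps)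
    have 2: "r * V = (p - L) * (2/3 * U + 1/3 * V)"
      using arg_cong[OF eq2, of "\<lambda>w. g w e"] by (simp add: rules Je U_def V_def L_def field_simps)
    have f1: "U * (3 * p - r + L) = 2 * (r - L) * V" using 1 by (simp add: field_simps)
    have f2: "V * (3 * r - p + L) = 2 * (p - L) * U" using 2 by (simp add: field_simps)
    \<comment> \<open>Along an eigenvector of eigenvalue \<open>L\<close> the two equations are a
      homogeneous linear system for \<open>U\<close> and \<open>V\<close>. This is its determinant,
      which is nonzero because \<open>p * r < 0\<close>.\<close>
    have det: "(3 * p - r + L) * (3 * r - p + L) - 4 * (r - L) * (p - L) = - 3 * ((L - (p + r))\<^sup>2 - 4 * (p * r))"
      by (simp add: power2_eq_square algebra_simps)
    have "p * r < 0" using a b by (simp add: mult_pos_neg)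
    then have nz: "(3 * p - r + L) * (3 * r - p + L) - 4 * (r - L) * (p - L) \<noteq> 0"
    proof -
      have "0 < (L - (p + r))\<^sup>2 - 4 * (p * r)"
        using zero_le_power2[of "L - (p + r)"] \<open>p * r < 0\<close> by linarith
      then show ?thesis unfolding det by simp
    qed
    define M K where "M = 3 * p - r + L" and "K = 3 * r - p + L"
    have "U * M * K = 2 * (r - L) * (V * K)" by (simp only: M_def f1 mult.assoc)
    also have "\<dots> = 2 * (r - L) * (2 * (p - L) * U)" by (simp only: K_def f2)
    finally have "U * (M * K - 4 * (r - L) * (p - L)) = 0" by (simp add: algebra_simps)
    moreover have "V * K * M = 2 * (p - L) * (U * M)" by (simp only: K_def f2 mult.assoc)
    then have "V * K * M = 2 * (p - L) * (2 * (r - L) * V)" by (simp only: M_def f1)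
    then have "V * (M * K - 4 * (r - L) * (p - L)) = 0" by (simp add: algebra_simps)
    ultimately show ?thesis using nz by (simp add: U_def V_def M_def K_def)
  qed
  have u0: "T a b = 0" and v0: "T b a = 0"
    using onb_vec_eqI[OF B(1), of u 0] onb_vec_eqI[OF B(1), of v 0] uv by (auto simp: rules u_def v_def)
  define N where "N = T a a"
  have JN: "J N = 0"
    using S0[of a a] by (simp add: a H_def Ts Js N_def scaleR_add_left[symmetric] flip: scaleR_add_right)
  define t1 t2 where "t1 = g (T N b) b" and "t2 = g (T b N) b"
  have t1: "t1 = - 2 * r * p / F" using crit[of N] y(2) by (simp add: t1_def N_def)
  have t2: "t2 = - t1 / 2"
  proof -
    have "r * t2 = - (r * (2/3 * t1 + 1/3 * t2))"
      using arg_cong[OF S0[of b N], of "\<lambda>w. g w b"]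
      by (simp add: b JN H_def Ts Js rules Jb t1_def t2_def algebra_simps)
    then have "r * (4/3 * t2) = r * (- (2/3) * t1)" by (simp add: algebra_simps)
    then have "4/3 * t2 = - (2/3) * t1" using b by (simp only: mult_cancel_left) simp
    then show ?thesis by simp
  qed
  \<comment> \<open>Two second derivatives of \<open>J\<close> at the minimum, subject to three
    instances of \<open>dS\<close>: \<open>E1\<close> determines \<open>uu\<close>,
    \<open>E2\<close> determines \<open>ww\<close>, and \<open>E3\<close> is a further relation that
    these values violate. The form \<open>dc\<close> enters \<open>E1\<close> as
    \<open>dc a a\<close> and is multiplied by \<open>g a b = 0\<close> in the other two.\<close>
  define uu ww where "uu = g (D2 a a b) b" and "ww = g (D2 b a a) b"
  have E1: "p * uu = - t1"
    using arg_cong[OF dS[of a a b], of "\<lambda>w. g w b"]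
    by (simp add: a b c0 dc H_def dH_def Ts Js Ds rules Jb u0 v0 uu_def t1_def N_def[symmetric] algebra_simps)
  have E2: "p * ww = (p - r) * ww - t2"
    using arg_cong[OF dS[of b a a], of "\<lambda>w. g w b"]
    by (simp add: a b c0 H_def dH_def Ts Js Ds rules Jb u0 v0 ab ww_def t2_def N_def[symmetric] algebra_simps)
  have E3: "r * ww = (p - r) * (2/3 * uu + 1/3 * ww) + (2/3 * t1 + 1/3 * t2)"
    using arg_cong[OF dS[of a b a], of "\<lambda>w. g w b"]
    by (simp add: a b c0 H_def dH_def Ts Js Ds rules Jb u0 v0 ab ww_def uu_def t1_def t2_def D2(3)[of a b a]
        N_def[symmetric] field_simps)
  have "p * uu = p * (2 * r / F)" unfolding E1 t1 by simp
  then have uu: "uu = 2 * r / F" using a(3) by (metis mult_left_cancel less_irrefl)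
  have "r * ww = r * (- p / F)"
  proof -
    have "r * ww = - t2" using E2 by (simp add: left_diff_distrib)
    then show ?thesis unfolding t2 t1 by simp
  qed
  then have ww: "ww = - p / F" using b(3) by (metis mult_left_cancel less_irrefl)
  have "r * (- p / F) = (p - r) * (2/3 * (2 * r / F) + 1/3 * (- p / F)) + t1 / 2"
    using E3 unfolding uu ww t2 by simp
  moreover define k where "k = 1 / F"
  ultimately have "r * (- p * k) = (p - r) * (2/3 * (2 * r * k) + 1/3 * (- p * k)) + (- 2 * r * p * k) / 2"
    unfolding t1 by simp
  then have "k * ((p - r) * (4 * r - p)) = 0" by (simp add: field_simps)
  then have "(p - r) * (4 * r - p) = 0" using F by (simp add: k_def)
  moreover have "(p - r) * (4 * r - p) < 0" using a(3) b(3) by (intro mult_pos_neg) auto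
  ultimately show False by (metis less_irrefl)
qed

text \<open>\<open>T\<close> and \<open>D2\<close> stand for the first two derivatives of
  \<open>J\<close> in \<open>y\<close>. With \<open>H X Z = 2/3 T Z X + 1/3 T X Z\<close>, the
  fourth conjunct says that the derivative of \<open>J\<close> in the direction \<open>J X\<close>
  is the commutator of \<open>H X\<close> with \<open>J\<close> up to a multiple of
  \<open>J\<close>; the fifth is its derivative in the direction \<open>W\<close>. The two
  applications differ in \<open>c\<close> and \<open>dc\<close>: zero in the first, the curl of
  \<open>A\<close> in the second.\<close>

definition fibre_identity :: "('e::euclidean_space \<Rightarrow> 'e) \<Rightarrow> ('e \<Rightarrow> 'e \<Rightarrow> 'e) \<Rightarrow> ('e \<Rightarrow> 'e \<Rightarrow> 'e \<Rightarrow> 'e) \<Rightarrow>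
    ('e \<Rightarrow> real) \<Rightarrow> ('e \<Rightarrow> 'e \<Rightarrow> real) \<Rightarrow> bool" where
  "fibre_identity J T D2 c dc \<longleftrightarrow>
    (\<forall>W Z. linear (D2 W Z)) \<and> (\<forall>W X. linear (\<lambda>Z. D2 W Z X)) \<and> (\<forall>W Z X. D2 W Z X = D2 Z W X) \<and>
    (\<forall>X Z. T (J X) Z = (2/3) *\<^sub>R T (J Z) X + (1/3) *\<^sub>R T X (J Z)
      - J ((2/3) *\<^sub>R T Z X + (1/3) *\<^sub>R T X Z) + c X *\<^sub>R J Z) \<and>
    (\<forall>W X Z. D2 W (J X) Z + T (T W X) Z =
      (2/3) *\<^sub>R D2 W (J Z) X + (1/3) *\<^sub>R D2 W X (J Z)
      + ((2/3) *\<^sub>R T (T W Z) X + (1/3) *\<^sub>R T X (T W Z))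
      - T W ((2/3) *\<^sub>R T Z X + (1/3) *\<^sub>R T X Z)
      - J ((2/3) *\<^sub>R D2 W Z X + (1/3) *\<^sub>R D2 W X Z) + dc W X *\<^sub>R J Z + c X *\<^sub>R T W Z) \<and>
    (\<forall>X. dc X X = 0)"

text \<open>Minimising over \<open>y\<close> and \<open>X\<close> simultaneously yields both an
  eigenvector, from minimality in \<open>X\<close>, and a first order condition, from minimality in
  \<open>y\<close>. The trace at \<open>y0\<close> makes the minimum negative; the trace at the
  minimising point supplies the positive eigenvalue there. The metric may vary with
  \<open>y\<close>, as it does in a Finsler fibre.\<close>

theorem fibre_flat:
  fixes J :: "'e::euclidean_space \<Rightarrow> 'e \<Rightarrow> 'e" and g :: "'e \<Rightarrow> 'e \<Rightarrow> 'e \<Rightarrow> real"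
    and T :: "'e \<Rightarrow> 'e \<Rightarrow> 'e \<Rightarrow> 'e"
  assumes g: "\<And>y. y \<noteq> 0 \<Longrightarrow> inner_form (g y)"
    and J: "\<And>y. y \<noteq> 0 \<Longrightarrow> linear (J y)" "\<And>y X Z. y \<noteq> 0 \<Longrightarrow> g y (J y X) Z = g y X (J y Z)"
    and tr: "\<And>y. y \<noteq> 0 \<Longrightarrow> endo_trace (J y) = 0"
    and hom: "\<And>y t X. y \<noteq> 0 \<Longrightarrow> t > 0 \<Longrightarrow> J (t *\<^sub>R y) X = t\<^sup>2 *\<^sub>R J y X"
      "\<And>y t X Z. y \<noteq> 0 \<Longrightarrow> t > 0 \<Longrightarrow> g (t *\<^sub>R y) X Z = g y X Z"
    and y: "\<And>y X. y \<noteq> 0 \<Longrightarrow> g y (J y X) y = 0"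
    and dJ: "\<And>y X. y \<noteq> 0 \<Longrightarrow> ((\<lambda>y. J y X) has_derivative (\<lambda>Z. T y Z X)) (at y)"
    and dg: "\<And>y X Y. y \<noteq> 0 \<Longrightarrow> (\<lambda>y. g y X Y) differentiable (at y)"
    and dF: "\<And>y. y \<noteq> 0 \<Longrightarrow> ((\<lambda>y. g y y y) has_derivative (\<lambda>Z. 2 * g y Z y)) (at y)"
    and Ty: "\<And>y X Z. y \<noteq> 0 \<Longrightarrow> g y (T y Z X) y = - g y (J y X) Z"
    and T: "\<And>y X. y \<noteq> 0 \<Longrightarrow> linear (T y X)"
    and S: "\<And>y X. y \<noteq> 0 \<Longrightarrow> J y X \<noteq> 0 \<Longrightarrow> \<exists>D2 c dc. fibre_identity (J y) (T y) D2 c dc"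
    and y0: "y0 \<noteq> 0"
  shows "J y0 X0 = 0"
proof (rule ccontr)
  assume nz: "J y0 X0 \<noteq> 0"
  define F where "F y = g y y y" for y
  have Fp: "F y > 0" if "y \<noteq> 0" for y
    using inner_form.pos[OF g[OF that] that] by (simp add: F_def)
  define q where "q y X = g y (J y X) X / (F y * g y X X)" for y X
  have gp: "g y X X > 0" if "y \<noteq> 0" "X \<noteq> 0" for y X
    using inner_form.pos[OF g] that by blast
  have Js: "J y (c *\<^sub>R X) = c *\<^sub>R J y X" if "y \<noteq> 0" for y c X
    using linear_scale[OF J(1)[OF that]] .
  have qhom: "q (t *\<^sub>R y) (s *\<^sub>R X) = q y X" if "y \<noteq> 0" "t > 0" "s \<noteq> 0" for y t s X
    using that
    by (simp add: q_def F_def hom Js inner_form.rules[OF g] power2_eq_square field_simps)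
  let ?S = "sphere (0::'e) 1 \<times> sphere (0::'e) 1"
  \<comment> \<open>The form is known to be differentiable in \<open>y\<close> for fixed arguments
    only; joint continuity comes from expanding the arguments in a basis.\<close>
  have cont: "continuous_on ?S (\<lambda>u. f (fst u) (h (fst u) (snd u)) (snd u))"
    if f: "\<And>y X Y. y \<noteq> 0 \<Longrightarrow> (\<lambda>y. f y X Y :: real) differentiable (at y)"
      and lf: "\<And>y. y \<noteq> 0 \<Longrightarrow> bilinear (f y)"
      and h: "continuous_on ?S (\<lambda>u. h (fst u) (snd u))" for f and h :: "'e \<Rightarrow> 'e \<Rightarrow> 'e"
  proof -
    have "continuous_on ?S (\<lambda>u. \<Sum>a\<in>Basis. \<Sum>b\<in>Basis. (h (fst u) (snd u) \<bullet> a) * (snd u \<bullet> b) * f (fst u) a b)"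
    proof (intro continuous_on_sum continuous_on_mult continuous_on_inner h continuous_on_snd
        continuous_on_id continuous_on_const)
      fix a b
      have "continuous_on (sphere 0 1) (\<lambda>y. f y a b)"
      proof (intro differentiable_imp_continuous_on, unfold differentiable_on_def, rule)
        fix y :: 'e assume "y \<in> sphere 0 1"
        then have "y \<noteq> 0" by auto
        then show "(\<lambda>y. f y a b) differentiable at y within sphere 0 1"
          by (rule differentiable_at_withinI[OF f])
      qed
      then show "continuous_on ?S (\<lambda>u. f (fst u) a b)"
        by (rule continuous_on_compose2) (auto intro: continuous_on_fst continuous_on_id)
    qed
    moreover have "(\<Sum>a\<in>Basis. \<Sum>b\<in>Basis. (h (fst u) (snd u) \<bullet> a) * (snd u \<bullet> b) * f (fst u) a b)
        = f (fst u) (h (fst u) (snd u)) (snd u)" if "u \<in> ?S" for u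
    proof -
      have b: "bilinear (f (fst u))" using that by (intro lf) auto
      have e1: "f (fst u) X Y = (\<Sum>a\<in>Basis. (X \<bullet> a) * f (fst u) a Y)" for X Y
        using linear_sum_Basis[of "\<lambda>X. f (fst u) X Y" X] b by (simp add: bilinear_def)
      have e2: "f (fst u) X Y = (\<Sum>a\<in>Basis. (Y \<bullet> a) * f (fst u) X a)" for X Y
        using linear_sum_Basis[of "f (fst u) X" Y] b by (simp add: bilinear_def)
      have "(\<Sum>a\<in>Basis. \<Sum>b\<in>Basis. (h (fst u) (snd u) \<bullet> a) * (snd u \<bullet> b) * f (fst u) a b)
          = (\<Sum>a\<in>Basis. (h (fst u) (snd u) \<bullet> a) * (\<Sum>b\<in>Basis. (snd u \<bullet> b) * f (fst u) a b))"
        by (simp add: sum_distrib_left mult.assoc)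
      also have "\<dots> = (\<Sum>a\<in>Basis. (h (fst u) (snd u) \<bullet> a) * f (fst u) a (snd u))"
        by (simp only: e2[symmetric])
      also have "\<dots> = f (fst u) (h (fst u) (snd u)) (snd u)" by (rule e1[symmetric])
      finally show ?thesis .
    qed
    ultimately show ?thesis by (rule continuous_on_eq)
  qed
  have bil: "bilinear (g y)" if "y \<noteq> 0" for y
    using inner_form.lin_right[OF g[OF that]] inner_form.lin_left[OF g[OF that]] by (simp add: bilinear_def)
  have cJ: "continuous_on ?S (\<lambda>u. J (fst u) (snd u))"
  proof -
    have "continuous_on ?S (\<lambda>u. \<Sum>b\<in>Basis. (snd u \<bullet> b) *\<^sub>R J (fst u) b)"
    proof (intro continuous_on_sum continuous_on_scaleR continuous_on_inner continuous_on_snd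
        continuous_on_id continuous_on_const)
      fix b
      have "continuous_on (sphere 0 1) (\<lambda>y. J y b)"
      proof (rule has_derivative_continuous_on)
        show "((\<lambda>y. J y b) has_derivative (\<lambda>Z. T y Z b)) (at y within sphere 0 1)" if "y \<in> sphere 0 1" for y
        proof -
          have "y \<noteq> 0" using that by auto
          from dJ[OF this] show ?thesis by (rule has_derivative_at_withinI)
        qed
      qed
      then show "continuous_on ?S (\<lambda>u. J (fst u) b)"
        by (rule continuous_on_compose2) (auto intro: continuous_on_fst continuous_on_id)
    qed
    then show ?thesis
    proof (rule continuous_on_eq)
      fix u :: "'e \<times> 'e" assume "u \<in> ?S"
      then have "fst u \<noteq> 0" by auto
      then show "(\<Sum>b\<in>Basis. (snd u \<bullet> b) *\<^sub>R J (fst u) b) = J (fst u) (snd u)"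
        using linear_sum_Basis[OF J(1), of "fst u" "snd u"] by simp
    qed
  qed
  have cF: "continuous_on ?S (\<lambda>u. F (fst u))"
  proof (rule continuous_on_compose2[of "sphere 0 1" F])
    show "continuous_on (sphere 0 1) F"
      unfolding F_def
    proof (rule has_derivative_continuous_on)
      show "((\<lambda>y. g y y y) has_derivative (\<lambda>Z. 2 * g y Z y)) (at y within sphere 0 1)" if "y \<in> sphere 0 1" for y
      proof -
        have "y \<noteq> 0" using that by auto
        from dF[OF this] show ?thesis by (rule has_derivative_at_withinI)
      qed
    qed
  qed (auto intro: continuous_on_fst continuous_on_id)
  have "continuous_on ?S (\<lambda>u. q (fst u) (snd u))"
    unfolding q_def
  proof (intro continuous_on_divide continuous_on_mult cF ballI)
    show "continuous_on ?S (\<lambda>u. g (fst u) (J (fst u) (snd u)) (snd u))"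
      by (rule cont[of g "J"]) (use dg bil cJ in auto)
    show "continuous_on ?S (\<lambda>u. g (fst u) (snd u) (snd u))"
      by (rule cont[of g "\<lambda>_ X. X"]) (use dg bil in \<open>auto intro: continuous_on_snd continuous_on_id\<close>)
    fix u assume u: "u \<in> ?S"
    then have "fst u \<noteq> 0" "snd u \<noteq> 0" by auto
    then show "F (fst u) * g (fst u) (snd u) (snd u) \<noteq> 0"
      using Fp gp by (metis less_numeral_extra(3) mult_eq_0_iff)
  qed
  moreover have "compact ?S" "?S \<noteq> {}"
    using y0 by (auto intro!: compact_Times exI[of _ "(1 / norm y0) *\<^sub>R y0"])
  ultimately obtain u where u: "u \<in> ?S" "\<And>v. v \<in> ?S \<Longrightarrow> q (fst u) (snd u) \<le> q (fst v) (snd v)"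
    using continuous_attains_inf[of ?S "\<lambda>u. q (fst u) (snd u)"] by blast
  define yy b0 \<kappa> where "yy = fst u" and "b0 = snd u" and "\<kappa> = q yy b0"
  have ne: "yy \<noteq> 0" "b0 \<noteq> 0" using u(1) by (auto simp: yy_def b0_def)
  have qmin: "\<kappa> \<le> q y X" if "y \<noteq> 0" "X \<noteq> 0" for y X
    using u(2)[of "((1 / norm y) *\<^sub>R y, (1 / norm X) *\<^sub>R X)"] that
    by (simp add: qhom \<kappa>_def yy_def b0_def)
  have min: "\<kappa> * (F y * g y X X) \<le> g y (J y X) X" if "y \<noteq> 0" for y X
  proof (cases "X = 0")
    case True
    then show ?thesis using inner_form.rules[OF g[OF that]] linear_0[OF J(1)[OF that]] by simp
  next
    case False
    then show ?thesis using qmin[OF that False] Fp[OF that] gp[OF that False]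
      by (simp add: q_def pos_le_divide_eq)
  qed
  have kneg: "\<kappa> < 0"
  proof -
    interpret inner_form "g y0" by (rule g[OF y0])
    obtain B l where B: "onb B" "\<And>a. a \<in> B \<Longrightarrow> J y0 a = l a *\<^sub>R a"
      using spectral[OF J(1)[OF y0] J(2)[OF y0]] by blast
    have "\<exists>c\<in>B. l c \<noteq> 0"
    proof (rule ccontr)
      assume "\<not> ?thesis"
      then have "J y0 a = 0" if "a \<in> B" for a using B that by auto
      then show False using onb_eqI[OF B(1) J(1)[OF y0] linear_zero, of X0] nz by simp
    qed
    then obtain c where c: "c \<in> B" "l c \<noteq> 0" by blast
    then obtain d where d: "d \<in> B" "l d * l c < 0"
      using trace_zero_signs[OF J(1)[OF y0] B tr[OF y0]] by blast
    obtain e where e: "e \<in> B" "l e < 0"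
      using c d by (cases "l c < 0") (auto simp: mult_less_0_iff)
    have "g y0 e e = 1" using B e by (simp add: onb_def)
    then have "\<kappa> * F y0 < 0" using min[OF y0, of e] e B(2)[OF e(1)] by (simp add: rules)
    then show ?thesis using Fp[OF y0] by (simp add: mult_less_0_iff)
  qed
  interpret inner_form "g yy" by (rule g[OF ne(1)])
  define b where "b = (1 / sqrt (g yy b0 b0)) *\<^sub>R b0"
  have bb: "g yy b b = 1"
    using gp[OF ne] real_sqrt_mult_self[of "g yy b0 b0"] by (simp add: b_def rules)
  define r where "r = \<kappa> * F yy"
  have r: "r < 0" using kneg Fp[OF ne(1)] by (simp add: r_def mult_neg_pos)
  have kb: "q yy b = \<kappa>"
    using qhom[OF ne(1), of 1 "1 / sqrt (g yy b0 b0)" b0] gp[OF ne] by (simp add: b_def \<kappa>_def)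
  then have Jbb: "g yy (J yy b) b = r"
    using bb Fp[OF ne(1)] by (simp add: q_def r_def field_simps)
  have Jb: "J yy b = r *\<^sub>R b"
  proof (rule eigen_min[OF J(1)[OF ne(1)] J(2)[OF ne(1)] subspace_UNIV])
    show "r * g yy x x \<le> g yy (J yy x) x" for x using min[OF ne(1), of x] by (simp add: r_def mult.assoc)
  qed (use Jbb bb in auto)
  have crit: "g yy (T yy N b) b = 2 * r * g yy N yy / F yy" for N
  proof -
    \<comment> \<open>The vector \<open>b\<close> is frozen while \<open>y\<close> moves. By
      \<open>min\<close> the function \<open>f\<close> is nonnegative near \<open>yy\<close>, and it
      vanishes there. Since \<open>b\<close> is an eigenvector, the derivatives of the metric enter
      with the factor \<open>r - \<kappa> * F yy = 0\<close>, so no formula for them is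
      required.\<close>
    define f where "f y = g y (J y b) b - \<kappa> * (g y y y * g y b b)" for y
    have gd: "((\<lambda>y. g y X Y) has_derivative dd (\<lambda>y. g y X Y) yy) (at yy)" for X Y
      by (rule dd_works[OF dg[OF ne(1)]])
    have Jd: "((\<lambda>y. J y b) has_derivative (\<lambda>Z. T yy Z b)) (at yy)" by (rule dJ[OF ne(1)])
    have e1: "((\<lambda>y. \<Sum>a\<in>Basis. (J y b \<bullet> a) * g y a b) has_derivative
        (\<lambda>Z. \<Sum>a\<in>Basis. (J yy b \<bullet> a) * dd (\<lambda>y. g y a b) yy Z + (T yy Z b \<bullet> a) * g yy a b)) (at yy)"
      by (intro has_derivative_sum has_derivative_mult gd has_derivative_inner_left[OF Jd])
    have e2: "(\<Sum>a\<in>Basis. (J y b \<bullet> a) * g y a b) = g y (J y b) b" if "y \<in> - {0}" for y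
      using linear_sum_Basis[of "\<lambda>X. g y X b" "J y b"] inner_form.lin_left[OF g, of y] that by simp
    have "((\<lambda>y. g y (J y b) b) has_derivative
        (\<lambda>Z. \<Sum>a\<in>Basis. (J yy b \<bullet> a) * dd (\<lambda>y. g y a b) yy Z + (T yy Z b \<bullet> a) * g yy a b)) (at yy)"
      using has_derivative_transform_within_open[OF e1 _ _ e2] ne by auto
    moreover have "(\<Sum>a\<in>Basis. (J yy b \<bullet> a) * dd (\<lambda>y. g y a b) yy Z + (T yy Z b \<bullet> a) * g yy a b)
        = r * dd (\<lambda>y. g y b b) yy Z + g yy (T yy Z b) b" for Z
    proof -
      have l: "linear (\<lambda>X. dd (\<lambda>y. g y X b) yy Z)"
      proof (rule linearI)
        show "dd (\<lambda>y. g y (X + X') b) yy Z = dd (\<lambda>y. g y X b) yy Z + dd (\<lambda>y. g y X' b) yy Z" for X X'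
        proof -
          have "dd (\<lambda>y. g y (X + X') b) yy = dd (\<lambda>y. g y X b + g y X' b) yy"
            by (rule dd_cong_open[of "- {0}"]) (use ne g in \<open>auto simp: inner_form.rules\<close>)
          then show ?thesis by (simp add: dd_eq[OF has_derivative_add[OF gd gd]])
        qed
        show "dd (\<lambda>y. g y (c *\<^sub>R X) b) yy Z = c *\<^sub>R dd (\<lambda>y. g y X b) yy Z" for X c
        proof -
          have "dd (\<lambda>y. g y (c *\<^sub>R X) b) yy = dd (\<lambda>y. c * g y X b) yy"
            by (rule dd_cong_open[of "- {0}"]) (use ne g in \<open>auto simp: inner_form.rules\<close>)
          then show ?thesis by (simp add: dd_eq[OF has_derivative_mult_right[OF gd]])
        qed
      qed
      show ?thesis
        using linear_sum_Basis[OF l, of "J yy b"] linear_sum_Basis[OF lin_left[of b], of "T yy Z b"]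
          linear_scale[OF l, of r b]
        by (simp add: sum.distrib Jb)
    qed
    ultimately have d1: "((\<lambda>y. g y (J y b) b) has_derivative
        (\<lambda>Z. r * dd (\<lambda>y. g y b b) yy Z + g yy (T yy Z b) b)) (at yy)" by simp
    have "(f has_derivative (\<lambda>Z. r * dd (\<lambda>y. g y b b) yy Z + g yy (T yy Z b) b
        - \<kappa> * (F yy * dd (\<lambda>y. g y b b) yy Z + 2 * g yy Z yy * g yy b b))) (at yy)"
      unfolding f_def F_def
      by (intro has_derivative_diff d1 has_derivative_mult_right has_derivative_mult dF[OF ne(1)] gd)
    moreover have "f yy \<le> f y" if "y \<in> ball yy (norm yy)" for y
    proof -
      have "y \<noteq> 0" using that by auto
      then show ?thesis using min[of y b] Jbb bb by (simp add: f_def F_def r_def)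
    qed
    ultimately have "(\<lambda>Z. r * dd (\<lambda>y. g y b b) yy Z + g yy (T yy Z b) b
        - \<kappa> * (F yy * dd (\<lambda>y. g y b b) yy Z + 2 * g yy Z yy * g yy b b)) = (\<lambda>v. 0)"
      using differential_zero_maxmin[of yy "ball yy (norm yy)" f] ne by auto
    from fun_cong[OF this, of N] show ?thesis
      using bb Fp[OF ne(1)] by (simp add: r_def field_simps)
  qed
  obtain B l where B: "onb B" "\<And>a. a \<in> B \<Longrightarrow> J yy a = l a *\<^sub>R a"
    using spectral[OF J(1)[OF ne(1)] J(2)[OF ne(1)]] by blast
  have "\<exists>a\<in>B. l a > 0"
  proof -
    have "\<exists>c\<in>B. l c \<noteq> 0"
    proof (rule ccontr)
      assume "\<not> ?thesis"
      then have "J yy a = 0" if "a \<in> B" for a using B that by auto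
      then have "J yy b = 0" using onb_eqI[OF B(1) J(1)[OF ne(1)] linear_zero, of b] by simp
      then show False using Jb r bb by (auto simp: rules)
    qed
    then obtain c where c: "c \<in> B" "l c \<noteq> 0" by blast
    then obtain d where "d \<in> B" "l d * l c < 0"
      using trace_zero_signs[OF J(1)[OF ne(1)] B tr[OF ne(1)]] by blast
    with c show ?thesis by (cases "l c > 0") (auto simp: mult_less_0_iff)
  qed
  then obtain a where a: "a \<in> B" "l a > 0" by blast
  have aa: "g yy a a = 1" using a B by (simp add: onb_def)
  have nb: "J yy b \<noteq> 0" using Jb r bb by (auto simp: rules)
  have T2: "linear (\<lambda>Z. T yy Z X)" for X using dJ[OF ne(1)] by (rule has_derivative_linear)
  obtain D2 c dc where DD: "fibre_identity (J yy) (T yy) D2 c dc"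
    using S[OF ne(1) nb] by blast
  note D = DD[unfolded fibre_identity_def]
  have Ta: "g yy (T yy a a) yy = - l a" using Ty[OF ne(1), of a a] B(2)[OF a(1)] aa by (simp add: rules)
  show False
    by (rule fibre_contradiction[of "J yy" "T yy" D2 c dc a "l a" b r yy "F yy", OF J(1)[OF ne(1)] J(2)[OF ne(1)]
        T[OF ne(1)] T2 _ _ _ _ _ _ B(2)[OF a(1)] aa a(2) Jb bb r crit Fp[OF ne(1)] y(1)[OF ne(1)] Ta])
      (use D in blast)+
qed

section \<open>The Cartan connection in a chart\<close>

text \<open>The second derivatives of \<open>f\<close> cancel by symmetry. This is the common source
  of the commutation arguments below: \<open>f\<close> is a quantity whose derivatives along both
  fields are known, and the bracket supplies the new information.\<close>

lemma (in smooth_domain) bracket_fields: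
  fixes f :: "'a \<Rightarrow> 'b::euclidean_space"
  assumes "x \<in> U" "sm f" "sm V" "sm W"
  shows "dd (\<lambda>z. dd f z (V z)) x (W x) - dd (\<lambda>z. dd f z (W z)) x (V x) = dd f x (dd V x (W x) - dd W x (V x))"
proof -
  have "dd (\<lambda>z. dd f z (A z)) x w = der1 (der0 f) x w (A x) + dd f x (dd A x w)" if "sm A" for A w
    using lf1_dd[OF lf1_der0[OF assms(2)] assms(1) that] by (simp add: der0_def)
  then show ?thesis
    using der_commute(1)[OF assms(1,2)] assms dd_lin[OF assms(1,2)] by simp
qed

lemma (in smooth_domain) lf1_cong:
  assumes "lf1 U F" "\<And>x X. x \<in> U \<Longrightarrow> F x X = G x X"
  shows "lf1 U G"
proof -
  have e: "F x = G x" if "x \<in> U" for x using assms(2) that by blast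
  have "linear (G x)" if "x \<in> U" for x
  proof -
    have "linear (F x)" using assms(1) that by (simp add: lf1_def)
    then show ?thesis unfolding e[OF that] .
  qed
  moreover have "sm (\<lambda>x. G x X)" for X
    by (rule smooth_on_cong[OF open_U, of "\<lambda>x. F x X"]) (use assms in \<open>auto simp: lf1_def\<close>)
  ultimately show ?thesis by (simp add: lf1_def)
qed

lemma (in smooth_domain) lf2_cong:
  assumes "lf2 U F" "\<And>x X Y. x \<in> U \<Longrightarrow> F x X Y = G x X Y"
  shows "lf2 U G"
  unfolding lf2_def
proof (intro conjI allI)
  show "lf1 U (\<lambda>x. G x X)" for X
    by (rule lf1_cong[OF lf2_D(1)[OF assms(1), of X]]) (rule assms(2))
  show "lf1 U (\<lambda>x X. G x X Y)" for Y
    by (rule lf1_cong[OF lf2_D(2)[OF assms(1), of Y]]) (rule assms(2))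
qed

context
  fixes U :: "('a::euclidean_space \<times> 'b::euclidean_space) set"
begin

lemma lf1_Pair0:
  assumes "open U" "lf1 U (F :: _ \<Rightarrow> 'a \<times> 'b \<Rightarrow> 'c::euclidean_space)" "x \<in> U"
  shows "F x (0, a + b) = F x (0, a) + F x (0, b)" "F x (0, a - b) = F x (0, a) - F x (0, b)"
    "F x (0, - a) = - F x (0, a)" "F x (0, c *\<^sub>R a) = c *\<^sub>R F x (0, a)" "F x (0, 0) = 0"
proof -
  have "linear (\<lambda>W. (0::'a, W::'b))" by (rule linearI) simp_all
  moreover have "linear (F x)" using assms by (simp add: lf1_def)
  ultimately have l: "linear (\<lambda>W. F x (0, W))" using linear_compose[of "\<lambda>W. (0::'a, W::'b)" "F x"] by (simp add: o_def)
  show "F x (0, a + b) = F x (0, a) + F x (0, b)" "F x (0, a - b) = F x (0, a) - F x (0, b)"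
    "F x (0, - a) = - F x (0, a)" "F x (0, c *\<^sub>R a) = c *\<^sub>R F x (0, a)" "F x (0, 0) = 0"
    by (rule linear_add[OF l] linear_diff[OF l] linear_neg[OF l] linear_scale[OF l] linear_0[OF l])+
qed

lemma lf2_Pair0:
  assumes "open U" "lf2 U (F :: _ \<Rightarrow> 'a \<times> 'b \<Rightarrow> 'd::euclidean_space \<Rightarrow> 'c::euclidean_space)" "x \<in> U"
  shows "F x (0, a + b) Y = F x (0, a) Y + F x (0, b) Y" "F x (0, a - b) Y = F x (0, a) Y - F x (0, b) Y"
    "F x (0, - a) Y = - F x (0, a) Y" "F x (0, c *\<^sub>R a) Y = c *\<^sub>R F x (0, a) Y" "F x (0, 0) Y = 0"
  using lf1_Pair0[OF assms(1) smooth_domain.lf2_D(2)[OF _ assms(2), unfolded smooth_domain_def, OF assms(1), of Y] assms(3)]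
  by simp_all

lemma lf3_Pair0:
  assumes "open U" "lf3 U (F :: _ \<Rightarrow> 'a \<times> 'b \<Rightarrow> 'd::euclidean_space \<Rightarrow> 'e::euclidean_space \<Rightarrow> 'c::euclidean_space)" "x \<in> U"
  shows "F x (0, a + b) Y Z = F x (0, a) Y Z + F x (0, b) Y Z" "F x (0, a - b) Y Z = F x (0, a) Y Z - F x (0, b) Y Z"
    "F x (0, - a) Y Z = - F x (0, a) Y Z" "F x (0, c *\<^sub>R a) Y Z = c *\<^sub>R F x (0, a) Y Z" "F x (0, 0) Y Z = 0"
  using lf1_Pair0[OF assms(1) smooth_domain.lf3_D(2)[OF _ assms(2), unfolded smooth_domain_def, OF assms(1), of Y Z] assms(3)]
  by simp_all

lemma lf1_slot_Pair0:
  assumes "open U" "lf1 U (F :: _ \<Rightarrow> 'a \<times> 'b \<Rightarrow> 'c::euclidean_space)"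
  shows "lf1 U (\<lambda>x X. F x (0, X))"
  unfolding lf1_def
proof (intro conjI ballI allI)
  show "linear (\<lambda>X. F x (0, X))" if "x \<in> U" for x
    using lf1_Pair0[OF assms that] by (auto intro: linearI)
  show "smooth_on U (\<lambda>x. F x (0, X))" for X using assms by (simp add: lf1_def)
qed

lemma lf2_slot_Pair0:
  assumes "open U" "lf2 U (F :: _ \<Rightarrow> 'a \<times> 'b \<Rightarrow> 'd::euclidean_space \<Rightarrow> 'c::euclidean_space)"
  shows "lf2 U (\<lambda>x X. F x (0, X))" "lf2 U (\<lambda>x Y X. F x (0, X) Y)"
proof -
  have "lf1 U (\<lambda>x X. F x (0, X) Y)" for Y
    using lf1_slot_Pair0[OF assms(1), of "\<lambda>x X. F x X Y"] assms(2) by (simp add: lf2_def)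
  then show "lf2 U (\<lambda>x X. F x (0, X))" "lf2 U (\<lambda>x Y X. F x (0, X) Y)"
    using assms(2) by (simp_all add: lf2_def)
qed

end

text \<open>In the coordinates \<open>(x, y)\<close> of a slit chart, \<open>F2\<close> is \<open>L\<^sup>2\<close>, \<open>N\<close> the nonlinear connection, \<open>h\<close> the
  horizontal lift \<open>\<beta>\<close>, and \<open>Gam\<close> are the coefficients of the Cartan connection in horizontal directions.\<close>

locale finsler_chart =
  fixes Q :: "'e::euclidean_space set" and F2 :: "'e \<times> 'e \<Rightarrow> real"
    and N :: "'e \<times> 'e \<Rightarrow> 'e \<Rightarrow> 'e" and Gam :: "'e \<times> 'e \<Rightarrow> 'e \<Rightarrow> 'e \<Rightarrow> 'e"
    and g :: "'e \<times> 'e \<Rightarrow> 'e \<Rightarrow> 'e \<Rightarrow> real" and U :: "('e \<times> 'e) set" and h :: "'e \<times> 'e \<Rightarrow> 'e \<Rightarrow> 'e \<times> 'e"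
  assumes open_Q: "open Q" and U_eq: "U = Q \<times> (- {0})"
    and F2_sm: "smooth_on U F2" and N_lf: "lf1 U N" and Gam_lf: "lf2 U Gam"
    and g_eq: "\<And>x X Y. x \<in> U \<Longrightarrow> g x X Y = der1 (der0 F2) x (0, X) (0, Y) / 2"
    and g_pos: "\<And>x X. x \<in> U \<Longrightarrow> X \<noteq> 0 \<Longrightarrow> g x X X > 0"
    and F2_euler: "\<And>x. x \<in> U \<Longrightarrow> der0 F2 x (0, snd x) = 2 * F2 x"
    and h_eq: "h = (\<lambda>x X. (X, - N x X))"
    and Gam_sym: "\<And>x X Y. x \<in> U \<Longrightarrow> Gam x X Y = Gam x Y X"
    and Gam_y: "\<And>x X. x \<in> U \<Longrightarrow> Gam x X (snd x) = N x X"
    and metric: "\<And>x X Y Z. x \<in> U \<Longrightarrow> der2 g x (h x X) Y Z = g x (Gam x X Y) Z + g x Y (Gam x X Z)"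
begin

sublocale smooth_domain U
  by unfold_locales (simp add: U_eq open_Q open_Times open_Compl)

lemma sm_div: "sm f \<Longrightarrow> sm (\<lambda>x. f x / c :: real)"
  using sm_rules(7)[OF _ sm_rules(1), of f "inverse c"] by (simp add: divide_inverse)

lemma g_lf: "lf2 U g"
proof -
  have "lf2 U (der1 (der0 F2))" using F2_sm by (intro lf2_der1 lf1_der0)
  then have "lf2 U (\<lambda>x X. der1 (der0 F2) x (0, X))" by (rule lf2_slot_Pair0(1)[OF open_U])
  then have "lf1 U (\<lambda>x Y. der1 (der0 F2) x (0, X) (0, Y))" "lf1 U (\<lambda>x X. der1 (der0 F2) x (0, X) (0, Y))" for X Y
    by (auto simp: lf2_def intro: lf1_slot_Pair0[OF open_U])
  then have 1: "lf2 U (\<lambda>x X Y. der1 (der0 F2) x (0, X) (0, Y))" by (simp add: lf2_def)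
  have "lf2 U (\<lambda>x X Y. (1/2) * der1 (der0 F2) x (0, X) (0, Y))"
    by (rule lf2I; (rule linearI)?; simp add: lf2_lin[OF 1] lf2_sm[OF 1] sm_rules sm_div algebra_simps)
  then show ?thesis
  proof (rule lf2_cong)
    show "(1/2) * der1 (der0 F2) x (0, X) (0, Y) = g x X Y" if "x \<in> U" for x X Y
      unfolding g_eq[OF that] by simp
  qed
qed

lemma h_lf: "lf1 U h"
  by (rule lf1I; (rule linearI)?; simp add: h_eq lf1_lin[OF N_lf] sm_rules lf1_sm[OF N_lf])

lemma snd_sm [simp]: "sm snd" and snd_dd [simp]: "x \<in> U \<Longrightarrow> dd snd x w = snd w"
  using sm_rules(12)[OF sm_rules(2)] dd_rules(8)[OF _ sm_rules(2), of x w] by auto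

lemma snd_h [simp]: "snd (h x X) = - N x X" and fst_h [simp]: "fst (h x X) = X"
  by (simp_all add: h_eq)

section \<open>Berwald coefficients, Jacobi endomorphism and Landsberg tensor\<close>

definition "B x X Y = der1 N x (0, Y) X"

definition "E x X Y = der1 N x (h x Y) X - der1 N x (h x X) Y"

definition "J x X = E x X (snd x)"

definition "T x Z X = der1 J x (0, Z) X"

text \<open>The Landsberg tensor, as the difference of the Berwald and the Cartan
  coefficients.\<close>

definition "P x X Y = B x X Y - Gam x X Y"

lemma B_lf: "lf2 U B"
  unfolding B_def by (rule lf2_slot_Pair0(2)[OF open_U lf2_der1[OF N_lf]])

lemma E_lf: "lf2 U E"
  unfolding E_def
  by (rule lf2I; (rule linearI)?; simp add: sm_rules lf2_sm[OF lf2_der1[OF N_lf]] lf1_sm[OF h_lf]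
      lf2_lin[OF lf2_der1[OF N_lf]] lf1_lin[OF h_lf] algebra_simps)

lemma J_lf: "lf1 U J"
  unfolding J_def
  by (rule lf1I; (rule linearI)?; simp add: sm_rules lf2_sm[OF E_lf] lf2_lin[OF E_lf])

lemma T_lf: "lf2 U T"
  unfolding T_def by (rule lf2_slot_Pair0(1)[OF open_U lf2_der1[OF J_lf]])

lemma P_lf: "lf2 U P"
  unfolding P_def
  by (rule lf2I; (rule linearI)?; simp add: sm_rules lf2_sm[OF B_lf] lf2_sm[OF Gam_lf] lf2_lin[OF B_lf]
      lf2_lin[OF Gam_lf] algebra_simps)

lemmas lf_all = lf1_rules[OF N_lf] lf2_rules[OF Gam_lf] lf2_rules[OF g_lf] lf1_rules[OF h_lf] lf2_rules[OF B_lf]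
  lf2_rules[OF E_lf] lf1_rules[OF J_lf] lf2_rules[OF T_lf] lf2_rules[OF P_lf]
  lf1_rules[OF lf1_der0[OF F2_sm]] lf2_rules[OF lf2_der1[OF N_lf]] lf2_rules[OF lf2_der1[OF J_lf]]
  lf3_rules[OF lf3_der2[OF g_lf]] lf3_rules[OF lf3_der2[OF Gam_lf]] lf3_rules[OF lf3_der2[OF B_lf]]
  lf3_rules[OF lf3_der2[OF E_lf]]

lemmas calc = sm_rules dd_rules lf_all der0_def[of F2, symmetric] F2_sm
  lf1_Pair0[OF open_U lf1_der0[OF F2_sm]] lf3_Pair0[OF open_U lf3_der2[OF g_lf]]
  lf3_Pair0[OF open_U lf3_der2[OF B_lf]] lf3_Pair0[OF open_U lf3_der2[OF E_lf]]

lemma der_h: "x \<in> U \<Longrightarrow> der1 h x w X = (0, - der1 N x w X)"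
  unfolding der1_def h_eq by (simp add: calc)

lemma g_inner: assumes x: "x \<in> U" shows "inner_form (g x)"
proof (rule inner_form.intro)
  show "linear (g x X)" for X using lf2_D(1)[OF g_lf] x by (auto simp: lf1_def)
  show "g x X Y = g x Y X" for X Y
    using der_commute(1)[OF x F2_sm] by (simp add: g_eq[OF x])
qed (use g_pos[OF x] in auto)

lemma g_sym: "x \<in> U \<Longrightarrow> g x X Y = g x Y X"
  using inner_form.sym[OF g_inner] .

lemma F2_grad: "x \<in> U \<Longrightarrow> der0 F2 x (0, Z) = 2 * g x Z (snd x)"
proof -
  assume x: "x \<in> U"
  have "dd (\<lambda>z. der0 F2 z (0, snd z)) x (0, Z) = dd (\<lambda>z. 2 * F2 z) x (0, Z)"
    by (rule dd_cong_U[OF x]) (simp add: F2_euler)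
  then show ?thesis
    using x by (simp add: calc g_eq lf2_rules[OF lf2_der1[OF lf1_der0[OF F2_sm]]])
qed

lemma g_vert_sym:
  assumes "x \<in> U"
  shows "der2 g x (0, W) X Y = der2 g x (0, X) W Y" "der2 g x w X Y = der2 g x w Y X"
proof -
  have e: "der2 g x w X Y = der2 (der1 (der0 F2)) x w (0, X) (0, Y) / 2" for w X Y
  proof -
    have "dd (\<lambda>z. 2 * g z X Y) x w = dd (\<lambda>z. der1 (der0 F2) z (0, X) (0, Y)) x w"
      by (rule dd_cong_U[OF assms]) (simp add: g_eq)
    then show ?thesis
      using assms by (simp add: calc lf2_rules[OF lf2_der1[OF lf1_der0[OF F2_sm]]])
  qed
  show "der2 g x (0, W) X Y = der2 g x (0, X) W Y"
    unfolding e using der_commute(2)[OF assms lf1_der0[OF F2_sm]] by simp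
  show "der2 g x w X Y = der2 g x w Y X"
    unfolding der2_def by (rule arg_cong[where f = "\<lambda>D. D w"], rule dd_cong_open[OF open_U assms]) (rule g_sym)
qed

text \<open>Differentiating \<open>F2_grad\<close> vertically gives twice \<open>g\<close> on both
  sides, which leaves no room for the contraction of the third derivative of
  \<open>L\<^sup>2\<close> with \<open>y\<close>. Total symmetry moves \<open>y\<close> to any
  slot.\<close>

lemma g_vert_y:
  assumes "x \<in> U"
  shows "der2 g x (0, W) Z (snd x) = 0" "der2 g x (0, W) (snd x) Z = 0" "der2 g x (0, snd x) W Z = 0"
proof -
  have "dd (\<lambda>z. der0 F2 z (0, Z)) x (0, W) = dd (\<lambda>z. 2 * g z Z (snd z)) x (0, W)" for W Z
    by (rule dd_cong_U[OF assms]) (simp add: F2_grad)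
  then have "der1 (der0 F2) x (0, W) (0, Z) = 2 * der2 g x (0, W) Z (snd x) + 2 * g x Z W" for W Z
    using assms by (simp add: calc lf2_rules[OF lf2_der1[OF lf1_der0[OF F2_sm]]] lf2_Pair0[OF open_U lf2_der1[OF lf1_der0[OF F2_sm]]])
  then show a: "der2 g x (0, W) Z (snd x) = 0" for W Z
  proof -
    have "der1 (der0 F2) x (0, W) (0, Z) = 2 * g x Z W"
      using g_eq[OF assms, of W Z] g_sym[OF assms, of Z W] by linarith
    with \<open>der1 (der0 F2) x (0, W) (0, Z) = 2 * der2 g x (0, W) Z (snd x) + 2 * g x Z W\<close>
    show ?thesis by linarith
  qed
  show "der2 g x (0, W) (snd x) Z = 0" "der2 g x (0, snd x) W Z = 0"
    using a g_vert_sym[OF assms] by metis+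
qed

lemma F2_eq: "x \<in> U \<Longrightarrow> F2 x = g x (snd x) (snd x)"
  using F2_grad[of x "snd x"] F2_euler[of x] by simp

text \<open>\<open>L\<^sup>2\<close> is \<open>g(y, y)\<close>; the connection is metric, and
  \<open>y\<close> is parallel in horizontal directions because
  \<open>Gam X y = N X\<close>.\<close>

lemma F2_h: "x \<in> U \<Longrightarrow> der0 F2 x (h x X) = 0"
proof -
  assume x: "x \<in> U"
  have "dd F2 x (h x X) = dd (\<lambda>z. g z (snd z) (snd z)) x (h x X)"
    by (rule dd_cong_U[OF x]) (simp add: F2_eq)
  then show ?thesis
    using x by (simp add: calc metric Gam_y)
qed

text \<open>The vertical derivative of \<open>F2_h\<close> sees the coefficients \<open>B\<close>
  only through their component along \<open>y\<close>. Equivalently, the Landsberg tensor takes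
  values orthogonal to \<open>y\<close>.\<close>

lemma B_y_comp: "x \<in> U \<Longrightarrow> g x (B x X W) (snd x) = g x (Gam x X W) (snd x)"
proof -
  assume x: "x \<in> U"
  have 1: "dd (\<lambda>z. dd F2 z (h z X)) x (0, W) = 0"
    by (rule dd_const_U[OF x, of _ 0]) (simp add: F2_h der0_def[symmetric])
  have 2: "dd (\<lambda>z. dd F2 z (0, W)) x (h x X) = dd (\<lambda>z. 2 * g z W (snd z)) x (h x X)"
    by (rule dd_cong_U[OF x]) (simp add: F2_grad der0_def[symmetric])
  show ?thesis
    using bracket_fields[OF x F2_sm, of "\<lambda>_. (0, W)" "\<lambda>z. h z X"] x
    unfolding 1 2 by (simp add: calc metric Gam_y der_h F2_grad B_def)
qed

lemma grad_sm: "sm (\<lambda>z. 2 * g z Z (snd z))"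
  by (simp add: calc)

lemma grad_dd:
  assumes "x \<in> U"
  shows "dd (\<lambda>z. 2 * g z Z (snd z)) x (0, W) = 2 * g x Z W"
    and "dd (\<lambda>z. 2 * g z Z (snd z)) x (h x X) = 2 * g x (Gam x X Z) (snd x)"
  using assms by (simp_all add: calc g_vert_y metric Gam_y)

text \<open>Differentiating the Euler-Lagrange equation of the spray: the nonlinear connection of \<open>Gam\<close> is
  the canonical one.\<close>

lemma B_y: "x \<in> U \<Longrightarrow> B x (snd x) W = N x W"
proof -
  assume x: "x \<in> U"
  interpret inner_form "g x" using x by (rule g_inner)
  show ?thesis
  proof (rule eqI)
    fix Z
    let ?f = "\<lambda>z. 2 * g z Z (snd z)"
    have 1: "dd (\<lambda>z. dd ?f z (h z (snd z))) x (0, W) = dd (\<lambda>z. 2 * g z (N z Z) (snd z)) x (0, W)"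
      by (rule dd_cong_U[OF x]) (simp add: grad_dd Gam_sym[of _ "snd _"] Gam_y)
    have 2: "dd (\<lambda>z. dd ?f z (0, W)) x (h x (snd x)) = dd (\<lambda>z. 2 * g z Z W) x (h x (snd x))"
      by (rule dd_cong_U[OF x]) (simp add: grad_dd)
    have 3: "dd ?f x (dd (\<lambda>z. h z (snd z)) x (0, W) - dd (\<lambda>_. (0, W)) x (h x (snd x))) = - 2 * g x Z (B x (snd x) W) + 2 * g x (Gam x W Z) (snd x)"
      using x by (simp add: calc der_h metric Gam_y g_vert_y flip: B_def)
    show "g x (B x (snd x) W) Z = g x (N x W) Z"
      using bracket_fields[OF x grad_sm[of Z], of "\<lambda>z. h z (snd z)" "\<lambda>_. (0, W)"] x
      unfolding 1 2 3
      by (simp add: calc metric Gam_y g_vert_y B_y_comp Gam_sym[of x "snd x"] Gam_sym[of x W Z] sym[of _ Z] flip: B_def)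
  qed
qed

text \<open>By \<open>B_y\<close> the vertical derivative of the spray coefficients
  \<open>N y\<close> is \<open>2 N\<close>, so \<open>B\<close> is half a second derivative of
  them.\<close>

lemma B_sym: "x \<in> U \<Longrightarrow> B x X Y = B x Y X"
proof -
  assume x: "x \<in> U"
  have s: "sm (\<lambda>z. N z (snd z))" by (simp add: calc)
  have k: "dd (\<lambda>z. dd (\<lambda>z. N z (snd z)) z (0, V)) x (0, W) = dd (\<lambda>z. 2 *\<^sub>R N z V) x (0, W)" for V W
  proof (rule dd_cong_U[OF x])
    fix z assume "z \<in> U"
    then show "dd (\<lambda>z. N z (snd z)) z (0, V) = 2 *\<^sub>R N z V"
      by (simp add: calc B_y scaleR_2 flip: B_def)
  qed
  have "dd (\<lambda>z. 2 *\<^sub>R N z Y) x (0, X) = dd (\<lambda>z. 2 *\<^sub>R N z X) x (0, Y)"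
    using dd_dd_commute[OF open_U x s, of "(0, Y)" "(0, X)"] unfolding k .
  then show ?thesis using x by (simp add: calc flip: B_def)
qed

lemma B_y': "x \<in> U \<Longrightarrow> B x X (snd x) = N x X"
  using B_y B_sym by metis

lemma P_sym: "x \<in> U \<Longrightarrow> P x X Y = P x Y X"
  by (simp add: P_def B_sym[of x X] Gam_sym[of x X])

lemma dB_sym:
  assumes "x \<in> U"
  shows "der2 B x w X Y = der2 B x w Y X" "der2 B x (0, W) X Y = der2 B x (0, Y) X W"
proof -
  show "der2 B x w X Y = der2 B x w Y X" for w X Y
    unfolding der2_def by (rule arg_cong[where f = "\<lambda>D. D w"], rule dd_cong_open[OF open_U assms]) (rule B_sym)
  have "der2 B x w X Y = der2 (der1 N) x w (0, Y) X" for w X Y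
    by (simp add: der2_def B_def)
  then show "der2 B x (0, W) X Y = der2 B x (0, Y) X W"
    using der_commute(2)[OF assms N_lf] by simp
qed

text \<open>Commuting a vertical derivative with one along \<open>h X\<close> on the gradient of
  \<open>L\<^sup>2\<close> expresses \<open>g (P X Z) W + g (P X W) Z\<close> by the vertical
  derivative of \<open>B\<close>, which is symmetric in all three arguments. Together with
  \<open>P_sym\<close> this forces the symmetry of the individual terms.\<close>

lemma g_P_sym: "x \<in> U \<Longrightarrow> g x (P x X Y) Z = g x (P x X Z) Y"
proof -
  assume x: "x \<in> U"
  interpret inner_form "g x" using x by (rule g_inner)
  have L: "g x (P x X Z) W + g x (P x X W) Z = - g x (der2 B x (0, W) X Z) (snd x)" for X Z W
  proof -
    let ?f = "\<lambda>z. 2 * g z Z (snd z)"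
    have 1: "dd (\<lambda>z. dd ?f z (0, W)) x (h x X) = dd (\<lambda>z. 2 * g z Z W) x (h x X)"
      by (rule dd_cong_U[OF x]) (simp add: grad_dd)
    have 2: "dd (\<lambda>z. dd ?f z (h z X)) x (0, W) = dd (\<lambda>z. 2 * g z (B z X Z) (snd z)) x (0, W)"
      by (rule dd_cong_U[OF x]) (simp add: grad_dd B_y_comp)
    show ?thesis
      using bracket_fields[OF x grad_sm[of Z], of "\<lambda>_. (0, W)" "\<lambda>z. h z X"] x
      unfolding 1 2
      by (simp add: calc metric g_vert_y der_h grad_dd P_def rules sym[of Z] sym[of _ W] flip: B_def)
  qed
  define f where "f X Z W = g x (P x X Z) W" for X Z W
  have s1: "f X Z W = f Z X W" for X Z W using P_sym[OF x] by (simp add: f_def)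
  have M: "f X Z W + f X W Z = f W X Z + f W Z X" for X Z W
    using L[of X Z W] L[of W X Z] dB_sym[OF x] unfolding f_def by (metis add.commute)
  have "f X Y Z = f X Z Y"
    using M[of X Y Z] M[of X Z Y] M[of Y X Z] s1 by (smt (verit))
  then show ?thesis by (simp add: f_def)
qed

section \<open>Curvature of the nonlinear connection and derivatives of the Jacobi
  endomorphism\<close>

lemma E_skew: "E x X Y = - E x Y X"
  by (simp add: E_def)

lemma E_self [simp]: "E x X X = 0"
  by (simp add: E_def)

lemma J_y: "J x (snd x) = 0"
  by (simp add: J_def)

text \<open>\<open>L\<^sup>2\<close> is constant along horizontal fields, hence along their
  brackets, which are vertical with component \<open>E\<close> up to sign.\<close>

lemma E_y: "x \<in> U \<Longrightarrow> g x (E x X Y) (snd x) = 0"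
proof -
  assume x: "x \<in> U"
  have z: "dd (\<lambda>z. dd F2 z (h z V)) x w = 0" for V w
    by (rule dd_const_U[OF x, of _ 0]) (simp add: F2_h der0_def[symmetric])
  have "dd F2 x (dd (\<lambda>z. h z X) x (h x Y) - dd (\<lambda>z. h z Y) x (h x X)) = 0"
    using bracket_fields[OF x F2_sm, of "\<lambda>z. h z X" "\<lambda>z. h z Y"] unfolding z by (simp add: calc)
  moreover have "dd (\<lambda>z. h z X) x (h x Y) - dd (\<lambda>z. h z Y) x (h x X) = (0, - E x X Y)"
    using x by (simp add: calc der_h E_def)
  ultimately have "der0 F2 x (0, - E x X Y) = 0" by (simp add: der0_def)
  then show ?thesis using x F2_grad[OF x, of "- E x X Y"] lf2_lin(3)[OF g_lf x] by simp
qed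

lemma J_perp: "x \<in> U \<Longrightarrow> g x (J x X) (snd x) = 0"
  by (simp add: J_def E_y)

lemma dE_vert:
  assumes x: "x \<in> U"
  shows "der2 E x (0, Z) X Y = der2 B x (h x Y) X Z - der2 B x (h x X) Y Z - B x X (B x Y Z) + B x Y (B x X Z)"
proof -
  have *: "dd (\<lambda>z. der1 N z (h z Y) X) x (0, Z) = der2 B x (h x Y) X Z - B x X (B x Y Z)" for X Y
  proof -
    have s: "sm (\<lambda>z. N z X)" by (simp add: calc)
    have a: "(\<lambda>z. dd (\<lambda>z. N z X) z (h z Y)) = (\<lambda>z. der1 N z (h z Y) X)" by (simp add: der1_def)
    have b: "(\<lambda>z. dd (\<lambda>z. N z X) z (0, Z)) = (\<lambda>z. B z X Z)" by (simp add: der1_def B_def)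
    have c: "dd (\<lambda>z. h z Y) x (0, Z) - dd (\<lambda>_. (0, Z)) x (h x Y) = (0, - B x Y Z)"
      using x by (simp add: calc der_h B_def)
    have d: "dd (\<lambda>z. N z X) x (0, - B x Y Z) = - B x X (B x Y Z)"
      using lf2_Pair0(3)[OF open_U lf2_der1[OF N_lf] x] by (simp add: B_def der1_def)
    show ?thesis
      using bracket_fields[OF x s, of "\<lambda>z. h z Y" "\<lambda>_. (0, Z)", unfolded a b c d]
      by (simp add: calc der2_def[of B] algebra_simps)
  qed
  have "der2 E x (0, Z) X Y = dd (\<lambda>z. der1 N z (h z Y) X) x (0, Z) - dd (\<lambda>z. der1 N z (h z X) Y) x (0, Z)"
    unfolding der2_def E_def using x by (subst dd_rules(2)) (simp_all add: calc)
  then show ?thesis by (simp add: *)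
qed

lemma dB_h_y:
  assumes x: "x \<in> U"
  shows "der2 B x (h x X) (snd x) Z = der1 N x (h x X) Z + B x (N x X) Z"
proof -
  have "dd (\<lambda>z. B z (snd z) Z) x (h x X) = dd (\<lambda>z. N z Z) x (h x X)"
    by (rule dd_cong_U[OF x]) (simp add: B_y)
  then show ?thesis using x by (simp add: calc algebra_simps)
qed

lemma T_eq: "x \<in> U \<Longrightarrow> T x Z X = der2 E x (0, Z) X (snd x) + E x X Z"
  unfolding T_def der1_def J_def by (simp add: calc)

lemma (in -) scaleR_3: "(3::real) *\<^sub>R v = v + v + (v::'v::real_vector)"
  using scaleR_add_left[of 2 1 v] by (simp add: scaleR_2)

text \<open>The curvature of the Berwald connection appears here through \<open>T - E\<close>.\<close>

lemma T_minus_E: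
  assumes x: "x \<in> U"
  shows "T x Z X - E x X Z = der2 B x (h x (snd x)) X Z + N x (B x X Z) - B x X (N x Z)
    - der1 N x (h x X) Z - B x (N x X) Z"
  using x by (simp add: T_eq dE_vert dB_h_y B_y)

text \<open>The classical fact that the Jacobi endomorphism determines the curvature of the spray.
  In \<open>T_minus_E\<close> everything collected in \<open>R\<close> is symmetric in
  \<open>X\<close> and \<open>Z\<close>; the remaining derivatives of \<open>N\<close> contribute
  one \<open>E\<close> to the difference and the explicit terms two, whence the factor 3.\<close>

lemma T_skew:
  assumes x: "x \<in> U"
  shows "T x Z X - T x X Z = 3 *\<^sub>R E x X Z"
proof -
  define R where "R = der2 B x (h x (snd x)) X Z + N x (B x X Z) - B x X (N x Z) - B x (N x X) Z"
  have 1: "T x Z X = R - der1 N x (h x X) Z + E x X Z"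
    using T_minus_E[OF x, of Z X] by (simp add: R_def algebra_simps)
  have 2: "T x X Z = R - der1 N x (h x Z) X - E x X Z"
    using T_minus_E[OF x, of X Z] dB_sym(1)[OF x, of "h x (snd x)" Z X] B_sym[OF x, of Z X]
      B_sym[OF x, of "N x Z" X] B_sym[OF x, of Z "N x X"] E_skew[of x Z X]
    by (simp add: R_def algebra_simps)
  show ?thesis unfolding 1 2 by (simp add: E_def algebra_simps scaleR_3)
qed

lemma T_y:
  assumes x: "x \<in> U"
  shows "T x Z (snd x) = - J x Z" "T x (snd x) Z = 2 *\<^sub>R J x Z"
proof -
  have "dd (\<lambda>z. J z (snd z)) x (0, Z) = 0"
    by (rule dd_const_U[OF x]) (rule J_y)
  moreover have "dd (\<lambda>z. J z (snd z)) x (0, Z) = T x Z (snd x) + J x Z"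
    using lf1_dd[OF J_lf x snd_sm, of "(0, Z)"] x by (simp add: T_def)
  ultimately show a: "T x Z (snd x) = - J x Z" by (simp add: eq_neg_iff_add_eq_0)
  have "T x (snd x) Z - T x Z (snd x) = 3 *\<^sub>R J x Z"
    using T_skew[OF x, of "snd x" Z] by (simp add: J_def)
  then have "T x (snd x) Z = 3 *\<^sub>R J x Z - J x Z"
    unfolding a by (simp add: algebra_simps)
  then show "T x (snd x) Z = 2 *\<^sub>R J x Z"
    by (simp add: scaleR_2 scaleR_3)
qed

text \<open>Commuting the spray with \<open>h X\<close> on the gradient of \<open>L\<^sup>2\<close>
  gives \<open>g (J X) Y\<close> as a sum whose terms are symmetric in \<open>X\<close> and
  \<open>Y\<close> or exchanged with each other. For the derivative of \<open>N\<close> this is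
  \<open>E_y\<close>.\<close>

lemma J_selfadj: "x \<in> U \<Longrightarrow> g x (J x X) Y = g x X (J x Y)"
proof -
  assume x: "x \<in> U"
  interpret inner_form "g x" using x by (rule g_inner)
  have e: "g x (J x X) Y = g x (Gam x X (N x Y)) (snd x) + g x (Gam x (N x X) Y) (snd x)
      + g x (der1 N x (h x X) Y) (snd x) - dd (\<lambda>z. g z (B z X Y) (snd z)) x (h x (snd x))" for X Y
  proof -
    let ?f = "\<lambda>z. 2 * g z Y (snd z)"
    have 1: "dd (\<lambda>z. dd ?f z (h z X)) x (h x (snd x)) = 2 * dd (\<lambda>z. g z (B z X Y) (snd z)) x (h x (snd x))"
    proof -
      have "dd (\<lambda>z. dd ?f z (h z X)) x (h x (snd x)) = dd (\<lambda>z. 2 * g z (B z X Y) (snd z)) x (h x (snd x))"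
        by (rule dd_cong_U[OF x]) (simp add: grad_dd B_y_comp)
      then show ?thesis using x by (simp add: calc)
    qed
    have 2: "dd (\<lambda>z. dd ?f z (h z (snd z))) x (h x X) = dd (\<lambda>z. 2 * g z (N z Y) (snd z)) x (h x X)"
      by (rule dd_cong_U[OF x]) (simp add: grad_dd Gam_sym[of _ "snd _"] Gam_y)
    have 3: "dd (\<lambda>z. h z X) x (h x (snd x)) - dd (\<lambda>z. h z (snd z)) x (h x X) = (0, - J x X) + h x (N x X)"
      using x by (simp add: calc der_h J_def E_def algebra_simps)
    have 4: "dd ?f x ((0, - J x X) + h x (N x X)) = - 2 * g x Y (J x X) + 2 * g x (Gam x (N x X) Y) (snd x)"
      using x grad_sm[of Y] by (simp add: dd_lin(1) grad_dd rules)
    show ?thesis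
      using bracket_fields[OF x grad_sm[of Y], of "\<lambda>z. h z X" "\<lambda>z. h z (snd z)"] x
      unfolding 1 2 3 4
      by (simp add: calc metric Gam_y sym[of Y])
  qed
  have "dd (\<lambda>z. g z (B z X Y) (snd z)) x w = dd (\<lambda>z. g z (B z Y X) (snd z)) x w" for w
    by (rule dd_cong_U[OF x]) (simp add: B_sym)
  moreover have "g x (der1 N x (h x X) Y) (snd x) = g x (der1 N x (h x Y) X) (snd x)"
    using E_y[OF x, of X Y] by (simp add: E_def rules)
  ultimately have "g x (J x X) Y = g x (J x Y) X"
    using e[of X Y] e[of Y X] Gam_sym[OF x, of X "N x Y"] Gam_sym[OF x, of Y "N x X"] by simp
  then show ?thesis by (simp add: sym)
qed

lemma T_perp: "x \<in> U \<Longrightarrow> g x (T x Z X) (snd x) = - g x (J x X) Z"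
proof -
  assume x: "x \<in> U"
  have "dd (\<lambda>z. g z (J z X) (snd z)) x (0, Z) = 0"
    by (rule dd_const_U[OF x]) (simp add: J_perp)
  then show ?thesis using x by (simp add: calc g_vert_y flip: T_def)
qed

text \<open>The Jacobi identity of three horizontal lifts in coordinates: exchanging two horizontal
  derivatives of \<open>N\<close> costs a vertical derivative, that is \<open>B\<close>, in the
  direction \<open>E\<close>.\<close>

lemma bianchi_E:
  assumes x: "x \<in> U"
  shows "der2 E x (h x Z) X Y + der2 E x (h x X) Y Z + der2 E x (h x Y) Z X
    + B x Z (E x X Y) + B x X (E x Y Z) + B x Y (E x Z X) = 0"
proof -
  define Q where "Q X Y Z = dd (\<lambda>z. dd (\<lambda>z. N z X) z (h z Y)) x (h x Z)" for X Y Z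
  have E: "der2 E x (h x Z) X Y = Q X Y Z - Q Y X Z" for X Y Z
    unfolding der2_def E_def Q_def using x by (subst dd_rules(2)) (simp_all add: calc flip: der1_def)
  have s: "sm (\<lambda>z. N z X)" for X by (simp add: calc)
  have "Q X Y Z - Q X Z Y = B x X (E x Z Y)" for X Y Z
    using bracket_fields[OF x s[of X], of "\<lambda>z. h z Y" "\<lambda>z. h z Z"] x
    by (simp add: Q_def calc der_h B_def E_def flip: der1_def)
  moreover have "B x X (E x Z Y) = - B x X (E x Y Z)" for X Y Z
    by (subst E_skew) (simp add: lf2_lin[OF B_lf x])
  ultimately have q: "Q X Y Z = Q X Z Y - B x X (E x Y Z)" for X Y Z
    by (metis add_diff_cancel_left' diff_add_cancel uminus_add_conv_diff add.commute)
  show ?thesis unfolding E q[of X Y Z] q[of Y Z X] q[of Z X Y] by simp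
qed

end

section \<open>Covariant derivatives along the spray\<close>

context finsler_chart
begin

text \<open>Covariant differentiation along the spray, for endomorphisms; \<open>D2\<close> and
  \<open>Dform\<close> treat the other types. The connection terms are given by \<open>N\<close>
  because \<open>Gam y X = N X\<close>.\<close>

definition D1 :: "('e \<times> 'e \<Rightarrow> 'e \<Rightarrow> 'e) \<Rightarrow> 'e \<times> 'e \<Rightarrow> 'e \<Rightarrow> 'e" where
  "D1 F x X = der1 F x (h x (snd x)) X + N x (F x X) - F x (N x X)"

definition D2 :: "('e \<times> 'e \<Rightarrow> 'e \<Rightarrow> 'e \<Rightarrow> 'e) \<Rightarrow> 'e \<times> 'e \<Rightarrow> 'e \<Rightarrow> 'e \<Rightarrow> 'e" where
  "D2 F x X Y = der2 F x (h x (snd x)) X Y + N x (F x X Y) - F x (N x X) Y - F x X (N x Y)"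

definition Dform :: "('e \<times> 'e \<Rightarrow> 'e \<Rightarrow> real) \<Rightarrow> 'e \<times> 'e \<Rightarrow> 'e \<Rightarrow> real" where
  "Dform f x X = der1 f x (h x (snd x)) X - f x (N x X)"

lemma D2_lf:
  assumes "lf2 U F"
  shows "lf2 U (D2 F)"
  unfolding D2_def
  by (rule lf2I; (rule linearI)?; simp add: sm_rules lf_all lf2_rules[OF assms] lf3_rules[OF lf3_der2[OF assms]] algebra_simps)

lemma D2_cong:
  assumes "x \<in> U" "\<And>z X Y. z \<in> U \<Longrightarrow> F z X Y = G z X Y"
  shows "D2 F x X Y = D2 G x X Y"
proof -
  have "der2 F x w X Y = der2 G x w X Y" for w
    unfolding der2_def by (rule dd_cong_U[OF assms(1)]) (rule assms(2))
  then show ?thesis by (simp add: D2_def assms)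
qed

lemma D2_arith:
  assumes "x \<in> U" "lf2 U F" "lf2 U G"
  shows "D2 (\<lambda>z X Y. F z X Y + G z X Y) x X Y = D2 F x X Y + D2 G x X Y"
    and "D2 (\<lambda>z X Y. F z X Y - G z X Y) x X Y = D2 F x X Y - D2 G x X Y"
    and "D2 (\<lambda>z X Y. c *\<^sub>R F z X Y) x X Y = c *\<^sub>R D2 F x X Y"
    and "D2 (\<lambda>z X Y. F z Y X) x X Y = D2 F x Y X"
proof -
  have [simp]: "sm (\<lambda>z. F z X Y)" "sm (\<lambda>z. G z X Y)" for X Y
    using assms by (auto simp: lf2_def lf1_def)
  have "der2 (\<lambda>z X Y. F z X Y + G z X Y) x w X Y = der2 F x w X Y + der2 G x w X Y"
    "der2 (\<lambda>z X Y. F z X Y - G z X Y) x w X Y = der2 F x w X Y - der2 G x w X Y"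
    "der2 (\<lambda>z X Y. c *\<^sub>R F z X Y) x w X Y = c *\<^sub>R der2 F x w X Y"
    "der2 (\<lambda>z X Y. F z Y X) x w X Y = der2 F x w Y X" for w
    using assms(1) by (simp_all add: der2_def dd_rules sm_rules)
  then show "D2 (\<lambda>z X Y. F z X Y + G z X Y) x X Y = D2 F x X Y + D2 G x X Y"
    and "D2 (\<lambda>z X Y. F z X Y - G z X Y) x X Y = D2 F x X Y - D2 G x X Y"
    and "D2 (\<lambda>z X Y. c *\<^sub>R F z X Y) x X Y = c *\<^sub>R D2 F x X Y"
    and "D2 (\<lambda>z X Y. F z Y X) x X Y = D2 F x Y X"
    using lf1_lin[OF N_lf assms(1)] by (simp_all add: D2_def algebra_simps)
qed

lemma D2_leibniz:
  assumes "x \<in> U" "lf2 U F" "lf1 U G" "lf1 U c"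
  shows "D2 (\<lambda>z X Y. F z (G z X) Y) x X Y = D2 F x (G x X) Y + F x (D1 G x X) Y"
    and "D2 (\<lambda>z X Y. F z X (G z Y)) x X Y = D2 F x X (G x Y) + F x X (D1 G x Y)"
    and "D2 (\<lambda>z X Y. G z (F z X Y)) x X Y = D1 G x (F x X Y) + G x (D2 F x X Y)"
    and "D2 (\<lambda>z X Y. c z X *\<^sub>R G z Y) x X Y = Dform c x X *\<^sub>R G x Y + c x X *\<^sub>R D1 G x Y"
proof -
  note r = lf2_rules[OF assms(2)] lf1_rules[OF assms(3)] lf1_rules[OF assms(4)] lf1_lin[OF N_lf]
  have "der2 (\<lambda>z X Y. F z (G z X) Y) x w X Y = der2 F x w (G x X) Y + F x (der1 G x w X) Y"
    "der2 (\<lambda>z X Y. F z X (G z Y)) x w X Y = der2 F x w X (G x Y) + F x X (der1 G x w Y)"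
    "der2 (\<lambda>z X Y. G z (F z X Y)) x w X Y = der1 G x w (F x X Y) + G x (der2 F x w X Y)"
    "der2 (\<lambda>z X Y. c z X *\<^sub>R G z Y) x w X Y = der1 c x w X *\<^sub>R G x Y + c x X *\<^sub>R der1 G x w Y" for w X Y
    using assms(1) unfolding der2_def[of "\<lambda>z X Y. _ z X Y"] by (simp_all add: r sm_rules dd_rules)
  then show "D2 (\<lambda>z X Y. F z (G z X) Y) x X Y = D2 F x (G x X) Y + F x (D1 G x X) Y"
    and "D2 (\<lambda>z X Y. F z X (G z Y)) x X Y = D2 F x X (G x Y) + F x X (D1 G x Y)"
    and "D2 (\<lambda>z X Y. G z (F z X Y)) x X Y = D1 G x (F x X Y) + G x (D2 F x X Y)"
    and "D2 (\<lambda>z X Y. c z X *\<^sub>R G z Y) x X Y = Dform c x X *\<^sub>R G x Y + c x X *\<^sub>R D1 G x Y"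
    using assms(1) by (simp_all add: D2_def D1_def Dform_def r algebra_simps)
qed

lemma Gam_y': "x \<in> U \<Longrightarrow> Gam x (snd x) X = N x X"
  by (simp add: Gam_sym[of x "snd x"] Gam_y)

text \<open>The class of tensors like the Landsberg tensor. It is stable under \<open>D2\<close>
  because the connection is metric, and it is applied to the first two spray derivatives of
  \<open>P\<close>.\<close>

definition totsym :: "('e \<times> 'e \<Rightarrow> 'e \<Rightarrow> 'e \<Rightarrow> 'e) \<Rightarrow> bool" where
  "totsym M \<longleftrightarrow> lf2 U M \<and> (\<forall>x\<in>U. \<forall>X Y Z. M x X Y = M x Y X \<and> g x (M x X Y) Z = g x (M x X Z) Y)"

lemma totsym_P: "totsym P"
  using P_lf P_sym g_P_sym by (auto simp: totsym_def)

lemma totsym_D2: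
  assumes "totsym M"
  shows "totsym (D2 M)"
  unfolding totsym_def
proof (intro conjI ballI allI)
  have lf: "lf2 U M" using assms by (simp add: totsym_def)
  show "lf2 U (D2 M)" using lf by (rule D2_lf)
  fix x X Y Z assume x: "x \<in> U"
  interpret inner_form "g x" using x by (rule g_inner)
  show "D2 M x X Y = D2 M x Y X"
    using D2_cong[OF x, of M "\<lambda>z X Y. M z Y X" X Y] D2_arith(4)[OF x lf lf] assms by (simp add: totsym_def)
  have 1: "dd (\<lambda>z. g z (M z X Y) Z) x (h x (snd x)) = dd (\<lambda>z. g z (M z X Z) Y) x (h x (snd x))"
    by (rule dd_cong_U[OF x]) (use assms in \<open>simp add: totsym_def\<close>)
  have 2: "dd (\<lambda>z. g z (M z X Y) Z) x (h x (snd x)) = g x (D2 M x X Y) Z + g x (M x (N x X) Y) Z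
      + g x (M x X (N x Y)) Z + g x (M x X Y) (N x Z)" for Y Z
  proof -
    have m: "sm (\<lambda>z. M z X Y)" using lf by (simp add: lf2_def lf1_def)
    have d: "dd (\<lambda>z. M z X Y) x (h x (snd x)) = D2 M x X Y - N x (M x X Y) + M x (N x X) Y + M x X (N x Y)"
      by (simp add: D2_def der2_def)
    show ?thesis
      unfolding lf2_dd[OF g_lf x m sm_rules(1)] metric[OF x] d by (simp add: Gam_y'[OF x] rules)
  qed
  have 3: "g x (M x V Y) W = g x (M x V W) Y" for V Y W
    using assms x by (simp add: totsym_def)
  show "g x (D2 M x X Y) Z = g x (D2 M x X Z) Y"
    using 1 2[of Y Z] 2[of Z Y] 3[of "N x X" Y Z] 3[of X "N x Y" Z] 3[of X "N x Z" Y] by linarith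
qed

end

section \<open>Recurrent curvature in a chart\<close>

text \<open>\<open>V\<close> are the coefficients of the Cartan connection in vertical directions; \<open>E\<close>, the curvature of the
  nonlinear connection, enters the formula for \<open>R\<close> because \<open>[h X, h Y]\<close> is the vertical lift of \<open>E X Y\<close>.\<close>

locale curved_chart = finsler_chart +
  fixes A :: "'a \<times> 'a \<Rightarrow> 'a \<Rightarrow> real" and V :: "'a \<times> 'a \<Rightarrow> 'a \<Rightarrow> 'a \<Rightarrow> 'a"
    and R :: "'a \<times> 'a \<Rightarrow> 'a \<Rightarrow> 'a \<Rightarrow> 'a \<Rightarrow> 'a"
  assumes A_lf: "lf1 U A" and R_lf: "lf3 U R"
    and V_y: "\<And>x W. x \<in> U \<Longrightarrow> V x W (snd x) = 0" and V_0: "\<And>x Z. x \<in> U \<Longrightarrow> V x 0 Z = 0"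
    and R_eq: "\<And>x X Y Z. x \<in> U \<Longrightarrow> R x X Y Z = V x (E x X Y) Z - (der2 Gam x (h x X) Y Z
      - der2 Gam x (h x Y) X Z + Gam x X (Gam x Y Z) - Gam x Y (Gam x X Z))"
    and rec_R: "\<And>x W X Y Z. x \<in> U \<Longrightarrow> der3 R x (h x W) X Y Z + Gam x W (R x X Y Z) - R x (Gam x W X) Y Z
      - R x X (Gam x W Y) Z - R x X Y (Gam x W Z) = A x W *\<^sub>R R x X Y Z"
begin

lemma R_y: "x \<in> U \<Longrightarrow> R x X Y (snd x) = E x X Y"
proof -
  assume x: "x \<in> U"
  have "der2 Gam x (h x X) Y (snd x) = der1 N x (h x X) Y + Gam x Y (N x X)" for X Y
  proof -
    have "dd (\<lambda>z. Gam z Y (snd z)) x (h x X) = dd (\<lambda>z. N z Y) x (h x X)"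
      by (rule dd_cong_U[OF x]) (simp add: Gam_y)
    then show ?thesis using x by (simp add: calc algebra_simps)
  qed
  then show ?thesis using x by (simp add: R_eq V_y Gam_y E_def algebra_simps)
qed

lemma rec_E:
  assumes x: "x \<in> U"
  shows "der2 E x (h x W) X Y = A x W *\<^sub>R E x X Y - Gam x W (E x X Y) + E x (Gam x W X) Y + E x X (Gam x W Y)"
proof -
  have "dd (\<lambda>z. R z X Y (snd z)) x (h x W) = dd (\<lambda>z. E z X Y) x (h x W)"
    by (rule dd_cong_U[OF x]) (simp add: R_y)
  then have "der3 R x (h x W) X Y (snd x) = der2 E x (h x W) X Y + R x X Y (N x W)"
    using x by (simp add: calc lf3_rules[OF R_lf] algebra_simps)
  then show ?thesis using rec_R[OF x, of W X Y "snd x"] x by (simp add: R_y Gam_y algebra_simps)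
qed

lemma rec_J:
  assumes x: "x \<in> U"
  shows "der1 J x (h x W) X = A x W *\<^sub>R J x X - Gam x W (J x X) + J x (Gam x W X)"
proof -
  have "der1 J x (h x W) X = der2 E x (h x W) X (snd x) - E x X (N x W)"
    unfolding der1_def J_def using x by (simp add: calc)
  then show ?thesis using rec_E[OF x] x by (simp add: J_def Gam_y)
qed

section \<open>Recurrence along the spray and the Ricci identity for the Jacobi endomorphism\<close>

definition "hh x = A x (snd x)"
definition "a x Z = der0 hh x (0, Z)"
text \<open>The failure of \<open>A\<close> to be the vertical derivative of the function
  \<open>A(y)\<close>. It appears whenever a vertical derivative is commuted with the spray
  derivative of a recurrent tensor.\<close>

definition "al x Z = a x Z - A x Z"

lemma hh_sm: "sm hh"
  unfolding hh_def by (rule lf1_sm[OF A_lf snd_sm])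

lemma a_lf: "lf1 U a"
  unfolding a_def by (rule lf1_slot_Pair0[OF open_U lf1_der0[OF hh_sm]])

lemma al_lf: "lf1 U al"
  unfolding al_def
  by (rule lf1I; (rule linearI)?; simp add: sm_rules lf1_rules[OF a_lf] lf1_rules[OF A_lf] algebra_simps)

lemmas calc2 = calc lf1_rules[OF A_lf] lf1_rules[OF a_lf] lf1_rules[OF al_lf] lf3_rules[OF R_lf] lf2_rules[OF lf2_der1[OF A_lf]]
  der0_def[of hh, symmetric] hh_sm lf1_rules[OF lf1_der0[OF hh_sm]] lf3_rules[OF lf3_der2[OF T_lf]]

lemma D1_J: "x \<in> U \<Longrightarrow> D1 J x X = hh x *\<^sub>R J x X"
  by (simp add: D1_def rec_J Gam_y' hh_def)

lemma D2_E: "x \<in> U \<Longrightarrow> D2 E x X Y = hh x *\<^sub>R E x X Y"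
  by (simp add: D2_def rec_E Gam_y' hh_def)

text \<open>The defect in commuting the vertical derivative with the spray derivative of
  \<open>J\<close>: one part from \<open>A\<close>, one from the difference of Berwald and Cartan
  coefficients.\<close>

definition "tau x X Y = al x X *\<^sub>R J x Y - P x X (J x Y) + J x (P x X Y)"

lemma D2_T: "x \<in> U \<Longrightarrow> D2 T x Z X = hh x *\<^sub>R T x Z X + tau x Z X"
proof -
  assume x: "x \<in> U"
  have s: "sm (\<lambda>z. J z X)" by (simp add: calc)
  have 1: "dd (\<lambda>z. dd (\<lambda>z. J z X) z (h z (snd z))) x (0, Z)
      = dd (\<lambda>z. hh z *\<^sub>R J z X - N z (J z X) + J z (N z X)) x (0, Z)"
    by (rule dd_cong_U[OF x]) (simp add: der1_def[symmetric] rec_J Gam_y' hh_def)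
  have 2: "(\<lambda>z. dd (\<lambda>z. J z X) z (0, Z)) = (\<lambda>z. T z Z X)" by (simp add: T_def der1_def)
  have 3: "dd (\<lambda>z. h z (snd z)) x (0, Z) - dd (\<lambda>_. (0, Z)) x (h x (snd x)) = (0, - N x Z) + h x Z"
    using x by (simp add: calc der_h B_y flip: B_def)
  have 4: "dd (\<lambda>z. J z X) x ((0, - N x Z) + h x Z) = A x Z *\<^sub>R J x X - Gam x Z (J x X) + J x (Gam x Z X) - T x (N x Z) X"
  proof -
    have "dd (\<lambda>z. J z X) x ((0, - N x Z) + h x Z) = der1 J x (0, - N x Z) X + der1 J x (h x Z) X"
      using x by (simp only: der1_def dd_lin(1)[OF x s])
    then show ?thesis using lf2_Pair0(3)[OF open_U lf2_der1[OF J_lf] x] by (simp add: rec_J[OF x] T_def)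
  qed
  show ?thesis
    using bracket_fields[OF x s, of "\<lambda>z. h z (snd z)" "\<lambda>_. (0, Z)"] x
    unfolding 1 2 3 4
    by (simp add: calc2 D2_def tau_def al_def P_def a_def[symmetric] B_def[symmetric] T_def[symmetric] B_sym[of x _ Z] algebra_simps)
qed

text \<open>The skew part of \<open>T\<close> is a multiple of \<open>E\<close>, and
  \<open>E\<close> is recurrent along the spray without any defect, by \<open>D2_E\<close>.\<close>

lemma tau_sym: "x \<in> U \<Longrightarrow> tau x X Y = tau x Y X"
proof -
  assume x: "x \<in> U"
  have "D2 (\<lambda>z X Y. T z X Y - T z Y X) x X Y = D2 (\<lambda>z X Y. 3 *\<^sub>R E z Y X) x X Y"
    by (rule D2_cong[OF x]) (rule T_skew)
  moreover have "lf2 U (\<lambda>z X Y. T z Y X)" "lf2 U (\<lambda>z X Y. E z Y X)" using T_lf E_lf by (simp_all add: lf2_def)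
  ultimately have "D2 T x X Y - D2 T x Y X = 3 *\<^sub>R D2 E x Y X"
    using D2_arith(2)[OF x T_lf, of "\<lambda>z X Y. T z Y X"] D2_arith(3)[OF x, of "\<lambda>z X Y. E z Y X"]
      D2_arith(4)[OF x T_lf T_lf] D2_arith(4)[OF x E_lf E_lf] by simp
  then have "tau x X Y - tau x Y X = hh x *\<^sub>R (3 *\<^sub>R E x Y X - (T x X Y - T x Y X))"
    using x by (simp add: D2_T D2_E algebra_simps)
  then show ?thesis using T_skew[OF x, of X Y] by simp
qed

text \<open>The symmetry that is behind the vanishing of \<open>P\<close>-terms below; it is inherited by the
  derivatives along the spray.\<close>

lemma PJ_sym: "x \<in> U \<Longrightarrow> P x X (J x Y) - al x X *\<^sub>R J x Y = P x Y (J x X) - al x Y *\<^sub>R J x X"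
  using tau_sym[of x X Y] P_sym[of x X Y] by (simp add: tau_def algebra_simps)

text \<open>The Bianchi identity with one argument equal to \<open>y\<close>. The recurrence turns
  every derivative of \<open>E\<close> into an algebraic term, and \<open>PJ_sym\<close> replaces
  the surviving terms in \<open>P\<close> by terms in \<open>al\<close>.\<close>

lemma E_J: "x \<in> U \<Longrightarrow> hh x *\<^sub>R E x X Y = a x Y *\<^sub>R J x X - a x X *\<^sub>R J x Y"
proof -
  assume x: "x \<in> U"
  have e: "der2 E x (h x X) Y (snd x) = A x X *\<^sub>R J x Y - Gam x X (J x Y) + J x (Gam x X Y) + E x Y (N x X)" for X Y
    using rec_E[OF x, of X Y "snd x"] x by (simp add: J_def Gam_y)
  have e2: "der2 E x (h x Y) (snd x) X = - der2 E x (h x Y) X (snd x)"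
  proof -
    have "dd (\<lambda>z. E z (snd x) X) x (h x Y) = dd (\<lambda>z. - E z X (snd x)) x (h x Y)"
      by (rule dd_cong_U[OF x]) (rule E_skew)
    then show ?thesis using x by (simp add: calc)
  qed
  have "hh x *\<^sub>R E x X Y + A x X *\<^sub>R J x Y - A x Y *\<^sub>R J x X + P x X (J x Y) - P x Y (J x X) = 0"
    using bianchi_E[OF x, of "snd x" X Y] x E_skew[of x "snd x" X] E_skew[of x "N x X" Y]
    unfolding e2 e rec_E[OF x, of "snd x"]
    by (simp add: Gam_y' B_y hh_def P_def lf2_lin[OF B_lf] Gam_sym[of x Y X] J_def[symmetric] algebra_simps)
  then have "hh x *\<^sub>R E x X Y = A x Y *\<^sub>R J x X - A x X *\<^sub>R J x Y - P x X (J x Y) + P x Y (J x X)"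
    by (simp add: algebra_simps)
  moreover have "P x X (J x Y) = al x X *\<^sub>R J x Y - al x Y *\<^sub>R J x X + P x Y (J x X)"
    using PJ_sym[OF x, of X Y] by (simp add: algebra_simps)
  ultimately show ?thesis by (simp add: al_def algebra_simps)
qed

text \<open>Expanding \<open>hh\<close> gives
  \<open>der1 A x (h x X) (snd x) - der1 A x (h x (snd x)) X\<close>, the horizontal curl of
  \<open>A\<close> on \<open>X\<close> and \<open>y\<close>.\<close>

definition "c x X = der0 hh x (h x X) - der1 A x (h x (snd x)) X + A x (N x X)"

lemma c_lf: "lf1 U c"
  unfolding c_def
  by (rule lf1I; (rule linearI)?; simp add: sm_rules lf_all calc2 algebra_simps)

lemma D2_P:
  assumes x: "x \<in> U"
  shows "D2 P x X Z = der2 B x (h x (snd x)) X Z - der2 Gam x (h x (snd x)) X Z + N x (P x X Z) - P x (N x X) Z - P x X (N x Z)"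
proof -
  have "der2 P x w X Z = der2 B x w X Z - der2 Gam x w X Z" for w
    unfolding der2_def P_def by (rule dd_rules(2)[OF x]) (simp_all add: calc)
  then show ?thesis by (simp add: D2_def)
qed

text \<open>By \<open>H_eq\<close> and \<open>T_eq\<close> this is the vertical derivative of
  \<open>E\<close> contracted with \<open>y\<close>, the Berwald curvature \<open>R(X, y) Z\<close>.
  The form with thirds is expressed by derivatives of \<open>J\<close> alone, as the argument in a
  fibre requires.\<close>

definition "H x X Z = (2/3) *\<^sub>R T x Z X + (1/3) *\<^sub>R T x X Z"

lemma H_lf: "lf2 U H"
  unfolding H_def by (rule lf2I; (rule linearI)?; simp add: sm_rules lf_all algebra_simps)

lemma H_eq:
  assumes x: "x \<in> U"
  shows "H x X Z = T x Z X - E x X Z"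
proof -
  have e: "E x X Z = (1/3) *\<^sub>R T x Z X - (1/3) *\<^sub>R T x X Z"
    using T_skew[OF x, of Z X] by (simp flip: scaleR_diff_right)
  have t: "(2/3) *\<^sub>R T x Z X = T x Z X - (1/3) *\<^sub>R T x Z X"
    using scaleR_left_diff_distrib[of 1 "1/3" "T x Z X"] by simp
  show ?thesis unfolding H_def e t by simp
qed

text \<open>Subtracting the spray derivative of \<open>P\<close> passes from Berwald to Cartan
  coefficients: \<open>K x X Z\<close> is \<open>R x X (snd x) Z\<close> without its
  \<open>V\<close> term.\<close>

definition "K x X Z = H x X Z - D2 P x X Z"

lemma K_lf: "lf2 U K"
  unfolding K_def
  by (rule lf2I; (rule linearI)?; simp add: sm_rules lf2_rules[OF H_lf] lf2_rules[OF D2_lf[OF P_lf]] algebra_simps)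

text \<open>The Ricci identity for \<open>J\<close> in the directions \<open>y\<close> and
  \<open>X\<close>. The bracket of the spray with \<open>h X\<close> has vertical part
  \<open>J X\<close> up to sign, which is how the derivative \<open>T (J X)\<close> arises;
  \<open>K\<close> is the curvature and \<open>c\<close> the curl of the recurrence form.\<close>

lemma T_J:
  assumes x: "x \<in> U"
  shows "T x (J x X) Z = K x X (J x Z) - J x (K x X Z) + c x X *\<^sub>R J x Z"
proof -
  have s: "sm (\<lambda>z. J z Z)" by (simp add: calc)
  have 1: "dd (\<lambda>z. dd (\<lambda>z. J z Z) z (h z (snd z))) x (h x X)
      = dd (\<lambda>z. hh z *\<^sub>R J z Z - N z (J z Z) + J z (N z Z)) x (h x X)"
    by (rule dd_cong_U[OF x]) (simp add: der1_def[symmetric] rec_J Gam_y' hh_def)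
  have 2: "dd (\<lambda>z. dd (\<lambda>z. J z Z) z (h z X)) x (h x (snd x))
      = dd (\<lambda>z. A z X *\<^sub>R J z Z - Gam z X (J z Z) + J z (Gam z X Z)) x (h x (snd x))"
    by (rule dd_cong_U[OF x]) (simp add: der1_def[symmetric] rec_J)
  have 3: "dd (\<lambda>z. h z (snd z)) x (h x X) - dd (\<lambda>z. h z X) x (h x (snd x)) = (0, J x X) - h x (N x X)"
    using x by (simp add: calc der_h J_def E_def algebra_simps)
  have 4: "dd (\<lambda>z. J z Z) x ((0, J x X) - h x (N x X)) = T x (J x X) Z
      - (A x (N x X) *\<^sub>R J x Z - Gam x (N x X) (J x Z) + J x (Gam x (N x X) Z))"
    using x by (simp only: dd_lin(2)[OF x s] rec_J[symmetric] T_def der1_def)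
  have K: "K x X Z = der2 Gam x (h x (snd x)) X Z + N x (Gam x X Z) - Gam x X (N x Z)
      - der1 N x (h x X) Z - Gam x (N x X) Z" for Z
    using T_minus_E[OF x, of Z X] x
    by (simp add: K_def H_eq D2_P P_def lf1_lin[OF N_lf] algebra_simps)
  show ?thesis
    using bracket_fields[OF x s, of "\<lambda>z. h z (snd z)" "\<lambda>z. h z X"] x
    unfolding 1 2 3 4 K
    by (simp add: calc2 rec_J Gam_y' hh_def[symmetric] c_def algebra_simps)
qed

end

section \<open>A Ricci flat recurrent chart is flat\<close>

text \<open>Evaluated on eigenvectors \<open>X\<^sub>k, X\<^sub>i, X\<^sub>j\<close> of \<open>J\<close>, the equation determines \<open>W\<^sub>k\<^sub>i\<^sub>j\<close> as a multiple of \<open>P\<^sub>k\<^sub>i\<^sub>j\<close>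
  that is not symmetric in \<open>i, j\<close> unless the eigenvalues agree.\<close>

lemma (in inner_form) commute_of_equation:
  assumes J: "linear J" "\<And>x y. g (J x) y = g x (J y)"
    and P: "\<And>X. linear (P X)" "\<And>Y. linear (\<lambda>X. P X Y)" "\<And>X Y Z. g (P X Y) Z = g (P X Z) Y"
    and W: "\<And>X. linear (W X)" "\<And>X Y Z. g (W X Y) Z = g (W X Z) Y"
    and al: "linear al"
    and eq: "\<And>X Z. al (J X) *\<^sub>R J Z - P (J X) (J Z) + J (P (J X) Z)
      = (al X *\<^sub>R J (J Z) - P X (J (J Z)) + J (P X (J Z))) - J (al X *\<^sub>R J Z - P X (J Z) + J (P X Z))
        - W X (J Z) + J (W X Z) + ch X *\<^sub>R J Z"
  shows "P X (J Z) = J (P X Z)"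
proof -
  obtain B l where B: "onb B" "\<And>a. a \<in> B \<Longrightarrow> J a = l a *\<^sub>R a"
    using spectral[OF J] by blast
  note lin = linear_scale[OF J(1)] linear_add[OF J(1)] linear_diff[OF J(1)]
    linear_scale[OF P(1)] linear_scale[OF P(2)] linear_scale[OF W(1)] linear_scale[OF al]
  have Jg: "g (J v) a = l a * g v a" if "a \<in> B" for a v
    using J(2)[of v a] B(2)[OF that] by (simp add: rules)
  have key: "(l j - l i) * (l k * g (P k i) j + (l j - l i) * g (P k i) j - g (W k i) j) = 0"
    if "i \<in> B" "j \<in> B" "k \<in> B" "i \<noteq> j" for i j k
  proof -
    have ij: "g i j = 0" using B(1) that by (auto simp: onb_def)
    show ?thesis
      using arg_cong[OF eq[of k i], of "\<lambda>v. g v j"] that(1-3)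
      by (simp add: B(2) lin rules Jg ij algebra_simps)
  qed
  have P0: "(l i - l j) * g (P k i) j = 0" if "i \<in> B" "j \<in> B" "k \<in> B" for i j k
  proof (cases "i = j \<or> l i = l j")
    case False
    then have ne: "i \<noteq> j" "l j - l i \<noteq> 0" "l i - l j \<noteq> 0" by auto
    have e: "g (P k j) i = g (P k i) j" "g (W k j) i = g (W k i) j" using P(3) W(2) by blast+
    have "l k * g (P k i) j + (l j - l i) * g (P k i) j - g (W k i) j = 0"
      using key[OF that(1,2,3) ne(1)] ne(2) by simp
    moreover have "l k * g (P k i) j + (l i - l j) * g (P k i) j - g (W k i) j = 0"
      using key[OF that(2,1,3)] ne by (simp add: e)
    ultimately have "(l j - l i) * g (P k i) j = (l i - l j) * g (P k i) j" by linarith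
    then show ?thesis by (auto simp: algebra_simps)
  qed auto
  have "P k (J i) = J (P k i)" if "k \<in> B" "i \<in> B" for k i
  proof (rule onb_vec_eqI[OF B(1)])
    fix j assume "j \<in> B"
    then show "g (P k (J i)) j = g (J (P k i)) j"
      using P0[of i j k] that by (simp add: B(2) lin rules Jg algebra_simps)
  qed
  then have "P k (J Z) = J (P k Z)" if "k \<in> B" for k Z
    using onb_eqI[OF B(1) linear_compose[OF J(1) P(1)[of k]] linear_compose[OF P(1)[of k] J(1)], of Z] that by simp
  then show ?thesis
    using onb_eqI[OF B(1) P(2)[of "J Z"] linear_compose[OF P(2)[of Z] J(1)], of X] by simp
qed

lemma (in inner_form) eigen_signs:
  assumes J: "linear J" "\<And>x y. g (J x) y = g x (J y)" and tr: "endo_trace J = 0" and nz: "J X0 \<noteq> 0"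
  obtains a b p r where "J a = p *\<^sub>R a" "g a a = 1" "0 < p" "J b = r *\<^sub>R b" "g b b = 1" "r < 0" "g a b = 0"
proof -
  obtain B l where B: "onb B" "\<And>a. a \<in> B \<Longrightarrow> J a = l a *\<^sub>R a"
    using spectral[OF J] by blast
  have "\<exists>c\<in>B. l c \<noteq> 0"
  proof (rule ccontr)
    assume "\<not> ?thesis"
    then have "J a = 0" if "a \<in> B" for a using B that by auto
    then show False using onb_eqI[OF B(1) J(1) linear_zero, of X0] nz by simp
  qed
  then obtain c where c: "c \<in> B" "l c \<noteq> 0" by blast
  obtain d where d: "d \<in> B" "l d * l c < 0"
    using trace_zero_signs[OF J(1) B tr c] by blast
  have cd: "c \<noteq> d" using d by (auto simp: mult_less_0_iff)
  show ?thesis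
  proof (cases "0 < l c")
    case True
    then show ?thesis using that[of c "l c" d "l d"] B c d cd by (auto simp: onb_def mult_less_0_iff)
  next
    case False
    then show ?thesis using that[of d "l d" c "l c"] B c d cd by (auto simp: onb_def mult_less_0_iff)
  qed
qed

text \<open>If \<open>al\<close> did not vanish, all values of \<open>J\<close> would be
  proportional to a single vector, whereas \<open>J\<close> has eigenvectors with eigenvalues of
  both signs.\<close>

lemma (in inner_form) form_zero_of_symmetric:
  assumes J: "linear J" "\<And>x y. g (J x) y = g x (J y)" and tr: "endo_trace J = 0" and nz: "J X0 \<noteq> 0"
    and sym: "\<And>X Y. al X *\<^sub>R J Y = al Y *\<^sub>R J X"
  shows "al X = (0::real)"
proof (rule ccontr)
  assume al: "al X \<noteq> 0"
  obtain a b p r where ab: "J a = p *\<^sub>R a" "g a a = 1" "0 < p" "J b = r *\<^sub>R b" "g b b = 1" "r < 0" "g a b = 0"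
    by (rule eigen_signs[OF J tr nz])
  have b: "al X * r = al b * g (J X) b"
    using arg_cong[OF sym[of X b], of "\<lambda>v. g v b"] by (simp add: rules ab(4,5))
  have a: "al X * p = al a * g (J X) a"
    using arg_cong[OF sym[of X a], of "\<lambda>v. g v a"] by (simp add: rules ab(1,2))
  have a0: "0 = al a * g (J X) b"
    using arg_cong[OF sym[of X a], of "\<lambda>v. g v b"] by (simp add: rules ab(1,7))
  have "al a \<noteq> 0"
  proof
    assume "al a = 0"
    with a have "al X * p = 0" by simp
    with al ab(3) show False by simp
  qed
  moreover have "g (J X) b \<noteq> 0"
  proof
    assume "g (J X) b = 0"
    with b have "al X * r = 0" by simp
    with al ab(6) show False by simp
  qed
  ultimately show False using a0 by simp
qed

context finsler_chart
begin

lemma dd_vertical: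
  assumes "(x, y) \<in> U" "sm f"
  shows "((\<lambda>y. f (x, y)) has_derivative (\<lambda>Z. dd f (x, y) (0, Z))) (at y)"
  by (rule has_derivative_compose[of "\<lambda>y. (x, y)" "\<lambda>Z. (0, Z)" y UNIV f])
     (auto intro!: derivative_eq_intros dd_works sm_diffble assms)

lemma euler:
  assumes f: "sm f" "\<And>z. z \<in> U \<Longrightarrow> dd f z (0, snd z) = k *\<^sub>R f z"
    and x: "(x, y) \<in> U" and t: "t > 0"
  shows "f (x, t *\<^sub>R y) = (t powr k) *\<^sub>R f (x, y)"
proof -
  \<comment> \<open>In the parameter \<open>ln t\<close> Euler's identity becomes a linear equation
    with constant coefficient, whose solution the factor \<open>exp (- k * s)\<close>
    freezes.\<close>
  define \<phi> where "\<phi> s = exp (- k * s) *\<^sub>R f (x, exp s *\<^sub>R y)" for s :: real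
  have in_U: "(x, exp s *\<^sub>R y) \<in> U" for s using x by (auto simp: U_eq)
  have "(\<phi> has_derivative (\<lambda>_. 0)) (at s)" for s
  proof -
    have "((\<lambda>s. f (x, exp s *\<^sub>R y)) has_derivative (\<lambda>d. dd f (x, exp s *\<^sub>R y) (0, (d * exp s) *\<^sub>R y))) (at s)"
      by (rule has_derivative_compose[of "\<lambda>s. exp s *\<^sub>R y" "\<lambda>d. (d * exp s) *\<^sub>R y" s UNIV, OF _ dd_vertical[OF in_U f(1)]])
         (auto intro!: derivative_eq_intros)
    moreover have "dd f (x, exp s *\<^sub>R y) (0, (d * exp s) *\<^sub>R y) = (d * k) *\<^sub>R f (x, exp s *\<^sub>R y)" for d
      using f(2)[OF in_U[of s]] dd_lin(4)[OF in_U[of s] f(1), of d "(0, exp s *\<^sub>R y)"] by simp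
    ultimately have d: "((\<lambda>s. f (x, exp s *\<^sub>R y)) has_derivative (\<lambda>d. (d * k) *\<^sub>R f (x, exp s *\<^sub>R y))) (at s)"
      by simp
    show ?thesis
      unfolding \<phi>_def
      by (rule has_derivative_eq_rhs[OF has_derivative_scaleR[OF _ d]])
         (auto intro!: derivative_eq_intros simp: fun_eq_iff algebra_simps)
  qed
  then have "\<phi> (ln t) = \<phi> 0"
    using has_derivative_zero_unique[of UNIV \<phi> 0 "ln t"] by simp
  then have "exp (- k * ln t) *\<^sub>R f (x, t *\<^sub>R y) = f (x, y)" using t by (simp add: \<phi>_def)
  then have "(exp (k * ln t) * exp (- k * ln t)) *\<^sub>R f (x, t *\<^sub>R y) = exp (k * ln t) *\<^sub>R f (x, y)"
    by (metis scaleR_scaleR)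
  then show ?thesis using t by (simp add: powr_def exp_add[symmetric])
qed

end

locale ricci_flat_chart = curved_chart +
  assumes ricci: "\<And>x X Z. x \<in> U \<Longrightarrow> endo_trace (\<lambda>Y. R x X Y Z) = 0"
begin

lemma trace_E: "x \<in> U \<Longrightarrow> endo_trace (E x X) = 0"
  using ricci[of x X "snd x"] by (simp add: R_y cong: )

lemma trace_J: "x \<in> U \<Longrightarrow> endo_trace (J x) = 0"
proof -
  assume x: "x \<in> U"
  have "endo_trace (J x) = - endo_trace (E x (snd x))"
    unfolding endo_trace_def J_def by (subst E_skew) (simp add: sum_negf)
  then show ?thesis using trace_E[OF x] by simp
qed

lemma J_linear: "x \<in> U \<Longrightarrow> linear (J x)"
  using J_lf by (simp add: lf1_def)

lemma lf2_linear: "lf2 U F \<Longrightarrow> x \<in> U \<Longrightarrow> linear (F x X)" "lf2 U F \<Longrightarrow> x \<in> U \<Longrightarrow> linear (\<lambda>X. F x X Y)"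
  by (auto simp: lf2_def lf1_def)

text \<open>The spray derivative of \<open>T_J\<close>. Each ingredient is recurrent along the spray
  up to \<open>tau\<close> and derivatives of \<open>P\<close>; the recurrent parts add up to twice
  \<open>T_J\<close> and cancel, except for the different weight of \<open>c\<close>.\<close>

lemma D2_T_J:
  assumes x: "x \<in> U"
  shows "tau x (J x X) Z = tau x X (J x Z) - J x (tau x X Z) - (D2 (D2 P) x X (J x Z) - hh x *\<^sub>R D2 P x X (J x Z))
    + J x (D2 (D2 P) x X Z - hh x *\<^sub>R D2 P x X Z) + (Dform c x X - hh x * c x X) *\<^sub>R J x Z"
proof -
  note P1 = D2_lf[OF P_lf] and P2 = D2_lf[OF D2_lf[OF P_lf]]
  note J1 = lf1_rules(3-)[OF J_lf x] and T1 = lf2_lin[OF T_lf x] and K1 = lf2_lin[OF K_lf x]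
  have T': "lf2 U (\<lambda>z X Y. T z Y X)" using T_lf by (simp add: lf2_def)
  have KJ: "lf2 U (\<lambda>z X Y. K z X (J z Y))" "lf2 U (\<lambda>z X Y. J z (K z X Y))" "lf2 U (\<lambda>z X Y. c z X *\<^sub>R J z Y)"
    "lf2 U (\<lambda>z X Y. K z X (J z Y) - J z (K z X Y))"
    by (rule lf2I; (rule linearI)?; simp add: sm_rules lf2_rules[OF K_lf] lf1_rules[OF J_lf] lf1_rules[OF c_lf] algebra_simps)+
  have "D2 H x X Z = (2/3) *\<^sub>R D2 T x Z X + (1/3) *\<^sub>R D2 T x X Z" for X Z
  proof -
    have l: "lf2 U (\<lambda>z X Y. (2/3) *\<^sub>R T z Y X)" "lf2 U (\<lambda>z X Y. (1/3) *\<^sub>R T z X Y)"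
      by (rule lf2I; (rule linearI)?; simp add: sm_rules lf2_rules[OF T_lf] algebra_simps)+
    show ?thesis
      unfolding H_def
      using D2_arith(1)[OF x l] D2_arith(3)[OF x T' T', of "2/3"] D2_arith(3)[OF x T_lf T_lf, of "1/3"]
        D2_arith(4)[OF x T_lf T_lf] by simp
  qed
  then have DH: "D2 H x X Z = hh x *\<^sub>R H x X Z + tau x X Z" for X Z
    using tau_sym[OF x, of Z X] x scaleR_add_left[of "2/3" "1/3" "tau x X Z"]
    by (simp add: D2_T H_def algebra_simps)
  have DK: "D2 K x X Z = hh x *\<^sub>R K x X Z + tau x X Z - (D2 (D2 P) x X Z - hh x *\<^sub>R D2 P x X Z)" for X Z
    unfolding K_def using D2_arith(2)[OF x H_lf P1] by (simp add: DH algebra_simps)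
  have "D2 (\<lambda>z X Z. T z (J z X) Z) x X Z = D2 (\<lambda>z X Z. K z X (J z Z) - J z (K z X Z) + c z X *\<^sub>R J z Z) x X Z"
    by (rule D2_cong[OF x]) (rule T_J)
  also have "\<dots> = D2 (\<lambda>z X Z. K z X (J z Z)) x X Z - D2 (\<lambda>z X Z. J z (K z X Z)) x X Z + D2 (\<lambda>z X Z. c z X *\<^sub>R J z Z) x X Z"
    using D2_arith(1)[OF x KJ(4,3)] D2_arith(2)[OF x KJ(1,2)] by simp
  finally have main: "D2 T x (J x X) Z + hh x *\<^sub>R T x (J x X) Z = D2 K x X (J x Z) + K x X (hh x *\<^sub>R J x Z)
      - (hh x *\<^sub>R J x (K x X Z) + J x (D2 K x X Z)) + (Dform c x X *\<^sub>R J x Z + c x X *\<^sub>R (hh x *\<^sub>R J x Z))"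
    using D2_leibniz[OF x T_lf J_lf c_lf] D2_leibniz[OF x K_lf J_lf c_lf] by (simp add: D1_J[OF x] T1)
  show ?thesis
    using main unfolding D2_T[OF x] DK T_J[OF x]
    by (simp add: J1 K1 algebra_simps)
qed

text \<open>At a fixed point \<open>D2_T_J\<close> is an algebraic equation between
  \<open>P\<close>, \<open>J\<close> and the combination \<open>W\<close> of spray derivatives of
  \<open>P\<close>, which enters only through its symmetry.\<close>

lemma P_commutes: "x \<in> U \<Longrightarrow> P x X (J x Z) = J x (P x X Z)"
proof -
  assume x: "x \<in> U"
  interpret inner_form "g x" using x by (rule g_inner)
  define W where "W X Z = D2 (D2 P) x X Z - hh x *\<^sub>R D2 P x X Z" for X Z
  have ts: "totsym (D2 P)" "totsym (D2 (D2 P))" using totsym_D2 totsym_P by auto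
  note P1 = lf2_lin[OF D2_lf[OF P_lf] x] lf2_lin[OF D2_lf[OF D2_lf[OF P_lf]] x]
  show ?thesis
  proof (rule commute_of_equation[of "J x" "P x" W "al x" "\<lambda>X. Dform c x X - hh x * c x X"])
    show "linear (J x)" by (rule J_linear[OF x])
    show "g x (J x X) Y = g x X (J x Y)" for X Y by (rule J_selfadj[OF x])
    show "linear (P x X)" "linear (\<lambda>X. P x X Y)" for X Y using lf2_linear[OF P_lf x] by auto
    show "g x (P x X Y) Z = g x (P x X Z) Y" for X Y Z by (rule g_P_sym[OF x])
    show "linear (W X)" for X unfolding W_def by (rule linearI; simp add: P1 algebra_simps)
    show "g x (W X Y) Z = g x (W X Z) Y" for X Y Z
      using ts x by (simp add: W_def rules totsym_def)
    show "linear (al x)" using al_lf x by (simp add: lf1_def)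
    show "al x (J x X) *\<^sub>R J x Z - P x (J x X) (J x Z) + J x (P x (J x X) Z) =
        al x X *\<^sub>R J x (J x Z) - P x X (J x (J x Z)) + J x (P x X (J x Z)) -
        J x (al x X *\<^sub>R J x Z - P x X (J x Z) + J x (P x X Z)) - W X (J x Z) + J x (W X Z)
        + (Dform c x X - hh x * c x X) *\<^sub>R J x Z" for X Z
      using D2_T_J[OF x, of X Z] by (simp only: tau_def W_def)
  qed
qed

text \<open>Once \<open>P\<close> commutes with \<open>J\<close>, the terms in \<open>P\<close> of
  \<open>PJ_sym\<close> agree by the symmetry of \<open>P\<close>, and a relation between
  \<open>al\<close> and \<open>J\<close> alone is left.\<close>

lemma al_zero: "x \<in> U \<Longrightarrow> J x X0 \<noteq> 0 \<Longrightarrow> al x X = 0"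
proof -
  assume x: "x \<in> U" and nz: "J x X0 \<noteq> 0"
  interpret inner_form "g x" using x by (rule g_inner)
  have "al x X *\<^sub>R J x Y = al x Y *\<^sub>R J x X" for X Y
    using PJ_sym[OF x, of X Y] P_commutes[OF x] P_sym[OF x, of X Y] by simp
  then show ?thesis
    using form_zero_of_symmetric[OF J_linear[OF x] J_selfadj[OF x] trace_J[OF x] nz] by blast
qed

lemma P'_commutes: "x \<in> U \<Longrightarrow> D2 P x X (J x Z) = J x (D2 P x X Z)"
proof -
  assume x: "x \<in> U"
  have "D2 (\<lambda>z X Z. P z X (J z Z)) x X Z = D2 (\<lambda>z X Z. J z (P z X Z)) x X Z"
    by (rule D2_cong[OF x]) (rule P_commutes)
  then show ?thesis
    using D2_leibniz[OF x P_lf J_lf c_lf] by (simp add: D1_J[OF x] P_commutes[OF x] lf2_lin[OF P_lf x])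
qed

lemma T_J': "x \<in> U \<Longrightarrow> T x (J x X) Z = H x X (J x Z) - J x (H x X Z) + c x X *\<^sub>R J x Z"
  using T_J[of x X Z] by (simp add: K_def P'_commutes lf1_lin[OF J_lf])

text \<open>Taking the trace of \<open>E_J\<close> shows that \<open>a\<close> vanishes on the image
  of \<open>J\<close>. As \<open>hh x\<close> is nonzero, \<open>E\<close> then vanishes on pairs of
  eigenvectors with nonzero eigenvalues, that is, \<open>T\<close> is symmetric on them.
  Eigenvectors of opposite signs, or a positive one against the kernel, detect
  \<open>c\<close>.\<close>

lemma c_zero_aux:
  assumes x: "x \<in> U" and nz: "J x X0 \<noteq> 0" and h0: "hh x \<noteq> 0"
  shows "c x X = 0"
proof -
  interpret inner_form "g x" using x by (rule g_inner)
  note J = J_linear[OF x] J_selfadj[OF x]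
  note Js = lf1_lin[OF J_lf x] and Ts = lf2_lin[OF T_lf x]
  obtain B l where B: "onb B" "\<And>a. a \<in> B \<Longrightarrow> J x a = l a *\<^sub>R a"
    using spectral[OF J] by blast
  have Jg: "g x (J x v) e = l e * g x v e" if "e \<in> B" for e v
    using J(2)[of v e] B(2)[OF that] by (simp add: rules)
  have "a x (J x Y) = 0" for Y
  proof -
    have "hh x * endo_trace (E x Y) = endo_trace (\<lambda>Z. hh x *\<^sub>R E x Y Z)"
      by (simp add: endo_trace_def sum_distrib_left)
    also have "\<dots> = endo_trace (\<lambda>Z. a x Z *\<^sub>R J x Y) - a x Y * endo_trace (J x)"
      by (simp add: E_J[OF x] endo_trace_def inner_diff_left sum_subtractf sum_distrib_left)
    also have "endo_trace (\<lambda>Z. a x Z *\<^sub>R J x Y) = a x (J x Y)"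
    proof -
      have "linear (a x)" using a_lf x by (simp add: lf1_def)
      from linear_sum_Basis[OF this, of "J x Y"] show ?thesis
        by (simp add: endo_trace_def mult.commute)
    qed
    finally show ?thesis using trace_E[OF x] trace_J[OF x] by simp
  qed
  then have a0: "a x e = 0" if "e \<in> B" "l e \<noteq> 0" for e
    using that B(2)[of e] lf1_lin(4)[OF a_lf x, of "l e" e] by (metis mult_eq_0_iff real_scaleR_def)
  have E0: "E x i j = 0" if "i \<in> B" "j \<in> B" "l i \<noteq> 0" "l j \<noteq> 0" for i j
    using E_J[OF x, of i j] a0 that h0 by simp
  have "c x i = 0" if i: "i \<in> B" for i
  proof (cases "l i = 0")
    case True
    interpret inner_form "g x" using x by (rule g_inner)
    obtain p j where j: "J x j = p *\<^sub>R j" "g x j j = 1" "0 < p"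
      using eigen_signs[OF J trace_J[OF x] nz] by blast
    have Jj: "g x (J x v) j = p * g x v j" for v using J(2)[of v j] j by (simp add: rules)
    show ?thesis
      using arg_cong[OF T_J'[OF x, of i j], of "\<lambda>v. g x v j"] B(2)[OF i] True j
      by (simp add: H_def Ts rules Jj algebra_simps)
  next
    case False
    obtain j where j: "j \<in> B" "l j * l i < 0"
      using trace_zero_signs[OF J(1) B trace_J[OF x] i False] by blast
    have ne: "l j \<noteq> 0" "i \<noteq> j" "2 * l j - l i \<noteq> 0" using j by (auto simp: mult_less_0_iff)
    have ij: "g x i j = 0" "g x j j = 1" using B(1) i j ne by (auto simp: onb_def)
    have TT: "T x j i = T x i j" using T_skew[OF x, of j i] E0[OF i j(1) False ne(1)] by simp
    \<comment> \<open>Two instances of \<open>T_J'\<close> paired with \<open>j\<close>: one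
      expresses \<open>c x i\<close> by \<open>t\<close>, the other reads
      \<open>(2 * l j - l i) * t = 0\<close>, where the factor is nonzero because the eigenvalues
      have opposite signs.\<close>
    define t where "t = g x (T x i j) j"
    have 1: "l i * t = c x i * l j"
      using arg_cong[OF T_J'[OF x, of i j], of "\<lambda>v. g x v j"] B(2)[OF i] B(2)[OF j(1)] ij
      by (simp add: H_def Ts rules Jg[OF j(1)] t_def algebra_simps)
    have "H x j i = T x i j"
      using scaleR_add_left[of "2/3" "1/3" "T x i j"] by (simp add: H_def TT)
    then have 2: "l j * t = (l i - l j) * t"
      using arg_cong[OF T_J'[OF x, of j i], of "\<lambda>v. g x v j"] B(2)[OF i] B(2)[OF j(1)] ij
        lf2_lin(9)[OF H_lf x, of j "l i" i]
      by (simp add: Ts rules Jg[OF j(1)] t_def TT algebra_simps)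
    then have "(2 * l j - l i) * t = 0" by (simp add: algebra_simps)
    then have "t = 0" using ne(3) by simp
    then show ?thesis using 1 ne by simp
  qed
  then show ?thesis
    using onb_eqI[OF B(1) _ linear_zero, of "c x" X] c_lf x by (simp add: lf1_def)
qed

lemma open_nonzero: "sm f \<Longrightarrow> open {z\<in>U. f z \<noteq> 0}"
  using continuous_open_preimage[OF smooth_on_cont[OF open_U] open_U, of f "- {0}"]
  by (simp add: open_Compl vimage_def Int_def)

text \<open>If \<open>c\<close> were nonzero at \<open>x\<close>, it would be so on an open set
  where \<open>J\<close> is nonzero too. There \<open>hh\<close> vanishes by
  \<open>c_zero_aux\<close>, hence so does its vertical derivative \<open>a\<close>, then
  \<open>A\<close> by \<open>al_zero\<close>, and finally \<open>c\<close>, which is built from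
  derivatives of \<open>A\<close>.\<close>

lemma c_zero: "x \<in> U \<Longrightarrow> J x X0 \<noteq> 0 \<Longrightarrow> c x X = 0"
proof (rule ccontr)
  assume x: "x \<in> U" and nz: "J x X0 \<noteq> 0" and ne: "c x X \<noteq> 0"
  define S where "S = {z\<in>U. J z X0 \<noteq> 0} \<inter> {z\<in>U. c z X \<noteq> 0}"
  have S: "open S" "x \<in> S" "S \<subseteq> U"
    using open_nonzero[of "\<lambda>z. J z X0"] open_nonzero[of "\<lambda>z. c z X"] x nz ne
    by (auto simp: S_def calc lf1_rules[OF c_lf] sm_rules)
  have h0: "hh z = 0" if "z \<in> S" for z
    using c_zero_aux[of z X0 X] that by (auto simp: S_def)
  have dh: "der0 hh z w = 0" if "z \<in> S" for z w
    using dd_cong_open[OF S(1) that, of hh "\<lambda>_. 0"] h0 by (simp add: der0_def)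
  have A0: "A z Y = 0" if "z \<in> S" for z Y
    using al_zero[of z X0 Y] dh[OF that] that by (simp add: S_def al_def a_def)
  have "der1 A x w X = 0" for w
    using dd_cong_open[OF S(1,2), of "\<lambda>z. A z X" "\<lambda>_. 0"] A0 by (simp add: der1_def)
  then have "c x X = 0" using dh[OF S(2)] A0[OF S(2)] by (simp add: c_def)
  with ne show False by simp
qed

text \<open>\<open>J\<close> is nonzero on a neighbourhood of \<open>x\<close>, so that
  \<open>T_J'\<close> holds there without its \<open>c\<close> term and may be differentiated
  vertically.\<close>

lemma fibre_identity_J:
  assumes x: "x \<in> U" and nz: "J x X0 \<noteq> 0"
  shows "fibre_identity (J x) (T x) (\<lambda>W. der2 T x (0, W)) (\<lambda>_. 0) (\<lambda>_ _. 0)"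
proof -
  define S where "S = {z\<in>U. J z X0 \<noteq> 0}"
  have S: "open S" "x \<in> S" "S \<subseteq> U"
    using open_nonzero[of "\<lambda>z. J z X0"] x nz by (auto simp: S_def calc)
  have T': "T z (J z X) Z = (2/3) *\<^sub>R T z (J z Z) X + (1/3) *\<^sub>R T z X (J z Z)
      - J z ((2/3) *\<^sub>R T z Z X + (1/3) *\<^sub>R T z X Z)" if "z \<in> S" for z X Z
    using T_J'[of z X Z] c_zero[of z X0 X] that by (simp add: S_def H_def)
  have s: "der2 T x (0, W) Z X = der2 T x (0, Z) W X" for W Z X
  proof -
    have "der2 T x w Z X = der2 (der1 J) x w (0, Z) X" for w Z by (simp add: der2_def T_def)
    then show ?thesis using der_commute(2)[OF x J_lf] by simp
  qed
  have lin: "linear (der2 T x (0, W) Z)" "linear (\<lambda>Z. der2 T x (0, W) Z X)" for W Z X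
    using lf2_linear[OF lf3_D(1)[OF lf3_der2[OF T_lf], of "(0, W)"] x] by auto
  have d: "der2 T x (0, W) (J x X) Z + T x (T x W X) Z =
      (2/3) *\<^sub>R der2 T x (0, W) (J x Z) X + (1/3) *\<^sub>R der2 T x (0, W) X (J x Z)
      + ((2/3) *\<^sub>R T x (T x W Z) X + (1/3) *\<^sub>R T x X (T x W Z))
      - T x W ((2/3) *\<^sub>R T x Z X + (1/3) *\<^sub>R T x X Z)
      - J x ((2/3) *\<^sub>R der2 T x (0, W) Z X + (1/3) *\<^sub>R der2 T x (0, W) X Z)" for W X Z
  proof -
    have e1: "dd (\<lambda>z. T z (J z X) Z) x (0, W) = dd (\<lambda>z. H z X (J z Z) - J z (H z X Z)) x (0, W)"
    proof -
      have "T z (J z X) Z = H z X (J z Z) - J z (H z X Z)" if "z \<in> S" for z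
        using T'[OF that] unfolding H_def .
      from dd_cong_open[OF S(1,2) this] show ?thesis by (rule fun_cong)
    qed
    have dH: "der2 H x w X Z = (2/3) *\<^sub>R der2 T x w Z X + (1/3) *\<^sub>R der2 T x w X Z" for w X Z
      using x by (simp add: der2_def H_def dd_rules sm_rules lf2_sm[OF T_lf])
    have Js: "sm (\<lambda>z. J z X)" and Jd: "dd (\<lambda>z. J z X) x (0, W) = T x W X" for X
      by (simp_all add: lf_all sm_rules T_def der1_def)
    have e2: "dd (\<lambda>z. T z (J z X) Z) x (0, W) = der2 T x (0, W) (J x X) Z + T x (T x W X) Z"
      using lf2_dd[OF T_lf x Js sm_rules(1), of X Z "(0, W)"] by (simp add: Jd lf2_lin[OF T_lf x])
    have e3: "dd (\<lambda>z. H z X (J z Z) - J z (H z X Z)) x (0, W)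
        = der2 H x (0, W) X (J x Z) + H x X (T x W Z) - (T x W (H x X Z) + J x (der2 H x (0, W) X Z))"
    proof -
      have Hs: "sm (\<lambda>z. H z X Z)" by (simp add: lf2_sm[OF H_lf] sm_rules)
      have "dd (\<lambda>z. H z X (J z Z)) x (0, W) = der2 H x (0, W) X (J x Z) + H x X (T x W Z)"
        using lf2_dd[OF H_lf x sm_rules(1) Js, of X Z "(0, W)"] by (simp add: Jd lf2_lin[OF H_lf x])
      moreover have "dd (\<lambda>z. J z (H z X Z)) x (0, W) = T x W (H x X Z) + J x (der2 H x (0, W) X Z)"
        using lf1_dd[OF J_lf x Hs, of "(0, W)"] by (simp add: T_def der2_def)
      moreover have s1: "sm (\<lambda>z. H z X (J z Z))" and s2: "sm (\<lambda>z. J z (H z X Z))"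
        by (simp_all add: lf2_sm[OF H_lf] sm_rules Js lf1_sm[OF J_lf] Hs)
      ultimately show ?thesis unfolding dd_rules(2)[OF x s1 s2] by (simp only:)
    qed
    show ?thesis
      using trans[OF e2[symmetric] trans[OF e1 e3]] unfolding dH H_def diff_diff_eq .
  qed
  show ?thesis
    unfolding fibre_identity_def scaleR_zero_left add_0_right
    by (intro conjI allI) (rule lin s T'[OF S(2)] d refl)+
qed

lemma J_zero:
  assumes "x \<in> U"
  shows "J x X = 0"
proof -
  obtain p y0 where x: "x = (p, y0)" by (cases x)
  have U: "(p, y) \<in> U" if "y \<noteq> 0" for y using assms that by (simp add: U_eq x)
  have y0: "y0 \<noteq> 0" using assms by (simp add: U_eq x)
  have Js: "sm (\<lambda>z. J z X)" and gs: "sm (\<lambda>z. g z X Y)" and Fs: "sm (\<lambda>z. g z (snd z) (snd z))" for X Y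
    by (simp_all add: calc)
  have "J (p, y0) X = 0"
  proof (rule fibre_flat[where J = "\<lambda>y. J (p, y)" and g = "\<lambda>y. g (p, y)" and T = "\<lambda>y. T (p, y)", OF _ _ _ _ _ _ _ _ _ _ _ _ _ y0])
    fix y :: 'a and X Y Z and t :: real assume y: "y \<noteq> 0"
    note u = U[OF y]
    show "inner_form (g (p, y))" by (rule g_inner[OF u])
    show "linear (J (p, y))" by (rule J_linear[OF u])
    show "g (p, y) (J (p, y) X) Z = g (p, y) X (J (p, y) Z)" by (rule J_selfadj[OF u])
    show "endo_trace (J (p, y)) = 0" by (rule trace_J[OF u])
    show "g (p, y) (J (p, y) X) y = 0" using J_perp[OF u] by simp
    show "((\<lambda>y. J (p, y) X) has_derivative (\<lambda>Z. T (p, y) Z X)) (at y)"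
      using dd_vertical[OF u Js[of X]] by (simp add: T_def der1_def)
    show "(\<lambda>y. g (p, y) X Y) differentiable (at y)"
      using dd_vertical[OF u gs[of X Y]] by (auto simp: differentiable_def)
    have "dd (\<lambda>z. g z (snd z) (snd z)) (p, y) (0, Z) = 2 * g (p, y) Z y" for Z
      using u g_vert_y[OF u] g_sym[OF u, of y Z] by (simp add: calc)
    then show "((\<lambda>y. g (p, y) y y) has_derivative (\<lambda>Z. 2 * g (p, y) Z y)) (at y)"
      using dd_vertical[OF u Fs] by simp
    show "g (p, y) (T (p, y) Z X) y = - g (p, y) (J (p, y) X) Z" using T_perp[OF u] by simp
    show "linear (T (p, y) X)" by (rule lf2_linear(1)[OF T_lf u])
    show "\<exists>D2 c dc. fibre_identity (J (p, y)) (T (p, y)) D2 c dc" if "J (p, y) X \<noteq> 0"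
      using fibre_identity_J[OF u that] by blast
    assume t: "t > 0"
    show "J (p, t *\<^sub>R y) X = t\<^sup>2 *\<^sub>R J (p, y) X"
    proof -
      have "dd (\<lambda>z. J z X) z (0, snd z) = 2 *\<^sub>R J z X" if "z \<in> U" for z
        using T_y(2)[OF that] by (simp add: T_def der1_def)
      from euler[OF Js this u t] show ?thesis using t by (simp add: powr_numeral)
    qed
    show "g (p, t *\<^sub>R y) X Z = g (p, y) X Z"
    proof -
      have "dd (\<lambda>z. g z X Z) z (0, snd z) = 0 *\<^sub>R g z X Z" if "z \<in> U" for z
        using g_vert_y(3)[OF that] by (simp add: der2_def)
      from euler[OF gs this u t] show ?thesis using t by simp
    qed
  qed
  then show ?thesis by (simp add: x)
qed

section \<open>From the vanishing of the Jacobi endomorphism to that of the curvature\<close>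

lemma E_zero: "x \<in> U \<Longrightarrow> E x X Y = 0"
proof -
  assume x: "x \<in> U"
  have "T x Z X = 0" for Z X
    unfolding T_def der1_def by (rule dd_const_U[OF x]) (rule J_zero)
  then show ?thesis using T_skew[OF x, of Y X] by simp
qed

lemma R_Gam: "x \<in> U \<Longrightarrow> R x X Y Z = der2 Gam x (h x Y) X Z - der2 Gam x (h x X) Y Z + Gam x Y (Gam x X Z) - Gam x X (Gam x Y Z)"
  by (simp add: R_eq E_zero V_0)

lemma R_skew: "x \<in> U \<Longrightarrow> R x X Y Z = - R x Y X Z"
  by (simp add: R_Gam)

lemma R_bianchi: "x \<in> U \<Longrightarrow> R x X Y Z + R x Y Z X + R x Z X Y = 0"
proof -
  assume x: "x \<in> U"
  have "der2 Gam x w X Y = der2 Gam x w Y X" for w X Y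
    unfolding der2_def by (rule arg_cong[where f = "\<lambda>D. D w"], rule dd_cong_open[OF open_U x]) (rule Gam_sym)
  then show ?thesis
    using Gam_sym[OF x, of X Y] Gam_sym[OF x, of Y Z] Gam_sym[OF x, of X Z]
    by (simp add: R_Gam[OF x])
qed

lemma bracket_h: "x \<in> U \<Longrightarrow> dd (\<lambda>z. h z X) x (h x Y) - dd (\<lambda>z. h z Y) x (h x X) = 0"
  using E_zero[of x X Y] by (simp add: calc der_h E_def)

lemma h_sm: "sm (\<lambda>z. h z X)"
  by (simp add: calc)

lemma R_metric: "x \<in> U \<Longrightarrow> g x (R x X Y Z) W = - g x Z (R x X Y W)"
proof -
  assume x: "x \<in> U"
  interpret inner_form "g x" using x by (rule g_inner)
  have s: "sm (\<lambda>z. g z Z W)" by (simp add: calc)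
  have e: "dd (\<lambda>z. dd (\<lambda>z. g z Z W) z (h z X)) x w = dd (\<lambda>z. g z (Gam z X Z) W + g z Z (Gam z X W)) x w" for X w
    by (rule dd_cong_U[OF x]) (simp add: metric der2_def[symmetric])
  have "dd (\<lambda>z. g z (Gam z X Z) W + g z Z (Gam z X W)) x (h x Y)
      = dd (\<lambda>z. g z (Gam z Y Z) W + g z Z (Gam z Y W)) x (h x X)"
    using bracket_fields[OF x s h_sm[of X] h_sm[of Y]]
    unfolding e bracket_h[OF x] by (simp add: dd_lin[OF x s])
  then show ?thesis
    using x by (simp add: calc metric R_Gam rules)
qed

definition "dA x X Y = der1 A x (h x X) Y - der1 A x (h x Y) X"

text \<open>The Ricci identity for the recurrent tensor \<open>R\<close>. Horizontal lifts of
  constant vectors commute now, so no vertical derivative occurs and only the curl of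
  \<open>A\<close> is left beside the action of \<open>R\<close> on itself.\<close>

lemma R_R:
  assumes x: "x \<in> U"
  shows "R x S T' (R x X Y Z) - R x (R x S T' X) Y Z - R x X (R x S T' Y) Z - R x X Y (R x S T' Z) = - dA x S T' *\<^sub>R R x X Y Z"
proof -
  have s: "sm (\<lambda>z. R z X Y Z)" by (simp add: calc2)
  have r: "der3 R z (h z W) X Y Z = A z W *\<^sub>R R z X Y Z - Gam z W (R z X Y Z) + R z (Gam z W X) Y Z
      + R z X (Gam z W Y) Z + R z X Y (Gam z W Z)" if "z \<in> U" for z W X Y Z
    using rec_R[OF that, of W X Y Z] by (simp add: algebra_simps)
  have e: "dd (\<lambda>z. dd (\<lambda>z. R z X Y Z) z (h z W)) x w = dd (\<lambda>z. A z W *\<^sub>R R z X Y Z - Gam z W (R z X Y Z)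
      + R z (Gam z W X) Y Z + R z X (Gam z W Y) Z + R z X Y (Gam z W Z)) x w" for W w
    by (rule dd_cong_U[OF x]) (simp add: r der3_def[symmetric])
  define DD where "DD W V = dd (\<lambda>z. A z W *\<^sub>R R z X Y Z - Gam z W (R z X Y Z)
      + R z (Gam z W X) Y Z + R z X (Gam z W Y) Z + R z X Y (Gam z W Z)) x (h x V)" for W V
  have 0: "DD S T' = DD T' S"
    using bracket_fields[OF x s h_sm[of S] h_sm[of T']]
    unfolding e bracket_h[OF x] by (simp add: dd_lin[OF x s] DD_def)
  have 1: "DD W V = der1 A x (h x V) W *\<^sub>R R x X Y Z - der2 Gam x (h x V) W (R x X Y Z)
      + R x (der2 Gam x (h x V) W X) Y Z + R x X (der2 Gam x (h x V) W Y) Z + R x X Y (der2 Gam x (h x V) W Z)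
      + A x W *\<^sub>R der3 R x (h x V) X Y Z - Gam x W (der3 R x (h x V) X Y Z)
      + der3 R x (h x V) (Gam x W X) Y Z + der3 R x (h x V) X (Gam x W Y) Z + der3 R x (h x V) X Y (Gam x W Z)" for W V
    unfolding DD_def using x by (simp add: calc2)
  show ?thesis
    using 0 unfolding 1 r[OF x] R_Gam[OF x, of S T'] dA_def
    by (simp add: lf3_lin[OF R_lf x] lf2_lin[OF Gam_lf x] lf1_lin[OF A_lf x] algebra_simps)
qed

theorem R_zero:
  assumes x: "x \<in> U"
  shows "R x X Y Z = 0"
proof -
  interpret inner_form "g x" using x by (rule g_inner)
  note L = lf3_lin[OF R_lf x]
  \<comment> \<open>Symmetry under exchange of pairs, from the classical combination of four Bianchi
    identities with the two skew symmetries.\<close>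
  have pair: "g x (R x X Y Z) W = g x (R x Z W X) Y" for X Y Z W
  proof -
    have b: "g x (R x X Y Z) W + g x (R x Y Z X) W + g x (R x Z X Y) W = 0" for X Y Z W
      using arg_cong[OF R_bianchi[OF x, of X Y Z], of "\<lambda>v. g x v W"] by (simp add: rules)
    have k1: "g x (R x X Y Z) W = - g x (R x Y X Z) W" for X Y Z W
      by (subst R_skew[OF x]) (simp add: rules)
    have k2: "g x (R x X Y Z) W = - g x (R x X Y W) Z" for X Y Z W
      using R_metric[OF x, of X Y Z W] sym by simp
    show ?thesis
      using b[of X Y Z W] b[of Y Z W X] b[of Z W X Y] b[of W X Y Z]
        k1[of X Y Z W] k1[of Y Z X W] k1[of Z X Y W] k1[of Z W Y X] k1[of Y W Z X] k1[of W X Z Y] k1[of X Z W Y] k1[of Z W X Y]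
        k1[of X Y W Z] k1[of W Y X Z] k1[of W X Y Z]
        k2[of X Y Z W] k2[of Y Z X W] k2[of Z X Y W] k2[of Z W Y X] k2[of Y W Z X] k2[of W X Z Y] k2[of X Z W Y] k2[of Z W X Y]
        k2[of X Y W Z] k2[of W Y X Z] k2[of Y Z W X] k2[of W X Y Z]
      by linarith
  qed
  \<comment> \<open>The variable of the fibre theorem is now \<open>v\<close>, with the metric
    frozen at \<open>x\<close>. The map is quadratic in \<open>v\<close>, so its derivatives are
    polarisations, and by \<open>HH\<close> the combination with thirds is
    \<open>R x X v Z\<close>.\<close>
  have J: "R x X v v = 0" if v: "v \<noteq> 0" for X v
  proof (rule fibre_flat[where J = "\<lambda>v X. R x X v v" and g = "\<lambda>_. g x" and T = "\<lambda>v Z X. R x X Z v + R x X v Z", OF _ _ _ _ _ _ _ _ _ _ _ _ _ v])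
    fix v :: 'a and X Y Z and t :: real
    show "inner_form (g x)" by unfold_locales
    show "linear (\<lambda>X. R x X v v)" by (rule linearI; simp add: L algebra_simps)
    show "g x (R x X v v) Z = g x X (R x Z v v)"
      using pair[of X v v Z] R_skew[OF x, of v Z X] R_metric[OF x, of Z v X v] sym by (simp add: rules)
    show "endo_trace (\<lambda>X. R x X v v) = 0"
    proof -
      have "endo_trace (\<lambda>X. R x X v v) = - endo_trace (\<lambda>X. R x v X v)"
        unfolding endo_trace_def by (subst R_skew[OF x]) (simp add: sum_negf)
      then show ?thesis using ricci[OF x, of v v] by simp
    qed
    show "g x (R x X v v) v = 0" using R_metric[OF x, of X v v v] sym[of v] by simp
    have "((\<lambda>v. \<Sum>b\<in>Basis. (v \<bullet> b) *\<^sub>R (\<Sum>d\<in>Basis. (v \<bullet> d) *\<^sub>R R x X b d)) has_derivative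
      (\<lambda>Z. \<Sum>b\<in>Basis. (v \<bullet> b) *\<^sub>R (\<Sum>d\<in>Basis. (Z \<bullet> d) *\<^sub>R R x X b d) + (Z \<bullet> b) *\<^sub>R (\<Sum>d\<in>Basis. (v \<bullet> d) *\<^sub>R R x X b d))) (at v)"
      by (auto intro!: derivative_eq_intros)
    moreover have l: "linear (\<lambda>Y. R x X Y Z)" "linear (R x X Y)" for Y Z
      by (rule linearI; simp add: L algebra_simps)+
    ultimately show "((\<lambda>v. R x X v v) has_derivative (\<lambda>Z. R x X Z v + R x X v Z)) (at v)"
      by (simp add: sum.distrib linear_sum_Basis[OF l(2), symmetric] linear_sum_Basis[OF l(1), symmetric] add.commute)
    show "(\<lambda>v. g x X Y) differentiable (at v)" by simp
    show "((\<lambda>v. g x v v) has_derivative (\<lambda>Z. 2 * g x Z v)) (at v)"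
      using bounded_bilinear.FDERIV[OF bounded_bilinear has_derivative_ident has_derivative_ident, of v UNIV]
      by (simp add: sym[of v])
    show "g x (R x X Z v + R x X v Z) v = - g x (R x X v v) Z"
      using R_metric[OF x, of X Z v v] R_metric[OF x, of X v Z v] sym[of v] sym[of Z] by (simp add: rules)
    show "linear (\<lambda>Xa. R x Xa X v + R x Xa v X)" by (rule linearI; simp add: L algebra_simps)
    have HH: "(2/3) *\<^sub>R (R x X Z v + R x X v Z) + (1/3) *\<^sub>R (R x Z X v + R x Z v X) = R x X v Z" for X Z v
    proof -
      have 1: "R x Z v X = R x X v Z - R x X Z v"
        using R_bianchi[OF x, of X Z v] R_skew[OF x, of v X Z] by (simp add: algebra_simps)
      have 2: "R x Z X v = - R x X Z v" by (rule R_skew[OF x])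
      have 3: "(2/3) *\<^sub>R w = w - (1/3) *\<^sub>R w" for w :: 'a
        using scaleR_left_diff_distrib[of 1 "1/3" w] by simp
      show ?thesis unfolding 1 2 3 by (simp add: algebra_simps scaleR_3) (simp add: scaleR_2 flip: scaleR_add_left)
    qed
    \<comment> \<open>Here the multiplier is the curl of \<open>A\<close> on \<open>X\<close> and
      \<open>v\<close>. It is linear in \<open>v\<close>, its derivative in the direction
      \<open>W\<close> is \<open>dA x X W\<close>, and this vanishes for \<open>W = X\<close>
      because the curl is skew.\<close>
    have "fibre_identity (\<lambda>X. R x X v v) (\<lambda>Z X. R x X Z v + R x X v Z) (\<lambda>W Z X. R x X Z W + R x X W Z)
      (\<lambda>X. dA x X v) (\<lambda>W X. dA x X W)"
      unfolding fibre_identity_def HH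
    proof (intro conjI allI)
      show "linear (\<lambda>X. R x X Z W + R x X W Z)" "linear (\<lambda>Z. R x X Z W + R x X W Z)" for X Z W
        by (rule linearI; simp add: L algebra_simps)+
      show "R x X Z W + R x X W Z = R x X W Z + R x X Z W" for X Z W by (rule add.commute)
      show "dA x X X = 0" for X by (simp add: dA_def)
      show "R x Z (R x X v v) v + R x Z v (R x X v v) = R x X v (R x Z v v) - R x (R x X v Z) v v + dA x X v *\<^sub>R R x Z v v" for X Z
        using R_R[OF x, of X v Z v v] by (simp add: algebra_simps)
      show "R x Z (R x X v v) W + R x Z W (R x X v v) + (R x Z (R x X W v + R x X v W) v + R x Z v (R x X W v + R x X v W)) =
        R x X W (R x Z v v) + R x X v (R x Z W v + R x Z v W) - (R x (R x X v Z) W v + R x (R x X v Z) v W)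
        - R x (R x X W Z) v v + dA x X W *\<^sub>R R x Z v v + dA x X v *\<^sub>R (R x Z W v + R x Z v W)" for W X Z
      proof -
        have 1: "R x Z v (R x X W v) = R x X W (R x Z v v) - R x (R x X W Z) v v - R x Z (R x X W v) v + dA x X W *\<^sub>R R x Z v v"
          using R_R[OF x, of X W Z v v] by (simp add: algebra_simps)
        have 2: "R x Z W (R x X v v) = R x X v (R x Z W v) - R x (R x X v Z) W v - R x Z (R x X v W) v + dA x X v *\<^sub>R R x Z W v"
          using R_R[OF x, of X v Z W v] by (simp add: algebra_simps)
        have 3: "R x Z v (R x X v W) = R x X v (R x Z v W) - R x (R x X v Z) v W - R x Z (R x X v v) W + dA x X v *\<^sub>R R x Z v W"
          using R_R[OF x, of X v Z v W] by (simp add: algebra_simps)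
        show ?thesis by (simp add: L 1 2 3 algebra_simps)
      qed
    qed
    then show "\<exists>D2 c dc. fibre_identity (\<lambda>X. R x X v v) (\<lambda>Z X. R x X Z v + R x X v Z) D2 c dc" by blast
    assume t: "t > 0"
    show "R x X (t *\<^sub>R v) (t *\<^sub>R v) = t\<^sup>2 *\<^sub>R R x X v v" by (simp add: L power2_eq_square)
  qed simp_all
  \<comment> \<open>Polarisation makes \<open>R\<close> skew in its last two arguments too, hence
    totally skew, and the Bianchi identity becomes \<open>3 R = 0\<close>.\<close>
  have t: "R x X Y Z = - R x X Z Y" for X Y Z
  proof -
    have J0: "R x X v v = 0" for v using J[of v X] by (cases "v = 0") (simp_all add: L)
    show ?thesis using J0[of "Y + Z"] J0[of Y] J0[of Z] by (simp add: L eq_neg_iff_add_eq_0 add.commute)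
  qed
  have "R x Y Z X = R x X Y Z" using t[of Y Z X] R_skew[OF x, of Y X Z] by simp
  moreover have "R x Z X Y = R x X Y Z" using R_skew[OF x, of Z X Y] t[of X Z Y] by simp
  ultimately have "3 *\<^sub>R R x X Y Z = 0" using R_bianchi[OF x, of X Y Z] by (simp add: scaleR_3)
  then show ?thesis by simp
qed

end

section \<open>Smooth solutions of linear equations\<close>

text \<open>Because the scalar factor vanishes at the point, continuity of the other factor is
  enough. This breaks the circle in \<open>Inv_deriv\<close>, where the inverse is known to be
  continuous and not yet differentiable.\<close>

lemma has_derivative_scaleR_zero:
  fixes \<phi> :: "'a::real_normed_vector \<Rightarrow> real" and \<psi> :: "'a \<Rightarrow> 'b::real_normed_vector"
  assumes \<phi>: "(\<phi> has_derivative \<phi>') (at x)" "\<phi> x = 0" and \<psi>: "isCont \<psi> x"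
  shows "((\<lambda>z. \<phi> z *\<^sub>R \<psi> z) has_derivative (\<lambda>w. \<phi>' w *\<^sub>R \<psi> x)) (at x)"
proof -
  have b: "bounded_linear \<phi>'" using \<phi>(1) by (rule has_derivative_bounded_linear)
  obtain K where K: "\<And>w. norm (\<phi>' w) \<le> norm w * K" "0 < K"
    using bounded_linear.pos_bounded[OF b] by blast
  have "((\<lambda>z. \<phi> z *\<^sub>R (\<psi> z - \<psi> x)) has_derivative (\<lambda>_. 0)) (at x)"
    unfolding has_derivative_at_alt
  proof (intro conjI allI impI)
    fix e :: real assume e: "0 < e"
    obtain d1 where d1: "0 < d1" "\<And>z. norm (z - x) < d1 \<Longrightarrow> norm (\<phi> z - \<phi> x - \<phi>' (z - x)) \<le> 1 * norm (z - x)"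
      using \<phi>(1) unfolding has_derivative_at_alt by (metis zero_less_one)
    obtain d2 where d2: "0 < d2" "\<And>z. dist z x < d2 \<Longrightarrow> dist (\<psi> z) (\<psi> x) < e / (K + 1)"
      using \<psi> e K(2) unfolding continuous_at_eps_delta by (metis add_pos_pos divide_pos_pos zero_less_one)
    show "\<exists>d>0. \<forall>y. norm (y - x) < d \<longrightarrow> norm (\<phi> y *\<^sub>R (\<psi> y - \<psi> x) - \<phi> x *\<^sub>R (\<psi> x - \<psi> x) - 0) \<le> e * norm (y - x)"
    proof (intro exI[of _ "min d1 d2"] conjI allI impI)
      fix z assume z: "norm (z - x) < min d1 d2"
      have 1: "norm (\<phi> z) \<le> (K + 1) * norm (z - x)"
        using d1(2)[of z] K(1)[of "z - x"] z norm_triangle_ineq2[of "\<phi> z" "\<phi>' (z - x)"]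
        by (simp add: \<phi>(2) algebra_simps)
      have 2: "norm (\<psi> z - \<psi> x) \<le> e / (K + 1)"
        using d2(2)[of z] z by (simp add: dist_norm)
      have "norm (\<phi> z *\<^sub>R (\<psi> z - \<psi> x)) \<le> ((K + 1) * norm (z - x)) * (e / (K + 1))"
        unfolding norm_scaleR real_norm_def[symmetric] using 1 2 K(2) by (intro mult_mono) auto
      also have "\<dots> = e * norm (z - x)" using K(2) by simp
      finally show "norm (\<phi> z *\<^sub>R (\<psi> z - \<psi> x) - \<phi> x *\<^sub>R (\<psi> x - \<psi> x) - 0) \<le> e * norm (z - x)"
        by (simp add: \<phi>(2))
    qed (use d1 d2 in auto)
  qed simp
  from has_derivative_add[OF this has_derivative_scaleR_left[OF \<phi>(1), of "\<psi> x"]]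
  show ?thesis by (simp add: scaleR_diff_right)
qed

context smooth_domain
begin

context
  fixes M :: "'a \<Rightarrow> 'b::euclidean_space \<Rightarrow> 'b"
  assumes M: "lf1 U M" and inj: "\<And>x v. x \<in> U \<Longrightarrow> M x v = 0 \<Longrightarrow> v = 0"
begin

lemma M_linear: "x \<in> U \<Longrightarrow> linear (M x)"
  using M by (simp add: lf1_def)

lemma M_bij: "x \<in> U \<Longrightarrow> bij (M x)"
proof -
  assume x: "x \<in> U"
  have "inj (M x)" using linear_injective_0[OF M_linear[OF x]] inj[OF x] by blast
  then show ?thesis using linear_injective_imp_surjective[OF M_linear[OF x]] by (simp add: bij_def)
qed

definition Inv :: "'a \<Rightarrow> 'b \<Rightarrow> 'b" where "Inv x = inv (M x)"

lemma M_Inv: "x \<in> U \<Longrightarrow> M x (Inv x b) = b"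
  using M_bij by (simp add: Inv_def bij_is_surj surj_f_inv_f)

lemma Inv_eq: "x \<in> U \<Longrightarrow> M x v = b \<Longrightarrow> Inv x b = v"
  using M_bij by (metis Inv_def bij_inv_eq_iff)

lemma Inv_linear: "x \<in> U \<Longrightarrow> linear (Inv x)"
  by (rule linearI; rule Inv_eq; simp add: lf1_lin[OF M] M_Inv)

text \<open>Near \<open>x\<close> the maps \<open>M z\<close> keep half of the lower bound
  \<open>B\<close> of \<open>M x\<close>, and \<open>M z\<close> sends the increment of the solution
  to minus the change of \<open>M\<close> at the fixed vector \<open>Inv x b\<close>.\<close>

lemma Inv_cont:
  assumes x: "x \<in> U"
  shows "isCont (\<lambda>z. Inv z b) x"
proof -
  obtain B where B: "B > 0" "\<And>v. B * norm v \<le> norm (M x v)"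
    using linear_inj_bounded_below_pos[OF M_linear[OF x]] M_bij[OF x] by (auto simp: bij_def)
  have c: "isCont (\<lambda>z. M z v) x" for v
    using M x smooth_on_cont[OF open_U, of "\<lambda>z. M z v"] open_U by (simp add: lf1_def continuous_on_eq_continuous_at)
  have "((\<lambda>z. \<Sum>i\<in>Basis. norm (M z i - M x i)) \<longlongrightarrow> (\<Sum>i\<in>Basis. norm (M x i - M x i))) (at x)"
    using c unfolding isCont_def by (intro tendsto_intros) auto
  then have "\<forall>\<^sub>F z in at x. (\<Sum>i\<in>Basis. norm (M z i - M x i)) < B / 2"
    by (rule order_tendstoD(2)) (use B in simp)
  moreover have "\<forall>\<^sub>F z in at x. z \<in> U" using open_U x by (rule eventually_at_in_open')
  ultimately have ev: "\<forall>\<^sub>F z in at x. norm (Inv z b - Inv x b) \<le> norm (M z (Inv x b) - M x (Inv x b)) * (2 / B)"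
  proof eventually_elim
    case (elim z)
    define v where "v = Inv z b - Inv x b"
    have "M z v - M x v = (\<Sum>i\<in>Basis. (v \<bullet> i) *\<^sub>R (M z i - M x i))"
      using linear_sum_Basis[OF M_linear[OF elim(2)], of v] linear_sum_Basis[OF M_linear[OF x], of v]
      by (simp add: sum_subtractf scaleR_diff_right)
    then have "norm (M z v - M x v) \<le> (\<Sum>i\<in>Basis. norm ((v \<bullet> i) *\<^sub>R (M z i - M x i)))"
      by (simp only: norm_sum)
    also have "\<dots> \<le> (\<Sum>i\<in>Basis. norm v * norm (M z i - M x i))"
      by (intro sum_mono) (simp add: mult_right_mono Basis_le_norm)
    also have "\<dots> \<le> norm v * (B / 2)" 
      unfolding sum_distrib_left[symmetric] using elim(1) by (intro mult_left_mono) auto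
    finally have "B * norm v - norm v * (B / 2) \<le> norm (M z v)"
      using B(2)[of v] norm_triangle_ineq2[of "M x v" "M z v"] norm_minus_commute[of "M x v" "M z v"] by linarith
    moreover have "M z v = - (M z (Inv x b) - M x (Inv x b))"
      using elim(2) x by (simp add: v_def lf1_lin[OF M] M_Inv)
    ultimately have "norm v * (B / 2) \<le> norm (M z (Inv x b) - M x (Inv x b))"
      by (simp add: norm_minus_commute mult.commute)
    then show ?case using B by (simp add: v_def field_simps)
  qed
  have "((\<lambda>z. norm (M z (Inv x b) - M x (Inv x b)) * (2 / B)) \<longlongrightarrow> norm (M x (Inv x b) - M x (Inv x b)) * (2 / B)) (at x)"
    using c[of "Inv x b"] unfolding isCont_def by (intro tendsto_intros) auto
  then have "((\<lambda>z. norm (M z (Inv x b) - M x (Inv x b)) * (2 / B)) \<longlongrightarrow> 0) (at x)" by simp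
  then have "((\<lambda>z. Inv z b - Inv x b) \<longlongrightarrow> 0) (at x)"
    by (rule Lim_null_comparison[OF ev])
  then show ?thesis unfolding isCont_def by (simp add: LIM_zero_iff)
qed

lemma Inv_deriv:
  assumes x: "x \<in> U"
  shows "((\<lambda>z. Inv z b) has_derivative (\<lambda>w. - Inv x (der1 M x w (Inv x b)))) (at x)"
proof -
  define v where "v = Inv x b"
  have s: "sm (\<lambda>z. M z v)" using M by (simp add: lf1_def)
  have d: "((\<lambda>z. (M z v - b) \<bullet> i) has_derivative (\<lambda>w. der1 M x w v \<bullet> i)) (at x)" for i
    using has_derivative_inner_left[OF has_derivative_diff[OF dd_works[OF sm_diffble[OF s x]] has_derivative_const]]
    by (simp add: der1_def)
  \<comment> \<open>The solution at \<open>z\<close> is the old solution \<open>v\<close> corrected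
    by \<open>Inv z\<close> of the residual \<open>M z v - b\<close>, and the residual vanishes at
    \<open>x\<close>.\<close>
  have "((\<lambda>z. v - (\<Sum>i\<in>Basis. ((M z v - b) \<bullet> i) *\<^sub>R Inv z i)) has_derivative
      (\<lambda>w. 0 - (\<Sum>i\<in>Basis. (der1 M x w v \<bullet> i) *\<^sub>R Inv x i))) (at x)"
    by (intro has_derivative_diff has_derivative_const has_derivative_sum has_derivative_scaleR_zero[OF d _ Inv_cont[OF x]])
       (simp add: v_def M_Inv[OF x])
  moreover have "v - (\<Sum>i\<in>Basis. ((M z v - b) \<bullet> i) *\<^sub>R Inv z i) = Inv z b" if "z \<in> U" for z
  proof -
    have "(\<Sum>i\<in>Basis. ((M z v - b) \<bullet> i) *\<^sub>R Inv z i) = Inv z (M z v - b)"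
      by (rule linear_sum_Basis[OF Inv_linear[OF that], symmetric])
    also have "\<dots> = v - Inv z b"
      using linear_diff[OF Inv_linear[OF that]] Inv_eq[OF that refl] by simp
    finally show ?thesis by simp
  qed
  ultimately have "((\<lambda>z. Inv z b) has_derivative (\<lambda>w. 0 - (\<Sum>i\<in>Basis. (der1 M x w v \<bullet> i) *\<^sub>R Inv x i))) (at x)"
    by (rule has_derivative_transform_within_open[OF _ open_U x])
  then show ?thesis
    by (simp add: linear_sum_Basis[OF Inv_linear[OF x], symmetric] v_def)
qed

text \<open>The derivative of the inverse is a polynomial expression in the inverse and the
  derivative of \<open>M\<close>, so each order of differentiability yields the next one.\<close>

lemma Inv_lf: "lf1 U Inv"
proof (rule lf1I[OF Inv_linear])
  have "Ck_on k U (\<lambda>z. Inv z b)" for k b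
  proof (induction k arbitrary: b)
    case 0
    show ?case
      using Inv_cont by (simp add: continuous_at_imp_continuous_on)
  next
    case (Suc k)
    have "(\<lambda>z. Inv z b) differentiable_on U"
      using Inv_deriv by (auto simp: differentiable_on_eq_differentiable_at[OF open_U] differentiable_def)
    moreover have "Ck_on k U (\<lambda>z. dd (\<lambda>z. Inv z b) z w)" for w
    proof (rule Ck_on_cong[OF open_U])
      have Mk: "Ck_on k U (\<lambda>z. der1 M z w j)" for j
        using smooth_on_dd[OF open_U, of "\<lambda>z. M z j" w] M by (simp add: lf1_def smooth_on_def der1_def)
      show "Ck_on k U (\<lambda>z. \<Sum>i\<in>Basis. (- (\<Sum>j\<in>Basis. (Inv z b \<bullet> j) *\<^sub>R der1 M z w j) \<bullet> i) *\<^sub>R Inv z i)"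
        by (intro Ck_on_sum[OF open_U] Ck_on_bilinear[OF open_U bounded_bilinear_scaleR] Suc.IH Mk Ck_on_const
            Ck_on_bilinear[OF open_U bounded_bilinear_inner] Ck_on_linear[OF open_U bounded_linear_minus[OF bounded_linear_ident]])
      fix z assume z: "z \<in> U"
      have l: "linear (der1 M z w)" using lf2_D(1)[OF lf2_der1[OF M], of w] z by (simp add: lf1_def)
      have "dd (\<lambda>z. Inv z b) z w = Inv z (- der1 M z w (Inv z b))"
        using linear_neg[OF Inv_linear[OF z]] by (simp add: dd_eq[OF Inv_deriv[OF z]])
      also have "\<dots> = (\<Sum>i\<in>Basis. (- der1 M z w (Inv z b) \<bullet> i) *\<^sub>R Inv z i)"
        by (rule linear_sum_Basis[OF Inv_linear[OF z]])
      also have "der1 M z w (Inv z b) = (\<Sum>j\<in>Basis. (Inv z b \<bullet> j) *\<^sub>R der1 M z w j)"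
        by (rule linear_sum_Basis[OF l])
      finally show "(\<Sum>i\<in>Basis. (- (\<Sum>j\<in>Basis. (Inv z b \<bullet> j) *\<^sub>R der1 M z w j) \<bullet> i) *\<^sub>R Inv z i) = dd (\<lambda>z. Inv z b) z w"
        by simp
    qed
    ultimately show ?case by simp
  qed
  then show "sm (\<lambda>x. Inv x b)" for b by (simp add: smooth_on_def)
qed

end

end

lemma endo_trace_commute:
  fixes f :: "'a::euclidean_space \<Rightarrow> 'b::euclidean_space" and k :: "'b \<Rightarrow> 'a"
  assumes "linear f" "linear k"
  shows "endo_trace (\<lambda>x. f (k x)) = endo_trace (\<lambda>x. k (f x))"
proof -
  have "endo_trace (\<lambda>x. f (k x)) = (\<Sum>b\<in>Basis. \<Sum>c\<in>Basis. (k b \<bullet> c) * (f c \<bullet> b))"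
    unfolding endo_trace_def
    by (subst linear_sum_Basis[OF assms(1)]) (simp add: inner_sum_left)
  also have "\<dots> = (\<Sum>c\<in>Basis. \<Sum>b\<in>Basis. (f c \<bullet> b) * (k b \<bullet> c))"
    by (subst sum.swap) (simp add: mult.commute)
  also have "\<dots> = endo_trace (\<lambda>x. k (f x))"
    unfolding endo_trace_def
    by (subst linear_sum_Basis[OF assms(2)]) (simp add: inner_sum_left)
  finally show ?thesis .
qed

lemma endo_trace_arith:
  "endo_trace (\<lambda>x. f x + k x) = endo_trace f + endo_trace k"
  "endo_trace (\<lambda>x. f x - k x) = endo_trace f - endo_trace k"
  "endo_trace (\<lambda>x. a *\<^sub>R f x) = a * endo_trace f"
  by (simp_all add: endo_trace_def inner_add_left inner_diff_left sum.distrib sum_subtractf sum_distrib_left)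

section \<open>Homogeneity\<close>

context finsler_chart
begin

lemma N_hom: "(p, y) \<in> U \<Longrightarrow> t > 0 \<Longrightarrow> N (p, t *\<^sub>R y) X = t *\<^sub>R N (p, y) X"
proof -
  assume u: "(p, y) \<in> U" and t: "t > 0"
  have "dd (\<lambda>z. N z X) z (0, snd z) = 1 *\<^sub>R N z X" if "z \<in> U" for z
    using B_y'[OF that, of X] by (simp add: B_def der1_def)
  from euler[OF _ this u t] t show ?thesis by (simp add: calc)
qed

text \<open>The vertical field \<open>y\<close> commutes with \<open>h X\<close> and leaves
  \<open>g\<close> invariant, so the derivative of the metric condition along it makes
  \<open>C X\<close> skew with respect to \<open>g\<close>. Being symmetric in its arguments as
  well, \<open>C\<close> vanishes as in the uniqueness proof of the Levi-Civita connection.\<close>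

lemma Gam_vert_y: "x \<in> U \<Longrightarrow> der2 Gam x (0, snd x) X Y = 0"
proof -
  assume x: "x \<in> U"
  interpret inner_form "g x" using x by (rule g_inner)
  define C where "C X Y = der2 Gam x (0, snd x) X Y" for X Y
  have skew: "g x (C X Y) Z = - g x (C X Z) Y" for X Y Z
  proof -
    have s: "sm (\<lambda>z. g z Y Z)" and hs: "sm (\<lambda>z. h z X)" and ys: "sm (\<lambda>z. (0::'e, snd z))"
      by (simp_all add: calc)
    have 1: "dd (\<lambda>z. dd (\<lambda>z. g z Y Z) z (h z X)) x (0, snd x) = dd (\<lambda>z. g z (Gam z X Y) Z + g z Y (Gam z X Z)) x (0, snd x)"
      by (rule dd_cong_U[OF x]) (simp add: metric der2_def[symmetric])
    have 2: "dd (\<lambda>z. dd (\<lambda>z. g z Y Z) z (0, snd z)) x (h x X) = 0"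
      by (rule dd_const_U[OF x, of _ 0]) (simp add: g_vert_y der2_def[symmetric])
    have 3: "dd (\<lambda>z. h z X) x (0, snd x) - dd (\<lambda>z. (0, snd z)) x (h x X) = 0"
      using x by (simp add: calc der_h B_y' flip: B_def)
    have e: "dd (\<lambda>z. g z (Gam z X Y) Z + g z Y (Gam z X Z)) x (0, snd x) = 0"
      using bracket_fields[OF x s hs ys] unfolding 1 2 3 by (simp add: dd_lin[OF x s])
    have "dd (\<lambda>z. g z (Gam z X Y) Z + g z Y (Gam z X Z)) x (0, snd x) = g x (C X Y) Z + g x Y (C X Z)"
      using x by (simp add: calc g_vert_y C_def)
    with e sym[of Y "C X Z"] show ?thesis by linarith
  qed
  have csym: "C X Y = C Y X" for X Y
    unfolding C_def der2_def
    by (rule arg_cong[where f = "\<lambda>D. D _"], rule dd_cong_open[OF open_U x]) (rule Gam_sym)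
  have z: "g x (C X Y) Z = 0" for X Y Z
  proof -
    have c: "g x (C X Y) Z = g x (C Y X) Z" for X Y Z by (subst csym) (rule refl)
    show ?thesis
      using skew[of X Y Z] skew[of Z X Y] skew[of Y Z X] c[of X Y Z] c[of Z X Y] c[of Y Z X] by linarith
  qed
  show ?thesis using z[of X Y "C X Y"] zero_iff[of "C X Y"] by (simp add: C_def)
qed

lemma Gam_hom: "(p, y) \<in> U \<Longrightarrow> t > 0 \<Longrightarrow> Gam (p, t *\<^sub>R y) X Y = Gam (p, y) X Y"
proof -
  assume u: "(p, y) \<in> U" and t: "t > 0"
  have "dd (\<lambda>z. Gam z X Y) z (0, snd z) = 0 *\<^sub>R Gam z X Y" if "z \<in> U" for z
    using Gam_vert_y[OF that, of X Y] by (simp add: der2_def)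
  from euler[OF _ this u t] t show ?thesis by (simp add: calc)
qed

text \<open>Dimension two or more makes the punctured fibre connected.\<close>

lemma vertical_const:
  assumes f: "sm f" and d: "\<And>x W. x \<in> U \<Longrightarrow> dd f x (0, W) = 0" and dim: "DIM('e) \<ge> 2"
    and u: "(p, y) \<in> U" "(p, y') \<in> U"
  shows "f (p, y) = f (p, y')"
proof (rule has_derivative_zero_unique_connected[where s = "- {0}" and f = "\<lambda>y. f (p, y)" and x = y and y = y'])
  show "open (- {0::'e})" by (simp add: open_Compl)
  show "connected (- {0::'e})" using dim by (rule connected_punctured_universe)
  show "((\<lambda>y. f (p, y)) has_derivative (\<lambda>_. 0)) (at z)" if "z \<in> - {0}" for z
  proof -
    have "(p, z) \<in> U" using u that by (auto simp: U_eq)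
    from dd_vertical[OF this f] d[OF this] show ?thesis by simp
  qed
qed (use u in \<open>auto simp: U_eq\<close>)

end

text \<open>Source of the test vectors in both Schur type arguments below, \<open>dk_vert\<close>
  and \<open>A_perp\<close>; it accounts for the dimension bound there.\<close>

lemma (in inner_form) orthogonal_to_two:
  assumes "DIM('e) \<ge> 3"
  obtains X where "X \<noteq> 0" "g X y = 0" "g X Z = 0"
proof -
  define G where "G v = (\<Sum>b\<in>Basis. g b v *\<^sub>R b)" for v
  have G: "g X v = X \<bullet> G v" for X v
    using linear_sum_Basis[OF lin_left[of v], of X] by (simp add: G_def inner_sum_right mult.commute)
  have "dim {G y, G Z} \<le> card {G y, G Z}" by (rule dim_le_card') simp
  also have "\<dots> \<le> 2" by (simp add: card_insert_le_m1)
  finally have "dim {G y, G Z} < DIM('e)" using assms by simp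
  then obtain X where "X \<noteq> 0" "\<And>v. v \<in> span {G y, G Z} \<Longrightarrow> orthogonal X v"
    using orthogonal_to_subspace_exists[of "{G y, G Z}"] by blast
  then show ?thesis
    using that[of X] by (simp add: G orthogonal_def span_base)
qed

section \<open>Traces of the curvature\<close>

context curved_chart
begin

definition "Ric x X Z = endo_trace (\<lambda>Y. R x X Y Z)"

lemma Ric_lf: "lf2 U Ric"
  unfolding Ric_def endo_trace_def
  by (rule lf2I; (rule linearI)?; simp add: sm_rules calc2 inner_add_left sum.distrib sum_distrib_left)

lemma trace_commutator: "x \<in> U \<Longrightarrow> linear M \<Longrightarrow> endo_trace (\<lambda>Y. Gam x W (M Y)) = endo_trace (\<lambda>Y. M (Gam x W Y))"
  using lf2_D(1)[OF Gam_lf, of W] by (intro endo_trace_commute) (auto simp: lf1_def)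

text \<open>Contraction commutes with covariant differentiation: the connection terms in the
  contracted slot form a commutator, whose trace is zero.\<close>

lemma rec_Ric:
  assumes x: "x \<in> U"
  shows "der2 Ric x (h x W) X Z = A x W * Ric x X Z + Ric x (Gam x W X) Z + Ric x X (Gam x W Z)"
proof -
  have "der2 Ric x (h x W) X Z = endo_trace (\<lambda>Y. der3 R x (h x W) X Y Z)"
  proof -
    have s: "sm (\<lambda>z. R z X b Z)" for b by (simp add: calc2)
    have "der2 Ric x (h x W) X Z = dd (\<lambda>z. \<Sum>b\<in>Basis. R z X b Z \<bullet> b) x (h x W)"
      by (simp add: der2_def Ric_def endo_trace_def)
    also have "\<dots> = (\<Sum>b\<in>Basis. dd (\<lambda>z. R z X b Z \<bullet> b) x (h x W))"
      by (rule dd_sum[OF x]) (intro sm_rules s)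
    also have "\<dots> = endo_trace (\<lambda>Y. der3 R x (h x W) X Y Z)"
      unfolding endo_trace_def der3_def by (intro sum.cong refl dd_inner_const sm_diffble[OF s x])
    finally show ?thesis .
  qed
  also have "(\<lambda>Y. der3 R x (h x W) X Y Z) = (\<lambda>Y. A x W *\<^sub>R R x X Y Z + R x (Gam x W X) Y Z + R x X Y (Gam x W Z)
      + (R x X (Gam x W Y) Z - Gam x W (R x X Y Z)))"
  proof
    show "der3 R x (h x W) X Y Z = A x W *\<^sub>R R x X Y Z + R x (Gam x W X) Y Z + R x X Y (Gam x W Z)
      + (R x X (Gam x W Y) Z - Gam x W (R x X Y Z))" for Y
      using rec_R[OF x, of W X Y Z] by (simp add: algebra_simps)
  qed
  also have "endo_trace \<dots> = A x W * Ric x X Z + Ric x (Gam x W X) Z + Ric x X (Gam x W Z)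
      + (endo_trace (\<lambda>Y. R x X (Gam x W Y) Z) - endo_trace (\<lambda>Y. Gam x W (R x X Y Z)))"
    by (simp add: endo_trace_arith Ric_def)
  also have "endo_trace (\<lambda>Y. R x X (Gam x W Y) Z) = endo_trace (\<lambda>Y. Gam x W (R x X Y Z))"
    by (rule trace_commutator[OF x, symmetric]) (rule linearI; simp add: lf3_lin[OF R_lf x])
  finally show ?thesis by simp
qed

definition "G_mat x w = (\<Sum>b\<in>Basis. g x w b *\<^sub>R b)"

lemma G_mat_lf: "lf1 U G_mat"
  unfolding G_mat_def
  by (rule lf1I; (rule linearI)?; simp add: sm_rules calc scaleR_add_left sum.distrib scaleR_sum_right)

lemma G_mat_inner: "x \<in> U \<Longrightarrow> G_mat x w \<bullet> Z = g x w Z"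
proof -
  assume x: "x \<in> U"
  have "linear (g x w)" using inner_form.lin_right[OF g_inner[OF x]] .
  from linear_sum_Basis[OF this, of Z] show ?thesis
    by (simp add: G_mat_def inner_sum_left mult.commute inner_commute[of Z])
qed

lemma G_mat_inj: "x \<in> U \<Longrightarrow> G_mat x w = 0 \<Longrightarrow> w = 0"
  using G_mat_inner[of x w w] inner_form.zero_iff[OF g_inner, of x w] by simp

text \<open>The Ricci endomorphism in the form that \<open>metric_trace\<close> prescribes;
  \<open>rc_eq\<close> turns the description into a smooth inverse.\<close>

definition "rc x X = (THE w. \<forall>Z. g x w Z = Ric x X Z)"

lemma rc_eq: "x \<in> U \<Longrightarrow> rc x X = Inv G_mat x (\<Sum>b\<in>Basis. Ric x X b *\<^sub>R b)"
  and g_rc: "x \<in> U \<Longrightarrow> g x (rc x X) Z = Ric x X Z"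
proof -
  assume x: "x \<in> U"
  define w where "w = Inv G_mat x (\<Sum>b\<in>Basis. Ric x X b *\<^sub>R b)"
  have "g x w Z = Ric x X Z" for Z
  proof -
    have l: "linear (Ric x X)" using lf2_D(1)[OF Ric_lf, of X] x by (simp add: lf1_def)
    have "g x w Z = (\<Sum>b\<in>Basis. Ric x X b *\<^sub>R b) \<bullet> Z"
      using M_Inv[OF G_mat_lf G_mat_inj x] by (simp add: w_def flip: G_mat_inner[OF x])
    also have "\<dots> = Ric x X Z"
      using linear_sum_Basis[OF l, of Z] by (simp add: inner_sum_left mult.commute inner_commute[of Z])
    finally show ?thesis .
  qed
  moreover have "v = w" if "\<forall>Z. g x v Z = Ric x X Z" for v
    using inner_form.eqI[OF g_inner[OF x], of v w] that calculation by simp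
  ultimately have "rc x X = w" unfolding rc_def by (intro the_equality) auto
  then show "rc x X = Inv G_mat x (\<Sum>b\<in>Basis. Ric x X b *\<^sub>R b)" and "g x (rc x X) Z = Ric x X Z"
    using \<open>\<And>Z. g x w Z = Ric x X Z\<close> by (simp_all add: w_def)
qed

lemma rc_lf: "lf1 U rc"
proof (rule lf1_cong)
  have I: "lf1 U (Inv G_mat)" by (rule Inv_lf[OF G_mat_lf G_mat_inj])
  show "lf1 U (\<lambda>x X. Inv G_mat x (\<Sum>b\<in>Basis. Ric x X b *\<^sub>R b))"
    by (rule lf1I; (rule linearI)?; simp add: sm_rules lf1_rules[OF I] lf2_rules[OF Ric_lf]
        scaleR_add_left sum.distrib scaleR_sum_right[symmetric] flip: scaleR_scaleR)
qed (simp add: rc_eq)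

section \<open>Scalar curvature and concircular tensor\<close>

definition "scal x = endo_trace (rc x)"

lemma scal_sm: "sm scal"
  unfolding scal_def endo_trace_def by (simp add: sm_rules lf1_sm[OF rc_lf])

lemma rec_scal:
  assumes x: "x \<in> U"
  shows "dd scal x (h x W) = A x W * scal x"
proof -
  interpret inner_form "g x" using x by (rule g_inner)
  have e: "der1 rc x (h x W) X = A x W *\<^sub>R rc x X + (rc x (Gam x W X) - Gam x W (rc x X))" for X
  proof (rule eqI)
    fix Z
    have "dd (\<lambda>z. g z (rc z X) Z) x (h x W) = dd (\<lambda>z. Ric z X Z) x (h x W)"
      by (rule dd_cong_U[OF x]) (rule g_rc)
    then have "g x (Gam x W (rc x X)) Z + g x (rc x X) (Gam x W Z) + g x (der1 rc x (h x W) X) Z = der2 Ric x (h x W) X Z"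
      using x by (simp add: calc lf1_rules[OF rc_lf] metric der2_def[of Ric])
    then show "g x (der1 rc x (h x W) X) Z = g x (A x W *\<^sub>R rc x X + (rc x (Gam x W X) - Gam x W (rc x X))) Z"
      by (simp add: rec_Ric[OF x] g_rc[OF x] rules)
  qed
  have "dd scal x (h x W) = endo_trace (der1 rc x (h x W))"
    unfolding scal_def endo_trace_def using x
    by (subst dd_sum) (simp_all add: sm_rules lf1_sm[OF rc_lf] dd_inner_const sm_diffble der1_def)
  also have "der1 rc x (h x W) = (\<lambda>X. A x W *\<^sub>R rc x X + (rc x (Gam x W X) - Gam x W (rc x X)))"
    using e by blast
  also have "endo_trace \<dots> = A x W * scal x + (endo_trace (\<lambda>X. rc x (Gam x W X)) - endo_trace (\<lambda>X. Gam x W (rc x X)))"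
    by (simp add: endo_trace_arith scal_def)
  also have "endo_trace (\<lambda>X. rc x (Gam x W X)) = endo_trace (\<lambda>X. Gam x W (rc x X))"
    using rc_lf x by (intro trace_commutator[OF x, symmetric]) (simp add: lf1_def)
  finally show ?thesis by simp
qed

definition "Conc x X Y Z = R x X Y Z - (scal x / (real DIM('a) * (real DIM('a) - 1))) *\<^sub>R (g x X Z *\<^sub>R Y - g x Y Z *\<^sub>R X)"

lemma Conc_lf: "lf3 U Conc"
  unfolding Conc_def divide_inverse
  by (rule lf3I; (rule linearI)?; simp add: sm_rules scal_sm calc2 algebra_simps)

lemma rec_Conc:
  assumes x: "x \<in> U"
  shows "der3 Conc x (h x W) X Y Z + Gam x W (Conc x X Y Z) - Conc x (Gam x W X) Y Z
      - Conc x X (Gam x W Y) Z - Conc x X Y (Gam x W Z) = A x W *\<^sub>R Conc x X Y Z"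
proof -
  define \<kappa> where "\<kappa> = inverse (real DIM('a) * (real DIM('a) - 1))"
  have C: "Conc z X Y Z = R z X Y Z - (scal z * \<kappa>) *\<^sub>R (g z X Z *\<^sub>R Y - g z Y Z *\<^sub>R X)" for z X Y Z
    by (simp add: Conc_def \<kappa>_def divide_inverse)
  have d: "der3 Conc x (h x W) X Y Z = der3 R x (h x W) X Y Z - (A x W * scal x * \<kappa>) *\<^sub>R (g x X Z *\<^sub>R Y - g x Y Z *\<^sub>R X)
      - (scal x * \<kappa>) *\<^sub>R ((g x (Gam x W X) Z + g x X (Gam x W Z)) *\<^sub>R Y - (g x (Gam x W Y) Z + g x Y (Gam x W Z)) *\<^sub>R X)"
    unfolding der3_def C using x
    by (simp add: calc2 scal_sm rec_scal metric algebra_simps)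
  have r: "der3 R x (h x W) X Y Z = A x W *\<^sub>R R x X Y Z - Gam x W (R x X Y Z) + R x (Gam x W X) Y Z
      + R x X (Gam x W Y) Z + R x X Y (Gam x W Z)"
    using rec_R[OF x, of W X Y Z] by (simp add: algebra_simps)
  show ?thesis
    unfolding d r C using x by (simp add: lf2_lin[OF Gam_lf] algebra_simps)
qed

end

section \<open>Isotropic recurrent charts\<close>

locale isotropic_chart = curved_chart +
  fixes k :: "'a \<times> 'a \<Rightarrow> real"
  assumes dim: "DIM('a) \<ge> 3" and k_sm: "smooth_on U k"
    and iso: "\<And>x X Y Z. x \<in> U \<Longrightarrow> R x X Y Z = k x *\<^sub>R (g x X Z *\<^sub>R Y - g x Y Z *\<^sub>R X)"
    and dk_h: "\<And>x W. x \<in> U \<Longrightarrow> dd k x (h x W) = A x W * k x"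
begin

lemma E_iso: "x \<in> U \<Longrightarrow> E x X Y = k x *\<^sub>R (g x X (snd x) *\<^sub>R Y - g x Y (snd x) *\<^sub>R X)"
  using R_y iso by metis

lemma J_iso: "x \<in> U \<Longrightarrow> J x X = k x *\<^sub>R (g x X (snd x) *\<^sub>R snd x - g x (snd x) (snd x) *\<^sub>R X)"
  by (simp add: J_def E_iso)

text \<open>\<open>T_skew\<close> is tested on \<open>X\<close> orthogonal to \<open>y\<close> and
  \<open>Z\<close> and paired with \<open>X\<close>: the terms in \<open>k\<close> agree on both
  sides, and only the one with the derivative of \<open>k\<close> remains.\<close>

lemma dk_vert: "x \<in> U \<Longrightarrow> dd k x (0, Z) = 0"
proof -
  assume x: "x \<in> U"
  interpret inner_form "g x" using x by (rule g_inner)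
  have T: "T x Z X = dd k x (0, Z) *\<^sub>R (g x X (snd x) *\<^sub>R snd x - g x (snd x) (snd x) *\<^sub>R X)
      + k x *\<^sub>R (g x X Z *\<^sub>R snd x + g x X (snd x) *\<^sub>R Z - (2 * g x Z (snd x)) *\<^sub>R X)" for X Z
  proof -
    have "T x Z X = dd (\<lambda>z. k z *\<^sub>R (g z X (snd z) *\<^sub>R snd z - g z (snd z) (snd z) *\<^sub>R X)) x (0, Z)"
      unfolding T_def der1_def by (rule dd_cong_U[OF x]) (rule J_iso)
    also have "\<dots> = dd k x (0, Z) *\<^sub>R (g x X (snd x) *\<^sub>R snd x - g x (snd x) (snd x) *\<^sub>R X)
      + k x *\<^sub>R (g x X Z *\<^sub>R snd x + g x X (snd x) *\<^sub>R Z - (2 * g x Z (snd x)) *\<^sub>R X)"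
      using x by (simp add: calc k_sm g_vert_y sym[of "snd x" Z] algebra_simps)
    finally show ?thesis .
  qed
  obtain X where X: "X \<noteq> 0" "g x X (snd x) = 0" "g x X Z = 0"
    using orthogonal_to_two[OF dim] by blast
  have s3: "(3::real) *\<^sub>R v = v + v + v" for v :: 'a by (rule scaleR_3)
  have "g x (T x Z X - T x X Z) X = g x (3 *\<^sub>R E x X Z) X" using T_skew[OF x, of Z X] by simp
  then have "dd k x (0, Z) * (g x (snd x) (snd x) * g x X X) = 0"
    using X sym[of Z X] sym[of "snd x" X] sym[of Z "snd x"]
    by (simp add: T E_iso[OF x] rules algebra_simps)
  moreover have "snd x \<noteq> 0" using x by (auto simp: U_eq)
  ultimately show ?thesis using X pos[of X] pos[of "snd x"] by auto
qed

text \<open>Since \<open>k\<close> is constant on fibres, commuting its spray derivative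
  \<open>hh k\<close> with a vertical derivative leaves the horizontal derivative
  \<open>A Z k\<close>.\<close>

lemma a_eq: "x \<in> U \<Longrightarrow> k x \<noteq> 0 \<Longrightarrow> a x Z = A x Z"
proof -
  assume x: "x \<in> U" and k0: "k x \<noteq> 0"
  have hs: "sm (\<lambda>z. h z (snd z))" by (simp add: calc)
  have 1: "dd (\<lambda>z. dd k z (h z (snd z))) x (0, Z) = dd (\<lambda>z. hh z * k z) x (0, Z)"
    by (rule dd_cong_U[OF x]) (simp add: dk_h hh_def)
  have 2: "dd (\<lambda>z. dd k z (0, Z)) x (h x (snd x)) = 0"
    by (rule dd_const_U[OF x, of _ 0]) (rule dk_vert)
  have 3: "dd (\<lambda>z. h z (snd z)) x (0, Z) - dd (\<lambda>_. (0, Z)) x (h x (snd x)) = (0, - N x Z) + h x Z"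
    using x by (simp add: calc der_h B_y flip: B_def)
  have 4: "dd k x ((0, - N x Z) + h x Z) = A x Z * k x"
    using dd_lin(1)[OF x k_sm] by (simp add: dk_vert[OF x] dk_h[OF x])
  have "dd (\<lambda>z. hh z * k z) x (0, Z) = A x Z * k x"
    using bracket_fields[OF x k_sm hs sm_rules(1), of "(0, Z)"] unfolding 1 2 3 4 by simp
  then have "a x Z * k x = A x Z * k x"
    using x by (simp add: dd_rules k_sm hh_sm dk_vert a_def der0_def)
  then show ?thesis using k0 by simp
qed

text \<open>\<open>E_J\<close> for isotropic \<open>E\<close> and \<open>J\<close>, paired with a
  vector \<open>X\<close> orthogonal to \<open>y\<close> and \<open>Y\<close>.\<close>

lemma A_perp: "x \<in> U \<Longrightarrow> k x \<noteq> 0 \<Longrightarrow> g x Y (snd x) = 0 \<Longrightarrow> A x Y = 0"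
proof -
  assume x: "x \<in> U" and k0: "k x \<noteq> 0" and Y: "g x Y (snd x) = 0"
  interpret inner_form "g x" using x by (rule g_inner)
  obtain X where X: "X \<noteq> 0" "g x X (snd x) = 0" "g x X Y = 0"
    using orthogonal_to_two[OF dim] by blast
  have "g x (hh x *\<^sub>R E x X Y) X = g x (a x Y *\<^sub>R J x X - a x X *\<^sub>R J x Y) X"
    using E_J[OF x, of X Y] by simp
  then have "k x * (A x Y * (g x (snd x) (snd x) * g x X X)) = 0"
    using X Y sym[of Y X] sym[of "snd x" X] by (auto simp: E_iso[OF x] J_iso[OF x] a_eq[OF x k0] rules)
  moreover have "snd x \<noteq> 0" using x by (auto simp: U_eq)
  ultimately show ?thesis using X pos[of X] pos[of "snd x"] k0 by auto
qed

theorem A_zero: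
  assumes x: "x \<in> U" and k0: "k x \<noteq> 0"
  shows "A x X = 0"
proof -
  obtain p y where py: "x = (p, y)" by (cases x)
  have dim2: "DIM('a) \<ge> 2" using dim by simp
  \<comment> \<open>The differential of \<open>k\<close> in the base directions. By
    \<open>wA\<close> it is \<open>A\<close> times \<open>k\<close>, and by \<open>wv\<close> it
    does not depend on the point of the fibre.\<close>
  define \<omega> where "\<omega> z X = dd k z (X, 0)" for z X
  have ws: "sm (\<lambda>z. \<omega> z X)" for X unfolding \<omega>_def by (rule smooth_on_dd[OF open_U k_sm])
  have wA: "\<omega> z X = A z X * k z" if z: "z \<in> U" for z X
    using dd_lin(1)[OF z k_sm, of "h z X" "(0, N z X)"] by (simp add: \<omega>_def h_eq dk_vert[OF z] flip: dk_h[OF z, unfolded h_eq])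
  have wv: "dd (\<lambda>z. \<omega> z X) z (0, W) = 0" if z: "z \<in> U" for z X W
  proof -
    have "dd (\<lambda>z. \<omega> z X) z (0, W) = dd (\<lambda>z. dd k z (0, W)) z (X, 0)"
      unfolding \<omega>_def by (rule dd_dd_commute[OF open_U z k_sm])
    also have "\<dots> = 0" by (rule dd_const_U[OF z, of _ 0]) (rule dk_vert)
    finally show ?thesis .
  qed
  have wc: "\<omega> (p, y') X = \<omega> x X" if "y' \<noteq> 0" for y' X
    using vertical_const[OF ws wv dim2, of p y' y X] that x by (auto simp: py U_eq)
  have kc: "k (p, y') = k x" if "y' \<noteq> 0" for y'
    using vertical_const[OF k_sm dk_vert dim2, of p y' y] that x by (auto simp: py U_eq)
  have wl: "\<omega> x (u + v) = \<omega> x u + \<omega> x v" "\<omega> x (c *\<^sub>R u) = c * \<omega> x u" for u v c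
    using wA[OF x] lf1_lin[OF A_lf x] by (simp_all add: algebra_simps)
  interpret gx: inner_form "g x" using x by (rule g_inner)
  define w where "w = (\<Sum>b\<in>Basis. \<omega> x b *\<^sub>R b)"
  have ww: "\<omega> x v = v \<bullet> w" for v
    using linear_sum_Basis[of "\<omega> x" v] wl by (simp add: linear_iff w_def inner_sum_right mult.commute)
  \<comment> \<open>The new direction \<open>y'\<close> lies in the kernel of the differential of
    \<open>k\<close>. With it, \<open>X\<close> splits into a multiple of \<open>y'\<close> and a
    part orthogonal to \<open>y'\<close>, to which \<open>A_perp\<close> at \<open>(p, y')\<close>
    applies.\<close>
  obtain y' where y': "y' \<noteq> 0" "w \<bullet> y' = 0"
    using orthogonal_to_vector_exists[of w] dim by (auto simp: orthogonal_def)
  have z: "(p, y') \<in> U" using x y' by (auto simp: py U_eq)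
  interpret inner_form "g (p, y')" using z by (rule g_inner)
  define c where "c = g (p, y') X y' / g (p, y') y' y'"
  have "A (p, y') (X - c *\<^sub>R y') = 0"
  proof (rule A_perp[OF z])
    show "k (p, y') \<noteq> 0" using kc y' k0 by simp
    show "g (p, y') (X - c *\<^sub>R y') (snd (p, y')) = 0" using pos[OF y'(1)] by (simp add: rules c_def)
  qed
  then have "\<omega> (p, y') (X - c *\<^sub>R y') = 0" using wA[OF z] by simp
  then have "\<omega> x (X - c *\<^sub>R y') = 0" using wc y' by simp
  then have "\<omega> x X = 0" using y' inner_commute[of w y'] by (simp add: ww inner_diff_left)
  then show ?thesis using wA[OF x] k0 by simp
qed

lemma dk_zero: "x \<in> U \<Longrightarrow> dd k x w = 0"
proof -
  assume x: "x \<in> U"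
  obtain X W where w: "w = (X, W)" by (cases w)
  have "dd k x w = dd k x (h x X) + dd k x (0, W + N x X)"
    using dd_lin(1)[OF x k_sm, of "h x X" "(0, W + N x X)"] by (simp add: h_eq w)
  then show ?thesis using A_zero[OF x] by (cases "k x = 0") (simp_all add: dk_h[OF x] dk_vert[OF x])
qed

end

section \<open>Tangent vectors in charts\<close>

locale smooth_mfd =
  fixes C :: "('p, 'e::euclidean_space) atlas"
  assumes atlas: "smooth_atlas C"
begin

definition trans :: "('p, 'e) chart \<Rightarrow> ('p, 'e) chart \<Rightarrow> 'e \<Rightarrow> 'e" where
  "trans c d = snd d \<circ> chart_inv c"

definition img :: "('p, 'e) chart \<Rightarrow> 'p set \<Rightarrow> 'e set" where
  "img c W = snd c ` (W \<inter> fst c)"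

lemma inj_chart: "c \<in> C \<Longrightarrow> inj_on (snd c) (fst c)"
  using atlas by (simp add: smooth_atlas_def)

lemma inv_chart [simp]: "c \<in> C \<Longrightarrow> p \<in> fst c \<Longrightarrow> chart_inv c (snd c p) = p"
  using inj_chart by (simp add: chart_inv_def)

lemma chart_inv_in: "c \<in> C \<Longrightarrow> x \<in> img c W \<Longrightarrow> chart_inv c x \<in> W \<and> chart_inv c x \<in> fst c \<and> snd c (chart_inv c x) = x"
  by (auto simp: img_def)

lemma img_mem: "p \<in> W \<Longrightarrow> p \<in> fst c \<Longrightarrow> snd c p \<in> img c W"
  by (auto simp: img_def)

lemma open_overlap: "c \<in> C \<Longrightarrow> d \<in> C \<Longrightarrow> open (img c (fst d))"
  using atlas by (simp add: smooth_atlas_def img_def Int_commute)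

lemma smooth_trans: "c \<in> C \<Longrightarrow> d \<in> C \<Longrightarrow> smooth_on (img c (fst d)) (trans c d)"
  using atlas by (simp add: smooth_atlas_def img_def trans_def Int_commute)

lemma openin_iff: "openin (atlas_topology C) W \<longleftrightarrow> W \<subseteq> carrier_of C \<and> (\<forall>c\<in>C. open (img c W))"
  using openin_atlas_topology[OF atlas] by (simp add: img_def)

lemma open_img: "openin (atlas_topology C) W \<Longrightarrow> c \<in> C \<Longrightarrow> open (img c W)"
  by (simp add: openin_iff)

lemma openin_chart: "c \<in> C \<Longrightarrow> openin (atlas_topology C) (fst c)"
  by (auto simp: openin_iff carrier_of_def open_overlap)

lemma openin_carrier: "openin (atlas_topology C) (carrier_of C)"
proof -
  have "img c (carrier_of C) = img c (fst c)" if "c \<in> C" for c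
    using that by (auto simp: img_def carrier_of_def)
  then show ?thesis by (auto simp: openin_iff open_overlap)
qed

lemma in_carrier: "c \<in> C \<Longrightarrow> p \<in> fst c \<Longrightarrow> p \<in> carrier_of C"
  by (auto simp: carrier_of_def)

lemma chart_at_in: "p \<in> carrier_of C \<Longrightarrow> chart_at C p \<in> C \<and> p \<in> fst (chart_at C p)"
  unfolding chart_at_def by (rule someI_ex) (auto simp: carrier_of_def)

lemmas chart_atD = chart_at_in[THEN conjunct1] chart_at_in[THEN conjunct2]

lemma trans_diffble: "c \<in> C \<Longrightarrow> d \<in> C \<Longrightarrow> p \<in> fst c \<Longrightarrow> p \<in> fst d \<Longrightarrow> trans c d differentiable (at (snd c p))"
  by (rule smooth_on_diffble[OF open_overlap smooth_trans]) (auto intro: img_mem)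

lemma trans_chart [simp]: "c \<in> C \<Longrightarrow> p \<in> fst c \<Longrightarrow> trans c d (snd c p) = snd d p"
  by (simp add: trans_def)

definition tr :: "('p, 'e) chart \<Rightarrow> ('p, 'e) chart \<Rightarrow> 'p \<Rightarrow> 'e \<Rightarrow> 'e" where
  "tr c d p w = dd (trans c d) (snd c p) w"

lemma tr_linear: "c \<in> C \<Longrightarrow> d \<in> C \<Longrightarrow> p \<in> fst c \<Longrightarrow> p \<in> fst d \<Longrightarrow> linear (tr c d p)"
  unfolding tr_def using linear_frechet_derivative[OF trans_diffble] by simp

lemma tr_tr:
  assumes "c \<in> C" "d \<in> C" "e \<in> C" "p \<in> fst c" "p \<in> fst d" "p \<in> fst e"
  shows "tr d e p (tr c d p w) = tr c e p w"
proof -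
  have o: "open (img c (fst d) \<inter> img c (fst e))" using assms open_overlap by blast
  have m: "snd c p \<in> img c (fst d) \<inter> img c (fst e)" using assms by (simp add: img_mem)
  have "((\<lambda>x. trans d e (trans c d x)) has_derivative (\<lambda>w. dd (trans d e) (snd d p) (dd (trans c d) (snd c p) w))) (at (snd c p))"
  proof -
    have 1: "(trans c d has_derivative dd (trans c d) (snd c p)) (at (snd c p))"
      by (rule dd_works[OF trans_diffble[OF assms(1,2,4,5)]])
    have 2: "(trans d e has_derivative dd (trans d e) (snd d p)) (at (trans c d (snd c p)))"
      unfolding trans_chart[OF assms(1,4)] by (rule dd_works[OF trans_diffble[OF assms(2,3,5,6)]])
    show ?thesis by (rule has_derivative_compose[OF 1 2])
  qed
  moreover have "trans d e (trans c d x) = trans c e x" if "x \<in> img c (fst d) \<inter> img c (fst e)" for x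
    using that chart_inv_in[OF assms(1)] assms by (auto simp: trans_def)
  ultimately have "(trans c e has_derivative (\<lambda>w. dd (trans d e) (snd d p) (dd (trans c d) (snd c p) w))) (at (snd c p))"
    by (rule has_derivative_transform_within_open[OF _ o m])
  then show ?thesis by (simp add: tr_def dd_eq)
qed

lemma tr_self:
  assumes "c \<in> C" "p \<in> fst c"
  shows "tr c c p w = w"
proof -
  have "dd (trans c c) (snd c p) w = dd (\<lambda>x. x) (snd c p) w"
    by (rule fun_cong, rule dd_cong_open[OF open_overlap[OF assms(1,1)]])
       (use assms chart_inv_in[OF assms(1)] in \<open>auto simp: img_mem trans_def\<close>)
  then show ?thesis by (simp add: tr_def)
qed

lemma comps_tr: "comps C c p v = tr (chart_at C p) c p v"
  by (simp add: comps_def dir_def tr_def trans_def)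

lemma of_comps_tr: "of_comps C c p w = tr c (chart_at C p) p w"
  by (simp add: of_comps_def tr_def trans_def)

context
  fixes c p assumes c: "c \<in> C" "p \<in> fst c"
begin

lemma comps_of_comps [simp]: "comps C c p (of_comps C c p w) = w"
  using c chart_atD[OF in_carrier[OF c]] by (simp add: comps_tr of_comps_tr tr_tr tr_self)

lemma of_comps_comps [simp]: "of_comps C c p (comps C c p w) = w"
  using c chart_atD[OF in_carrier[OF c]] by (simp add: comps_tr of_comps_tr tr_tr tr_self)

lemma comps_change: "d \<in> C \<Longrightarrow> p \<in> fst d \<Longrightarrow> comps C d p w = tr c d p (comps C c p w)"
  using c chart_atD[OF in_carrier[OF c]] by (simp add: comps_tr of_comps_tr tr_tr)

lemma linear_comps: "linear (comps C c p)" and linear_of_comps: "linear (of_comps C c p)"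
proof -
  note ca = chart_atD[OF in_carrier[OF c]]
  have "comps C c p = tr (chart_at C p) c p" "of_comps C c p = tr c (chart_at C p) p"
    by (rule ext, simp add: comps_tr of_comps_tr)+
  then show "linear (comps C c p)" "linear (of_comps C c p)"
    using tr_linear[OF ca(1) c(1) ca(2) c(2)] tr_linear[OF c(1) ca(1) c(2) ca(2)] by simp_all
qed

lemma dir_chart:
  assumes S: "open S" "snd c p \<in> S" "S \<subseteq> img c UNIV" and f: "\<And>x. x \<in> S \<Longrightarrow> f (chart_inv c x) = F x"
    and F: "F differentiable (at (snd c p))"
  shows "dir C f p v = dd F (snd c p) (comps C c p v)"
proof -
  define c0 where "c0 = chart_at C p"
  have c0: "c0 \<in> C" "p \<in> fst c0" using chart_atD[OF in_carrier[OF c]] by (auto simp: c0_def)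
  have "((\<lambda>x. F (trans c0 c x)) has_derivative (\<lambda>w. dd F (snd c p) (dd (trans c0 c) (snd c0 p) w))) (at (snd c0 p))"
  proof -
    have 1: "(trans c0 c has_derivative dd (trans c0 c) (snd c0 p)) (at (snd c0 p))"
      by (rule dd_works[OF trans_diffble[OF c0(1) c(1) c0(2) c(2)]])
    have 2: "(F has_derivative dd F (snd c p)) (at (trans c0 c (snd c0 p)))"
      unfolding trans_chart[OF c0] by (rule dd_works[OF F])
    show ?thesis by (rule has_derivative_compose[OF 1 2])
  qed
  moreover define V where "V = {x \<in> img c0 (fst c). trans c0 c x \<in> S}"
  have "open V"
  proof -
    have "V = img c0 (fst c) \<inter> trans c0 c -` S" by (auto simp: V_def)
    then show ?thesis
      using continuous_open_preimage[OF smooth_on_cont[OF open_overlap smooth_trans] open_overlap S(1), OF c0(1) c(1) c0(1) c(1) c0(1) c(1)]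
      by (simp only:)
  qed
  moreover have "snd c0 p \<in> V" using c c0 S by (simp add: V_def img_mem)
  moreover have "F (trans c0 c x) = (f \<circ> chart_inv c0) x" if "x \<in> V" for x
  proof -
    have "chart_inv c0 x \<in> fst c" using that chart_inv_in[OF c0(1)] by (auto simp: V_def)
    then show ?thesis
      using f[of "trans c0 c x"] that c by (simp add: V_def trans_def)
  qed
  ultimately have "((f \<circ> chart_inv c0) has_derivative (\<lambda>w. dd F (snd c p) (dd (trans c0 c) (snd c0 p) w))) (at (snd c0 p))"
    by (rule has_derivative_transform_within_open)
  then show ?thesis
    by (simp add: dir_def c0_def[symmetric] dd_eq comps_tr tr_def)
qed

text \<open>The bracket is defined in the chart chosen at \<open>p\<close>, where the components of
  a field are the derivative of the transition map applied to those in \<open>c\<close>.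
  \<open>bracket_fields\<close> for the transition map removes its second derivatives.\<close>

lemma bracket_chart:
  assumes S: "open S" "snd c p \<in> S" "S \<subseteq> img c UNIV"
    and X: "smooth_on S (\<lambda>x. comps C c (chart_inv c x) (X (chart_inv c x)))" (is "smooth_on S ?X")
    and Y: "smooth_on S (\<lambda>x. comps C c (chart_inv c x) (Y (chart_inv c x)))" (is "smooth_on S ?Y")
  shows "comps C c p (bracket C X Y p) = dd ?Y (snd c p) (?X (snd c p)) - dd ?X (snd c p) (?Y (snd c p))"
proof -
  define c0 where "c0 = chart_at C p"
  have c0: "c0 \<in> C" "p \<in> fst c0" using chart_atD[OF in_carrier[OF c]] by (auto simp: c0_def)
  define S' where "S' = S \<inter> img c (fst c0)"
  have S': "open S'" "snd c p \<in> S'" "S' \<subseteq> img c UNIV"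
    using S open_overlap[OF c(1) c0(1)] c c0 by (auto simp: S'_def img_mem)
  interpret smooth_domain S' by unfold_locales (rule S')
  have t: "smooth_on S' (trans c c0)" using smooth_on_subset[OF smooth_trans[OF c(1) c0(1)]] by (simp add: S'_def)
  have d: "dir C (\<lambda>q. comps C c0 q (Z q)) p v = dd (\<lambda>x. dd (trans c c0) x (comps C c (chart_inv c x) (Z (chart_inv c x)))) (snd c p) (comps C c p v)"
    if "smooth_on S (\<lambda>x. comps C c (chart_inv c x) (Z (chart_inv c x)))" for Z v
  proof (rule dir_chart[OF S'])
    show "comps C c0 (chart_inv c x) (Z (chart_inv c x)) = dd (trans c c0) x (comps C c (chart_inv c x) (Z (chart_inv c x)))"
      if "x \<in> S'" for x
    proof -
      have q: "chart_inv c x \<in> fst c" "chart_inv c x \<in> fst c0" "snd c (chart_inv c x) = x"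
        using that chart_inv_in[OF c(1)] by (auto simp: S'_def)
      show ?thesis
        using q comps_tr tr_tr[of "chart_at C (chart_inv c x)" c c0 "chart_inv c x"] c c0 chart_atD[OF in_carrier[OF c(1) q(1)]]
        by (simp add: tr_def)
    qed
    show "(\<lambda>x. dd (trans c c0) x (comps C c (chart_inv c x) (Z (chart_inv c x)))) differentiable (at (snd c p))"
      using smooth_on_diffble[OF S'(1) smooth_on_dd_field[OF S'(1) t smooth_on_subset[OF that]] S'(2)] by (simp add: S'_def)
  qed
  have "bracket C X Y p = dd (trans c c0) (snd c p) (dd ?Y (snd c p) (?X (snd c p)) - dd ?X (snd c p) (?Y (snd c p)))"
    unfolding bracket_def c0_def[symmetric] d[OF X] d[OF Y]
    using bracket_fields[OF S'(2) t smooth_on_subset[OF Y] smooth_on_subset[OF X]] c by (simp add: S'_def)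
  also have "\<dots> = of_comps C c p (dd ?Y (snd c p) (?X (snd c p)) - dd ?X (snd c p) (?Y (snd c p)))"
    by (simp add: of_comps_tr tr_def c0_def)
  finally show ?thesis by simp
qed

end

lemma smooth_transfer:
  fixes G :: "'p \<Rightarrow> 'b::real_normed_vector"
  assumes c: "c \<in> C" and d: "d \<in> C" and W: "openin (atlas_topology C) W" "W \<subseteq> fst c"
    and G: "smooth_on (img c (W \<inter> fst d)) (\<lambda>x. G (chart_inv c x))"
  shows "smooth_on (img d W) (\<lambda>x. G (chart_inv d x))"
proof -
  have o: "open (img d W)" "open (img c (W \<inter> fst d))"
    using open_img[OF openin_Int[OF W(1) openin_chart[OF d]] c] open_img[OF W(1) d] by auto
  have m: "trans d c x \<in> img c (W \<inter> fst d)" "chart_inv c (trans d c x) = chart_inv d x" "x \<in> img d (fst c)"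
    if "x \<in> img d W" for x
    using chart_inv_in[OF d that] c W(2) img_mem[of "chart_inv d x" "fst c" d]
      img_mem[of "chart_inv d x" "W \<inter> fst d" c] by (auto simp: trans_def)
  have "smooth_on (img d W) (\<lambda>x. G (chart_inv c (trans d c x)))"
  proof (rule smooth_on_compose[OF o _ _ G])
    show "trans d c ` img d W \<subseteq> img c (W \<inter> fst d)" using m(1) by blast
    show "smooth_on (img d W) (trans d c)"
      by (rule smooth_on_subset[OF smooth_trans[OF d c]]) (use m(3) in blast)
  qed
  then show ?thesis by (rule smooth_on_cong[OF o(1)]) (simp add: m(2))
qed

lemma img_subset: "V \<subseteq> W \<Longrightarrow> img c V \<subseteq> img c W"
  by (auto simp: img_def)

lemma smooth_funI:
  assumes "c \<in> C" "openin (atlas_topology C) W" "W \<subseteq> fst c" "smooth_on (img c W) (\<lambda>x. f (chart_inv c x))"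
  shows "smooth_fun C W f"
  unfolding smooth_fun_def
proof
  fix d assume d: "d \<in> C"
  have "smooth_on (img d W) (\<lambda>x. f (chart_inv d x))"
    by (rule smooth_transfer[OF assms(1) d assms(2,3)], rule smooth_on_subset[OF assms(4)]) (simp add: img_subset)
  then show "smooth_on (snd d ` (W \<inter> fst d)) (f \<circ> chart_inv d)" by (simp add: img_def o_def)
qed

lemma smooth_funD: "smooth_fun C W f \<Longrightarrow> c \<in> C \<Longrightarrow> smooth_on (img c W) (\<lambda>x. f (chart_inv c x))"
  by (simp add: smooth_fun_def img_def o_def)

lemma smooth_change_comps:
  assumes c: "c \<in> C" and d: "d \<in> C" and W: "openin (atlas_topology C) W" "W \<subseteq> fst c"
    and X: "smooth_on (img c W) (\<lambda>x. comps C c (chart_inv c x) (X (chart_inv c x)))"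
  shows "smooth_on (img d W) (\<lambda>x. comps C d (chart_inv d x) (X (chart_inv d x)))"
proof (rule smooth_transfer[OF c d W])
  let ?S = "img c (W \<inter> fst d)"
  have S: "open ?S" by (rule open_img[OF openin_Int[OF W(1) openin_chart[OF d]] c])
  have "smooth_on ?S (\<lambda>x. dd (trans c d) x (comps C c (chart_inv c x) (X (chart_inv c x))))"
    by (intro smooth_on_dd_field[OF S] smooth_on_subset[OF smooth_trans[OF c d]] smooth_on_subset[OF X] img_subset) auto
  then show "smooth_on ?S (\<lambda>x. comps C d (chart_inv c x) (X (chart_inv c x)))"
  proof (rule smooth_on_cong[OF S])
    fix x assume "x \<in> ?S"
    then have q: "chart_inv c x \<in> fst c" "chart_inv c x \<in> fst d" "snd c (chart_inv c x) = x"
      using chart_inv_in[OF c] by auto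
    show "dd (trans c d) x (comps C c (chart_inv c x) (X (chart_inv c x))) = comps C d (chart_inv c x) (X (chart_inv c x))"
      using comps_change[OF c q(1) d q(2)] q(3) by (simp add: tr_def)
  qed
qed

lemma smooth_vfI:
  assumes c: "c \<in> C" and W: "openin (atlas_topology C) W" "W \<subseteq> fst c"
    and X: "smooth_on (img c W) (\<lambda>x. comps C c (chart_inv c x) (X (chart_inv c x)))"
  shows "smooth_vf C W X"
  using smooth_change_comps[OF c _ W X] by (simp add: smooth_vf_def img_def o_def)

end

section \<open>The slit tangent bundle\<close>

lemma smooth_on_slit_trans:
  fixes f :: "'e::euclidean_space \<Rightarrow> 'e"
  assumes V: "open V" and f: "smooth_on V f"
  shows "smooth_on (V \<times> (- {0})) (\<lambda>z. (f (fst z), dd f (fst z) (snd z)))"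
proof -
  let ?U = "V \<times> (- {0::'e})"
  have U: "open ?U" using V by (simp add: open_Times open_Compl)
  interpret smooth_domain ?U by unfold_locales (rule U)
  have fs: "smooth_on ?U (\<lambda>z. F (fst z))" if "smooth_on V F" for F :: "'e \<Rightarrow> 'e"
    by (rule smooth_on_compose[OF U V _ _ that]) (auto intro: sm_rules)
  have "smooth_on ?U (\<lambda>z. \<Sum>b\<in>Basis. (snd z \<bullet> b) *\<^sub>R dd f (fst z) b)"
    by (intro sm_rules fs smooth_on_dd[OF V f])
  then have "smooth_on ?U (\<lambda>z. dd f (fst z) (snd z))"
    by (rule smooth_on_cong[OF U]) (auto simp: dd_sum_Basis[symmetric] smooth_on_diffble[OF V f])
  then show ?thesis by (intro smooth_on_Pair[OF U] fs f)
qed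

locale base_mfd = smooth_mfd C for C :: "('m, 'e::euclidean_space) atlas"
begin

abbreviation sc :: "('m, 'e) chart \<Rightarrow> ('m \<times> 'e, 'e \<times> 'e) chart" where "sc \<equiv> slit_chart C"

lemma fst_sc: "fst (sc c) = fst c \<times> (- {0})"
  by (auto simp: slit_chart_def)

lemma snd_sc: "snd (sc c) = (\<lambda>(p, y). (snd c p, comps C c p y))"
  by (simp add: slit_chart_def)

lemma comps_zero_iff: "c \<in> C \<Longrightarrow> p \<in> fst c \<Longrightarrow> comps C c p y = 0 \<longleftrightarrow> y = 0"
  by (metis linear_0 linear_comps linear_of_comps of_comps_comps)

lemma inj_sc: "c \<in> C \<Longrightarrow> inj_on (snd (sc c)) (fst (sc c))"
proof (rule inj_onI)
  fix u v assume c: "c \<in> C" and uv: "u \<in> fst (sc c)" "v \<in> fst (sc c)" "snd (sc c) u = snd (sc c) v"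
  then have p: "fst u \<in> fst c" "fst v \<in> fst c" by (auto simp: fst_sc)
  have e: "snd c (fst u) = snd c (fst v)" "comps C c (fst u) (snd u) = comps C c (fst v) (snd v)"
    using uv(3) by (auto simp: snd_sc split: prod.splits)
  have "fst u = fst v" by (rule inj_onD[OF inj_chart[OF c] e(1) p])
  moreover have "of_comps C c (fst u) (comps C c (fst u) (snd u)) = of_comps C c (fst v) (comps C c (fst v) (snd v))"
    using e(2) calculation by simp
  then have "snd u = snd v" using c p by simp
  ultimately show "u = v" by (simp add: prod_eq_iff)
qed

lemma sc_image:
  assumes c: "c \<in> C" and "V \<subseteq> fst c"
  shows "snd (sc c) ` (V \<times> (- {0})) = (snd c ` V) \<times> (- {0::'e})"
proof (intro equalityI subsetI)
  fix z assume "z \<in> snd c ` V \<times> (- {0::'e})"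
  then obtain p w where z: "z = (snd c p, w)" and p: "p \<in> V" and w: "w \<noteq> 0" by auto
  then have q: "p \<in> fst c" using assms by auto
  have "snd (sc c) (p, of_comps C c p w) = (snd c p, w)" using q c by (simp add: snd_sc)
  moreover have "of_comps C c p w \<noteq> 0" using w comps_of_comps[OF c q, of w] linear_0[OF linear_comps[OF c q]] by auto
  ultimately show "z \<in> snd (sc c) ` (V \<times> (- {0}))"
    using p by (intro image_eqI[of _ _ "(p, of_comps C c p w)"]) (auto simp: z)
next
  fix z assume "z \<in> snd (sc c) ` (V \<times> (- {0}))"
  then show "z \<in> snd c ` V \<times> (- {0::'e})"
    using assms(2) comps_zero_iff[OF c] by (fastforce simp: snd_sc)
qed

lemma inv_sc:
  assumes c: "c \<in> C" and x: "x \<in> snd c ` fst c" and w: "w \<noteq> 0"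
  shows "chart_inv (sc c) (x, w) = (chart_inv c x, of_comps C c (chart_inv c x) w)"
proof -
  obtain p where p: "p \<in> fst c" "x = snd c p" using x by auto
  have "of_comps C c p w \<noteq> 0" using w comps_of_comps[OF c p(1), of w] linear_0[OF linear_comps[OF c p(1)]] by auto
  moreover have "snd (sc c) (p, of_comps C c p w) = (x, w)" using p c by (simp add: snd_sc)
  ultimately show ?thesis
    using inj_sc[OF c] p c unfolding chart_inv_def[of "sc c"] by (intro inv_into_f_eq) (auto simp: fst_sc)
qed

lemma fst_sc_Int: "fst (sc c) \<inter> fst (sc d) = (fst c \<inter> fst d) \<times> (- {0})"
  by (auto simp: fst_sc)

lemma sc_trans:
  assumes c: "c \<in> C" and d: "d \<in> C" and z: "z \<in> snd (sc c) ` (fst (sc c) \<inter> fst (sc d))"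
  shows "snd (sc d) (chart_inv (sc c) z) = (trans c d (fst z), dd (trans c d) (fst z) (snd z))"
proof -
  obtain p y where u: "p \<in> fst c" "p \<in> fst d" "y \<noteq> 0" "z = snd (sc c) (p, y)"
    using z by (auto simp: fst_sc)
  have "chart_inv (sc c) z = (p, y)" using inj_sc[OF c] u by (simp add: chart_inv_def fst_sc)
  then show ?thesis
    using u c comps_change[OF c u(1) d u(2), of y] by (simp add: snd_sc tr_def)
qed

lemma slit_atlas: "smooth_atlas (slit C)"
  unfolding smooth_atlas_def slit_def
proof (intro conjI ballI)
  show "inj_on (snd c) (fst c)" if "c \<in> sc ` C" for c using that inj_sc by auto
  fix c' d' assume "c' \<in> sc ` C" "d' \<in> sc ` C"
  then obtain c d where c: "c \<in> C" and d: "d \<in> C" and e: "c' = sc c" "d' = sc d" by blast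
  have i: "snd (sc c) ` (fst (sc c) \<inter> fst (sc d)) = img c (fst d) \<times> (- {0})"
    using sc_image[OF c, of "fst c \<inter> fst d"] by (simp add: fst_sc_Int img_def Int_commute)
  have o: "open (snd (sc c) ` (fst (sc c) \<inter> fst (sc d)))"
    unfolding i using open_overlap[OF c d] by (simp add: open_Times open_Compl)
  moreover have "smooth_on (snd (sc c) ` (fst (sc c) \<inter> fst (sc d))) (snd (sc d) \<circ> chart_inv (sc c))"
  proof (rule smooth_on_cong[OF o])
    show "smooth_on (snd (sc c) ` (fst (sc c) \<inter> fst (sc d))) (\<lambda>z. (trans c d (fst z), dd (trans c d) (fst z) (snd z)))"
      unfolding i by (rule smooth_on_slit_trans[OF open_overlap[OF c d] smooth_trans[OF c d]])
  qed (simp add: sc_trans[OF c d])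
  ultimately show "open (snd c' ` (fst c' \<inter> fst d'))" "smooth_on (snd c' ` (fst c' \<inter> fst d')) (snd d' \<circ> chart_inv c')"
    by (simp_all add: e)
qed

sublocale S: smooth_mfd "slit C"
  by unfold_locales (rule slit_atlas)

lemma sc_in: "c \<in> C \<Longrightarrow> sc c \<in> slit C"
  by (simp add: slit_def)

lemma TM0_eq: "u \<in> TM0 C \<longleftrightarrow> fst u \<in> carrier_of C \<and> snd u \<noteq> 0"
  by (cases u) (auto simp: carrier_of_def slit_def fst_sc)

definition dom :: "('m, 'e) chart \<Rightarrow> ('e \<times> 'e) set" where
  "dom c = (snd c ` fst c) \<times> (- {0})"

definition pt :: "('m, 'e) chart \<Rightarrow> 'e \<times> 'e \<Rightarrow> 'm \<times> 'e" where
  "pt c = chart_inv (sc c)"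

definition co :: "('m, 'e) chart \<Rightarrow> 'm \<times> 'e \<Rightarrow> 'e \<times> 'e" where
  "co c = snd (sc c)"

context
  fixes c assumes c: "c \<in> C"
begin

lemma open_base: "open (snd c ` fst c)"
  using open_overlap[OF c c] by (simp add: img_def)

lemma open_dom: "open (dom c)"
  unfolding dom_def using open_base by (simp add: open_Times open_Compl)

lemma img_sc: "S.img (sc c) (fst (sc c)) = dom c" "S.img (sc c) UNIV = dom c" "W \<subseteq> fst (sc c) \<Longrightarrow> S.img (sc c) W = co c ` W"
  using sc_image[OF c, of "fst c"] by (auto simp: S.img_def dom_def fst_sc co_def)

lemma pt_co: "u \<in> fst (sc c) \<Longrightarrow> pt c (co c u) = u"
  using S.inv_chart[OF sc_in[OF c]] by (simp add: pt_def co_def)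

lemma co_dom: "u \<in> fst (sc c) \<Longrightarrow> co c u \<in> dom c"
  using S.img_mem[of u UNIV "sc c"] by (simp add: img_sc co_def)

lemma pt_dom: "z \<in> dom c \<Longrightarrow> pt c z \<in> fst (sc c)" "z \<in> dom c \<Longrightarrow> co c (pt c z) = z"
  using S.chart_inv_in[OF sc_in[OF c], of z UNIV] by (simp_all add: img_sc pt_def co_def)

lemma fst_pt: "z \<in> dom c \<Longrightarrow> fst (pt c z) \<in> fst c \<and> snd c (fst (pt c z)) = fst z"
  using pt_dom[of z] by (cases "pt c z") (auto simp: fst_sc co_def snd_sc)

lemma snd_pt: "z \<in> dom c \<Longrightarrow> comps C c (fst (pt c z)) (snd (pt c z)) = snd z"
  using pt_dom[of z] by (cases "pt c z") (auto simp: co_def snd_sc)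

lemma pt_eq: "z \<in> dom c \<Longrightarrow> pt c z = (chart_inv c (fst z), of_comps C c (chart_inv c (fst z)) (snd z))"
  by (cases z) (auto simp: pt_def dom_def intro!: inv_sc[OF c])

lemma fst_sc_TM0: "u \<in> fst (sc c) \<Longrightarrow> u \<in> TM0 C \<and> fst u \<in> fst c"
  using S.in_carrier[OF sc_in[OF c]] by (auto simp: fst_sc)

lemma openin_sc: "openin (atlas_topology (slit C)) (fst (sc c))"
  by (rule S.openin_chart[OF sc_in[OF c]])

abbreviation "comps2 \<equiv> comps (slit C) (sc c)"
abbreviation "of_comps2 \<equiv> of_comps (slit C) (sc c)"

lemma rho_chart:
  assumes u: "u \<in> fst (sc c)"
  shows "comps C c (fst u) (rho C u \<xi>) = fst (comps2 u \<xi>)"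
proof -
  define d where "d = chart_at C (fst u)"
  have p: "fst u \<in> fst c" using u by (auto simp: fst_sc)
  have d: "d \<in> C" "fst u \<in> fst d" using chart_atD[OF in_carrier[OF c p]] by (auto simp: d_def)
  have z: "co c u = (snd c (fst u), comps C c (fst u) (snd u))" by (cases u) (simp add: co_def snd_sc)
  let ?S = "img c (fst d) \<times> (- {0::'e})"
  have D: "((\<lambda>z. trans c d (fst z)) has_derivative (\<lambda>w. dd (trans c d) (snd c (fst u)) (fst w))) (at (snd (sc c) u))"
  proof -
    have 1: "(fst has_derivative fst) (at (snd (sc c) u))" by (rule has_derivative_fst[OF has_derivative_ident])
    have 2: "(trans c d has_derivative dd (trans c d) (snd c (fst u))) (at (fst (snd (sc c) u)))"
      using dd_works[OF trans_diffble[OF c d(1) p d(2)]] z by (simp add: co_def)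
    show ?thesis by (rule has_derivative_compose[OF 1 2])
  qed
  have "dir (slit C) (snd d \<circ> fst) u \<xi> = dd (\<lambda>z. trans c d (fst z)) (snd (sc c) u) (comps2 u \<xi>)"
  proof (rule S.dir_chart[OF sc_in[OF c] u])
    show "open ?S" using open_overlap[OF c d(1)] by (simp add: open_Times open_Compl)
    show "snd (sc c) u \<in> ?S" using co_dom[OF u] z d p img_mem[OF d(2) p] by (auto simp: co_def dom_def)
    show "?S \<subseteq> S.img (sc c) UNIV" unfolding img_sc dom_def by (auto simp: img_def)
    show "(snd d \<circ> fst) (chart_inv (sc c) x) = trans c d (fst x)" if "x \<in> ?S" for x
    proof -
      have "x \<in> dom c" using that by (auto simp: dom_def img_def)
      then show ?thesis using pt_eq by (simp add: pt_def trans_def)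
    qed
    show "(\<lambda>z. trans c d (fst z)) differentiable (at (snd (sc c) u))"
      using D by (auto simp: differentiable_def)
  qed
  also have "\<dots> = tr c d (fst u) (fst (comps2 u \<xi>))"
    using D by (simp add: dd_eq tr_def)
  finally have "rho C u \<xi> = of_comps C c (fst u) (fst (comps2 u \<xi>))"
    by (simp add: rho_def d_def of_comps_tr)
  then show ?thesis using c p by simp
qed

text \<open>Transition maps of slit charts are linear on fibres, so the curve
  \<open>(p, y + t v)\<close> is affine in each of them and its velocity can be read off in
  \<open>c\<close>.\<close>

lemma gamma_chart:
  assumes u: "u \<in> fst (sc c)"
  shows "comps2 u (gamma C u v) = (0, comps C c (fst u) v)"
proof -
  have "u \<in> carrier_of (slit C)" using S.in_carrier[OF sc_in[OF c] u] .
  from S.chart_atD[OF this] obtain d where d: "d \<in> C" "chart_at (slit C) u = sc d" "u \<in> fst (sc d)"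
    by (auto simp: slit_def)
  have p: "fst u \<in> fst c" "fst u \<in> fst d" using u d by (auto simp: fst_sc)
  have "((\<lambda>t. snd (sc d) (fst u, snd u + t *\<^sub>R v)) has_vector_derivative (0, comps C d (fst u) v)) (at 0)"
    by (simp add: snd_sc linear_add[OF linear_comps[OF d(1) p(2)]] linear_scale[OF linear_comps[OF d(1) p(2)]])
       (auto intro!: derivative_eq_intros simp: has_vector_derivative_def)
  then have g: "gamma C u v = (0, comps C d (fst u) v)"
    by (simp add: gamma_def d(2) vector_derivative_at)
  have co: "snd (sc d) u = (snd d (fst u), comps C d (fst u) (snd u))" by (cases u) (simp add: snd_sc)
  have zin: "snd (sc d) u \<in> snd (sc d) ` (fst (sc d) \<inter> fst (sc c))" using u d by auto
  have o: "open (snd (sc d) ` (fst (sc d) \<inter> fst (sc c)))"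
    using S.open_overlap[OF sc_in[OF d(1)] sc_in[OF c]] by (simp add: S.img_def Int_commute)
  have D: "((\<lambda>t. (trans d c (fst (snd (sc d) u)), dd (trans d c) (fst (snd (sc d) u)) (snd (snd (sc d) u) + t *\<^sub>R w)))
    has_vector_derivative (0, tr d c (fst u) w)) (at 0)" for w
    using linear_frechet_derivative[OF trans_diffble[OF d(1) c p(2,1)]]
    by (simp add: co linear_add linear_scale tr_def)
       (auto intro!: derivative_eq_intros simp: has_vector_derivative_def)
  have "comps2 u (gamma C u v) = dd (S.trans (sc d) (sc c)) (snd (sc d) u) (0, comps C d (fst u) v)"
    by (simp add: S.comps_tr d(2) S.tr_def g)
  also have "S.trans (sc d) (sc c) = snd (sc c) \<circ> chart_inv (sc d)" by (simp add: S.trans_def)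
  also have "dd (snd (sc c) \<circ> chart_inv (sc d)) (snd (sc d) u) (0, comps C d (fst u) v)
      = (0, tr d c (fst u) (comps C d (fst u) v))"
  proof -
    let ?F = "snd (sc c) \<circ> chart_inv (sc d)" and ?z = "snd (sc d) u" and ?w = "comps C d (fst u) v"
    have F: "(?F has_derivative dd ?F ?z) (at ?z)"
      using S.trans_diffble[OF sc_in[OF d(1)] sc_in[OF c] d(3) u] by (intro dd_works) (simp add: S.trans_def)
    have "((\<lambda>t. ?z + t *\<^sub>R (0, ?w)) has_derivative (\<lambda>t. t *\<^sub>R (0, ?w))) (at 0)"
      by (rule has_derivative_eq_rhs[OF has_derivative_add[OF has_derivative_const has_derivative_scaleR_left[OF has_derivative_ident]]]) simp
    moreover have "(?F has_derivative dd ?F ?z) (at (?z + 0 *\<^sub>R (0, ?w)))"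
      using F by (simp add: zero_prod_def[symmetric])
    ultimately have "((\<lambda>t. ?F (?z + t *\<^sub>R (0, ?w))) has_derivative (\<lambda>t. dd ?F ?z (t *\<^sub>R (0, ?w)))) (at 0)"
      by (rule has_derivative_compose)
    moreover have "dd ?F ?z (t *\<^sub>R (0, ?w)) = t *\<^sub>R dd ?F ?z (0, ?w)" for t
      by (rule linear_scale[OF has_derivative_linear[OF F]])
    ultimately have 1: "((\<lambda>t. ?F (?z + t *\<^sub>R (0, ?w))) has_vector_derivative dd ?F ?z (0, ?w)) (at 0)"
      by (simp add: has_vector_derivative_def)
    define V where "V = (\<lambda>t::real. ?z + t *\<^sub>R (0, ?w)) -` (snd (sc d) ` (fst (sc d) \<inter> fst (sc c)))"
    have V: "open V" "0 \<in> V"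
      unfolding V_def using zin by (auto intro!: open_vimage[OF o] continuous_intros simp: zero_prod_def[symmetric])
    have "((\<lambda>t. ?F (?z + t *\<^sub>R (0, ?w))) has_vector_derivative (0, tr d c (fst u) ?w)) (at 0)"
    proof (rule has_vector_derivative_transform_within_open[OF D V])
      fix t assume "t \<in> V"
      then show "(trans d c (fst ?z), dd (trans d c) (fst ?z) (snd ?z + t *\<^sub>R ?w)) = ?F (?z + t *\<^sub>R (0, ?w))"
        using sc_trans[OF d(1) c] by (simp add: V_def)
    qed
    from vector_derivative_unique_at[OF 1 this] show ?thesis .
  qed
  also have "tr d c (fst u) (comps C d (fst u) v) = comps C c (fst u) v"
    by (rule comps_change[OF d(1) p(2) c p(1), symmetric])
  finally show ?thesis .
qed

end

end

section \<open>The Cartan connection in slit charts\<close>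

locale cartan_mfd =
  fixes C :: "('m, 'e::euclidean_space) atlas" and L :: "'m \<times> 'e \<Rightarrow> real" and D :: "('m, 'e) conn"
  assumes finsler: "finsler_manifold C L" and cartan: "cartan_connection C L D"
begin

sublocale base_mfd C
  using finsler by unfold_locales (simp add: finsler_manifold_def smooth_manifold_def)

abbreviation cp where "cp c \<equiv> comps (slit C) (sc c)"
abbreviation ocp where "ocp c \<equiv> of_comps (slit C) (sc c)"
abbreviation base_comps where "base_comps c u \<equiv> comps C c (fst u)"

definition hat :: "('m, 'e) chart \<Rightarrow> ('m, 'e) pi_field \<Rightarrow> 'e \<times> 'e \<Rightarrow> 'e" where
  "hat c Z z = base_comps c (pt c z) (Z (pt c z))"

definition frame :: "('m, 'e) chart \<Rightarrow> 'e \<Rightarrow> ('m, 'e) pi_field" where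
  "frame c v q = of_comps C c (fst q) v"

abbreviation "opn W \<equiv> openin (atlas_topology (slit C)) W"

lemma img_co: "c \<in> C \<Longrightarrow> W \<subseteq> fst (sc c) \<Longrightarrow> S.img (sc c) W = co c ` W"
  by (rule img_sc(3))

lemma open_co: "c \<in> C \<Longrightarrow> opn W \<Longrightarrow> W \<subseteq> fst (sc c) \<Longrightarrow> open (co c ` W)"
  using S.open_img[OF _ sc_in] img_co by metis

lemma co_image: "c \<in> C \<Longrightarrow> co c ` fst (sc c) = dom c"
  using img_sc(1) img_co by blast

lemma pt_image: "c \<in> C \<Longrightarrow> W \<subseteq> fst (sc c) \<Longrightarrow> z \<in> co c ` W \<Longrightarrow> pt c z \<in> W \<and> co c (pt c z) = z \<and> z \<in> dom c"
proof -
  assume a: "c \<in> C" "W \<subseteq> fst (sc c)" "z \<in> co c ` W"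
  then obtain u where u: "u \<in> W" "z = co c u" by (elim imageE)
  then have "u \<in> fst (sc c)" using a(2) by (rule_tac subsetD)
  then show ?thesis using u pt_co[OF a(1)] co_dom[OF a(1)] by simp
qed

lemma hat_co: "c \<in> C \<Longrightarrow> u \<in> fst (sc c) \<Longrightarrow> hat c Z (co c u) = base_comps c u (Z u)"
  by (simp add: hat_def pt_co)

lemma fst_in: "u \<in> fst (sc c) \<Longrightarrow> fst u \<in> fst c"
  by (auto simp: fst_sc)

lemma hat_change:
  assumes c: "c \<in> C" and d: "d \<in> C" and u: "u \<in> fst (sc c)" "u \<in> fst (sc d)"
  shows "base_comps d u v = dd (trans c d) (fst (co c u)) (base_comps c u v)"
  using comps_change[OF c fst_in[OF u(1)] d fst_in[OF u(2)]] by (cases u) (simp add: tr_def co_def snd_sc)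

lemma smooth_pi_iff:
  assumes c: "c \<in> C" and W: "opn W" "W \<subseteq> fst (sc c)"
  shows "smooth_pi C W Z \<longleftrightarrow> smooth_on (co c ` W) (hat c Z)"
proof
  assume "smooth_pi C W Z"
  then have "smooth_on (snd (sc c) ` (W \<inter> fst (sc c))) ((\<lambda>q. comps C c (fst q) (Z q)) \<circ> chart_inv (sc c))"
    using c by (simp add: smooth_pi_def)
  moreover have "W \<inter> fst (sc c) = W" using W by blast
  ultimately show "smooth_on (co c ` W) (hat c Z)"
    by (simp add: co_def o_def hat_def[abs_def] pt_def)
next
  assume Z: "smooth_on (co c ` W) (hat c Z)"
  show "smooth_pi C W Z"
    unfolding smooth_pi_def
  proof
    fix d assume d: "d \<in> C"
    let ?V = "S.img (sc c) (W \<inter> fst (sc d))"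
    have V: "open ?V" by (rule S.open_img[OF openin_Int[OF W(1) openin_sc[OF d]] sc_in[OF c]])
    have Ve: "?V = co c ` (W \<inter> fst (sc d))" using W by (intro img_co c) auto
    interpret smooth_domain ?V by unfold_locales (rule V)
    have 1: "smooth_on ?V (\<lambda>z. dd (trans c d) (fst z) b)" for b
    proof (rule smooth_on_compose[OF V open_overlap[OF c d], where f=fst and g="\<lambda>x. dd (trans c d) x b"])
      show "fst ` ?V \<subseteq> img c (fst d)"
        unfolding Ve using W(2) by (auto simp: co_def snd_sc fst_sc img_def)
      show "smooth_on ?V fst" using sm_rules(11)[OF sm_rules(2)] by simp
      show "smooth_on (img c (fst d)) (\<lambda>x. dd (trans c d) x b)"
        by (rule smooth_on_dd[OF open_overlap[OF c d] smooth_trans[OF c d]])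
    qed
    have "smooth_on ?V (\<lambda>z. \<Sum>b\<in>Basis. (hat c Z z \<bullet> b) *\<^sub>R dd (trans c d) (fst z) b)"
      by (intro sm_rules 1 smooth_on_subset[OF Z]) (auto simp: Ve)
    then have "smooth_on ?V (\<lambda>z. base_comps d (chart_inv (sc c) z) (Z (chart_inv (sc c) z)))"
    proof (rule smooth_on_cong[OF V])
      fix z assume "z \<in> ?V"
      then have z: "pt c z \<in> W" "pt c z \<in> fst (sc d)" "co c (pt c z) = z"
        using pt_image[OF c, of "W \<inter> fst (sc d)" z] W(2) unfolding Ve by auto
      then have zc: "pt c z \<in> fst (sc c)" using W by auto
      have "fst z \<in> img c (fst d)"
        using z(3) fst_in[OF zc] fst_in[OF z(2)] by (cases "pt c z") (auto simp: co_def snd_sc img_def)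
      then have "trans c d differentiable (at (fst z))"
        by (rule smooth_on_diffble[OF open_overlap[OF c d] smooth_trans[OF c d]])
      from dd_sum_Basis[OF this, of "hat c Z z"]
      show "(\<Sum>b\<in>Basis. (hat c Z z \<bullet> b) *\<^sub>R dd (trans c d) (fst z) b) = base_comps d (chart_inv (sc c) z) (Z (chart_inv (sc c) z))"
        using hat_change[OF c d zc z(2)] z(3) by (simp add: hat_def pt_def)
    qed
    from S.smooth_transfer[OF sc_in[OF c] sc_in[OF d] W this]
    show "smooth_on (snd (sc d) ` (W \<inter> fst (sc d))) ((\<lambda>q. comps C d (fst q) (Z q)) \<circ> chart_inv (sc d))"
      by (simp add: S.img_def o_def)
  qed
qed

lemma smooth_pi_subset: "smooth_pi C W Z \<Longrightarrow> V \<subseteq> W \<Longrightarrow> smooth_pi C V Z"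
  unfolding smooth_pi_def by (auto intro: smooth_on_subset)

lemma smooth_pi_cong:
  assumes "opn W" "smooth_pi C W Z" "\<And>q. q \<in> W \<Longrightarrow> Z q = Z' q"
  shows "smooth_pi C W Z'"
  unfolding smooth_pi_def
proof
  fix d assume d: "d \<in> C"
  have o: "open (snd (sc d) ` (W \<inter> fst (sc d)))" using S.open_img[OF assms(1) sc_in[OF d]] by (simp add: S.img_def)
  show "smooth_on (snd (sc d) ` (W \<inter> fst (sc d))) ((\<lambda>q. comps C d (fst q) (Z' q)) \<circ> chart_inv (sc d))"
  proof (rule smooth_on_cong[OF o])
    show "smooth_on (snd (sc d) ` (W \<inter> fst (sc d))) ((\<lambda>q. comps C d (fst q) (Z q)) \<circ> chart_inv (sc d))"
      using assms(2) d by (simp add: smooth_pi_def)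
  qed (use assms(3) S.inv_chart[OF sc_in[OF d]] in auto)
qed

lemma lin_conn: "linear_connection C D"
  using cartan by (simp add: cartan_connection_def)

context
  fixes W u assumes W: "opn W" "u \<in> W"
begin

lemma conn_rules:
  assumes Z: "smooth_pi C W Z"
  shows D_lin: "linear (\<lambda>\<xi>. D u \<xi> Z)"
    and D_add: "smooth_pi C W Z' \<Longrightarrow> D u \<xi> (\<lambda>q. Z q + Z' q) = D u \<xi> Z + D u \<xi> Z'"
    and D_leibniz: "smooth_fun (slit C) W (f :: _ \<Rightarrow> real) \<Longrightarrow>
      D u \<xi> (\<lambda>q. f q *\<^sub>R Z q) = f u *\<^sub>R D u \<xi> Z + dir (slit C) f u \<xi> *\<^sub>R Z u"
proof -
  note * = lin_conn[unfolded linear_connection_def, rule_format (no_asm), OF W(1) Z]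
  show "linear (\<lambda>\<xi>. D u \<xi> Z)" by (rule *[THEN conjunct1, rule_format, OF W(2)])
  show "D u \<xi> (\<lambda>q. Z q + Z' q) = D u \<xi> Z + D u \<xi> Z'" if "smooth_pi C W Z'"
    by (rule *[THEN conjunct2, THEN conjunct2, THEN conjunct1, rule_format, OF that W(2)])
  show "D u \<xi> (\<lambda>q. f q *\<^sub>R Z q) = f u *\<^sub>R D u \<xi> Z + dir (slit C) f u \<xi> *\<^sub>R Z u" if "smooth_fun (slit C) W f"
    by (rule *[THEN conjunct2, THEN conjunct2, THEN conjunct2, rule_format, OF that W(2)])
qed

lemma dir_const: "(\<And>q. q \<in> W \<Longrightarrow> f q = k) \<Longrightarrow> dir (slit C) f u \<xi> = 0"
proof -
  assume f: "\<And>q. q \<in> W \<Longrightarrow> f q = k"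
  have "u \<in> TM0 C" using W S.openin_iff by blast
  note e = S.chart_atD[OF this]
  have "dir (slit C) f u \<xi> = dd (\<lambda>_. k) (snd (chart_at (slit C) u) u) (comps (slit C) (chart_at (slit C) u) u \<xi>)"
    by (rule S.dir_chart[OF e S.open_img[OF W(1) e(1)] S.img_mem[OF W(2) e(2)]])
       (use f S.chart_inv_in[OF e(1)] in \<open>auto simp: S.img_def\<close>)
  then show ?thesis by simp
qed

text \<open>Locality, from the Leibniz rule with the indicator of \<open>W\<close>: on
  \<open>W\<close> it is the constant 1, and it erases the values of both sections outside.\<close>

lemma D_cong:
  assumes Z: "smooth_pi C W Z" and eq: "\<And>q. q \<in> W \<Longrightarrow> Z q = Z' q"
  shows "D u \<xi> Z = D u \<xi> Z'"
proof -
  have f: "smooth_fun (slit C) W (\<lambda>q. if q \<in> W then 1 else 0 :: real)"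
    unfolding smooth_fun_def
  proof
    fix d assume d: "d \<in> slit C"
    have o: "open (snd d ` (W \<inter> fst d))" using S.open_img[OF W(1) d] by (simp add: S.img_def)
    show "smooth_on (snd d ` (W \<inter> fst d)) ((\<lambda>q. if q \<in> W then 1 else 0) \<circ> chart_inv d)"
      by (rule smooth_on_cong[OF o smooth_on_const[OF o, of 1]]) (use d in auto)
  qed
  have d0: "dir (slit C) (\<lambda>q. if q \<in> W then 1 else 0 :: real) u \<xi> = 0" by (rule dir_const[of _ 1]) simp
  have Z': "smooth_pi C W Z'" by (rule smooth_pi_cong[OF W(1) Z eq])
  have "(\<lambda>q. (if q \<in> W then 1 else 0) *\<^sub>R Z q) = (\<lambda>q. (if q \<in> W then 1 else 0 :: real) *\<^sub>R Z' q)"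
    using eq by auto
  then show ?thesis
    using D_leibniz[OF Z f, of \<xi>] D_leibniz[OF Z' f, of \<xi>] W(2) by (simp only: d0) simp
qed

lemma smooth_pi_zero: "smooth_pi C W (\<lambda>_. 0)"
  unfolding smooth_pi_def
proof
  fix d assume d: "d \<in> C"
  have o: "open (snd (sc d) ` (W \<inter> fst (sc d)))" using S.open_img[OF W(1) sc_in[OF d]] by (simp add: S.img_def)
  show "smooth_on (snd (sc d) ` (W \<inter> fst (sc d))) ((\<lambda>q. comps C d (fst q) 0) \<circ> chart_inv (sc d))"
  proof (rule smooth_on_cong[OF o smooth_on_const[OF o, of 0]])
    fix x assume "x \<in> snd (sc d) ` (W \<inter> fst (sc d))"
    then have "fst (chart_inv (sc d) x) \<in> fst d"
      using S.inv_chart[OF sc_in[OF d]] fst_in[of _ d] by auto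
    then show "0 = ((\<lambda>q. comps C d (fst q) 0) \<circ> chart_inv (sc d)) x"
      by (simp add: linear_0[OF linear_comps[OF d]])
  qed
qed

lemma D_zero: "D u \<xi> (\<lambda>_. 0) = 0"
  using D_add[OF smooth_pi_zero smooth_pi_zero, of \<xi>] by simp

end

section \<open>Connection coefficients in a coordinate frame\<close>

lemma smooth_pi_chart:
  assumes c: "c \<in> C" and W: "opn W" "W \<subseteq> fst (sc c)" and F: "smooth_on (co c ` W) F"
    and eq: "\<And>z. z \<in> co c ` W \<Longrightarrow> hat c Z z = F z"
  shows "smooth_pi C W Z"
  unfolding smooth_pi_iff[OF c W] by (rule smooth_on_cong[OF open_co[OF c W] F]) (simp add: eq)

lemma hat_frame: "c \<in> C \<Longrightarrow> z \<in> dom c \<Longrightarrow> hat c (frame c v) z = v"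
  using fst_pt by (simp add: hat_def frame_def)

lemma frame_smooth: "c \<in> C \<Longrightarrow> smooth_pi C (fst (sc c)) (frame c v)"
  by (rule smooth_pi_chart[OF _ openin_sc subset_refl smooth_on_const[of _ v]])
     (auto simp: co_image open_dom hat_frame)

text \<open>The connection form of the coordinate frame. Expanding \<open>v\<close> in the basis
  builds in linearity in \<open>v\<close>; \<open>D_frame\<close> gives the meaning for every
  \<open>v\<close>.\<close>

definition om :: "('m, 'e) chart \<Rightarrow> 'e \<times> 'e \<Rightarrow> 'e \<times> 'e \<Rightarrow> 'e \<Rightarrow> 'e" where
  "om c z \<zeta> v = (\<Sum>b\<in>Basis. (v \<bullet> b) *\<^sub>R base_comps c (pt c z) (D (pt c z) (ocp c (pt c z) \<zeta>) (frame c b)))"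

lemma om_lf:
  assumes c: "c \<in> C"
  shows "lf2 (dom c) (om c)"
proof -
  interpret smooth_domain "dom c" by unfold_locales (rule open_dom[OF c])
  have s: "smooth_on (dom c) (\<lambda>z. base_comps c (pt c z) (D (pt c z) (ocp c (pt c z) \<zeta>) (frame c b)))" for \<zeta> b
  proof -
    have "smooth_vf (slit C) (fst (sc c)) (\<lambda>u. ocp c u \<zeta>)"
    proof (rule S.smooth_vfI[OF sc_in[OF c] openin_sc[OF c] subset_refl])
      have o: "open (S.img (sc c) (fst (sc c)))" by (simp add: img_sc[OF c] open_dom[OF c])
      show "smooth_on (S.img (sc c) (fst (sc c))) (\<lambda>x. cp c (chart_inv (sc c) x) (ocp c (chart_inv (sc c) x) \<zeta>))"
        by (rule smooth_on_cong[OF o smooth_on_const[OF o, of \<zeta>]])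
           (use S.chart_inv_in[OF sc_in[OF c]] S.comps_of_comps[OF sc_in[OF c]] in auto)
    qed
    then have "smooth_pi C (fst (sc c)) (\<lambda>u. D u (ocp c u \<zeta>) (frame c b))"
      by (rule lin_conn[unfolded linear_connection_def, rule_format (no_asm), OF openin_sc[OF c] frame_smooth[OF c],
            THEN conjunct2, THEN conjunct1, rule_format])
    then show ?thesis
      unfolding smooth_pi_iff[OF c openin_sc[OF c] subset_refl] co_image[OF c] by (simp add: hat_def[abs_def])
  qed
  define T where "T z \<zeta> b = base_comps c (pt c z) (D (pt c z) (ocp c (pt c z) \<zeta>) (frame c b))" for z \<zeta> b
  have l: "linear (\<lambda>\<zeta>. T z \<zeta> b)" if z: "z \<in> dom c" for z b
  proof -
    note p = pt_dom(1)[OF c z]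
    show ?thesis
      unfolding T_def
      using linear_compose[OF linear_compose[OF S.linear_of_comps[OF sc_in[OF c] p]
            D_lin[OF openin_sc[OF c] p frame_smooth[OF c]]] linear_comps[OF c fst_in[OF p]]]
      by (simp only: o_def)
  qed
  have om: "om c = (\<lambda>z \<zeta> v. \<Sum>b\<in>Basis. (v \<bullet> b) *\<^sub>R T z \<zeta> b)" by (intro ext) (simp add: om_def T_def)
  show ?thesis
    unfolding om
  proof (rule lf2I)
    fix x X
    show "linear (\<lambda>v. \<Sum>b\<in>Basis. (v \<bullet> b) *\<^sub>R T x X b)"
      by (rule linearI) (simp_all add: inner_add_left scaleR_add_left sum.distrib scaleR_sum_right)
  next
    fix x v assume x: "x \<in> dom c"
    have "T x (a + b) k = T x a k + T x b k" "T x (r *\<^sub>R a) k = r *\<^sub>R T x a k" for a b k r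
      using linear_add[OF l[OF x]] linear_scale[OF l[OF x]] by blast+
    then show "linear (\<lambda>X. \<Sum>b\<in>Basis. (v \<bullet> b) *\<^sub>R T x X b)"
      by (intro linearI) (simp_all add: scaleR_add_right sum.distrib scaleR_sum_right mult.commute)
  next
    fix X v
    show "smooth_on (dom c) (\<lambda>x. \<Sum>b\<in>Basis. (v \<bullet> b) *\<^sub>R T x X b)"
      unfolding T_def by (intro sm_rules s)
  qed
qed

lemma D_sum:
  assumes W: "opn W" "u \<in> W" and "finite I" and "\<And>i. i \<in> I \<Longrightarrow> smooth_pi C W (Z i)"
  shows "smooth_pi C W (\<lambda>q. \<Sum>i\<in>I. Z i q) \<and> D u \<xi> (\<lambda>q. \<Sum>i\<in>I. Z i q) = (\<Sum>i\<in>I. D u \<xi> (Z i))"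
  using assms(3,4)
proof (induction I rule: finite_induct)
  case empty
  then show ?case using smooth_pi_zero[OF W] D_zero[OF W] by simp
next
  case (insert i I)
  then have Z: "smooth_pi C W (Z i)" "smooth_pi C W (\<lambda>q. \<Sum>i\<in>I. Z i q)" by auto
  have "smooth_pi C W (\<lambda>q. Z i q + (\<Sum>i\<in>I. Z i q))"
    unfolding smooth_pi_def
  proof
    fix d assume d: "d \<in> C"
    have o: "open (snd (sc d) ` (W \<inter> fst (sc d)))" using S.open_img[OF W(1) sc_in[OF d]] by (simp add: S.img_def)
    let ?h = "\<lambda>Z. (\<lambda>q. comps C d (fst q) (Z q)) \<circ> chart_inv (sc d)"
    have "smooth_on (snd (sc d) ` (W \<inter> fst (sc d))) (\<lambda>x. ?h (Z i) x + ?h (\<lambda>q. \<Sum>i\<in>I. Z i q) x)"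
      by (rule smooth_on_add[OF o Z(1)[unfolded smooth_pi_def, rule_format, OF d] Z(2)[unfolded smooth_pi_def, rule_format, OF d]])
    then show "smooth_on (snd (sc d) ` (W \<inter> fst (sc d))) (?h (\<lambda>q. Z i q + (\<Sum>i\<in>I. Z i q)))"
    proof (rule smooth_on_cong[OF o])
      fix x assume "x \<in> snd (sc d) ` (W \<inter> fst (sc d))"
      then have "fst (chart_inv (sc d) x) \<in> fst d"
        using S.inv_chart[OF sc_in[OF d]] fst_in[of _ d] by auto
      then show "?h (Z i) x + ?h (\<lambda>q. \<Sum>i\<in>I. Z i q) x = ?h (\<lambda>q. Z i q + (\<Sum>i\<in>I. Z i q)) x"
        by (simp add: linear_add[OF linear_comps[OF d]])
    qed
  qed
  moreover have "D u \<xi> (\<lambda>q. Z i q + (\<Sum>i\<in>I. Z i q)) = D u \<xi> (Z i) + D u \<xi> (\<lambda>q. \<Sum>i\<in>I. Z i q)"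
    by (rule D_add[OF W Z])
  ultimately show ?case using insert by simp
qed

lemma D_chart:
  assumes c: "c \<in> C" and W: "opn W" "W \<subseteq> fst (sc c)" "u \<in> W" and Z: "smooth_pi C W Z"
  shows "base_comps c u (D u \<xi> Z) = dd (hat c Z) (co c u) (cp c u \<xi>) + om c (co c u) (cp c u \<xi>) (hat c Z (co c u))"
proof -
  have u: "u \<in> fst (sc c)" using W by auto
  have o: "open (co c ` W)" by (rule open_co[OF c W(1,2)])
  interpret smooth_domain "co c ` W" by unfold_locales (rule o)
  have Zs: "smooth_on (co c ` W) (hat c Z)" using Z smooth_pi_iff[OF c W(1,2)] by simp
  have z: "co c u \<in> co c ` W" using W by simp
  define f where "f b q = base_comps c q (Z q) \<bullet> b" for b q
  have fs: "smooth_fun (slit C) W (f b)" for b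
  proof (rule S.smooth_funI[OF sc_in[OF c] W(1,2)])
    have "smooth_on (co c ` W) (\<lambda>z. hat c Z z \<bullet> b)" by (intro sm_rules Zs)
    then show "smooth_on (S.img (sc c) W) (\<lambda>x. f b (chart_inv (sc c) x))"
      unfolding img_co[OF c W(2)] by (simp add: f_def hat_def pt_def)
  qed
  have fd: "dir (slit C) (f b) u \<xi> = dd (hat c Z) (co c u) (cp c u \<xi>) \<bullet> b" for b
  proof -
    have "dir (slit C) (f b) u \<xi> = dd (\<lambda>z. hat c Z z \<bullet> b) (snd (sc c) u) (cp c u \<xi>)"
    proof (rule S.dir_chart[OF sc_in[OF c] u o])
      show "snd (sc c) u \<in> co c ` W" using z by (simp add: co_def)
      show "co c ` W \<subseteq> S.img (sc c) UNIV" using W(2) co_dom[OF c] by (auto simp: img_sc[OF c])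
      show "(\<lambda>z. hat c Z z \<bullet> b) differentiable (at (snd (sc c) u))"
        using sm_diffble[OF sm_rules(8)[OF Zs sm_rules(1)] z] by (simp add: co_def)
    qed (simp add: f_def hat_def pt_def)
    then show ?thesis using dd_inner_const[OF sm_diffble[OF Zs z]] by (simp add: co_def)
  qed
  have fr: "smooth_pi C W (frame c b)" for b by (rule smooth_pi_subset[OF frame_smooth[OF c] W(2)])
  have ffr: "smooth_pi C W (\<lambda>q. f b q *\<^sub>R frame c b q)" for b
  proof (rule smooth_pi_chart[OF c W(1,2)])
    show "smooth_on (co c ` W) (\<lambda>z. (hat c Z z \<bullet> b) *\<^sub>R b)" by (intro sm_rules Zs)
    show "hat c (\<lambda>q. f b q *\<^sub>R frame c b q) z = (hat c Z z \<bullet> b) *\<^sub>R b" if "z \<in> co c ` W" for z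
      using pt_image[OF c W(2) that] fst_pt[OF c, of z]
      by (simp add: hat_def frame_def f_def linear_scale[OF linear_comps[OF c]] c)
  qed
  have eq: "Z q = (\<Sum>b\<in>Basis. f b q *\<^sub>R frame c b q)" if "q \<in> W" for q
  proof -
    have p: "fst q \<in> fst c" using that W(2) fst_in by blast
    have "Z q = of_comps C c (fst q) (base_comps c q (Z q))" using c p by simp
    also have "\<dots> = (\<Sum>b\<in>Basis. f b q *\<^sub>R frame c b q)"
      by (subst linear_sum_Basis[OF linear_of_comps[OF c p]]) (simp add: f_def frame_def)
    finally show ?thesis .
  qed
  have "D u \<xi> Z = D u \<xi> (\<lambda>q. \<Sum>b\<in>Basis. f b q *\<^sub>R frame c b q)"
    by (rule D_cong[OF W(1,3) Z eq])
  also have "\<dots> = (\<Sum>b\<in>Basis. D u \<xi> (\<lambda>q. f b q *\<^sub>R frame c b q))"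
    by (rule D_sum[OF W(1,3) finite_Basis, of "\<lambda>b q. f b q *\<^sub>R frame c b q", OF ffr, THEN conjunct2])
  also have "\<dots> = (\<Sum>b\<in>Basis. f b u *\<^sub>R D u \<xi> (frame c b) + dir (slit C) (f b) u \<xi> *\<^sub>R frame c b u)"
    by (simp add: D_leibniz[OF W(1,3) fr fs])
  finally have "base_comps c u (D u \<xi> Z) =
      (\<Sum>b\<in>Basis. f b u *\<^sub>R base_comps c u (D u \<xi> (frame c b)) + dir (slit C) (f b) u \<xi> *\<^sub>R b)"
    using linear_comps[OF c fst_in[OF u]] c fst_in[OF u]
    by (simp add: linear_sum linear_add linear_scale frame_def)
  then show ?thesis
    using S.of_comps_comps[OF sc_in[OF c] u]
    by (simp add: fd om_def pt_co[OF c u] hat_def f_def sum.distrib euclidean_representation add.commute)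
qed

lemma D_frame:
  assumes c: "c \<in> C" and u: "u \<in> fst (sc c)"
  shows "base_comps c u (D u \<xi> (frame c v)) = om c (co c u) (cp c u \<xi>) v"
proof -
  have "dd (hat c (frame c v)) (co c u) = dd (\<lambda>_. v) (co c u)"
    by (rule dd_cong_open[OF open_dom[OF c] co_dom[OF c u]]) (rule hat_frame[OF c])
  then show ?thesis
    using D_chart[OF c openin_sc[OF c] subset_refl u frame_smooth[OF c]] hat_frame[OF c co_dom[OF c u]] by simp
qed

section \<open>Metric and nonlinear connection in a chart\<close>

definition "F2c c z = (L (pt c z))\<^sup>2"

definition "gc c z V W = der1 (der0 (F2c c)) z (0, V) (0, W) / 2"

lemma F2c_sm:
  assumes c: "c \<in> C"
  shows "smooth_on (dom c) (F2c c)"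
proof -
  have "smooth_on (S.img (sc c) (TM0 C)) (\<lambda>x. L (chart_inv (sc c) x))"
    using finsler by (intro S.smooth_funD sc_in c) (simp add: finsler_manifold_def)
  moreover have "S.img (sc c) (TM0 C) = dom c"
  proof -
    have "TM0 C \<inter> fst (sc c) = fst (sc c)" using S.in_carrier[OF sc_in[OF c]] by blast
    then show ?thesis using img_sc(1)[OF c] by (simp add: S.img_def)
  qed
  ultimately show ?thesis
    unfolding F2c_def[abs_def] pt_def using smooth_on_power[OF open_dom[OF c], of _ 2] by simp
qed

lemma F2c_co: "c \<in> C \<Longrightarrow> p \<in> fst c \<Longrightarrow> y \<noteq> 0 \<Longrightarrow> F2c c (snd c p, comps C c p y) = (L (p, y))\<^sup>2"
  using pt_co[of c "(p, y)"] by (simp add: F2c_def co_def snd_sc fst_sc)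

text \<open>Passing to chart components is linear on a fibre, so the second fibre derivative
  transforms without correction terms.\<close>

lemma fmetric_chart:
  assumes c: "c \<in> C" and u: "u \<in> fst (sc c)"
  shows "fmetric L u v w = gc c (co c u) (base_comps c u v) (base_comps c u w)"
proof -
  obtain p y where py: "u = (p, y)" by (cases u)
  have p: "p \<in> fst c" and y: "y \<noteq> 0" using u by (auto simp: py fst_sc)
  define K where "K = comps C c p"
  have K: "linear K" unfolding K_def by (rule linear_comps[OF c p])
  have Kd: "((\<lambda>y. (snd c p, K y)) has_derivative (\<lambda>v. (0, K v))) (at y)" for y
    using linear_imp_has_derivative[OF K] by (intro has_derivative_Pair has_derivative_const) auto
  interpret smooth_domain "dom c" by unfold_locales (rule open_dom[OF c])
  have in_dom: "(snd c p, K z) \<in> dom c" if "z \<noteq> 0" for z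
    using co_dom[OF c, of "(p, z)"] that p by (simp add: co_def snd_sc fst_sc K_def)
  have F: "sm (F2c c)" by (rule F2c_sm[OF c])
  have half: "((\<lambda>x. f x / 2) has_derivative (\<lambda>v. f' v / 2)) (at y)"
    if "(f has_derivative f') (at y)" for f f' :: "'e \<Rightarrow> real" and y
    using bounded_linear.has_derivative[OF bounded_linear_divide[of 2] that] .
  have 1: "dd (\<lambda>y. (L (p, y))\<^sup>2 / 2) z v = der0 (F2c c) (snd c p, K z) (0, K v) / 2" if z: "z \<noteq> 0" for z
  proof -
    have "((\<lambda>y. F2c c (snd c p, K y) / 2) has_derivative (\<lambda>v. dd (F2c c) (snd c p, K z) (0, K v) / 2)) (at z)"
      by (rule half[OF has_derivative_compose[OF Kd dd_works[OF sm_diffble[OF F in_dom[OF z]]]]])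
    moreover have e: "F2c c (snd c p, K y) / 2 = (L (p, y))\<^sup>2 / 2" if "y \<in> - {0}" for y
      using F2c_co[OF c p, of y] that by (simp add: K_def)
    moreover have o: "open (- {0::'e})" "z \<in> - {0}" using z by (auto simp: open_Compl)
    ultimately have "((\<lambda>y. (L (p, y))\<^sup>2 / 2) has_derivative (\<lambda>v. dd (F2c c) (snd c p, K z) (0, K v) / 2)) (at z)"
      by (rule_tac has_derivative_transform_within_open[OF _ o])
    then show ?thesis by (simp add: dd_eq der0_def)
  qed
  have d: "((\<lambda>z. der0 (F2c c) (snd c p, K z) (0, K v) / 2) has_derivative
      (\<lambda>w. der1 (der0 (F2c c)) (snd c p, K y) (0, K w) (0, K v) / 2)) (at y)"
  proof -
    have "sm (\<lambda>z. der0 (F2c c) z (0, K v))" using lf1_der0[OF F] by (simp add: lf1_def)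
    from half[OF has_derivative_compose[OF Kd dd_works[OF sm_diffble[OF this in_dom[OF y]]]]]
    show ?thesis unfolding der1_def .
  qed
  have "fmetric L u v w = dd (\<lambda>z. der0 (F2c c) (snd c p, K z) (0, K v) / 2) y w"
    unfolding fmetric_def py fst_conv snd_conv
    by (rule fun_cong, rule dd_cong_open[of "- {0}"]) (use 1 y in \<open>auto simp: open_Compl\<close>)
  also have "\<dots> = der1 (der0 (F2c c)) (snd c p, K y) (0, K w) (0, K v) / 2" by (simp add: dd_eq[OF d])
  also have "\<dots> = gc c (snd c p, K y) (K v) (K w)"
    using der_commute(1)[OF in_dom[OF y] F] by (simp add: gc_def)
  finally show ?thesis by (simp add: py co_def snd_sc K_def)
qed

lemma gc_pos:
  assumes c: "c \<in> C" and z: "z \<in> dom c" and X: "X \<noteq> 0"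
  shows "gc c z X X > 0"
proof -
  note p = pt_dom[OF c z]
  have "of_comps C c (fst (pt c z)) X \<noteq> 0"
    using X comps_of_comps[OF c fst_in[OF p(1)], of X] linear_0[OF linear_comps[OF c fst_in[OF p(1)]]] by auto
  then have "fmetric L (pt c z) (of_comps C c (fst (pt c z)) X) (of_comps C c (fst (pt c z)) X) > 0"
    using finsler S.in_carrier[OF sc_in[OF c] p(1)] by (simp add: finsler_manifold_def)
  then show ?thesis using fmetric_chart[OF c p(1)] p c fst_in[OF p(1)] by simp
qed

lemma F2c_euler:
  assumes c: "c \<in> C" and z: "z \<in> dom c"
  shows "der0 (F2c c) z (0, snd z) = 2 * F2c c z"
proof -
  note p = pt_dom[OF c z]
  obtain q y where qy: "pt c z = (q, y)" by (cases "pt c z")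
  have q: "q \<in> fst c" "y \<noteq> 0" using p(1) by (auto simp: qy fst_sc)
  have zz: "z = (snd c q, comps C c q y)" using p(2) by (simp add: qy co_def snd_sc)
  have hom: "F2c c (fst z, t *\<^sub>R snd z) = t\<^sup>2 * F2c c z" if "t > 0" for t
  proof -
    have "F2c c (snd c q, comps C c q (t *\<^sub>R y)) = (L (q, t *\<^sub>R y))\<^sup>2" using q that by (intro F2c_co c) auto
    moreover have "L (q, t *\<^sub>R y) = t * L (q, y)"
      using finsler in_carrier[OF c q(1)] that by (simp add: finsler_manifold_def)
    ultimately show ?thesis
      using F2c_co[OF c q] by (simp add: zz linear_scale[OF linear_comps[OF c q(1)]] power_mult_distrib)
  qed
  have "(F2c c has_derivative dd (F2c c) z) (at (fst z, 1 *\<^sub>R snd z))"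
    using dd_works[OF smooth_on_diffble[OF open_dom[OF c] F2c_sm[OF c] z]] by simp
  moreover have "((\<lambda>t::real. (fst z, t *\<^sub>R snd z)) has_derivative (\<lambda>t. (0, t *\<^sub>R snd z))) (at 1)"
    by (auto intro!: derivative_eq_intros)
  ultimately have d1: "((\<lambda>t. F2c c (fst z, t *\<^sub>R snd z)) has_derivative (\<lambda>t. dd (F2c c) z (0, t *\<^sub>R snd z))) (at 1)"
    by (rule_tac has_derivative_compose)
  have d2: "((\<lambda>t. F2c c (fst z, t *\<^sub>R snd z)) has_derivative (\<lambda>t. 2 * t * F2c c z)) (at 1)"
  proof (rule has_derivative_transform_within_open[of "\<lambda>t. t\<^sup>2 * F2c c z" _ _ _ "{0<..}"])
    show "((\<lambda>t. t\<^sup>2 * F2c c z) has_derivative (\<lambda>t. 2 * t * F2c c z)) (at 1)"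
      by (auto intro!: derivative_eq_intros)
  qed (use hom in auto)
  from has_derivative_unique[OF d1 d2] have "dd (F2c c) z (0, 1 *\<^sub>R snd z) = 2 * 1 * F2c c z" by (rule fun_cong)
  then show ?thesis by (simp add: der0_def)
qed

section \<open>Horizontal vectors and the nonlinear connection\<close>

lemma eta_smooth: "c \<in> C \<Longrightarrow> smooth_pi C (fst (sc c)) eta"
proof -
  assume c: "c \<in> C"
  interpret smooth_domain "dom c" by unfold_locales (rule open_dom[OF c])
  show ?thesis
    by (rule smooth_pi_chart[OF c openin_sc[OF c] subset_refl, of snd])
       (use sm_rules(12)[OF sm_rules(2)] in \<open>auto simp: co_image[OF c] hat_def eta_def snd_pt[OF c]\<close>)
qed

lemma D_eta:
  assumes c: "c \<in> C" and u: "u \<in> fst (sc c)"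
  shows "base_comps c u (D u \<xi> eta) = snd (cp c u \<xi>) + om c (co c u) (cp c u \<xi>) (snd (co c u))"
proof -
  have h: "hat c eta z = snd z" if "z \<in> dom c" for z by (simp add: hat_def eta_def snd_pt[OF c that])
  have "dd (hat c eta) (co c u) = dd snd (co c u)"
    by (rule dd_cong_open[OF open_dom[OF c] co_dom[OF c u]]) (rule h)
  moreover have "dd snd (co c u) = snd"
    by (rule dd_eq[OF has_derivative_snd[OF has_derivative_ident]])
  ultimately show ?thesis
    using D_chart[OF c openin_sc[OF c] subset_refl u eta_smooth[OF c]] h[OF co_dom[OF c u]] by simp
qed

text \<open>A vector with components \<open>(X, W)\<close> is horizontal iff
  \<open>Mc c z W = - om c z (X, 0) (snd z)\<close>, so the horizontal lift is obtained by inverting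
  \<open>Mc\<close>, and regularity of the connection is its injectivity. By \<open>Vc_y\<close> it
  is in fact the identity, but the proof of this rests on the nonlinear connection constructed
  here.\<close>

definition "Mc c z W = W + om c z (0, W) (snd z)"

lemma Mc_lf:
  assumes c: "c \<in> C"
  shows "lf1 (dom c) (Mc c)"
proof -
  interpret smooth_domain "dom c" by unfold_locales (rule open_dom[OF c])
  show ?thesis
    unfolding Mc_def
    by (rule lf1I; (rule linearI)?; simp add: sm_rules lf2_rules[OF om_lf[OF c]] lf2_Pair0[OF open_U om_lf[OF c]]
        sm_rules(12)[OF sm_rules(2), simplified] algebra_simps)
qed

lemma reg: "u \<in> TM0 C \<Longrightarrow> \<xi> \<in> vertical C u \<Longrightarrow> \<xi> \<in> horizontal D u \<Longrightarrow> \<xi> = 0"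
  using cartan unfolding cartan_connection_def regular_connection_def by blast

lemma Mc_inj:
  assumes c: "c \<in> C" and z: "z \<in> dom c" and W: "Mc c z W = 0"
  shows "W = 0"
proof -
  note p = pt_dom[OF c z]
  define \<xi> where "\<xi> = ocp c (pt c z) (0, W)"
  have x: "cp c (pt c z) \<xi> = (0, W)" using S.comps_of_comps[OF sc_in[OF c] p(1)] by (simp add: \<xi>_def)
  have z0: "base_comps c (pt c z) v = 0 \<Longrightarrow> v = 0" for v
    using comps_zero_iff[OF c fst_in[OF p(1)]] by simp
  have "\<xi> \<in> vertical C (pt c z)"
    using rho_chart[OF c p(1), of \<xi>] z0 by (simp add: vertical_def x)
  moreover have "\<xi> \<in> horizontal D (pt c z)"
    using D_eta[OF c p(1), of \<xi>] W z0 by (simp add: horizontal_def x p(2) Mc_def)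
  ultimately have "\<xi> = 0" using reg S.in_carrier[OF sc_in[OF c] p(1)] by blast
  then show ?thesis using x linear_0[OF S.linear_comps[OF sc_in[OF c] p(1)]] by (simp add: zero_prod_def)
qed

definition "Nc c z X = smooth_domain.Inv (Mc c) z (om c z (X, 0) (snd z))"
definition "hc c = (\<lambda>z X. (X, - Nc c z X))"
definition "Gc c z X Y = om c z (hc c z X) Y"
definition "Vc c z W Y = om c z (0, W) Y"

lemma Nc_lf:
  assumes c: "c \<in> C"
  shows "lf1 (dom c) (Nc c)"
proof -
  interpret smooth_domain "dom c" by unfold_locales (rule open_dom[OF c])
  have I: "lf1 (dom c) (Inv (Mc c))" by (rule Inv_lf[OF Mc_lf[OF c] Mc_inj[OF c]])
  have s: "sm snd" using sm_rules(12)[OF sm_rules(2)] by simp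
  have P: "(X + Y, 0) = (X, 0) + (Y, 0::'e)" "(k *\<^sub>R X, 0) = k *\<^sub>R (X, 0::'e)" for X Y :: 'e and k by simp_all
  show ?thesis
    unfolding Nc_def
  proof (rule lf1I)
    show "linear (\<lambda>X. Inv (Mc c) x (om c x (X, 0) (snd x)))" if "x \<in> dom c" for x
      by (rule linearI) (simp_all only: P lf2_lin[OF om_lf[OF c] that] lf1_lin[OF I that])
    show "sm (\<lambda>x. Inv (Mc c) x (om c x (X, 0) (snd x)))" for X
      by (intro lf1_sm[OF I] lf2_sm[OF om_lf[OF c]] s sm_rules)
  qed
qed

lemma hor_iff:
  assumes c: "c \<in> C" and z: "z \<in> dom c"
  shows "snd \<zeta> + om c z \<zeta> (snd z) = 0 \<longleftrightarrow> \<zeta> = hc c z (fst \<zeta>)"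
proof -
  interpret smooth_domain "dom c" by unfold_locales (rule open_dom[OF c])
  obtain X W where w: "\<zeta> = (X, W)" by (cases \<zeta>)
  have "om c z \<zeta> v = om c z (X, 0) v + om c z (0, W) v" for v
    using lf2_lin(1)[OF om_lf[OF c] z, of "(X, 0)" "(0, W)"] by (simp add: w)
  then have "snd \<zeta> + om c z \<zeta> (snd z) = Mc c z W + om c z (X, 0) (snd z)" by (simp add: Mc_def w)
  also have "\<dots> = 0 \<longleftrightarrow> Mc c z (- W) = om c z (X, 0) (snd z)"
    unfolding lf1_lin(3)[OF Mc_lf[OF c] z] by (auto simp: neg_eq_iff_add_eq_0)
  also have "\<dots> \<longleftrightarrow> Nc c z X = - W"
  proof
    assume "Mc c z (- W) = om c z (X, 0) (snd z)"
    then show "Nc c z X = - W"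
      unfolding Nc_def by (intro Inv_eq[OF Mc_lf[OF c] _ z]) (auto intro: Mc_inj[OF c])
  next
    assume "Nc c z X = - W"
    then show "Mc c z (- W) = om c z (X, 0) (snd z)"
      using M_Inv[OF Mc_lf[OF c] _ z, of "om c z (X, 0) (snd z)"] Mc_inj[OF c] by (simp add: Nc_def)
  qed
  finally show ?thesis by (auto simp: hc_def w)
qed

lemma beta_chart:
  assumes c: "c \<in> C" and u: "u \<in> fst (sc c)"
  shows "cp c u (beta C D u v) = hc c (co c u) (base_comps c u v)"
proof -
  define \<xi> where "\<xi> = ocp c u (hc c (co c u) (base_comps c u v))"
  have x: "cp c u \<xi> = hc c (co c u) (base_comps c u v)"
    using S.comps_of_comps[OF sc_in[OF c] u] by (simp add: \<xi>_def)
  have z0: "base_comps c u w = 0 \<longleftrightarrow> w = 0" for w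
    using comps_zero_iff[OF c fst_in[OF u]] by simp
  have hor: "a \<in> horizontal D u \<longleftrightarrow> cp c u a = hc c (co c u) (fst (cp c u a))" for a
    unfolding hor_iff[OF c co_dom[OF c u], symmetric] D_eta[OF c u, of a, symmetric] z0 horizontal_def by simp
  have "\<xi> \<in> horizontal D u" unfolding hor x by (simp add: hc_def)
  moreover have "rho C u \<xi> = v"
  proof -
    have "base_comps c u (rho C u \<xi>) = base_comps c u v" using rho_chart[OF c u, of \<xi>] by (simp add: x hc_def)
    then show ?thesis using of_comps_comps[OF c fst_in[OF u]] by metis
  qed
  moreover have "inj_on (rho C u) (horizontal D u)"
  proof (rule inj_onI)
    fix a b assume ab: "a \<in> horizontal D u" "b \<in> horizontal D u" "rho C u a = rho C u b"
    have "cp c u a = hc c (co c u) (fst (cp c u a))" "cp c u b = hc c (co c u) (fst (cp c u b))"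
      using ab(1,2) by (simp_all only: hor)
    moreover have "fst (cp c u a) = fst (cp c u b)" using rho_chart[OF c u] ab(3) by metis
    ultimately have "cp c u a = cp c u b" by metis
    then show "a = b" using S.of_comps_comps[OF sc_in[OF c] u] by metis
  qed
  ultimately have "beta C D u v = \<xi>" unfolding beta_def by (intro inv_into_f_eq) auto
  then show ?thesis by (simp add: x)
qed

end

lemma lf1_subset: "lf1 U F \<Longrightarrow> V \<subseteq> U \<Longrightarrow> lf1 V F"
  unfolding lf1_def using smooth_on_subset by blast

lemma lf2_subset:
  assumes "lf2 U F" "V \<subseteq> U"
  shows "lf2 V F"
proof -
  have a: "\<forall>X. lf1 U (\<lambda>x. F x X)" and b: "\<forall>Y. lf1 U (\<lambda>x X. F x X Y)"
    using assms(1) unfolding lf2_def by simp_all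
  show ?thesis
    unfolding lf2_def by (intro conjI allI) (rule lf1_subset[OF a[rule_format] assms(2)], rule lf1_subset[OF b[rule_format] assms(2)])
qed

lemma lf3_subset:
  assumes "lf3 U F" "V \<subseteq> U"
  shows "lf3 V F"
proof -
  have a: "\<forall>X. lf2 U (\<lambda>x. F x X)" and b: "\<forall>Y Z. lf1 U (\<lambda>x X. F x X Y Z)"
    using assms(1) unfolding lf3_def by simp_all
  show ?thesis
    unfolding lf3_def by (intro conjI allI) (rule lf2_subset[OF a[rule_format] assms(2)], rule lf1_subset[OF b[rule_format] assms(2)])
qed

context cartan_mfd
begin

lemma cartan_rules:
  assumes "opn W" "u \<in> W" "smooth_pi C W X" "smooth_pi C W Y" "smooth_pi C W Z"
  shows "dir (slit C) (\<lambda>q. fmetric L q (Y q) (Z q)) u \<xi> = fmetric L u (D u \<xi> Y) (Z u) + fmetric L u (Y u) (D u \<xi> Z)"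
    and "torsion C D (\<lambda>q. beta C D q (X q)) (\<lambda>q. beta C D q (Y q)) u = 0"
    and "fmetric L u (mixed_torsion C D X Y u) (Z u) = fmetric L u (mixed_torsion C D X Z u) (Y u)"
proof -
  have XYZ: "smooth_pi C W X \<and> smooth_pi C W Y \<and> smooth_pi C W Z" using assms(3-5) by blast
  note * = cartan[unfolded cartan_connection_def, THEN conjunct2, THEN conjunct2, rule_format (no_asm), OF assms(1) XYZ assms(2)]
  show "dir (slit C) (\<lambda>q. fmetric L q (Y q) (Z q)) u \<xi> = fmetric L u (D u \<xi> Y) (Z u) + fmetric L u (Y u) (D u \<xi> Z)"
    by (rule *[THEN conjunct1, rule_format])
  show "torsion C D (\<lambda>q. beta C D q (X q)) (\<lambda>q. beta C D q (Y q)) u = 0"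
    by (rule *[THEN conjunct2, THEN conjunct1])
  show "fmetric L u (mixed_torsion C D X Y u) (Z u) = fmetric L u (mixed_torsion C D X Z u) (Y u)"
    by (rule *[THEN conjunct2, THEN conjunct2])
qed

lemma dir_sc:
  assumes c: "c \<in> C" and W: "opn W" "W \<subseteq> fst (sc c)" "u \<in> W"
    and F: "smooth_on (co c ` W) F" and eq: "\<And>q. q \<in> W \<Longrightarrow> f q = F (co c q)"
  shows "dir (slit C) f u \<xi> = dd F (co c u) (cp c u \<xi>)"
proof -
  have o: "open (co c ` W)" by (rule open_co[OF c W(1,2)])
  have "dir (slit C) f u \<xi> = dd F (snd (sc c) u) (cp c u \<xi>)"
  proof (rule S.dir_chart[OF sc_in[OF c] _ o])
    show "u \<in> fst (sc c)" using W by auto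
    show "snd (sc c) u \<in> co c ` W" using W by (simp add: co_def)
    show "co c ` W \<subseteq> S.img (sc c) UNIV" using W(2) co_dom[OF c] by (auto simp: img_sc[OF c])
    show "F differentiable (at (snd (sc c) u))"
      using smooth_on_diffble[OF o F, of "co c u"] W(3) by (simp add: co_def)
    show "f (chart_inv (sc c) x) = F x" if "x \<in> co c ` W" for x
      using eq[of "pt c x"] pt_image[OF c W(2) that] by (simp add: pt_def)
  qed
  then show ?thesis by (simp add: co_def)
qed

lemma bracket_sc:
  assumes c: "c \<in> C" and W: "opn W" "W \<subseteq> fst (sc c)" "u \<in> W"
    and Xh: "smooth_on (co c ` W) Xh" "\<And>q. q \<in> W \<Longrightarrow> cp c q (X q) = Xh (co c q)"
    and Yh: "smooth_on (co c ` W) Yh" "\<And>q. q \<in> W \<Longrightarrow> cp c q (Y q) = Yh (co c q)"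
  shows "cp c u (bracket (slit C) X Y u) = dd Yh (co c u) (Xh (co c u)) - dd Xh (co c u) (Yh (co c u))"
proof -
  have o: "open (co c ` W)" by (rule open_co[OF c W(1,2)])
  have u: "u \<in> fst (sc c)" and z: "co c u \<in> co c ` W" using W by auto
  let ?f = "\<lambda>X x. cp c (chart_inv (sc c) x) (X (chart_inv (sc c) x))"
  have e: "?f X x = Xh x" "?f Y x = Yh x" if "x \<in> co c ` W" for x
    using Xh(2)[of "pt c x"] Yh(2)[of "pt c x"] pt_image[OF c W(2) that] by (simp_all add: pt_def)
  have s: "smooth_on (co c ` W) (?f X)" "smooth_on (co c ` W) (?f Y)"
    by (rule smooth_on_cong[OF o Xh(1)], simp add: e) (rule smooth_on_cong[OF o Yh(1)], simp add: e)
  have d: "dd (?f X) (co c u) = dd Xh (co c u)" "dd (?f Y) (co c u) = dd Yh (co c u)"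
    by (rule dd_cong_open[OF o z], simp add: e)+
  have "cp c u (bracket (slit C) X Y u) = dd (?f Y) (snd (sc c) u) (?f X (snd (sc c) u)) - dd (?f X) (snd (sc c) u) (?f Y (snd (sc c) u))"
  proof (rule S.bracket_chart[OF sc_in[OF c] u o _ _ s])
    show "snd (sc c) u \<in> co c ` W" using z by (simp add: co_def)
    show "co c ` W \<subseteq> S.img (sc c) UNIV" using W(2) co_dom[OF c] by (auto simp: img_sc[OF c])
  qed
  also have "snd (sc c) u = co c u" by (simp add: co_def)
  finally show ?thesis unfolding d e[OF z] .
qed

lemma base_comps_inj: "c \<in> C \<Longrightarrow> u \<in> fst (sc c) \<Longrightarrow> base_comps c u v = base_comps c u w \<Longrightarrow> v = w"
proof -
  assume a: "c \<in> C" "u \<in> fst (sc c)" "base_comps c u v = base_comps c u w"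
  have "v = of_comps C c (fst u) (base_comps c u v)" using a(1) fst_in[OF a(2)] by simp
  also have "\<dots> = w" unfolding a(3) using a(1) fst_in[OF a(2)] by simp
  finally show ?thesis .
qed

lemma rho_beta:
  assumes c: "c \<in> C" and u: "u \<in> fst (sc c)"
  shows "rho C u (beta C D u v) = v"
  by (rule base_comps_inj[OF c u]) (simp add: rho_chart[OF c u] beta_chart[OF c u] hc_def)

lemma rho_gamma:
  assumes c: "c \<in> C" and u: "u \<in> fst (sc c)"
  shows "rho C u (gamma C u v) = 0"
proof -
  have "base_comps c u (rho C u (gamma C u v)) = 0" by (simp add: rho_chart[OF c u] gamma_chart[OF c u])
  then show ?thesis using comps_zero_iff[OF c fst_in[OF u]] by simp
qed

section \<open>The axioms of the Cartan connection in coordinates\<close>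

context
  fixes c assumes c: "c \<in> C"
begin

interpretation smooth_domain "dom c"
  by unfold_locales (rule open_dom[OF c])

lemma gc_lf: "lf2 (dom c) (gc c)"
proof -
  have "lf2 (dom c) (der1 (der0 (F2c c)))" by (intro lf2_der1 lf1_der0 F2c_sm c)
  then have "lf2 (dom c) (\<lambda>x X. der1 (der0 (F2c c)) x (0, X))" by (rule lf2_slot_Pair0(1)[OF open_U])
  then have "lf1 (dom c) (\<lambda>x Y. der1 (der0 (F2c c)) x (0, X) (0, Y))" "lf1 (dom c) (\<lambda>x X. der1 (der0 (F2c c)) x (0, X) (0, Y))" for X Y
    by (auto simp: lf2_def intro: lf1_slot_Pair0[OF open_U])
  then have 1: "lf2 (dom c) (\<lambda>x X Y. der1 (der0 (F2c c)) x (0, X) (0, Y))" by (simp add: lf2_def)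
  have "lf2 (dom c) (\<lambda>x X Y. (1/2) * der1 (der0 (F2c c)) x (0, X) (0, Y))"
  proof (rule lf2I)
    show "sm (\<lambda>x. (1/2) * der1 (der0 (F2c c)) x (0, X) (0, Y))" for X Y
      by (rule sm_rules(7)[OF sm_rules(1) lf2_sm[OF 1 sm_rules(1) sm_rules(1)]])
  qed ((rule linearI, simp_all add: lf2_lin[OF 1] algebra_simps)+)
  then show ?thesis by (simp add: gc_def[abs_def])
qed

lemma frame_comps: "u \<in> fst (sc c) \<Longrightarrow> base_comps c u (frame c v u) = v"
  using c fst_in by (simp add: frame_def)

lemma gc_parallel:
  assumes z: "z \<in> dom c"
  shows "der2 (gc c) z \<zeta> Y Z = gc c z (om c z \<zeta> Y) Z + gc c z Y (om c z \<zeta> Z)"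
proof -
  note p = pt_dom[OF c z]
  have "dir (slit C) (\<lambda>q. fmetric L q (frame c Y q) (frame c Z q)) (pt c z) (ocp c (pt c z) \<zeta>)
      = dd (\<lambda>z. gc c z Y Z) (co c (pt c z)) (cp c (pt c z) (ocp c (pt c z) \<zeta>))"
    by (rule dir_sc[OF c openin_sc[OF c] subset_refl p(1)])
       (simp_all add: co_image[OF c] lf2_sm[OF gc_lf] sm_rules fmetric_chart[OF c] frame_comps)
  moreover have "cp c (pt c z) (ocp c (pt c z) \<zeta>) = \<zeta>" using S.comps_of_comps[OF sc_in[OF c] p(1)] by simp
  ultimately show ?thesis
    using cartan_rules(1)[OF openin_sc[OF c] p(1) frame_smooth[OF c, of Y] frame_smooth[OF c, of Y] frame_smooth[OF c, of Z], of "ocp c (pt c z) \<zeta>"]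
    by (simp add: fmetric_chart[OF c p(1)] p(2) frame_comps[OF p(1)] D_frame[OF c p(1)] der2_def)
qed

lemma D_rho_beta: "u \<in> fst (sc c) \<Longrightarrow> base_comps c u (D u \<xi> (\<lambda>q. rho C q (beta C D q (frame c v q)))) = om c (co c u) (cp c u \<xi>) v"
proof -
  assume u: "u \<in> fst (sc c)"
  have "D u \<xi> (frame c v) = D u \<xi> (\<lambda>q. rho C q (beta C D q (frame c v q)))"
    by (rule D_cong[OF openin_sc[OF c] u frame_smooth[OF c]]) (simp add: rho_beta[OF c])
  then show ?thesis using D_frame[OF c u, of \<xi> v] by simp
qed

lemma beta_frame: "u \<in> fst (sc c) \<Longrightarrow> cp c u (beta C D u (frame c v u)) = (v, - Nc c (co c u) v)"
  by (simp add: beta_chart[OF c] frame_comps hc_def)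

lemma beta_frame_sm: "sm (\<lambda>z. (v, - Nc c z v))"
  by (intro sm_rules lf1_sm[OF Nc_lf[OF c]])

lemma fst_dd_Pair_const: "z \<in> dom c \<Longrightarrow> sm f \<Longrightarrow> fst (dd (\<lambda>z. (k, f z)) z w) = 0"
  by (simp add: dd_rules sm_rules)

text \<open>The bracket of horizontal lifts of coordinate fields has no base component, so that
  vanishing horizontal torsion is the symmetry of the coefficients.\<close>

lemma Gc_sym:
  assumes z: "z \<in> dom c"
  shows "Gc c z X Y = Gc c z Y X"
proof -
  note p = pt_dom[OF c z]
  let ?b = "\<lambda>X q. beta C D q (frame c X q)"
  have "cp c (pt c z) (bracket (slit C) (?b X) (?b Y) (pt c z)) =
      dd (\<lambda>z. (Y, - Nc c z Y)) (co c (pt c z)) (X, - Nc c (co c (pt c z)) X) - dd (\<lambda>z. (X, - Nc c z X)) (co c (pt c z)) (Y, - Nc c (co c (pt c z)) Y)"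
    by (rule bracket_sc[OF c openin_sc[OF c] subset_refl p(1)]) (simp_all add: co_image[OF c] beta_frame beta_frame_sm)
  then have "fst (cp c (pt c z) (bracket (slit C) (?b X) (?b Y) (pt c z))) = 0"
    by (simp add: p(2) fst_dd_Pair_const[OF z] sm_rules lf1_sm[OF Nc_lf[OF c]])
  then have "base_comps c (pt c z) (torsion C D (?b X) (?b Y) (pt c z)) = om c z (hc c z X) Y - om c z (hc c z Y) X"
    unfolding torsion_def linear_diff[OF linear_comps[OF c fst_in[OF p(1)]]] D_rho_beta[OF p(1)] rho_chart[OF c p(1)] beta_frame[OF p(1)] p(2)
    by (simp add: hc_def)
  moreover have "torsion C D (?b X) (?b Y) (pt c z) = 0"
    by (rule cartan_rules(2)[OF openin_sc[OF c] p(1) frame_smooth[OF c] frame_smooth[OF c] frame_smooth[OF c, of X]])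
  ultimately show ?thesis
    using linear_0[OF linear_comps[OF c fst_in[OF p(1)]]] by (simp add: Gc_def)
qed

lemma Gc_y: "z \<in> dom c \<Longrightarrow> Gc c z X (snd z) = Nc c z X"
  using hor_iff[OF c, of z "hc c z X"] by (simp add: Gc_def hc_def)

lemma Vc_sym:
  assumes z: "z \<in> dom c"
  shows "gc c z (Vc c z X Y) Z = gc c z (Vc c z X Z) Y"
proof -
  note p = pt_dom[OF c z]
  have m: "base_comps c (pt c z) (mixed_torsion C D (frame c X) (frame c Y) (pt c z)) = Vc c z X Y" for Y
  proof -
    let ?b = "\<lambda>q. beta C D q (frame c Y q)" and ?g = "\<lambda>q. gamma C q (frame c X q)"
    have "cp c (pt c z) (bracket (slit C) ?g ?b (pt c z)) =
        dd (\<lambda>z. (Y, - Nc c z Y)) (co c (pt c z)) (0, X) - dd (\<lambda>z. (0, X)) (co c (pt c z)) (Y, - Nc c (co c (pt c z)) Y)"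
      by (rule bracket_sc[OF c openin_sc[OF c] subset_refl p(1)])
         (simp_all add: co_image[OF c] beta_frame beta_frame_sm gamma_chart[OF c] frame_comps sm_rules)
    then have "fst (cp c (pt c z) (bracket (slit C) ?g ?b (pt c z))) = 0"
      by (simp add: p(2) fst_dd_Pair_const[OF z] sm_rules lf1_sm[OF Nc_lf[OF c]])
    moreover have "D (pt c z) \<xi> (\<lambda>q. rho C q (?g q)) = 0" for \<xi>
    proof -
      have "D (pt c z) \<xi> (\<lambda>_. 0) = D (pt c z) \<xi> (\<lambda>q. rho C q (?g q))"
        by (rule D_cong[OF openin_sc[OF c] p(1) smooth_pi_zero[OF openin_sc[OF c] p(1)]]) (simp add: rho_gamma[OF c])
      then show ?thesis using D_zero[OF openin_sc[OF c] p(1)] by simp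
    qed
    ultimately show ?thesis
      unfolding mixed_torsion_def torsion_def linear_diff[OF linear_comps[OF c fst_in[OF p(1)]]] D_rho_beta[OF p(1)] rho_chart[OF c p(1)] p(2)
        gamma_chart[OF c p(1)] frame_comps[OF p(1)]
      by (simp add: Vc_def linear_0[OF linear_comps[OF c fst_in[OF p(1)]]])
  qed
  show ?thesis
    using cartan_rules(3)[OF openin_sc[OF c] p(1) frame_smooth[OF c, of X] frame_smooth[OF c, of Y] frame_smooth[OF c, of Z]]
    by (simp add: fmetric_chart[OF c p(1)] m p(2) frame_comps[OF p(1)])
qed

lemma hc_sm: "sm f \<Longrightarrow> sm (\<lambda>z. hc c z (f z))"
  unfolding hc_def by (intro sm_rules lf1_sm[OF Nc_lf[OF c]])

lemma hc_lin: "z \<in> dom c \<Longrightarrow> hc c z (X + Y) = hc c z X + hc c z Y" "z \<in> dom c \<Longrightarrow> hc c z (k *\<^sub>R X) = k *\<^sub>R hc c z X"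
  by (simp_all add: hc_def lf1_lin[OF Nc_lf[OF c]])

lemma Gc_lf: "lf2 (dom c) (Gc c)"
  unfolding Gc_def
proof (rule lf2I)
  note l = lf2_lin[OF om_lf[OF c]]
  show "linear (om c x (hc c x X))" if "x \<in> dom c" for x X by (rule linearI) (simp_all only: l that)
  show "linear (\<lambda>X. om c x (hc c x X) Y)" if "x \<in> dom c" for x Y
    by (rule linearI) (simp_all only: l that hc_lin)
  show "sm (\<lambda>x. om c x (hc c x X) Y)" for X Y
    by (intro lf2_sm[OF om_lf[OF c]] hc_sm sm_rules)
qed

lemma finsler_chart: "finsler_chart (snd c ` fst c) (F2c c) (Nc c) (Gc c) (gc c) (dom c) (hc c)"
proof
  show "open (snd c ` fst c)" by (rule open_base[OF c])
  show "dom c = snd c ` fst c \<times> - {0}" by (simp add: dom_def)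
  show "smooth_on (dom c) (F2c c)" by (rule F2c_sm[OF c])
  show "lf1 (dom c) (Nc c)" by (rule Nc_lf[OF c])
  show "lf2 (dom c) (Gc c)" by (rule Gc_lf)
  show "der0 (F2c c) x (0, snd x) = 2 * F2c c x" if "x \<in> dom c" for x by (rule F2c_euler[OF c that])
  show "gc c x X X > 0" if "x \<in> dom c" "X \<noteq> 0" for x X by (rule gc_pos[OF c that])
  show "Gc c x X Y = Gc c x Y X" if "x \<in> dom c" for x X Y by (rule Gc_sym[OF that])
  show "Gc c x X (snd x) = Nc c x X" if "x \<in> dom c" for x X by (rule Gc_y[OF that])
  show "der2 (gc c) x (hc c x X) Y Z = gc c x (Gc c x X Y) Z + gc c x Y (Gc c x X Z)" if "x \<in> dom c" for x X Y Z
    using gc_parallel[OF that] by (simp add: Gc_def)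
qed (simp_all add: gc_def hc_def)

interpretation F: finsler_chart "snd c ` fst c" "F2c c" "Nc c" "Gc c" "gc c" "dom c" "hc c"
  by (rule finsler_chart)

text \<open>Metricity in vertical directions and \<open>Vc_sym\<close> make \<open>Vc\<close> half
  the vertical derivative of the metric, that is the Cartan tensor, which is annihilated by
  \<open>y\<close>.\<close>

lemma Vc_y:
  assumes z: "z \<in> dom c"
  shows "Vc c z W (snd z) = 0"
proof -
  interpret inner_form "gc c z" by (rule F.g_inner[OF z])
  have "gc c z (Vc c z W (snd z)) Z = gc c z 0 Z" for Z
  proof -
    have "der2 (gc c) z (0, W) (snd z) Z = gc c z (Vc c z W (snd z)) Z + gc c z (snd z) (Vc c z W Z)"
      using gc_parallel[OF z] by (simp add: Vc_def)
    moreover have "der2 (gc c) z (0, W) (snd z) Z = 0" using F.g_vert_y[OF z] by simp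
    moreover have "gc c z (snd z) (Vc c z W Z) = gc c z (Vc c z W (snd z)) Z"
      using Vc_sym[OF z, of W Z "snd z"] F.g_sym[OF z] by simp
    ultimately show ?thesis using lf2_lin(5)[OF gc_lf z] by simp
  qed
  then show ?thesis by (rule eqI)
qed

end

end

context cartan_mfd
begin

section \<open>The curvature of the connection form\<close>

context
  fixes c assumes c: "c \<in> C"
begin

interpretation smooth_domain "dom c"
  by unfold_locales (rule open_dom[OF c])

interpretation F: finsler_chart "snd c ` fst c" "F2c c" "Nc c" "Gc c" "gc c" "dom c" "hc c"
  by (rule finsler_chart[OF c])

definition "Kf z a b v = - (der2 (om c) z a b v - der2 (om c) z b a v + om c z a (om c z b v) - om c z b (om c z a v))"

text \<open>The second derivatives of \<open>Z\<close> are symmetric and the derivatives of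
  \<open>X\<close> and \<open>Y\<close> cancel against the bracket term. The result depends on the
  values at \<open>u\<close> only, which makes the evaluation by means of \<open>ext\<close>
  legitimate.\<close>

lemma curv_chart:
  assumes W: "opn W" "W \<subseteq> fst (sc c)" "u \<in> W" and Z: "smooth_pi C W Z"
    and Xh: "smooth_on (co c ` W) Xh" "\<And>q. q \<in> W \<Longrightarrow> cp c q (X q) = Xh (co c q)"
    and Yh: "smooth_on (co c ` W) Yh" "\<And>q. q \<in> W \<Longrightarrow> cp c q (Y q) = Yh (co c q)"
  shows "base_comps c u (curv C D X Y Z u) = Kf (co c u) (Xh (co c u)) (Yh (co c u)) (hat c Z (co c u))"
proof -
  have o: "open (co c ` W)" by (rule open_co[OF c W(1,2)])
  interpret V: smooth_domain "co c ` W" by unfold_locales (rule o)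
  have sub: "co c ` W \<subseteq> dom c" using co_dom[OF c] W(2) by blast
  have omW: "lf2 (co c ` W) (om c)"
    by (rule lf2_subset[OF om_lf[OF c] sub])
  have u: "u \<in> fst (sc c)" and z: "co c u \<in> co c ` W" using W by auto
  define Zh where "Zh = hat c Z"
  have Zs: "V.sm Zh" using Z smooth_pi_iff[OF c W(1,2)] by (simp add: Zh_def)
  have h: "V.sm (\<lambda>z. dd Zh z (Xh z) + om c z (Xh z) (Zh z))
      \<and> smooth_pi C W (\<lambda>q. D q (X q) Z)
      \<and> (\<forall>z\<in>co c ` W. hat c (\<lambda>q. D q (X q) Z) z = dd Zh z (Xh z) + om c z (Xh z) (Zh z))"
    if Xh: "V.sm Xh" "\<forall>q\<in>W. cp c q (X q) = Xh (co c q)" for Xh X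
  proof -
    have 1: "V.sm (\<lambda>z. dd Zh z (Xh z) + om c z (Xh z) (Zh z))"
      by (intro V.sm_rules V.lf2_sm[OF omW] Xh Zs smooth_on_dd_field[OF o])
    moreover have 2: "hat c (\<lambda>q. D q (X q) Z) z = dd Zh z (Xh z) + om c z (Xh z) (Zh z)" if "z \<in> co c ` W" for z
    proof -
      note q = pt_image[OF c W(2) that]
      show ?thesis
        using D_chart[OF c W(1,2) conjunct1[OF q] Z, of "X (pt c z)"] bspec[OF Xh(2) conjunct1[OF q]] q by (simp add: hat_def Zh_def)
    qed
    moreover have "smooth_pi C W (\<lambda>q. D q (X q) Z)"
      by (rule smooth_pi_chart[OF c W(1,2) 1 2])
    ultimately show ?thesis by blast
  qed
  have t: "base_comps c u (D u (X u) (\<lambda>q. D q (Y q) Z)) =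
      der1 (der0 Zh) (co c u) (Xh (co c u)) (Yh (co c u)) + dd Zh (co c u) (dd Yh (co c u) (Xh (co c u)))
      + der2 (om c) (co c u) (Xh (co c u)) (Yh (co c u)) (Zh (co c u))
      + om c (co c u) (dd Yh (co c u) (Xh (co c u))) (Zh (co c u))
      + om c (co c u) (Yh (co c u)) (dd Zh (co c u) (Xh (co c u)))
      + om c (co c u) (Xh (co c u)) (dd Zh (co c u) (Yh (co c u)) + om c (co c u) (Yh (co c u)) (Zh (co c u)))"
    if Xh: "V.sm Xh" "\<forall>q\<in>W. cp c q (X q) = Xh (co c q)"
      and Yh: "V.sm Yh" "\<forall>q\<in>W. cp c q (Y q) = Yh (co c q)" for Xh X Yh Y
  proof -
    note hY = h[OF Yh]
    let ?w = "Xh (co c u)"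
    have "dd (hat c (\<lambda>q. D q (Y q) Z)) (co c u) ?w = dd (\<lambda>z. dd Zh z (Yh z) + om c z (Yh z) (Zh z)) (co c u) ?w"
      by (rule V.dd_cong_U[OF z]) (rule hY[THEN conjunct2, THEN conjunct2, rule_format])
    also have "\<dots> = dd (\<lambda>z. dd Zh z (Yh z)) (co c u) ?w + dd (\<lambda>z. om c z (Yh z) (Zh z)) (co c u) ?w"
      by (rule V.dd_rules(1)[OF z smooth_on_dd_field[OF o Zs Yh(1)] V.lf2_sm[OF omW Yh(1) Zs]])
    also have "dd (\<lambda>z. dd Zh z (Yh z)) (co c u) ?w = der1 (der0 Zh) (co c u) ?w (Yh (co c u)) + dd Zh (co c u) (dd Yh (co c u) ?w)"
      using V.lf1_dd[OF V.lf1_der0[OF Zs] z Yh(1), of ?w] unfolding der0_def .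
    also have "dd (\<lambda>z. om c z (Yh z) (Zh z)) (co c u) ?w = der2 (om c) (co c u) ?w (Yh (co c u)) (Zh (co c u))
      + om c (co c u) (dd Yh (co c u) ?w) (Zh (co c u)) + om c (co c u) (Yh (co c u)) (dd Zh (co c u) ?w)"
      by (rule V.lf2_dd[OF omW z Yh(1) Zs])
    finally show ?thesis
      using D_chart[OF c W hY[THEN conjunct2, THEN conjunct1], of "X u"] hY[THEN conjunct2, THEN conjunct2, rule_format, OF z] bspec[OF Xh(2) W(3)]
      by (simp add: add.assoc)
  qed
  have X2: "\<forall>q\<in>W. cp c q (X q) = Xh (co c q)" and Y2: "\<forall>q\<in>W. cp c q (Y q) = Yh (co c q)"
    using Xh(2) Yh(2) by blast+
  have b: "base_comps c u (D u (bracket (slit C) X Y u) Z) =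
     dd Zh (co c u) (dd Yh (co c u) (Xh (co c u)) - dd Xh (co c u) (Yh (co c u)))
     + om c (co c u) (dd Yh (co c u) (Xh (co c u)) - dd Xh (co c u) (Yh (co c u))) (Zh (co c u))"
    using D_chart[OF c W Z] bracket_sc[OF c W Xh Yh] by (simp add: Zh_def)
  note lc = linear_comps[OF c fst_in[OF u]]
  have "base_comps c u (curv C D X Y Z u) = - base_comps c u (D u (X u) (\<lambda>q. D q (Y q) Z))
      + base_comps c u (D u (Y u) (\<lambda>q. D q (X q) Z)) + base_comps c u (D u (bracket (slit C) X Y u) Z)"
    by (simp add: curv_def linear_add[OF lc] linear_neg[OF lc] linear_diff[OF lc])
  also note t[OF Xh(1) X2 Yh(1) Y2]
  also note t[OF Yh(1) Y2 Xh(1) X2]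
  also note b
  also note V.der_commute(1)[OF z Zs, of "Xh (co c u)" "Yh (co c u)"]
  finally show ?thesis
    unfolding Kf_def Zh_def[symmetric] V.lf2_lin[OF omW z] V.dd_lin[OF z Zs] by (simp add: algebra_simps)
qed

definition "Rc z X Y Z = Kf z (hc c z X) (hc c z Y) Z"

text \<open>\<open>Gc\<close> is the connection form on horizontal lifts. Its derivative therefore
  contains the derivative of the lift, which is vertical; skew symmetrised, this is the term with
  \<open>E\<close>.\<close>

lemma Rc_eq:
  assumes z: "z \<in> dom c"
  shows "Rc z X Y Z = Vc c z (F.E z X Y) Z - (der2 (Gc c) z (hc c z X) Y Z - der2 (Gc c) z (hc c z Y) X Z
      + Gc c z X (Gc c z Y Z) - Gc c z Y (Gc c z X Z))"
proof -
  have d: "der2 (Gc c) z w Y Z = der2 (om c) z w (hc c z Y) Z - Vc c z (der1 (Nc c) z w Y) Z" for w Y Z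
  proof -
    have "dd (\<lambda>z. hc c z Y) z w = (0, - der1 (Nc c) z w Y)"
      unfolding hc_def der1_def using z by (simp add: dd_rules sm_rules lf1_sm[OF Nc_lf[OF c]])
    moreover have "der2 (Gc c) z w Y Z = der2 (om c) z w (hc c z Y) Z + om c z (dd (\<lambda>z. hc c z Y) z w) Z + om c z (hc c z Y) (dd (\<lambda>_. Z) z w)"
      unfolding der2_def[of "Gc c"] Gc_def by (rule lf2_dd[OF om_lf[OF c] z]) (intro hc_sm[OF c] sm_rules)+
    moreover have "om c z (0, - W) Z = - Vc c z W Z" for W
      using lf2_lin(3)[OF om_lf[OF c] z, of "(0, W)" Z] by (simp add: Vc_def)
    ultimately show ?thesis by (simp add: lf2_lin[OF om_lf[OF c] z])
  qed
  have "Vc c z (a - b) Z = Vc c z a Z - Vc c z b Z" for a b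
    using lf2_lin(2)[OF om_lf[OF c] z, of "(0, a)" "(0, b)" Z] by (simp add: Vc_def)
  then show ?thesis
    unfolding d F.E_def Rc_def Kf_def Gc_def by (simp add: algebra_simps)
qed

lemma Rc_lf: "lf3 (dom c) Rc"
proof (rule lf3I)
  note l = lf2_lin[OF om_lf[OF c]] and l3 = lf3_lin[OF lf3_der2[OF om_lf[OF c]]]
  show "linear (Rc x X Y)" if "x \<in> dom c" for x X Y
    unfolding Rc_def[abs_def] Kf_def by (rule linearI) (simp_all add: l[OF that] l3[OF that] algebra_simps)
  show "linear (\<lambda>Y. Rc x X Y Z)" if "x \<in> dom c" for x X Z
    unfolding Rc_def[abs_def] Kf_def by (rule linearI) (simp_all add: hc_lin[OF c that] l[OF that] l3[OF that] algebra_simps)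
  show "linear (\<lambda>X. Rc x X Y Z)" if "x \<in> dom c" for x Y Z
    unfolding Rc_def[abs_def] Kf_def by (rule linearI) (simp_all add: hc_lin[OF c that] l[OF that] l3[OF that] algebra_simps)
  show "sm (\<lambda>x. Rc x X Y Z)" for X Y Z
    unfolding Rc_def Kf_def
    by (intro sm_rules lf3_sm[OF lf3_der2[OF om_lf[OF c]]] lf2_sm[OF om_lf[OF c]] hc_sm[OF c])
qed

end

lemma ext_smooth:
  assumes u: "u \<in> TM0 C"
  shows "smooth_pi C (fst (sc (chart_at C (fst u)))) (ext C u v)" "ext C u v u = v" "u \<in> fst (sc (chart_at C (fst u)))"
    "chart_at C (fst u) \<in> C"
proof -
  have "fst u \<in> carrier_of C" "snd u \<noteq> 0" using u by (simp_all add: TM0_eq)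
  note c0 = chart_atD[OF this(1)]
  show "chart_at C (fst u) \<in> C" by (rule c0)
  show "u \<in> fst (sc (chart_at C (fst u)))" using c0 \<open>snd u \<noteq> 0\<close> by (cases u) (simp add: fst_sc)
  show "ext C u v u = v" using tr_self[OF c0] by (simp add: ext_def of_comps_tr)
  have "ext C u v = frame (chart_at C (fst u)) v" by (rule ext) (simp add: ext_def frame_def)
  then show "smooth_pi C (fst (sc (chart_at C (fst u)))) (ext C u v)" using frame_smooth[OF c0(1)] by simp
qed

text \<open>A neighbourhood of \<open>u\<close> inside the chart \<open>c\<close> on which all the fields \<open>ext C u v\<close> are smooth.\<close>

definition "nbh c u = fst (sc c) \<inter> fst (sc (chart_at C (fst u)))"

lemma nbh:
  assumes c: "c \<in> C" and u: "u \<in> fst (sc c)"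
  shows "opn (nbh c u)" "nbh c u \<subseteq> fst (sc c)" "u \<in> nbh c u" "smooth_pi C (nbh c u) (ext C u v)"
    "base_comps c u (ext C u v u) = base_comps c u v" "open (co c ` nbh c u)" "co c ` nbh c u \<subseteq> dom c" "co c u \<in> co c ` nbh c u"
    "smooth_on (co c ` nbh c u) (hat c (ext C u v))" "hat c (ext C u v) (co c u) = base_comps c u v"
proof -
  note t = fst_sc_TM0[OF c u, THEN conjunct1]
  note e = ext_smooth[OF t]
  show 1: "opn (nbh c u)" "nbh c u \<subseteq> fst (sc c)" "u \<in> nbh c u"
    using openin_Int[OF openin_sc[OF c] openin_sc[OF e(4)]] u e(3) by (auto simp: nbh_def)
  show 2: "smooth_pi C (nbh c u) (ext C u v)" by (rule smooth_pi_subset[OF e(1)]) (simp add: nbh_def)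
  show "base_comps c u (ext C u v u) = base_comps c u v" by (simp add: e(2))
  show "open (co c ` nbh c u)" by (rule open_co[OF c 1(1,2)])
  show "co c ` nbh c u \<subseteq> dom c" using co_dom[OF c] 1(2) by blast
  show "co c u \<in> co c ` nbh c u" using 1 by blast
  show "smooth_on (co c ` nbh c u) (hat c (ext C u v))" using 2 smooth_pi_iff[OF c 1(1,2)] by simp
  show "hat c (ext C u v) (co c u) = base_comps c u v" by (simp add: hat_co[OF c u] e(2))
qed

theorem hcurv_chart:
  assumes c: "c \<in> C" and u: "u \<in> fst (sc c)"
  shows "base_comps c u (hcurv C D u x y z) = Rc c (co c u) (base_comps c u x) (base_comps c u y) (base_comps c u z)"
proof -
  note n = nbh[OF c u]
  have s: "smooth_on (co c ` nbh c u) (\<lambda>z. hc c z (hat c (ext C u x) z))" for x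
  proof -
    interpret smooth_domain "co c ` nbh c u" by unfold_locales (rule n(6))
    have "lf1 (co c ` nbh c u) (Nc c)"
      by (rule lf1_subset[OF Nc_lf[OF c] n(7)])
    from sm_rules(10)[OF n(9)[of x] sm_rules(5)[OF lf1_sm[OF this n(9)[of x]]]]
    show ?thesis by (simp add: hc_def)
  qed
  have e: "cp c q (beta C D q (ext C u x q)) = hc c (co c q) (hat c (ext C u x) (co c q))" if "q \<in> nbh c u" for x q
  proof -
    have "q \<in> fst (sc c)" using that n(2) by (rule_tac subsetD)
    then show ?thesis by (simp add: beta_chart[OF c] hat_co[OF c])
  qed
  have "base_comps c u (curv C D (\<lambda>q. beta C D q (ext C u x q)) (\<lambda>q. beta C D q (ext C u y q)) (ext C u z) u) =
      Kf c (co c u) (hc c (co c u) (hat c (ext C u x) (co c u))) (hc c (co c u) (hat c (ext C u y) (co c u))) (hat c (ext C u z) (co c u))"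
    by (rule curv_chart[OF c n(1-3) n(4)[of z], where Xh="\<lambda>z. hc c z (hat c (ext C u x) z)" and Yh="\<lambda>z. hc c z (hat c (ext C u y) z)"])
       (rule s, erule e, rule s, erule e)
  then show ?thesis unfolding hcurv_def Rc_def[OF c] n(10) .
qed

end

section \<open>Horizontal derivatives in charts\<close>

context cartan_mfd
begin

context
  fixes c u assumes c: "c \<in> C" and u: "u \<in> fst (sc c)"
begin

interpretation V: smooth_domain "co c ` nbh c u"
  by unfold_locales (rule nbh(6)[OF c u])

lemma lf_nbh:
  "lf1 (dom c) F \<Longrightarrow> lf1 (co c ` nbh c u) F" "lf2 (dom c) G \<Longrightarrow> lf2 (co c ` nbh c u) G" "lf3 (dom c) H \<Longrightarrow> lf3 (co c ` nbh c u) H"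
  by (rule lf1_subset[OF _ nbh(7)[OF c u]], assumption) (rule lf2_subset[OF _ nbh(7)[OF c u]], assumption,
      rule lf3_subset[OF _ nbh(7)[OF c u]], assumption)

lemma nbh_sub: "q \<in> nbh c u \<Longrightarrow> q \<in> fst (sc c)"
  using nbh(2)[OF c u] by blast

lemma D_ext: "base_comps c u (D u (beta C D u x) (ext C u y)) =
    dd (hat c (ext C u y)) (co c u) (hc c (co c u) (base_comps c u x)) + Gc c (co c u) (base_comps c u x) (base_comps c u y)"
  using D_chart[OF c nbh(1-4)[OF c u], of "beta C D u x" y] by (simp add: beta_chart[OF c u] nbh(10)[OF c u] Gc_def)

lemma hcov01_chart:
  assumes S: "lf1 (dom c) Sc" and eq: "\<And>q v. q \<in> fst (sc c) \<Longrightarrow> S q v = Sc (co c q) (base_comps c q v)"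
  shows "hcov01 C D S u x y = der1 Sc (co c u) (hc c (co c u) (base_comps c u x)) (base_comps c u y)
    - Sc (co c u) (Gc c (co c u) (base_comps c u x) (base_comps c u y))"
proof -
  note n = nbh[OF c u] and S' = lf_nbh(1)[OF S]
  have "dir (slit C) (\<lambda>q. S q (ext C u y q)) u (beta C D u x) =
      dd (\<lambda>z. Sc z (hat c (ext C u y) z)) (co c u) (cp c u (beta C D u x))"
    by (rule dir_sc[OF c n(1-3) V.lf1_sm[OF S' n(9)]]) (simp add: eq nbh_sub hat_co[OF c])
  also have "\<dots> = der1 Sc (co c u) (hc c (co c u) (base_comps c u x)) (base_comps c u y)
      + Sc (co c u) (dd (hat c (ext C u y)) (co c u) (hc c (co c u) (base_comps c u x)))"
    unfolding V.lf1_dd[OF S' n(8,9)] beta_chart[OF c u] n(10) ..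
  finally show ?thesis
    unfolding hcov01_def Let_def eq[OF u] D_ext V.lf1_lin(1)[OF S' n(8)] by simp
qed

lemma hcov02_chart:
  assumes S: "lf2 (dom c) Sc" and eq: "\<And>q v w. q \<in> fst (sc c) \<Longrightarrow> S q v w = Sc (co c q) (base_comps c q v) (base_comps c q w)"
  shows "hcov02 C D S u x y z = der2 Sc (co c u) (hc c (co c u) (base_comps c u x)) (base_comps c u y) (base_comps c u z)
    - Sc (co c u) (Gc c (co c u) (base_comps c u x) (base_comps c u y)) (base_comps c u z)
    - Sc (co c u) (base_comps c u y) (Gc c (co c u) (base_comps c u x) (base_comps c u z))"
proof -
  note n = nbh[OF c u] and S' = lf_nbh(2)[OF S]
  let ?X = "hc c (co c u) (base_comps c u x)"
  have "dir (slit C) (\<lambda>q. S q (ext C u y q) (ext C u z q)) u (beta C D u x) =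
      dd (\<lambda>p. Sc p (hat c (ext C u y) p) (hat c (ext C u z) p)) (co c u) (cp c u (beta C D u x))"
    by (rule dir_sc[OF c n(1-3) V.lf2_sm[OF S' n(9) n(9)]]) (simp add: eq nbh_sub hat_co[OF c])
  also have "\<dots> = der2 Sc (co c u) ?X (base_comps c u y) (base_comps c u z)
      + Sc (co c u) (dd (hat c (ext C u y)) (co c u) ?X) (base_comps c u z)
      + Sc (co c u) (base_comps c u y) (dd (hat c (ext C u z)) (co c u) ?X)"
    unfolding V.lf2_dd[OF S' n(8) n(9) n(9)] beta_chart[OF c u] n(10) ..
  finally show ?thesis
    unfolding hcov02_def Let_def eq[OF u] D_ext V.lf2_lin(1,6)[OF S' n(8)] by simp
qed

lemma tensor13_smooth:
  assumes S: "lf3 (dom c) Sc"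
    and eq: "\<And>q v w x. q \<in> fst (sc c) \<Longrightarrow> base_comps c q (S q v w x) = Sc (co c q) (base_comps c q v) (base_comps c q w) (base_comps c q x)"
  shows "smooth_pi C (nbh c u) (\<lambda>q. S q (ext C u y q) (ext C u z q) (ext C u w q))"
    and "p \<in> co c ` nbh c u \<Longrightarrow> hat c (\<lambda>q. S q (ext C u y q) (ext C u z q) (ext C u w q)) p
      = Sc p (hat c (ext C u y) p) (hat c (ext C u z) p) (hat c (ext C u w) p)"
proof -
  note n = nbh[OF c u]
  have h: "hat c (\<lambda>q. S q (ext C u y q) (ext C u z q) (ext C u w q)) p
      = Sc p (hat c (ext C u y) p) (hat c (ext C u z) p) (hat c (ext C u w) p)" if "p \<in> co c ` nbh c u" for p
    using pt_image[OF c n(2) that] nbh_sub by (simp add: hat_def eq)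
  show "smooth_pi C (nbh c u) (\<lambda>q. S q (ext C u y q) (ext C u z q) (ext C u w q))"
    by (rule smooth_pi_chart[OF c n(1,2) V.lf3_sm[OF lf_nbh(3)[OF S] n(9) n(9) n(9)] h])
  show "p \<in> co c ` nbh c u \<Longrightarrow> hat c (\<lambda>q. S q (ext C u y q) (ext C u z q) (ext C u w q)) p
      = Sc p (hat c (ext C u y) p) (hat c (ext C u z) p) (hat c (ext C u w) p)" by (rule h)
qed

lemma hcov13_chart:
  assumes S: "lf3 (dom c) Sc"
    and eq: "\<And>q v w x. q \<in> fst (sc c) \<Longrightarrow> base_comps c q (S q v w x) = Sc (co c q) (base_comps c q v) (base_comps c q w) (base_comps c q x)"
  shows "base_comps c u (hcov13 C D S u x y z w) =
    der3 Sc (co c u) (hc c (co c u) (base_comps c u x)) (base_comps c u y) (base_comps c u z) (base_comps c u w)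
    + Gc c (co c u) (base_comps c u x) (Sc (co c u) (base_comps c u y) (base_comps c u z) (base_comps c u w))
    - Sc (co c u) (Gc c (co c u) (base_comps c u x) (base_comps c u y)) (base_comps c u z) (base_comps c u w)
    - Sc (co c u) (base_comps c u y) (Gc c (co c u) (base_comps c u x) (base_comps c u z)) (base_comps c u w)
    - Sc (co c u) (base_comps c u y) (base_comps c u z) (Gc c (co c u) (base_comps c u x) (base_comps c u w))"
proof -
  note n = nbh[OF c u] and S' = lf_nbh(3)[OF S]
  let ?X = "hc c (co c u) (base_comps c u x)" and ?H = "\<lambda>v. hat c (ext C u v)"
  let ?T = "\<lambda>q. S q (ext C u y q) (ext C u z q) (ext C u w q)"
  have "base_comps c u (D u (beta C D u x) ?T) = dd (hat c ?T) (co c u) ?X + Gc c (co c u) (base_comps c u x) (hat c ?T (co c u))"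
    using D_chart[OF c n(1-3) tensor13_smooth(1)[OF S eq], of "beta C D u x" y z w]
    by (simp add: beta_chart[OF c u] Gc_def)
  also have "hat c ?T (co c u) = Sc (co c u) (base_comps c u y) (base_comps c u z) (base_comps c u w)"
    by (simp only: tensor13_smooth(2)[OF S eq n(8)] n(10))
  also have "dd (hat c ?T) (co c u) ?X = dd (\<lambda>p. Sc p (?H y p) (?H z p) (?H w p)) (co c u) ?X"
    by (rule V.dd_cong_U[OF n(8)]) (rule tensor13_smooth(2)[OF S eq])
  also have "\<dots> = der3 Sc (co c u) ?X (base_comps c u y) (base_comps c u z) (base_comps c u w)
      + Sc (co c u) (dd (?H y) (co c u) ?X) (base_comps c u z) (base_comps c u w)
      + Sc (co c u) (base_comps c u y) (dd (?H z) (co c u) ?X) (base_comps c u w)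
      + Sc (co c u) (base_comps c u y) (base_comps c u z) (dd (?H w) (co c u) ?X)"
    unfolding V.lf3_dd[OF S' n(8) n(9) n(9) n(9)] n(10) ..
  finally show ?thesis
    unfolding hcov13_def Let_def linear_diff[OF linear_comps[OF c fst_in[OF u]]] eq[OF u] D_ext V.lf3_lin(1,6,11)[OF S' n(8)] by simp
qed

lemma tensor02_smooth:
  assumes S: "lf2 (dom c) Sc" and eq: "\<And>q v w. q \<in> fst (sc c) \<Longrightarrow> S q v w = Sc (co c q) (base_comps c q v) (base_comps c q w)"
  shows "smooth_fun (slit C) (nbh c u) (\<lambda>q. S q (ext C u y q) (ext C u z q))"
proof (rule S.smooth_funI[OF sc_in[OF c] nbh(1,2)[OF c u]])
  note n = nbh[OF c u]
  show "smooth_on (S.img (sc c) (nbh c u)) (\<lambda>x. S (chart_inv (sc c) x) (ext C u y (chart_inv (sc c) x)) (ext C u z (chart_inv (sc c) x)))"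
    unfolding img_co[OF c n(2)]
  proof (rule smooth_on_cong[OF n(6) V.lf2_sm[OF lf_nbh(2)[OF S] n(9) n(9)]])
    fix p assume "p \<in> co c ` nbh c u"
    from pt_image[OF c n(2) this]
    show "Sc p (hat c (ext C u y) p) (hat c (ext C u z) p) = S (chart_inv (sc c) p) (ext C u y (chart_inv (sc c) p)) (ext C u z (chart_inv (sc c) p))"
      using nbh_sub by (simp add: eq hat_def flip: pt_def)
  qed
qed

lemma dir_mult:
  assumes f: "smooth_fun (slit C) (nbh c u) f" and k: "smooth_fun (slit C) (nbh c u) k"
  shows "dir (slit C) (\<lambda>q. f q * k q :: real) u \<xi> = dir (slit C) f u \<xi> * k u + f u * dir (slit C) k u \<xi>"
proof -
  note n = nbh[OF c u]
  have s: "V.sm (\<lambda>z. f (pt c z))" "V.sm (\<lambda>z. k (pt c z))"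
    using S.smooth_funD[OF f sc_in[OF c]] S.smooth_funD[OF k sc_in[OF c]] unfolding img_co[OF c n(2)] pt_def .
  have e: "f q = f (pt c (co c q))" "k q = k (pt c (co c q))" "f q * k q = f (pt c (co c q)) * k (pt c (co c q))"
    if "q \<in> nbh c u" for q
    using pt_co[OF c nbh_sub[OF that]] by simp_all
  have "dir (slit C) f u \<xi> = dd (\<lambda>z. f (pt c z)) (co c u) (cp c u \<xi>)"
    by (rule dir_sc[OF c n(1-3) s(1)]) (rule e(1))
  moreover have "dir (slit C) k u \<xi> = dd (\<lambda>z. k (pt c z)) (co c u) (cp c u \<xi>)"
    by (rule dir_sc[OF c n(1-3) s(2)]) (rule e(2))
  moreover have "dir (slit C) (\<lambda>q. f q * k q) u \<xi> = dd (\<lambda>z. f (pt c z) * k (pt c z)) (co c u) (cp c u \<xi>)"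
    by (rule dir_sc[OF c n(1-3) V.sm_rules(7)[OF s]]) (rule e(3))
  ultimately show ?thesis
    using V.dd_rules(5)[OF n(8) s] by (simp only: pt_co[OF c u])
qed

text \<open>The Leibniz rule for a function times a tensor. In the second derivative the function is
  \<open>A\<close> on the extension of a vector, and its differential provides the derivative of
  \<open>A\<close>.\<close>

lemma hcov13_scale:
  assumes S: "lf3 (dom c) Sc"
    and eq: "\<And>q v w x. q \<in> fst (sc c) \<Longrightarrow> base_comps c q (S q v w x) = Sc (co c q) (base_comps c q v) (base_comps c q w) (base_comps c q x)"
    and f: "smooth_fun (slit C) (nbh c u) f" and T: "\<And>q v w x. q \<in> nbh c u \<Longrightarrow> T q v w x = f q *\<^sub>R S q v w x"
  shows "hcov13 C D T u x y z w = f u *\<^sub>R hcov13 C D S u x y z w + dir (slit C) f u (beta C D u x) *\<^sub>R S u y z w"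
proof -
  note n = nbh[OF c u]
  note s = tensor13_smooth(1)[OF S eq]
  have e: "ext C u v u = v" for v using ext_smooth(2) fst_sc_TM0[OF c u] by blast
  have fs: "smooth_pi C (nbh c u) (\<lambda>q. f q *\<^sub>R S q (ext C u y q) (ext C u z q) (ext C u w q))"
  proof (rule smooth_pi_chart[OF c n(1,2)])
    show "V.sm (\<lambda>p. f (pt c p) *\<^sub>R hat c (\<lambda>q. S q (ext C u y q) (ext C u z q) (ext C u w q)) p)"
      using S.smooth_funD[OF f sc_in[OF c]] s smooth_pi_iff[OF c n(1,2)] unfolding img_co[OF c n(2)] pt_def
      by (intro V.sm_rules) auto
    show "hat c (\<lambda>q. f q *\<^sub>R S q (ext C u y q) (ext C u z q) (ext C u w q)) p = f (pt c p) *\<^sub>R hat c (\<lambda>q. S q (ext C u y q) (ext C u z q) (ext C u w q)) p"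
      if "p \<in> co c ` nbh c u" for p
      using pt_image[OF c n(2) that] linear_scale[OF linear_comps[OF c fst_in[OF nbh_sub]]] by (simp add: hat_def)
  qed
  have "D u \<xi> (\<lambda>q. T q (ext C u y q) (ext C u z q) (ext C u w q)) = D u \<xi> (\<lambda>q. f q *\<^sub>R S q (ext C u y q) (ext C u z q) (ext C u w q))" for \<xi>
    by (rule D_cong[OF n(1,3) fs, symmetric]) (simp add: T)
  then show ?thesis
    unfolding hcov13_def Let_def T[OF n(3)]
    by (simp add: D_leibniz[OF n(1,3) s f] e scaleR_diff_right)
qed

lemma hcov02_scale:
  assumes S: "lf2 (dom c) Sc" and eq: "\<And>q v w. q \<in> fst (sc c) \<Longrightarrow> S q v w = Sc (co c q) (base_comps c q v) (base_comps c q w)"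
    and f: "smooth_fun (slit C) (nbh c u) f" and T: "\<And>q v w. q \<in> TM0 C \<Longrightarrow> T q v w = f q * S q v w"
  shows "hcov02 C D T u x y z = f u * hcov02 C D S u x y z + dir (slit C) f u (beta C D u x) * S u y z"
proof -
  note n = nbh[OF c u]
  have s: "smooth_fun (slit C) (nbh c u) (\<lambda>q. S q (ext C u y q) (ext C u z q))" for y z
    by (rule tensor02_smooth[OF S eq])
  have e: "ext C u v u = v" for v using ext_smooth(2) fst_sc_TM0[OF c u] by blast
  have "dir (slit C) (\<lambda>q. T q (ext C u y q) (ext C u z q)) u \<xi> = dir (slit C) (\<lambda>q. f q * S q (ext C u y q) (ext C u z q)) u \<xi>" for \<xi>
  proof -
    have s': "V.sm (\<lambda>p. f (pt c p) * S (pt c p) (ext C u y (pt c p)) (ext C u z (pt c p)))"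
      using S.smooth_funD[OF f sc_in[OF c]] S.smooth_funD[OF s sc_in[OF c], of y z] unfolding img_co[OF c n(2)] pt_def
      by (intro V.sm_rules)
    have t: "q \<in> TM0 C" if "q \<in> nbh c u" for q using fst_sc_TM0[OF c nbh_sub[OF that]] by blast
    show ?thesis
      by (subst (1 2) dir_sc[OF c n(1-3) s']) (simp_all add: pt_co[OF c nbh_sub] T t)
  qed
  then show ?thesis
    unfolding hcov02_def Let_def dir_mult[OF f s]
    using T[OF fst_sc_TM0[OF c u, THEN conjunct1]] by (simp add: e algebra_simps)
qed

end

end

section \<open>Recurrent Finsler manifolds\<close>

locale recurrent_mfd = cartan_mfd C L D
  for C :: "('m, 'e::euclidean_space) atlas" and L :: "'m \<times> 'e \<Rightarrow> real" and D :: "('m, 'e) conn" +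
  fixes A :: "('m, 'e) tensor01"
  assumes rec: "recurrent C D A"
begin

lemma A_form: "recurrence_form1 C A" and dim3: "DIM('e) \<ge> 3" and R_nonzero: "nonzero13 C (hcurv C D)"
  and rec_hcurv: "u \<in> TM0 C \<Longrightarrow> hcov13 C D (hcurv C D) u x y z w = A u x *\<^sub>R hcurv C D u y z w"
  using rec by (simp_all add: recurrent_def)

lemma A_rules:
  "u \<in> TM0 C \<Longrightarrow> linear (A u)" "opn W \<Longrightarrow> smooth_pi C W X \<Longrightarrow> smooth_fun (slit C) W (\<lambda>q. A q (X q))"
  "(p, y) \<in> TM0 C \<Longrightarrow> t > 0 \<Longrightarrow> A (p, t *\<^sub>R y) = A (p, y)"
  using A_form unfolding recurrence_form1_def by blast+

definition "Ac c z X = A (pt c z) (of_comps C c (fst (pt c z)) X)"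

lemma TM0_chart:
  assumes "u \<in> TM0 C"
  obtains c where "c \<in> C" "u \<in> fst (sc c)"
  using ext_smooth(3,4)[OF assms] by (rule that[rotated])

context
  fixes c assumes c: "c \<in> C"
begin

lemma A_chart: "u \<in> fst (sc c) \<Longrightarrow> A u v = Ac c (co c u) (base_comps c u v)"
  using c fst_in by (simp add: Ac_def pt_co)

lemma Ac_lf: "lf1 (dom c) (Ac c)"
proof -
  interpret smooth_domain "dom c" by unfold_locales (rule open_dom[OF c])
  show ?thesis
  proof (rule lf1I)
    fix x assume "x \<in> dom c"
    note p = pt_dom[OF c this]
    show "linear (Ac c x)"
      using linear_compose[OF linear_of_comps[OF c fst_in[OF p(1)]] A_rules(1)[OF fst_sc_TM0[OF c p(1), THEN conjunct1]]]
      by (simp add: Ac_def[abs_def] o_def)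
  next
    fix X
    have "smooth_fun (slit C) (fst (sc c)) (\<lambda>q. A q (frame c X q))"
      by (rule A_rules(2)[OF openin_sc[OF c] frame_smooth[OF c]])
    from S.smooth_funD[OF this sc_in[OF c]]
    show "sm (\<lambda>x. Ac c x X)" by (simp add: img_sc[OF c] Ac_def frame_def pt_def)
  qed
qed

lemma curved: "curved_chart (snd c ` fst c) (F2c c) (Nc c) (Gc c) (gc c) (dom c) (hc c) (Ac c) (Vc c) (Rc c)"
proof -
  interpret finsler_chart "snd c ` fst c" "F2c c" "Nc c" "Gc c" "gc c" "dom c" "hc c" by (rule finsler_chart[OF c])
  show ?thesis
  proof
    show "lf1 (dom c) (Ac c)" by (rule Ac_lf)
    show "lf3 (dom c) (Rc c)" by (rule Rc_lf[OF c])
    show "Vc c x W (snd x) = 0" if "x \<in> dom c" for x W by (rule Vc_y[OF c that])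
    show "Vc c x 0 Z = 0" if "x \<in> dom c" for x Z
      using lf2_lin(5)[OF om_lf[OF c] that] by (simp add: Vc_def zero_prod_def)
    show "Rc c x X Y Z = Vc c x (E x X Y) Z - (der2 (Gc c) x (hc c x X) Y Z - der2 (Gc c) x (hc c x Y) X Z
        + Gc c x X (Gc c x Y Z) - Gc c x Y (Gc c x X Z))" if "x \<in> dom c" for x X Y Z
      by (rule Rc_eq[OF c that])
    show "der3 (Rc c) x (hc c x W) X Y Z + Gc c x W (Rc c x X Y Z) - Rc c x (Gc c x W X) Y Z
        - Rc c x X (Gc c x W Y) Z - Rc c x X Y (Gc c x W Z) = Ac c x W *\<^sub>R Rc c x X Y Z" if "x \<in> dom c" for x W X Y Z
    proof -
      note p = pt_dom[OF c that]
      note pc = c fst_in[OF p(1)]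
      let ?o = "of_comps C c (fst (pt c x))"
      have "base_comps c (pt c x) (hcov13 C D (hcurv C D) (pt c x) (?o W) (?o X) (?o Y) (?o Z))
          = base_comps c (pt c x) (A (pt c x) (?o W) *\<^sub>R hcurv C D (pt c x) (?o X) (?o Y) (?o Z))"
        using rec_hcurv[OF fst_sc_TM0[OF c p(1), THEN conjunct1]] by simp
      then show ?thesis
        by (simp only: hcov13_chart[OF c p(1) Rc_lf[OF c] hcurv_chart[OF c]] linear_scale[OF linear_comps[OF pc]] hcurv_chart[OF c p(1)]
          A_chart[OF p(1)] comps_of_comps[OF pc] p(2))
    qed
  qed
qed

interpretation K: curved_chart "snd c ` fst c" "F2c c" "Nc c" "Gc c" "gc c" "dom c" "hc c" "Ac c" "Vc c" "Rc c"
  by (rule curved)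

lemma trace_chart:
  assumes u: "u \<in> fst (sc c)" and M: "linear M" and N: "\<And>v. N v = of_comps C c (fst u) (M (base_comps c u v))"
  shows "endo_trace N = endo_trace M"
proof -
  note p = c fst_in[OF u]
  have "endo_trace N = endo_trace (\<lambda>v. of_comps C c (fst u) ((M \<circ> base_comps c u) v))" by (simp add: N[abs_def])
  also have "\<dots> = endo_trace (\<lambda>v. (M \<circ> base_comps c u) (of_comps C c (fst u) v))"
    by (rule endo_trace_commute[OF linear_of_comps[OF p] linear_compose[OF linear_comps[OF p] M]])
  finally show ?thesis using comps_of_comps[OF p] by simp
qed

lemma hric_chart:
  assumes u: "u \<in> fst (sc c)"
  shows "hric C D u x z = K.Ric (co c u) (base_comps c u x) (base_comps c u z)"
  unfolding hric_def K.Ric_def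
proof (rule trace_chart[OF u])
  show "linear (\<lambda>Y. Rc c (co c u) (base_comps c u x) Y (base_comps c u z))"
    using K.lf2_D(2)[OF K.lf3_D(1)[OF Rc_lf[OF c]]] co_dom[OF c u] unfolding lf1_def by blast
  show "hcurv C D u x y z = of_comps C c (fst u) (Rc c (co c u) (base_comps c u x) (base_comps c u y) (base_comps c u z))" for y
    unfolding hcurv_chart[OF c u, symmetric] using c fst_in[OF u] by simp
qed

lemma hscal_chart:
  assumes u: "u \<in> fst (sc c)"
  shows "hscal C L D u = K.scal (co c u)"
  unfolding hscal_def metric_trace_def K.scal_def
proof (rule trace_chart[OF u])
  note z = co_dom[OF c u] and p = c fst_in[OF u]
  show "linear (K.rc (co c u))" using K.rc_lf z by (simp add: lf1_def)
  show "(THE w. \<forall>z. fmetric L u w z = hric C D u x z) = of_comps C c (fst u) (K.rc (co c u) (base_comps c u x))" for x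
  proof (rule the_equality)
    show "\<forall>z. fmetric L u (of_comps C c (fst u) (K.rc (co c u) (base_comps c u x))) z = hric C D u x z"
      using comps_of_comps[OF p] K.g_rc[OF z] by (simp add: fmetric_chart[OF c u] hric_chart[OF u])
    fix w assume w: "\<forall>z. fmetric L u w z = hric C D u x z"
    have "base_comps c u w = K.rc (co c u) (base_comps c u x)"
    proof (rule inner_form.eqI[OF K.g_inner[OF z]])
      fix Z
      show "gc c (co c u) (base_comps c u w) Z = gc c (co c u) (K.rc (co c u) (base_comps c u x)) Z"
        using w[rule_format, of "of_comps C c (fst u) Z"] comps_of_comps[OF p] K.g_rc[OF z]
        by (simp add: fmetric_chart[OF c u] hric_chart[OF u])
    qed
    then show "w = of_comps C c (fst u) (K.rc (co c u) (base_comps c u x))"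
      using of_comps_comps[OF p, of w] by simp
  qed
qed

lemma concircular_chart:
  assumes u: "u \<in> fst (sc c)"
  shows "base_comps c u (concircular C L D u x y z) = K.Conc (co c u) (base_comps c u x) (base_comps c u y) (base_comps c u z)"
  unfolding concircular_def K.Conc_def Gtensor_def linear_diff[OF linear_comps[OF c fst_in[OF u]]]
    linear_scale[OF linear_comps[OF c fst_in[OF u]]] hcurv_chart[OF c u] hscal_chart[OF u] fmetric_chart[OF c u] ..

lemma rec_hric:
  assumes u: "u \<in> fst (sc c)"
  shows "hcov02 C D (hric C D) u x y z = A u x * hric C D u y z"
  by (simp only: hcov02_chart[OF c u K.Ric_lf hric_chart] K.rec_Ric[OF co_dom[OF c u]] A_chart[OF u] hric_chart[OF u])

lemma rec_concircular:
  assumes u: "u \<in> fst (sc c)"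
  shows "hcov13 C D (concircular C L D) u x y z w = A u x *\<^sub>R concircular C L D u y z w"
  by (rule base_comps_inj[OF c u])
     (simp only: hcov13_chart[OF c u K.Conc_lf concircular_chart] K.rec_Conc[OF co_dom[OF c u]]
       linear_scale[OF linear_comps[OF c fst_in[OF u]]] A_chart[OF u] concircular_chart[OF u])

lemma hcurv_zero_chart:
  assumes "\<And>u x z. u \<in> TM0 C \<Longrightarrow> hric C D u x z = 0" and u: "u \<in> fst (sc c)"
  shows "hcurv C D u x y z = 0"
proof -
  interpret ricci_flat_chart "snd c ` fst c" "F2c c" "Nc c" "Gc c" "gc c" "dom c" "hc c" "Ac c" "Vc c" "Rc c"
  proof
    fix z X Z assume "z \<in> dom c"
    note p = pt_dom[OF c this]
    have "K.Ric z X Z = hric C D (pt c z) (of_comps C c (fst (pt c z)) X) (of_comps C c (fst (pt c z)) Z)"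
      using comps_of_comps[OF c fst_in[OF p(1)]] by (simp add: hric_chart[OF p(1)] p(2))
    then show "endo_trace (\<lambda>Y. Rc c z X Y Z) = 0"
      using assms(1)[OF fst_sc_TM0[OF c p(1), THEN conjunct1]] by (simp add: K.Ric_def)
  qed
  have "base_comps c u (hcurv C D u x y z) = 0"
    unfolding hcurv_chart[OF c u] by (rule R_zero[OF co_dom[OF c u]])
  then show ?thesis using comps_zero_iff[OF c fst_in[OF u]] by simp
qed

context
  assumes flat: "\<And>u x y z. u \<in> TM0 C \<Longrightarrow> concircular C L D u x y z = 0"
begin

definition "kc z = K.scal z / (real DIM('e) * (real DIM('e) - 1))"

lemma isotropic: "isotropic_chart (snd c ` fst c) (F2c c) (Nc c) (Gc c) (gc c) (dom c) (hc c) (Ac c) (Vc c) (Rc c) kc"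
proof
  have kc: "kc z = K.scal z * inverse (real DIM('e) * (real DIM('e) - 1))" for z
    by (simp add: kc_def divide_inverse)
  show "DIM('e) \<ge> 3" by (rule dim3)
  show "K.sm kc" unfolding kc[abs_def] by (intro K.sm_rules K.scal_sm)
  show "dd kc x (hc c x W) = Ac c x W * kc x" if "x \<in> dom c" for x W
    unfolding kc[abs_def] using that by (simp add: K.dd_rules K.scal_sm K.sm_rules K.rec_scal)
  show "Rc c x X Y Z = kc x *\<^sub>R (gc c x X Z *\<^sub>R Y - gc c x Y Z *\<^sub>R X)" if "x \<in> dom c" for x X Y Z
  proof -
    note p = pt_dom[OF c that]
    have "K.Conc x X Y Z = base_comps c (pt c x) (concircular C L D (pt c x) (of_comps C c (fst (pt c x)) X)
        (of_comps C c (fst (pt c x)) Y) (of_comps C c (fst (pt c x)) Z))"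
      using comps_of_comps[OF c fst_in[OF p(1)]] by (simp add: concircular_chart[OF p(1)] p(2))
    also have "\<dots> = 0"
      using flat[OF fst_sc_TM0[OF c p(1), THEN conjunct1]] linear_0[OF linear_comps[OF c fst_in[OF p(1)]]] by simp
    finally show ?thesis by (simp add: K.Conc_def kc_def)
  qed
qed

interpretation I: isotropic_chart "snd c ` fst c" "F2c c" "Nc c" "Gc c" "gc c" "dom c" "hc c" "Ac c" "Vc c" "Rc c" kc
  by (rule isotropic)

lemma kc_hscal: "u \<in> fst (sc c) \<Longrightarrow> kc (co c u) = hscal C L D u / (real DIM('e) * (real DIM('e) - 1))"
  by (simp add: kc_def hscal_chart)

lemma kc_hscal_eq: "u \<in> fst (sc c) \<Longrightarrow> v \<in> fst (sc c) \<Longrightarrow> kc (co c u) = kc (co c v) \<longleftrightarrow> hscal C L D u = hscal C L D v"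
  using dim3 by (simp add: kc_hscal)

lemma hscal_vertical:
  assumes "p \<in> fst c" "y \<noteq> 0" "y' \<noteq> 0"
  shows "hscal C L D (p, y) = hscal C L D (p, y')"
proof -
  have m: "(p, y) \<in> fst (sc c)" "(p, y') \<in> fst (sc c)" using assms by (auto simp: fst_sc)
  have e: "co c (p, y) = (snd c p, comps C c p y)" for y by (simp add: co_def snd_sc)
  have "kc (snd c p, comps C c p y) = kc (snd c p, comps C c p y')"
    by (rule K.vertical_const[OF I.k_sm I.dk_zero]) (use co_dom[OF c] m dim3 in \<open>auto simp flip: e\<close>)
  then show ?thesis using kc_hscal_eq[OF m] by (simp add: e)
qed

text \<open>The vector \<open>w\<close> at \<open>q\<close> has the chart components of
  \<open>y\<close>, so that the comparison takes place on a slice with constant fibre coordinates,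
  where \<open>kc\<close> has derivative zero.\<close>

lemma hscal_horizontal:
  assumes p: "p \<in> fst c" and y: "y \<noteq> 0"
  obtains e where "e > 0" "ball (snd c p) e \<subseteq> snd c ` fst c"
    "\<And>q. q \<in> fst c \<Longrightarrow> snd c q \<in> ball (snd c p) e \<Longrightarrow> \<exists>w. w \<noteq> 0 \<and> hscal C L D (q, w) = hscal C L D (p, y)"
proof -
  obtain e where e: "e > 0" "ball (snd c p) e \<subseteq> snd c ` fst c"
    using open_base[OF c] p open_contains_ball by (metis imageI)
  have m: "(p, y) \<in> fst (sc c)" using p y by (auto simp: fst_sc)
  have co: "co c (p, y) = (snd c p, comps C c p y)" for p y by (simp add: co_def snd_sc)
  have v0: "comps C c p y \<noteq> 0" using comps_zero_iff[OF c p] y by simp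
  show ?thesis
  proof (rule that[OF e])
    fix q assume q: "q \<in> fst c" "snd c q \<in> ball (snd c p) e"
    define w where "w = of_comps C c q (comps C c p y)"
    have w: "comps C c q w = comps C c p y" using comps_of_comps[OF c q(1)] by (simp add: w_def)
    have w0: "w \<noteq> 0" using v0 comps_zero_iff[OF c q(1), of w] w by simp
    have mq: "(q, w) \<in> fst (sc c)" using q w0 by (auto simp: fst_sc)
    have "(\<lambda>x. kc (x, comps C c p y)) (snd c p) = (\<lambda>x. kc (x, comps C c p y)) (snd c q)"
    proof (rule has_derivative_zero_unique[of "ball (snd c p) e"])
      fix x assume x: "x \<in> ball (snd c p) e"
      then have xd: "(x, comps C c p y) \<in> dom c" using e v0 by (auto simp: dom_def)
      have 1: "((\<lambda>x. (x, comps C c p y)) has_derivative (\<lambda>v. (v, 0))) (at x)"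
        by (intro has_derivative_Pair has_derivative_ident has_derivative_const)
      have 2: "(kc has_derivative dd kc (x, comps C c p y)) (at (x, comps C c p y))"
        by (rule dd_works[OF K.sm_diffble[OF I.k_sm xd]])
      from has_derivative_compose[OF 1 2]
      have "((\<lambda>x. kc (x, comps C c p y)) has_derivative (\<lambda>h. 0)) (at x)"
        by (simp add: I.dk_zero[OF xd])
      then show "((\<lambda>x. kc (x, comps C c p y)) has_derivative (\<lambda>h. 0)) (at x within ball (snd c p) e)"
        by (rule has_derivative_at_withinI)
    qed (use e q in auto)
    then have "hscal C L D (q, w) = hscal C L D (p, y)"
      using kc_hscal_eq[OF mq m] by (simp add: co w)
    with w0 show "\<exists>w. w \<noteq> 0 \<and> hscal C L D (q, w) = hscal C L D (p, y)" by blast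
  qed
qed

lemma A_zero_chart:
  assumes u: "u \<in> fst (sc c)" and "hscal C L D u \<noteq> 0"
  shows "A u x = 0"
proof -
  have "kc (co c u) \<noteq> 0" using assms dim3 by (simp add: kc_hscal)
  from I.A_zero[OF co_dom[OF c u] this] show ?thesis by (simp add: A_chart[OF u])
qed

end

end

end

context recurrent_mfd
begin

lemma hcurv_TM0_zero:
  assumes "\<And>u x z. u \<in> TM0 C \<Longrightarrow> hric C D u x z = 0"
  shows False
proof -
  obtain u x y z where u: "u \<in> TM0 C" "hcurv C D u x y z \<noteq> 0"
    using R_nonzero by (auto simp: nonzero13_def)
  obtain c where "c \<in> C" "u \<in> fst (sc c)" by (rule TM0_chart[OF u(1)])
  from hcurv_zero_chart[OF this(1) assms this(2)] u(2) show False by simp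
qed

theorem ricci_recurrent: "ricci_recurrent C D A"
  unfolding ricci_recurrent_def
proof (intro conjI ballI allI)
  show "nonzero02 C (hric C D)" using hcurv_TM0_zero by (auto simp: nonzero02_def)
  fix u x y z assume "u \<in> TM0 C"
  then obtain c where "c \<in> C" "u \<in> fst (sc c)" by (rule TM0_chart)
  then show "hcov02 C D (hric C D) u x y z = A u x * hric C D u y z" by (rule rec_hric)
qed (rule dim3 A_form)+

section \<open>Concircular recurrence\<close>

context
  assumes flat: "\<And>u x y z. u \<in> TM0 C \<Longrightarrow> concircular C L D u x y z = 0"
begin

text \<open>Local constancy of the scalar curvature gives openness for an arbitrary property
  \<open>P\<close> of its value. The connectedness argument takes \<open>P\<close> to be vanishing
  and non-vanishing.\<close>

lemma openin_scal: "openin (atlas_topology C) {p \<in> carrier_of C. \<exists>y. y \<noteq> 0 \<and> P (hscal C L D (p, y))}" (is "openin _ ?P")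
  unfolding openin_iff
proof (intro conjI ballI)
  fix c assume c: "c \<in> C"
  show "open (img c ?P)"
    unfolding open_contains_ball
  proof
    fix x assume "x \<in> img c ?P"
    then obtain p y where p: "p \<in> fst c" "x = snd c p" "y \<noteq> 0" "P (hscal C L D (p, y))"
      by (auto simp: img_def)
    obtain e where e: "e > 0" "ball (snd c p) e \<subseteq> snd c ` fst c"
      and w: "\<And>q. q \<in> fst c \<Longrightarrow> snd c q \<in> ball (snd c p) e \<Longrightarrow> \<exists>w. w \<noteq> 0 \<and> hscal C L D (q, w) = hscal C L D (p, y)"
      by (rule hscal_horizontal[OF c flat p(1,3)]) auto
    have "ball x e \<subseteq> img c ?P"
    proof
      fix x' assume x': "x' \<in> ball x e"
      then obtain q where q: "q \<in> fst c" "x' = snd c q" using e(2) p(2) by blast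
      have qb: "snd c q \<in> ball (snd c p) e" using x' q p(2) by simp
      obtain v where "v \<noteq> 0" "hscal C L D (q, v) = hscal C L D (p, y)" using w[OF q(1) qb] by (elim exE conjE)
      then have "q \<in> ?P" using p(4) in_carrier[OF c q(1)] by auto
      then show "x' \<in> img c ?P" unfolding q(2) by (rule img_mem[OF _ q(1)])
    qed
    then show "\<exists>e>0. ball x e \<subseteq> img c ?P" using e(1) by blast
  qed
qed blast

lemma hscal_vertical_TM0: "p \<in> carrier_of C \<Longrightarrow> y \<noteq> 0 \<Longrightarrow> y' \<noteq> 0 \<Longrightarrow> hscal C L D (p, y) = hscal C L D (p, y')"
  using chart_atD hscal_vertical[OF _ flat] by metis

lemma hscal_zero:
  assumes u: "u \<in> TM0 C"
  shows "hscal C L D u = 0"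
proof (rule ccontr)
  assume u0: "hscal C L D u \<noteq> 0"
  let ?P = "{p \<in> carrier_of C. \<exists>y. y \<noteq> 0 \<and> hscal C L D (p, y) \<noteq> 0}"
    and ?Q = "{p \<in> carrier_of C. \<exists>y. y \<noteq> 0 \<and> hscal C L D (p, y) = 0}"
  have conn: "connected_space (atlas_topology C)"
    using finsler by (simp add: finsler_manifold_def smooth_manifold_def)
  have top: "topspace (atlas_topology C) = carrier_of C"
    using openin_subset[OF openin_carrier] openin_iff[of "topspace (atlas_topology C)"] by auto
  have "?P \<noteq> {}" using u u0 by (cases u) (auto simp: TM0_eq)
  moreover have "carrier_of C \<subseteq> ?P \<union> ?Q"
  proof
    fix p assume "p \<in> carrier_of C"
    moreover obtain b :: 'e where "b \<in> Basis" using nonempty_Basis by blast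
    then have "b \<noteq> 0" by (rule nonzero_Basis)
    ultimately show "p \<in> ?P \<union> ?Q" by blast
  qed
  moreover have "?P \<inter> ?Q = {}"
  proof (rule ccontr)
    assume "?P \<inter> ?Q \<noteq> {}"
    then obtain p y y' where "p \<in> carrier_of C" "y \<noteq> 0" "hscal C L D (p, y) \<noteq> 0" "y' \<noteq> 0" "hscal C L D (p, y') = 0"
      by auto
    then show False using hscal_vertical_TM0[of p y y'] by simp
  qed
  moreover have "openin (atlas_topology C) ?P" "openin (atlas_topology C) ?Q" by (rule openin_scal)+
  ultimately have "?Q \<noteq> {} \<Longrightarrow> \<exists>E1 E2. openin (atlas_topology C) E1 \<and> openin (atlas_topology C) E2 \<and>
      topspace (atlas_topology C) \<subseteq> E1 \<union> E2 \<and> E1 \<inter> E2 = {} \<and> E1 \<noteq> {} \<and> E2 \<noteq> {}"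
    unfolding top by (intro exI[of _ ?P] exI[of _ ?Q] conjI)
  then have Q: "?Q = {}" using conn unfolding connected_space_def by argo
  have "A v x = 0" if v: "v \<in> TM0 C" for v x
  proof -
    have "hscal C L D v \<noteq> 0" using Q v by (cases v) (auto simp: TM0_eq)
    moreover obtain c where "c \<in> C" "v \<in> fst (sc c)" by (rule TM0_chart[OF v])
    ultimately show ?thesis using A_zero_chart[OF _ flat] by blast
  qed
  then show False using A_form by (auto simp: recurrence_form1_def nonzero01_def)
qed

end

theorem concircularly_recurrent:
  assumes "u \<in> TM0 C" "hscal C L D u \<noteq> 0"
  shows "concircularly_recurrent C L D A"
  unfolding concircularly_recurrent_def
proof (intro conjI ballI allI)
  show "nonzero13 C (concircular C L D)"
    using hscal_zero[OF _ assms(1)] assms(2) unfolding nonzero13_def by blast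
  fix u x y z w assume "u \<in> TM0 C"
  then obtain c where "c \<in> C" "u \<in> fst (sc c)" by (rule TM0_chart)
  then show "hcov13 C D (concircular C L D) u x y z w = A u x *\<^sub>R concircular C L D u y z w" by (rule rec_concircular)
qed (rule dim3 A_form)+

section \<open>The second recurrence form\<close>

text \<open>The slots follow the convention of \<open>hcov2\<close>: \<open>y\<close> belongs to the
  first derivative and \<open>x\<close> to the second.\<close>

definition "al u y x = hcov01 C D A u x y + A u y * A u x"

definition "alc c z Y X = der1 (Ac c) z (hc c z X) Y - Ac c z (Gc c z X Y) + Ac c z Y * Ac c z X"

lemma al_chart:
  assumes c: "c \<in> C" and u: "u \<in> fst (sc c)"
  shows "al u y x = alc c (co c u) (base_comps c u y) (base_comps c u x)"
  by (simp only: al_def alc_def hcov01_chart[OF c u Ac_lf[OF c] A_chart[OF c]] A_chart[OF c u])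

lemma alc_lf:
  assumes c: "c \<in> C"
  shows "lf2 (dom c) (alc c)"
proof -
  interpret smooth_domain "dom c" by unfold_locales (rule open_dom[OF c])
  note A = Ac_lf[OF c] and G = Gc_lf[OF c]
  note l = lf1_lin[OF A] lf2_lin[OF G] lf2_lin[OF lf2_der1[OF A]] hc_lin[OF c]
  show ?thesis
    unfolding alc_def
  proof (rule lf2I)
    show "linear (\<lambda>X. der1 (Ac c) x (hc c x X) Y - Ac c x (Gc c x X Y) + Ac c x Y * Ac c x X)" if "x \<in> dom c" for x Y
      by (rule linearI) (simp_all add: l[OF that] hc_lin[OF c that] algebra_simps)
    show "linear (\<lambda>Y. der1 (Ac c) x (hc c x X) Y - Ac c x (Gc c x X Y) + Ac c x Y * Ac c x X)" if "x \<in> dom c" for x X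
      by (rule linearI) (simp_all add: l[OF that] algebra_simps)
    show "sm (\<lambda>x. der1 (Ac c) x (hc c x X) Y - Ac c x (Gc c x X Y) + Ac c x Y * Ac c x X)" for X Y
      by (intro sm_rules(3) sm_rules(4) sm_rules(7) lf2_sm[OF lf2_der1[OF A]] lf1_sm[OF A] lf2_sm[OF G] hc_sm[OF c] sm_rules(1))
  qed
qed

lemma al_bilinear:
  assumes "u \<in> TM0 C"
  shows "bilinear (al u)"
proof -
  obtain c where c: "c \<in> C" and u: "u \<in> fst (sc c)" by (rule TM0_chart[OF assms])
  interpret smooth_domain "dom c" by unfold_locales (rule open_dom[OF c])
  note b = linear_comps[OF c fst_in[OF u]]
  show ?thesis
    unfolding bilinear_def
    by (intro conjI allI linearI)
       (simp_all add: al_chart[OF c u] linear_add[OF b] linear_scale[OF b] lf2_lin[OF alc_lf[OF c] co_dom[OF c u]])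
qed

lemma al_smooth:
  assumes W: "opn W" and X: "smooth_pi C W X" and Y: "smooth_pi C W Y"
  shows "smooth_fun (slit C) W (\<lambda>q. al q (X q) (Y q))"
  unfolding smooth_fun_def slit_def
proof
  fix d assume "d \<in> sc ` C"
  then obtain c where c: "c \<in> C" and d: "d = sc c" by (rule imageE)
  let ?W = "W \<inter> fst (sc c)"
  have W': "opn ?W" "?W \<subseteq> fst (sc c)" using openin_Int[OF W openin_sc[OF c]] by auto
  interpret smooth_domain "co c ` ?W" by unfold_locales (rule open_co[OF c W'])
  have XY: "sm (hat c X)" "sm (hat c Y)"
    using smooth_pi_subset[OF X] smooth_pi_subset[OF Y] unfolding smooth_pi_iff[OF c W', symmetric] by blast+
  have "co c ` ?W \<subseteq> dom c" using co_dom[OF c] by blast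
  from lf2_sm[OF lf2_subset[OF alc_lf[OF c] this] XY]
  have "sm ((\<lambda>q. al q (X q) (Y q)) \<circ> chart_inv (sc c))"
  proof (rule smooth_on_cong[OF open_co[OF c W']])
    fix z assume "z \<in> co c ` ?W"
    note p = pt_image[OF c W'(2) this]
    then have u: "pt c z \<in> fst (sc c)" by blast
    show "alc c z (hat c X z) (hat c Y z) = ((\<lambda>q. al q (X q) (Y q)) \<circ> chart_inv (sc c)) z"
      using al_chart[OF c u] p by (simp add: hat_def flip: pt_def)
  qed
  then show "smooth_on (snd d ` (W \<inter> fst d)) ((\<lambda>q. al q (X q) (Y q)) \<circ> chart_inv d)"
    by (simp add: d co_def)
qed

text \<open>\<open>N\<close> has degree one in \<open>y\<close>, so the lift at
  \<open>(x, t a)\<close> is the image of the lift at \<open>(x, a)\<close> under the fibre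
  dilation, which preserves \<open>Ac\<close>. The remaining terms have degree zero, for
  \<open>Gam\<close> by \<open>Gam_hom\<close>.\<close>

lemma al_hom:
  assumes u: "(p, y) \<in> TM0 C" and t: "t > 0"
  shows "al (p, t *\<^sub>R y) = al (p, y)"
proof (intro ext)
  fix v w
  obtain c where c: "c \<in> C" and pc: "(p, y) \<in> fst (sc c)" by (rule TM0_chart[OF u])
  interpret K: curved_chart "snd c ` fst c" "F2c c" "Nc c" "Gc c" "gc c" "dom c" "hc c" "Ac c" "Vc c" "Rc c"
    by (rule curved[OF c])
  have p: "p \<in> fst c" "y \<noteq> 0" using pc by (auto simp: fst_sc)
  have tc: "(p, t *\<^sub>R y) \<in> fst (sc c)" using p t by (auto simp: fst_sc)
  have co: "co c (p, z) = (snd c p, comps C c p z)" for p z by (simp add: co_def snd_sc)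
  define x a where "x = snd c p" and "a = comps C c p y"
  have cy: "co c (p, y) = (x, a)" by (simp add: co x_def a_def)
  have ct: "co c (p, t *\<^sub>R y) = (x, t *\<^sub>R a)"
    by (simp add: co x_def a_def linear_scale[OF linear_comps[OF c p(1)]])
  have xa: "(x, a) \<in> dom c" using co_dom[OF c pc] by (simp add: cy)
  have xt: "(x, t *\<^sub>R a) \<in> dom c" using co_dom[OF c tc] by (simp add: ct)
  have hom: "Ac c (q, t *\<^sub>R b) X = Ac c (q, b) X" if "(q, b) \<in> dom c" for q b X
  proof -
    note pq = pt_dom[OF c that]
    obtain r s where rs: "pt c (q, b) = (r, s)" by (cases "pt c (q, b)")
    have r: "r \<in> fst c" "s \<noteq> 0" using pq(1) by (auto simp: rs fst_sc)
    have ts: "(r, t *\<^sub>R s) \<in> fst (sc c)" using r t by (auto simp: fst_sc)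
    have "co c (r, t *\<^sub>R s) = (q, t *\<^sub>R b)"
      using pq(2) by (simp add: rs co linear_scale[OF linear_comps[OF c r(1)]])
    then have "pt c (q, t *\<^sub>R b) = (r, t *\<^sub>R s)" using pt_co[OF c ts] by simp
    moreover have "(r, s) \<in> TM0 C" using fst_sc_TM0[OF c pq(1)] rs by simp
    ultimately show ?thesis using A_rules(3)[OF _ t, of r s] by (simp add: Ac_def rs)
  qed
  have d: "der1 (Ac c) (x, t *\<^sub>R a) (X, t *\<^sub>R Z) Y = der1 (Ac c) (x, a) (X, Z) Y" for X Y Z
  proof -
    let ?f = "\<lambda>z. Ac c z Y"
    have s: "K.sm ?f" by (rule K.lf1_sm[OF Ac_lf[OF c] K.sm_rules(1)])
    have 1: "((\<lambda>z. (fst z, t *\<^sub>R snd z)) has_derivative (\<lambda>z. (fst z, t *\<^sub>R snd z))) (at (x, a))"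
      by (intro has_derivative_Pair has_derivative_fst has_derivative_snd has_derivative_scaleR_right has_derivative_ident)
    have 2: "(?f has_derivative dd ?f (x, t *\<^sub>R a)) (at (fst (x, a), t *\<^sub>R snd (x, a)))"
      using dd_works[OF K.sm_diffble[OF s xt]] by simp
    have "(?f has_derivative (\<lambda>z. dd ?f (x, t *\<^sub>R a) (fst z, t *\<^sub>R snd z))) (at (x, a))"
      by (rule has_derivative_transform_within_open[OF has_derivative_compose[OF 1 2] K.open_U xa]) (metis hom prod.collapse)
    from dd_eq[OF this] show ?thesis by (simp add: der1_def)
  qed
  have h: "hc c (x, t *\<^sub>R a) X = (X, t *\<^sub>R - Nc c (x, a) X)" for X
    by (simp add: hc_def K.N_hom[OF xa t])
  have "alc c (x, t *\<^sub>R a) Y X = alc c (x, a) Y X" for Y X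
    unfolding alc_def h d hom[OF xa] K.Gam_hom[OF xa t] by (simp add: hc_def)
  then show "al (p, t *\<^sub>R y) v w = al (p, y) v w"
    by (simp add: al_chart[OF c tc] al_chart[OF c pc] cy ct)
qed

lemma al_form: "nonzero02 C al \<Longrightarrow> recurrence_form2 C al"
  unfolding recurrence_form2_def using al_bilinear al_smooth al_hom by blast

lemma A_ext_smooth: "c \<in> C \<Longrightarrow> u \<in> fst (sc c) \<Longrightarrow> smooth_fun (slit C) (nbh c u) (\<lambda>q. A q (ext C u x q))"
  by (rule A_rules(2)[OF nbh(1,4)])

theorem two_recurrent:
  assumes "nonzero02 C al"
  shows "two_recurrent C D al"
  unfolding two_recurrent_def
proof (intro conjI ballI allI)
  fix u x x' y z w assume u: "u \<in> TM0 C"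
  obtain c where c: "c \<in> C" "u \<in> fst (sc c)" by (rule TM0_chart[OF u])
  have T: "hcov13 C D (hcurv C D) q (ext C u x q) v w k = A q (ext C u x q) *\<^sub>R hcurv C D q v w k" if "q \<in> nbh c u" for q v w k
    using rec_hcurv fst_sc_TM0[OF c(1)] that by (simp add: nbh_def)
  have e: "ext C u v u = v" for v by (rule ext_smooth(2)[OF u])
  have h: "hcov13 C D (\<lambda>q. hcov13 C D (hcurv C D) q (ext C u x q)) u x' y z w =
      A u (ext C u x u) *\<^sub>R hcov13 C D (hcurv C D) u x' y z w
      + dir (slit C) (\<lambda>q. A q (ext C u x q)) u (beta C D u x') *\<^sub>R hcurv C D u y z w"
    by (rule hcov13_scale[OF c Rc_lf[OF c(1)] hcurv_chart[OF c(1)] A_ext_smooth[OF c] T])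
  show "hcov2 C D (hcov13 C D) (hcurv C D) u x x' y z w = al u x x' *\<^sub>R hcurv C D u y z w"
    \<comment> \<open>The correction term of \<open>hcov2\<close>, rewritten by the recurrence,
      supplies exactly the subtraction that turns \<open>dir\<close> of \<open>A\<close> into its
      covariant derivative.\<close>
    unfolding hcov2_def Let_def minus_apply h rec_hcurv[OF u]
    by (simp add: al_def hcov01_def Let_def e algebra_simps)
qed (use dim3 R_nonzero al_form[OF assms] in auto)

theorem two_ricci_recurrent:
  assumes "nonzero02 C al"
  shows "two_ricci_recurrent C D al"
  unfolding two_ricci_recurrent_def
proof (intro conjI ballI allI)
  note r = ricci_recurrent[unfolded ricci_recurrent_def]
  show "nonzero02 C (hric C D)" using r by blast
  fix u x x' y z assume u: "u \<in> TM0 C"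
  obtain c where c: "c \<in> C" "u \<in> fst (sc c)" by (rule TM0_chart[OF u])
  interpret K: curved_chart "snd c ` fst c" "F2c c" "Nc c" "Gc c" "gc c" "dom c" "hc c" "Ac c" "Vc c" "Rc c"
    by (rule curved[OF c(1)])
  have R': "hcov02 C D (hric C D) u v w k = A u v * hric C D u w k" for v w k using r u by blast
  have R: "hcov02 C D (hric C D) q v w k = A q v * hric C D q w k" if "q \<in> TM0 C" for q v w k
    using r that by blast
  have e: "ext C u v u = v" for v by (rule ext_smooth(2)[OF u])
  have h: "hcov02 C D (\<lambda>q. hcov02 C D (hric C D) q (ext C u x q)) u x' y z =
      A u (ext C u x u) * hcov02 C D (hric C D) u x' y z
      + dir (slit C) (\<lambda>q. A q (ext C u x q)) u (beta C D u x') * hric C D u y z"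
    by (rule hcov02_scale[OF c K.Ric_lf hric_chart[OF c(1)] A_ext_smooth[OF c] R])
  show "hcov2 C D (hcov02 C D) (hric C D) u x x' y z = al u x x' * hric C D u y z"
    unfolding hcov2_def Let_def minus_apply h R'
    by (simp add: al_def hcov01_def Let_def e algebra_simps)
qed (use dim3 al_form[OF assms] in auto)

end

theorem theorem3p2:
  fixes \<A> :: "('m, 'e::euclidean_space) atlas"
    and L :: "'m \<times> 'e \<Rightarrow> real"
    and D :: "('m, 'e) conn"
    and A :: "('m, 'e) tensor01"
  assumes finsler: "finsler_manifold \<A> L"
    and cartan: "cartan_connection \<A> L D"
    and dim: "DIM('e) \<ge> 3"
    and rec: "recurrent \<A> D A"
  shows "(\<exists>B. ricci_recurrent \<A> D B) \<and>
    ((\<exists>u\<in>TM0 \<A>. hscal \<A> L D u \<noteq> 0) \<longrightarrow> (\<exists>B. concircularly_recurrent \<A> L D B)) \<and>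
    (nonzero02 \<A> (\<lambda>u y x. hcov01 \<A> D A u x y + A u y * A u x) \<longrightarrow>
       (\<exists>\<alpha>. two_recurrent \<A> D \<alpha>) \<and> (\<exists>\<alpha>. two_ricci_recurrent \<A> D \<alpha>))"
proof -
  interpret recurrent_mfd \<A> L D A
    using finsler cartan rec by unfold_locales
  have al: "al = (\<lambda>u y x. hcov01 \<A> D A u x y + A u y * A u x)"
    by (intro ext) (simp add: al_def)
  show ?thesis
    using ricci_recurrent concircularly_recurrent two_recurrent two_ricci_recurrent unfolding al by blast
qed

end
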